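(* Let $\Gamma$ be a normalized zonal Fuchsian group with quotient orbifold $S=\mathbb{H}/\Gamma$, as in the context, and let $\mathcal{A}:(0,2]\to\mathbb{R}$ be given by $\mathcal{A}(z)=z$ for $0<z\le 1$ and $\mathcal{A}(z)=2-z+2\log z$ for $1\le z\le 2$. Then for almost all $\mathbf{v}\in T_1S$ the following hold for all $0<k\le 2$: $$\lim_{t\to\infty}\frac{N_{\mathbf v}(k)(t)}{t}=\frac{k}{\pi\,\mathrm{area}(S)}\qquad(1)$$ and $$\lim_{t\to\infty}\frac{N^a_{\mathbf v}(k)(t)}{t}=\frac{\mathcal{A}(k)}{\pi\,\mathrm{area}(S)}.\qquad(2)$$ For (1) it is assumed that either $\Gamma=\mathrm{PSL}_2(\mathbb{Z})$ or $U_\eta\notin\Gamma$; for (2) no such restriction is made.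
   Context: **Setting.** $\mathbb{H}$ is the upper half-plane with its hyperbolic metric. $\Gamma\subset \mathrm{PSL}_2(\mathbb{R})$ is a discrete group such that $S=\mathbb{H}/\Gamma$ is a non-compact hyperbolic 2-orbifold of finite area and the stabilizer of $\infty$ in $\Gamma$, $\mathrm{Stab}(\infty)$, is generated by $z\mapsto z+1$ (a zonal Fuchsian group). $P$ is the cusp of $S$ corresponding to $\infty$. For $m>0$ let $H_m=\{z: \mathrm{Im}(z)>m\}$, and let $C_k$ be the projection of $H_{1/k}$ to $S$. Let $\eta=\eta(\Gamma)$ be the smallest number with $H_\eta\cap g(H_\eta)=\emptyset$ for all $g\in\Gamma\setminus\mathrm{Stab}(\infty)$. Normalization: there is $h\in\Gamma$ with $h(\infty)=0$ and the closures of $H_\eta$ and $h(H_\eta)$ tangent at the single point $\eta i$. Put $U_\eta(z)=-\eta^2/z$. $T_1S=\Gamma\backslash T_1\mathbb{H}$ is the unit tangent bundle; "almost all $\mathbf v$" refers to the measure on $T_1S$ induced by $dA\,d\theta$ on $T_1\mathbb{H}=\mathbb{H}\times S^1$. For $\mathbf v\in T_1S$, $\gamma=\gamma(\mathbf v):\mathbb{R}\to S$ is the unit-speed geodesic with $\dot\gamma(0)=\mathbf v$. A lift $\tilde\gamma$ to $\mathbb{H}$ has forward endpoint $\tilde\gamma_+$ and backward endpoint $\tilde\gamma_-$. **Excursions.** A $k$-excursion of $\gamma$ is a point $e=\gamma(t_e)$ at which $\gamma$ is tangent to a neighborhood $C_d$ with $d<k$, i.e. some lift $\tilde\gamma$ of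 $\gamma$ is tangent to the boundary of $H_{1/d}$ at $\tilde\gamma(t_e)$. The number $t_e$ is the depth parameter of $e$ and $d=d(e)$ its depth (for almost every $\mathbf v$, $d(e)$ is well defined and the lift is unique up to $\mathrm{Stab}(\infty)$). Let $J=[(-1,0)\times(0,\infty)]\cup[(0,1)\times(-\infty,0)]$ and $I=[(-1,0)\times(1,\infty)]\cup[(0,1)\times(-\infty,-1)]$. For $k\le 2$ and a $k$-excursion $e$, let $\tilde\gamma_e$ be the unique lift of $\gamma$ tangent to $\partial H_{1/d(e)}$ at $\tilde\gamma_e(t_e)$ with $((\tilde\gamma_e)_+,(\tilde\gamma_e)_-)\in J$. The $k$-excursion $e$ is an approximating $k$-excursion if $((\tilde\gamma_e)_+,(\tilde\gamma_e)_-)\in I$. $N_{\mathbf v}(k)(t)$ is the number of depth parameters in $[0,t]$ of $k$-excursions of $\gamma(\mathbf v)$, and $N^a_{\mathbf v}(k)(t)$ is the number of depth parameters in $[0,t]$ of approximating $k$-excursions of $\gamma(\mathbf v)$. *)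

theory Defs
  imports "HOL-Analysis.Analysis" "HOL-Algebra.Coset" "HOL-Algebra.Generated_Groups"
begin


section \<open>The group \<open>PSL\<^sub>2(\<real>)\<close> and its action on the upper half-plane\<close>

definition SL2R :: "(real^2^2) monoid" where
  "SL2R = \<lparr>carrier = {A. det A = 1}, mult = (**), one = mat 1\<rparr>"

definition PSL2R :: "(real^2^2) set monoid" where
  "PSL2R = SL2R Mod {mat 1, - mat 1}"

text \<open>The elements of \<^const>\<open>PSL2R\<close> are the cosets \<open>{A, -A}\<close>.\<close>

definition psl_of :: "real^2^2 \<Rightarrow> (real^2^2) set" where
  "psl_of A = {mat 1, - mat 1} #>\<^bsub>SL2R\<^esub> A"

definition mat2 :: "real \<Rightarrow> real \<Rightarrow> real \<Rightarrow> real \<Rightarrow> real^2^2" where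
  "mat2 a b c d = vector [vector [a, b], vector [c, d]]"

definition PSL2Z :: "(real^2^2) set set" where
  "PSL2Z = {psl_of A | A. A \<in> carrier SL2R \<and> (\<forall>i j. A $ i $ j \<in> \<int>)}"

definition upper_half_plane :: "complex set" where
  "upper_half_plane = {z. Im z > 0}"

definition moebius :: "real^2^2 \<Rightarrow> complex \<Rightarrow> complex" where
  "moebius A z = (of_real (A $ 1 $ 1) * z + of_real (A $ 1 $ 2)) /
                 (of_real (A $ 2 $ 1) * z + of_real (A $ 2 $ 2))"

text \<open>The value at \<open>\<infinity>\<close>, in \<open>\<real> \<union> {\<infinity>}\<close>; \<^const>\<open>None\<close> stands for \<open>\<infinity>\<close>.\<close>

definition moebius_at_infinity :: "real^2^2 \<Rightarrow> real option" where
  "moebius_at_infinity A = (if A $ 2 $ 1 = 0 then None else Some (A $ 1 $ 1 / A $ 2 $ 1))"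

text \<open>The action of a coset is that of either representative; see \<open>moebius_uminus\<close> below.\<close>

definition psl_act :: "(real^2^2) set \<Rightarrow> complex \<Rightarrow> complex" where
  "psl_act g = moebius (SOME A. A \<in> g)"

definition psl_at_infinity :: "(real^2^2) set \<Rightarrow> real option" where
  "psl_at_infinity g = moebius_at_infinity (SOME A. A \<in> g)"

lemma matrix_uminus_mult_left: "(- A) ** B = - (A ** B)" for A :: "real^'n^'m"
  by (simp add: matrix_matrix_mult_def vec_eq_iff sum_negf)

lemma matrix_uminus_mult_right: "A ** (- B) = - (A ** B)" for A :: "real^'n^'m"
  by (simp add: matrix_matrix_mult_def vec_eq_iff sum_negf)

lemma det_uminus_2: "det (- A) = det A" for A :: "real^2^2"
  by (simp add: det_2)

lemma psl_of_eq: "psl_of A = {A, - A}"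
  by (auto simp: psl_of_def r_coset_def SL2R_def matrix_uminus_mult_left)

lemma moebius_uminus [simp]: "moebius (- A) = moebius A"
proof
  fix z
  have "moebius (- A) z = (- (of_real (A $ 1 $ 1) * z + of_real (A $ 1 $ 2))) /
      (- (of_real (A $ 2 $ 1) * z + of_real (A $ 2 $ 2)))"
    by (simp add: moebius_def)
  then show "moebius (- A) z = moebius A z"
    by (simp only: minus_divide_divide moebius_def)
qed

lemma moebius_at_infinity_uminus [simp]:
  "moebius_at_infinity (- A) = moebius_at_infinity A"
  by (simp add: moebius_at_infinity_def)

lemma psl_act_psl_of: "psl_act (psl_of A) = moebius A"
  unfolding psl_act_def psl_of_eq
  by (rule someI2[of _ A]) auto

lemma psl_at_infinity_psl_of: "psl_at_infinity (psl_of A) = moebius_at_infinity A"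
  unfolding psl_at_infinity_def psl_of_eq
  by (rule someI2[of _ A]) auto

lemma group_SL2R: "group SL2R"
proof (rule groupI)
  fix A assume "A \<in> carrier SL2R"
  then have A: "det A = 1" by (simp add: SL2R_def)
  then have "invertible A" by (simp add: invertible_det_nz)
  then obtain B where B: "B ** A = mat 1" by (auto simp: invertible_def)
  then have "det B * det A = 1" by (metis det_I det_mul)
  with A B show "\<exists>B\<in>carrier SL2R. B \<otimes>\<^bsub>SL2R\<^esub> A = \<one>\<^bsub>SL2R\<^esub>"
    by (auto simp: SL2R_def)
qed (auto simp: SL2R_def det_mul matrix_mul_assoc)

lemma normal_centre_SL2R: "{mat 1, - mat 1} \<lhd> SL2R"
proof -
  interpret group SL2R by (rule group_SL2R)
  have one: "\<one>\<^bsub>SL2R\<^esub> = mat 1" and mult: "\<And>A B. A \<otimes>\<^bsub>SL2R\<^esub> B = A ** B"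
    and carr: "\<And>A. A \<in> carrier SL2R \<longleftrightarrow> det A = 1"
    by (auto simp: SL2R_def)
  have inv: "inv\<^bsub>SL2R\<^esub> (- mat 1) = - mat 1"
    by (rule inv_equality)
      (auto simp: mult one carr matrix_uminus_mult_left matrix_uminus_mult_right det_uminus_2)
  have sub: "subgroup {mat 1, - mat 1} SL2R"
  proof (rule subgroupI)
    have "inv\<^bsub>SL2R\<^esub> (mat 1) = mat 1" using inv_one by (simp only: one)
    then show "inv\<^bsub>SL2R\<^esub> A \<in> {mat 1, - mat 1}" if "A \<in> {mat 1, - mat 1}" for A
      using that inv by auto
  qed (auto simp: mult carr det_uminus_2 matrix_uminus_mult_left matrix_uminus_mult_right)
  show ?thesis
    by (rule normalI[OF sub])
      (auto simp: r_coset_def l_coset_def mult matrix_uminus_mult_left matrix_uminus_mult_right)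
qed

lemma group_PSL2R: "group PSL2R"
  unfolding PSL2R_def by (rule normal.factorgroup_is_group[OF normal_centre_SL2R])

lemma carrier_PSL2R: "carrier PSL2R = psl_of ` carrier SL2R"
  by (auto simp: PSL2R_def FactGroup_def RCOSETS_def psl_of_def)


section \<open>Push-down of a measure to a quotient\<close>

text \<open>
  For a countable group acting on \<open>M\<close> by measure preserving maps, freely outside a null set, and
  the orbit map \<open>p\<close>, this is the measure induced on the quotient, that is, the measure of the part
  over \<open>E\<close> of a fundamental set.  The supremum avoids choosing the fundamental set (and differs
  from \<^const>\<open>distr\<close>, which would count every sheet).
\<close>

definition quotient_measure :: "'a measure \<Rightarrow> ('a \<Rightarrow> 'b) \<Rightarrow> 'b measure" where
  "quotient_measure M p = measure_of (p ` space M)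
     {E. E \<subseteq> p ` space M \<and> p -` E \<inter> space M \<in> sets M}
     (\<lambda>E. SUP B \<in> {B \<in> sets M. B \<subseteq> p -` E \<and> inj_on p B}. emeasure M B)"

lemma sigma_algebra_quotient:
  "sigma_algebra (p ` space M) {E. E \<subseteq> p ` space M \<and> p -` E \<inter> space M \<in> sets M}"
  (is "sigma_algebra _ ?S")
proof (unfold sigma_algebra_iff2, intro conjI ballI allI impI)
  fix E assume "E \<in> ?S"
  moreover have "p -` (p ` space M - E) \<inter> space M = space M - (p -` E \<inter> space M)" by auto
  ultimately show "p ` space M - E \<in> ?S" by auto
next
  fix A :: "nat \<Rightarrow> _" assume A: "range A \<subseteq> ?S"
  have "p -` (\<Union>i. A i) \<inter> space M = (\<Union>i. p -` A i \<inter> space M)" by auto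
  moreover have "\<dots> \<in> sets M" using A by (intro sets.countable_UN) auto
  ultimately show "(\<Union>i. A i) \<in> ?S" using A by auto
qed auto

lemma space_quotient_measure: "space (quotient_measure M p) = p ` space M"
  unfolding quotient_measure_def by (rule space_measure_of) auto

lemma sets_quotient_measure:
  "sets (quotient_measure M p) = {E. E \<subseteq> p ` space M \<and> p -` E \<inter> space M \<in> sets M}"
  unfolding quotient_measure_def
  using sigma_algebra.sigma_sets_eq[OF sigma_algebra_quotient] by (subst sets_measure_of) auto

lemma emeasure_quotient_measure:
  fixes M :: "'a measure" and p :: "'a \<Rightarrow> 'b"
  assumes "E \<in> sets (quotient_measure M p)"
  shows "emeasure (quotient_measure M p) E =
    (SUP B \<in> {B \<in> sets M. B \<subseteq> p -` E \<and> inj_on p B}. emeasure M B)"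
proof -
  let ?S = "{E. E \<subseteq> p ` space M \<and> p -` E \<inter> space M \<in> sets M}"
  define adm where "adm E = {B \<in> sets M. B \<subseteq> p -` E \<and> inj_on p B}" for E
  define \<mu> where "\<mu> E = (SUP B \<in> adm E. emeasure M B)" for E
  have ca: "countably_additive ?S \<mu>"
  proof (rule countably_additiveI)
    fix A :: "nat \<Rightarrow> _"
    assume A: "range A \<subseteq> ?S" and disj: "disjoint_family A"
    define I where "I = {B :: nat \<Rightarrow> 'a set. \<forall>n. B n \<in> adm (A n)}"
    have coord: "\<mu> (A n) = (SUP B \<in> I. emeasure M (B n))" for n
    proof -
      have "(\<lambda>B. B n) ` I = adm (A n)"
      proof (intro equalityI subsetI)
        fix X assume "X \<in> adm (A n)"
        then have "(\<lambda>m. if m = n then X else {}) \<in> I" by (auto simp: I_def adm_def)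
        then show "X \<in> (\<lambda>B. B n) ` I" by (rule rev_image_eqI) simp
      qed (auto simp: I_def)
      moreover have "(\<lambda>B. emeasure M (B n)) ` I = emeasure M ` (\<lambda>B. B n) ` I"
        by (simp only: image_image)
      ultimately show ?thesis by (simp only: \<mu>_def)
    qed
    have "(\<Sum>n. \<mu> (A n)) = (SUP B \<in> I. \<Sum>n. emeasure M (B n))"
      unfolding coord
    proof (rule ennreal_suminf_SUP_eq_directed)
      fix N :: "nat set" and B C assume "B \<in> I" "C \<in> I"
      then show "\<exists>D\<in>I. \<forall>n\<in>N. emeasure M (B n) \<le> emeasure M (D n) \<and>
          emeasure M (C n) \<le> emeasure M (D n)"
        by (intro bexI[of _ "\<lambda>n. if emeasure M (B n) \<le> emeasure M (C n) then C n else B n"])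
          (auto simp: I_def)
    qed
    also have "\<dots> = \<mu> (\<Union>n. A n)"
    proof (rule antisym)
      show "(SUP B \<in> I. \<Sum>n. emeasure M (B n)) \<le> \<mu> (\<Union>n. A n)"
      proof (rule SUP_least)
        fix B assume B: "B \<in> I"
        then have sub: "B n \<subseteq> p -` A n" and inj: "inj_on p (B n)" and meas: "B n \<in> sets M" for n
          by (auto simp: I_def adm_def)
        have djB: "disjoint_family B"
          unfolding disjoint_family_on_def
        proof (intro ballI impI)
          fix m n :: nat assume "m \<noteq> n"
          then have "A m \<inter> A n = {}" using disj by (simp add: disjoint_family_on_def)
          then show "B m \<inter> B n = {}" using sub[of m] sub[of n] by blast
        qed
        have "inj_on p (\<Union>n. B n)"
        proof (rule inj_onI)
          fix x y assume "x \<in> (\<Union>n. B n)" "y \<in> (\<Union>n. B n)" and eq: "p x = p y"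
          then obtain m n where mn: "x \<in> B m" "y \<in> B n" by auto
          then have "p x \<in> A m" using sub[of m] by blast
          moreover have "p x \<in> A n" using mn(2) sub[of n] eq by (metis subsetD vimageE)
          ultimately have "m = n" using disj unfolding disjoint_family_on_def by blast
          then show "x = y" using mn inj_onD[OF inj eq] by blast
        qed
        moreover have "(\<Union>n. B n) \<subseteq> p -` (\<Union>n. A n)"
          using sub by blast
        ultimately have "(\<Union>n. B n) \<in> adm (\<Union>n. A n)"
          using meas by (simp add: adm_def sets.countable_UN image_subset_iff)
        moreover have "(\<Sum>n. emeasure M (B n)) = emeasure M (\<Union>n. B n)"
          using meas djB by (intro suminf_emeasure) auto
        ultimately show "(\<Sum>n. emeasure M (B n)) \<le> \<mu> (\<Union>n. A n)"
          unfolding \<mu>_def by (simp only: SUP_upper)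
      qed
      show "\<mu> (\<Union>n. A n) \<le> (SUP B \<in> I. \<Sum>n. emeasure M (B n))"
        unfolding \<mu>_def
      proof (rule SUP_least)
        fix X assume X: "X \<in> adm (\<Union>n. A n)"
        define B where "B n = X \<inter> (p -` A n \<inter> space M)" for n
        have XM: "X \<in> sets M" "X \<subseteq> space M" "X \<subseteq> p -` (\<Union>n. A n)" "inj_on p X"
          using X sets.sets_into_space by (auto simp: adm_def)
        have "p -` A n \<inter> space M \<in> sets M" for n
          using A by blast
        then have meas: "B n \<in> sets M" for n
          unfolding B_def using XM(1) by blast
        then have "B \<in> I"
          using XM by (auto simp: I_def adm_def B_def intro: inj_on_subset)
        moreover have "emeasure M X = (\<Sum>n. emeasure M (B n))"
        proof -
          have "X \<subseteq> (\<Union>n. B n)"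
          proof
            fix x assume x: "x \<in> X"
            then have "p x \<in> (\<Union>n. A n)" using XM(3) by blast
            then obtain n where "p x \<in> A n" by (rule UN_E)
            then have "x \<in> B n" using x XM(2) unfolding B_def by blast
            then show "x \<in> (\<Union>n. B n)" by (rule UN_I[OF UNIV_I])
          qed
          then have "X = (\<Union>n. B n)" by (auto simp: B_def)
          moreover have "disjoint_family B"
            using disj unfolding disjoint_family_on_def B_def by blast
          ultimately show ?thesis using meas by (simp add: suminf_emeasure image_subset_iff)
        qed
        ultimately show "emeasure M X \<le> (SUP B \<in> I. \<Sum>n. emeasure M (B n))"
          using SUP_upper[of B I "\<lambda>B. \<Sum>n. emeasure M (B n)"] by (simp only:)
      qed
    qed
    finally show "(\<Sum>n. \<mu> (A n)) = \<mu> (\<Union>n. A n)" .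
  qed
  have pos: "positive ?S \<mu>"
    by (auto simp: positive_def \<mu>_def adm_def)
  have E: "E \<in> ?S"
    using assms by (simp only: sets_quotient_measure)
  have "quotient_measure M p = measure_of (p ` space M) ?S \<mu>"
    by (simp add: quotient_measure_def \<mu>_def[abs_def] adm_def)
  then have "emeasure (quotient_measure M p) E = \<mu> E"
    using emeasure_measure_of_sigma[OF sigma_algebra_quotient pos ca E] by (simp only:)
  then show ?thesis by (simp add: \<mu>_def adm_def)
qed


section \<open>The orbifold \<open>\<H>/\<Gamma>\<close> and its unit tangent bundle\<close>

definition hyperbolic_area :: "complex measure" where
  "hyperbolic_area =
     density (restrict_space lborel upper_half_plane) (\<lambda>z. ennreal (1 / (Im z)\<^sup>2))"

definition orbit :: "(real^2^2) set set \<Rightarrow> complex \<Rightarrow> complex set" where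
  "orbit \<Gamma> z = (\<lambda>g. psl_act g z) ` \<Gamma>"

definition orbifold_topology :: "(real^2^2) set set \<Rightarrow> complex set topology" where
  "orbifold_topology \<Gamma> = topology (\<lambda>U. U \<subseteq> orbit \<Gamma> ` upper_half_plane \<and>
     openin (top_of_set upper_half_plane) {z \<in> upper_half_plane. orbit \<Gamma> z \<in> U})"

lemma openin_orbifold_topology:
  "openin (orbifold_topology \<Gamma>) U \<longleftrightarrow> U \<subseteq> orbit \<Gamma> ` upper_half_plane \<and>
     openin (top_of_set upper_half_plane) {z \<in> upper_half_plane. orbit \<Gamma> z \<in> U}"
proof -
  let ?H = upper_half_plane
  have "istopology (\<lambda>U. U \<subseteq> orbit \<Gamma> ` ?H \<and> openin (top_of_set ?H) {z \<in> ?H. orbit \<Gamma> z \<in> U})"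
    unfolding istopology_def
  proof (intro conjI allI impI)
    fix S T
    assume S: "S \<subseteq> orbit \<Gamma> ` ?H \<and> openin (top_of_set ?H) {z \<in> ?H. orbit \<Gamma> z \<in> S}"
      and T: "T \<subseteq> orbit \<Gamma> ` ?H \<and> openin (top_of_set ?H) {z \<in> ?H. orbit \<Gamma> z \<in> T}"
    have "{z \<in> ?H. orbit \<Gamma> z \<in> S \<inter> T} = {z \<in> ?H. orbit \<Gamma> z \<in> S} \<inter> {z \<in> ?H. orbit \<Gamma> z \<in> T}"
      by auto
    with S T show "openin (top_of_set ?H) {z \<in> ?H. orbit \<Gamma> z \<in> S \<inter> T}" by auto
  next
    fix \<K>
    assume K: "\<forall>K\<in>\<K>. K \<subseteq> orbit \<Gamma> ` ?H \<and> openin (top_of_set ?H) {z \<in> ?H. orbit \<Gamma> z \<in> K}"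
    have "{z \<in> ?H. orbit \<Gamma> z \<in> \<Union> \<K>} = \<Union> ((\<lambda>K. {z \<in> ?H. orbit \<Gamma> z \<in> K}) ` \<K>)" by auto
    moreover have "openin (top_of_set ?H) (\<Union> ((\<lambda>K. {z \<in> ?H. orbit \<Gamma> z \<in> K}) ` \<K>))"
      using K by (intro openin_Union) blast
    ultimately show "openin (top_of_set ?H) {z \<in> ?H. orbit \<Gamma> z \<in> \<Union> \<K>}"
      by (simp only:)
  qed blast+
  then show ?thesis
    unfolding orbifold_topology_def by (simp add: topology_inverse')
qed

lemma topspace_orbifold_topology: "topspace (orbifold_topology \<Gamma>) = orbit \<Gamma> ` upper_half_plane"
proof (rule antisym)
  show "topspace (orbifold_topology \<Gamma>) \<subseteq> orbit \<Gamma> ` upper_half_plane"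
    using openin_orbifold_topology openin_topspace by blast
  have "{z \<in> upper_half_plane. orbit \<Gamma> z \<in> orbit \<Gamma> ` upper_half_plane} = upper_half_plane"
    by auto
  then have "openin (orbifold_topology \<Gamma>) (orbit \<Gamma> ` upper_half_plane)"
    by (simp add: openin_orbifold_topology)
  then show "orbit \<Gamma> ` upper_half_plane \<subseteq> topspace (orbifold_topology \<Gamma>)"
    by (rule openin_subset)
qed

definition orbifold_area_measure :: "(real^2^2) set set \<Rightarrow> complex set measure" where
  "orbifold_area_measure \<Gamma> = quotient_measure hyperbolic_area (orbit \<Gamma>)"

definition orbifold_area :: "(real^2^2) set set \<Rightarrow> real" where
  "orbifold_area \<Gamma> = measure (orbifold_area_measure \<Gamma>) (space (orbifold_area_measure \<Gamma>))"

text \<open>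
  A unit tangent vector of \<open>\<H>\<close> is given by its base point \<open>z\<close> and its direction \<open>u\<close>, \<open>\<bar>u\<bar> = 1\<close>;
  as a tangent vector in the plane it is \<open>Im z *\<^sub>R u\<close>, which has hyperbolic length \<open>1\<close>.
\<close>

definition circle_measure :: "complex measure" where
  "circle_measure =
     distr (restrict_space lborel {0..<2 * pi}) (restrict_space borel (sphere 0 1)) cis"

definition liouville :: "(complex \<times> complex) measure" where
  "liouville = hyperbolic_area \<Otimes>\<^sub>M circle_measure"

definition tangent_act :: "(real^2^2) set \<Rightarrow> complex \<times> complex \<Rightarrow> complex \<times> complex" where
  "tangent_act g = (\<lambda>(z, u). (psl_act g z, sgn (deriv (psl_act g) z) * u))"

definition tangent_orbit :: "(real^2^2) set set \<Rightarrow> complex \<times> complex \<Rightarrow> (complex \<times> complex) set" where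
  "tangent_orbit \<Gamma> w = (\<lambda>g. tangent_act g w) ` \<Gamma>"

text \<open>The measure on \<open>T\<^sub>1S = \<Gamma> \ T\<^sub>1\<H>\<close>; its space is the set of \<open>\<Gamma>\<close>-orbits in \<open>T\<^sub>1\<H>\<close>.\<close>

definition unit_tangent_measure :: "(real^2^2) set set \<Rightarrow> (complex \<times> complex) set measure" where
  "unit_tangent_measure \<Gamma> = quotient_measure liouville (tangent_orbit \<Gamma>)"


section \<open>Normalized zonal Fuchsian groups\<close>

definition horodisk :: "real \<Rightarrow> complex set" where
  "horodisk m = {z. Im z > m}"

definition stab_infinity :: "(real^2^2) set set \<Rightarrow> (real^2^2) set set" where
  "stab_infinity \<Gamma> = {g \<in> \<Gamma>. psl_at_infinity g = None}"

text \<open>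
  \<open>\<Union>\<Gamma>\<close> is the full preimage of \<open>\<Gamma>\<close> in \<open>SL\<^sub>2(\<real>)\<close>.  As \<open>SL\<^sub>2(\<real>) \<rightarrow> PSL\<^sub>2(\<real>)\<close> is a twofold covering,
  \<open>\<Gamma>\<close> is discrete iff \<open>\<Union>\<Gamma>\<close> is.
\<close>

definition zonal_fuchsian :: "(real^2^2) set set \<Rightarrow> bool" where
  "zonal_fuchsian \<Gamma> \<longleftrightarrow>
     subgroup \<Gamma> PSL2R \<and>
     discrete (\<Union>\<Gamma>) \<and>
     \<not> compact_space (orbifold_topology \<Gamma>) \<and>
     emeasure (orbifold_area_measure \<Gamma>) (space (orbifold_area_measure \<Gamma>)) < \<infinity> \<and>
     stab_infinity \<Gamma> = generate PSL2R {psl_of (mat2 1 1 0 1)}"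

definition eta :: "(real^2^2) set set \<Rightarrow> real" where
  "eta \<Gamma> = (LEAST m. m > 0 \<and>
     (\<forall>g \<in> \<Gamma> - stab_infinity \<Gamma>. horodisk m \<inter> psl_act g ` horodisk m = {}))"

text \<open>
  The closures are a closed half-plane and a closed disk, so they are tangent at a point iff this is
  their only common point.
\<close>

definition normalized :: "(real^2^2) set set \<Rightarrow> bool" where
  "normalized \<Gamma> \<longleftrightarrow> (\<exists>h \<in> \<Gamma>. psl_at_infinity h = Some 0 \<and>
     closure (horodisk (eta \<Gamma>)) \<inter> closure (psl_act h ` horodisk (eta \<Gamma>)) =
       {of_real (eta \<Gamma>) * \<i>})"

text \<open>The map \<open>z \<mapsto> -\<eta>\<^sup>2/z\<close>, with matrix normalized to determinant \<open>1\<close>.\<close>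

definition U_eta :: "real \<Rightarrow> (real^2^2) set" where
  "U_eta \<eta> = psl_of (mat2 0 (- \<eta>) (1 / \<eta>) 0)"


section \<open>Geodesics\<close>

definition hyperbolic_dist :: "complex \<Rightarrow> complex \<Rightarrow> real" where
  "hyperbolic_dist z w = arcosh (1 + (cmod (z - w))\<^sup>2 / (2 * Im z * Im w))"

text \<open>Unit-speed geodesics of \<open>\<H>\<close> are globally minimizing, i.e. the isometric embeddings of \<open>\<real>\<close>.\<close>

definition geodesic_line :: "(real \<Rightarrow> complex) \<Rightarrow> bool" where
  "geodesic_line \<gamma> \<longleftrightarrow>
     (\<forall>t. \<gamma> t \<in> upper_half_plane) \<and> (\<forall>s t. hyperbolic_dist (\<gamma> s) (\<gamma> t) = \<bar>s - t\<bar>)"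

definition geodesic_from :: "complex \<times> complex \<Rightarrow> real \<Rightarrow> complex" where
  "geodesic_from = (\<lambda>(z, u). THE \<gamma>. geodesic_line \<gamma> \<and> \<gamma> 0 = z \<and>
     (\<gamma> has_vector_derivative Im z *\<^sub>R u) (at 0))"

text \<open>
  The geodesic \<open>\<gamma>(v)\<close> of \<open>S\<close>, for \<open>v\<close> a \<open>\<Gamma>\<close>-orbit in \<open>T\<^sub>1\<H>\<close>.  All \<open>w \<in> v\<close> give the same curve.
\<close>

definition orbifold_geodesic ::
    "(real^2^2) set set \<Rightarrow> (complex \<times> complex) set \<Rightarrow> real \<Rightarrow> complex set" where
  "orbifold_geodesic \<Gamma> v t = orbit \<Gamma> (geodesic_from (SOME w. w \<in> v) t)"

definition lift_of ::
    "(real^2^2) set set \<Rightarrow> (real \<Rightarrow> complex set) \<Rightarrow> (real \<Rightarrow> complex) \<Rightarrow> bool" where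
  "lift_of \<Gamma> \<gamma> \<gamma>' \<longleftrightarrow> geodesic_line \<gamma>' \<and> (\<forall>t. orbit \<Gamma> (\<gamma>' t) = \<gamma> t)"

text \<open>The pair (forward endpoint, backward endpoint) of the geodesic lies in \<open>X\<close>.\<close>

definition endpoints_in :: "(real \<Rightarrow> complex) \<Rightarrow> (real \<times> real) set \<Rightarrow> bool" where
  "endpoints_in \<gamma>' X \<longleftrightarrow> (\<exists>(x, y) \<in> X.
     (\<gamma>' \<longlongrightarrow> complex_of_real x) at_top \<and> (\<gamma>' \<longlongrightarrow> complex_of_real y) at_bot)"


section \<open>Excursions\<close>

text \<open>Tangency to the boundary of a horodisk at \<open>\<infinity>\<close>, which is a horizontal line.\<close>

definition tangent_to_horocycle :: "(real \<Rightarrow> complex) \<Rightarrow> real \<Rightarrow> real \<Rightarrow> bool" where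
  "tangent_to_horocycle \<gamma>' m s \<longleftrightarrow>
     \<gamma>' s \<in> frontier (horodisk m) \<and> Im (vector_derivative \<gamma>' (at s)) = 0"

definition excursion_at ::
    "(real^2^2) set set \<Rightarrow> (real \<Rightarrow> complex set) \<Rightarrow> real \<Rightarrow> real \<Rightarrow> bool" where
  "excursion_at \<Gamma> \<gamma> d s \<longleftrightarrow>
     d > 0 \<and> (\<exists>\<gamma>'. lift_of \<Gamma> \<gamma> \<gamma>' \<and> tangent_to_horocycle \<gamma>' (1 / d) s)"

text \<open>Depth parameters of the \<open>k\<close>-excursions.\<close>

definition excursions ::
    "(real^2^2) set set \<Rightarrow> (real \<Rightarrow> complex set) \<Rightarrow> real \<Rightarrow> real set" where
  "excursions \<Gamma> \<gamma> k = {s. \<exists>d < k. excursion_at \<Gamma> \<gamma> d s}"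

text \<open>The depth and the distinguished lift are unique for almost every geodesic (and \<open>k \<le> 2\<close>).\<close>

definition depth :: "(real^2^2) set set \<Rightarrow> (real \<Rightarrow> complex set) \<Rightarrow> real \<Rightarrow> real" where
  "depth \<Gamma> \<gamma> s = (THE d. excursion_at \<Gamma> \<gamma> d s)"

definition region_J :: "(real \<times> real) set" where
  "region_J = ({-1<..<0} \<times> {0<..}) \<union> ({0<..<1} \<times> {..<0})"

definition region_I :: "(real \<times> real) set" where
  "region_I = ({-1<..<0} \<times> {1<..}) \<union> ({0<..<1} \<times> {..<-1})"

definition excursion_lift ::
    "(real^2^2) set set \<Rightarrow> (real \<Rightarrow> complex set) \<Rightarrow> real \<Rightarrow> real \<Rightarrow> complex" where
  "excursion_lift \<Gamma> \<gamma> s = (THE \<gamma>'. lift_of \<Gamma> \<gamma> \<gamma>' \<and>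
     tangent_to_horocycle \<gamma>' (1 / depth \<Gamma> \<gamma> s) s \<and> endpoints_in \<gamma>' region_J)"

definition approximating_excursions ::
    "(real^2^2) set set \<Rightarrow> (real \<Rightarrow> complex set) \<Rightarrow> real \<Rightarrow> real set" where
  "approximating_excursions \<Gamma> \<gamma> k =
     {s \<in> excursions \<Gamma> \<gamma> k. endpoints_in (excursion_lift \<Gamma> \<gamma> s) region_I}"

definition N_exc :: "(real^2^2) set set \<Rightarrow> (complex \<times> complex) set \<Rightarrow> real \<Rightarrow> real \<Rightarrow> nat" where
  "N_exc \<Gamma> v k t = card (excursions \<Gamma> (orbifold_geodesic \<Gamma> v) k \<inter> {0..t})"

definition N_approx :: "(real^2^2) set set \<Rightarrow> (complex \<times> complex) set \<Rightarrow> real \<Rightarrow> real \<Rightarrow> nat" where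
  "N_approx \<Gamma> v k t = card (approximating_excursions \<Gamma> (orbifold_geodesic \<Gamma> v) k \<inter> {0..t})"

definition calA :: "real \<Rightarrow> real" where
  "calA z = (if z \<le> 1 then z else 2 - z + 2 * ln z)"

end

theory Submission
  imports Defs
begin

text \<open>
  A geodesic line of \<open>\<H>\<close> is the image of the imaginary axis under a matrix \<open>M\<close> with rows \<open>(a, b)\<close> and
  \<open>(c, d)\<close>.  Its endpoints are \<open>x = a / c\<close> (forward) and \<open>y = b / d\<close> (backward), and if \<open>det M = 1\<close> it is highest
  at the time \<open>ln \<bar>d / c\<bar>\<close>, called \<open>peak M\<close> below, where its height is \<open>\<bar>x - y\<bar> / 2 = 1 / (2 * \<bar>c * d\<bar>)\<close>.
  Right multiplication by \<open>geo t\<close>, the diagonal matrix with entries \<open>exp (t / 2)\<close> and \<open>exp (- t / 2)\<close>, is the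
  geodesic flow: it fixes the endpoints and lowers the peak time by \<open>t\<close>.  Let \<open>S\<close> be the preimage of \<open>\<Gamma>\<close> in
  \<open>SL\<^sub>2(\<real>)\<close>.  The lifts of the geodesic of \<open>M\<close> are the geodesics of \<open>A ** M\<close> with \<open>A \<in> S\<close>, so its
  \<open>k\<close>-excursions are the peaks of those lifts whose endpoints satisfy \<open>\<bar>x - y\<bar> > 2 / k\<close>.  For \<open>k \<le> 2\<close> and a
  generic \<open>M\<close>, each of them is the peak of exactly one lift with endpoints in \<^const>\<open>region_J\<close>, up to
  replacing \<open>A\<close> by \<open>- A\<close> (\<open>excursions_generic\<close>, \<open>card_crossing\<close>), and it is approximating iff these endpoints
  are in \<^const>\<open>region_I\<close> (\<open>approximating_excursions_generic\<close>).

  Both counts are therefore of the following kind: for a region \<open>R\<close> of pairs of endpoints, count the \<open>A \<in> S\<close>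
  such that \<open>A ** M\<close> has its endpoints in \<open>R\<close> and its peak in \<open>{0..<n}\<close>.  This number is a Birkhoff sum for the
  time-one map of the flow.  By ergodicity it grows like \<open>n\<close> times the mean number for \<open>{0..<1}\<close>
  (\<open>crossings_asymptotics\<close>).  The integral of the number for \<open>{0..<1}\<close> over a fundamental domain unfolds to the
  mass of all geodesics with endpoints in \<open>R\<close> in one unit of time, which is the integral \<open>flux R\<close> of
  \<open>1 / (x - y)\<^sup>2\<close> over \<open>R\<close>.  An elementary integration gives the value \<open>k\<close> for the deep pairs in \<open>J\<close>, and
  \<open>calA k\<close> for those in \<open>I\<close> (\<open>flux_J\<close>, \<open>flux_I\<close>).  The total mass is \<open>pi / 2\<close> times the area of the orbifold
  (\<open>measure_ford_cone\<close>), and each excursion is counted for \<open>A\<close> and for \<open>- A\<close>; together this makes the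
  constant \<open>1 / (pi * area)\<close>.

  Instead of Haar measure, Lebesgue measure on the matrices with \<open>0 < det M < 1\<close> is used, which is invariant
  under left and right multiplication by matrices of determinant \<open>1\<close>.  The quotient by \<open>S\<close> and by positive
  scalars is represented by the \<open>\<sigma>\<close>-algebra of invariant sets of matrices, with the measure \<open>N\<close> of their part
  over the Ford domain of \<open>\<Gamma>\<close>.  Ergodicity is the Mautner phenomenon: sets invariant under the geodesic flow
  are invariant under the shears that it contracts or expands, and these generate \<open>SL\<^sub>2(\<real>)\<close>
  (\<open>mautner\<close>, \<open>geodesic_flow_ergodic\<close>).

  The good matrices, for which the limits hold for all rational \<open>k\<close>, thus form a set of full measure, and
  monotonicity of the counts in \<open>k\<close> extends the limits to all \<open>k\<close> (\<open>monotone_family_limit\<close>).  Finally, an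
  invariant null set of matrices consists of the representatives of a null set of unit tangent vectors, because
  in Iwasawa coordinates a matrix is a base point, a direction and a scale (\<open>unit_tangent_null\<close>).
\<close>


section \<open>Birkhoff's ergodic theorem\<close>

text \<open>
  The maximum of \<open>0\<close> and the first \<open>n\<close> Birkhoff sums of \<open>g\<close>.  The recursion, which peels off the first
  term of the orbit, is the form in which the maximal ergodic inequality is visible.
\<close>

fun birkhoff_max :: "('a \<Rightarrow> 'a) \<Rightarrow> ('a \<Rightarrow> real) \<Rightarrow> nat \<Rightarrow> 'a \<Rightarrow> real" where
  "birkhoff_max T g 0 x = 0"
| "birkhoff_max T g (Suc n) x = max 0 (g x + birkhoff_max T g n (T x))"

lemma birkhoff_max_nonneg: "birkhoff_max T g n x \<ge> 0"
  by (cases n) auto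

lemma birkhoff_max_mono: "birkhoff_max T g n x \<le> birkhoff_max T g (Suc n) x"
proof (induction n arbitrary: x)
  case (Suc n)
  show ?case using Suc[of "T x"] by (auto simp del: birkhoff_max.simps(2) simp: birkhoff_max.simps(2)[of T g _ x])
qed simp

lemma birkhoff_sum_Suc:
  "(\<Sum>i<Suc n. g ((T ^^ i) x)) = g x + (\<Sum>i<n. (g ((T ^^ i) (T x)) :: real))"
  by (simp only: sum.lessThan_Suc_shift funpow_simps_right o_apply funpow_0 id_apply)

lemma birkhoff_sum_le_max: "(\<Sum>i<n. g ((T ^^ i) x)) \<le> birkhoff_max T g n x"
proof (induction n arbitrary: x)
  case (Suc n)
  then show ?case
    unfolding birkhoff_sum_Suc using Suc[of "T x"] by (simp add: max.coboundedI2)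
qed simp

locale measure_preserving_map = finite_measure N for N :: "'a measure" +
  fixes T :: "'a \<Rightarrow> 'a"
  assumes T_measurable [measurable]: "T \<in> measurable N N"
    and T_preserves: "A \<in> sets N \<Longrightarrow> emeasure N (T -` A \<inter> space N) = emeasure N A"
begin

lemma distr_T: "distr N N T = N"
  by (rule measure_eqI) (auto simp: emeasure_distr T_preserves)

lemma integrable_comp: "integrable N f \<Longrightarrow> integrable N (\<lambda>x. f (T x))"
  for f :: "'a \<Rightarrow> real"
  using integrable_distr[OF T_measurable, of f] by (simp add: distr_T)

lemma integral_comp:
  "f \<in> borel_measurable N \<Longrightarrow> integral\<^sup>L N (\<lambda>x. f (T x)) = integral\<^sup>L N f" for f :: "'a \<Rightarrow> real"
  using integral_distr[OF T_measurable, of f] by (simp add: distr_T)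

lemma funpow_measurable [measurable]: "(T ^^ n) \<in> measurable N N"
  by (induction n) (auto intro: measurable_comp)

lemma AE_comp: "AE x in N. P x \<Longrightarrow> AE x in N. P (T x)"
proof -
  assume "AE x in N. P x"
  then obtain Z where Z: "{x \<in> space N. \<not> P x} \<subseteq> Z" "emeasure N Z = 0" "Z \<in> sets N"
    by (rule AE_E)
  then have "T -` Z \<inter> space N \<in> null_sets N"
    by (auto simp: T_preserves intro!: measurable_sets[OF T_measurable])
  moreover have "{x \<in> space N. \<not> P (T x)} \<subseteq> T -` Z \<inter> space N"
    using Z measurable_space[OF T_measurable] by auto
  ultimately show ?thesis by (rule AE_I')
qed

lemma AE_funpow: "AE x in N. P x \<Longrightarrow> AE x in N. P ((T ^^ n) x)"
proof (induction n)
  case (Suc n)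
  from AE_comp[OF Suc.IH[OF Suc.prems]] show ?case by (simp add: funpow_swap1)
qed simp

lemma birkhoff_max_integrable:
  "integrable N g \<Longrightarrow> integrable N (birkhoff_max T g n)"
proof (induction n)
  case 0
  have "birkhoff_max T g 0 = (\<lambda>_. 0)" by auto
  then show ?case by simp
next
  case (Suc n)
  have "birkhoff_max T g (Suc n) = (\<lambda>x. max 0 (g x + birkhoff_max T g n (T x)))" by auto
  then show ?case using Suc by (simp add: integrable_comp)
qed

text \<open>
  Let \<open>M\<^sub>n\<close> be \<open>birkhoff_max T g n\<close>.  Then \<open>M\<^sub>n\<^sub>+\<^sub>1 - M\<^sub>n \<circ> T = max (- M\<^sub>n \<circ> T) g\<close>, and its integral over an
  invariant set is nonnegative since \<open>M\<^sub>n\<close> increases with \<open>n\<close> and \<open>T\<close> preserves the measure.  Where the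
  Birkhoff sums are unbounded this function is eventually equal to \<open>g\<close>, and it is always dominated by
  \<open>\<bar>g\<bar>\<close>, so that the inequality passes to the limit.
\<close>

lemma maximal_ergodic:
  fixes g :: "'a \<Rightarrow> real"
  assumes g: "integrable N g"
    and A: "A \<in> sets N" "T -` A \<inter> space N = A"
    and unbounded: "\<And>x K. x \<in> A \<Longrightarrow> \<exists>n. (\<Sum>i<n. g ((T ^^ i) x)) > K"
  shows "0 \<le> integral\<^sup>L N (\<lambda>x. g x * indicator A x)"
proof -
  let ?M = "birkhoff_max T g"
  have A_iff: "T x \<in> A \<longleftrightarrow> x \<in> A" if "x \<in> space N" for x
    using A(2) that by blast
  note [measurable] = A(1) borel_measurable_integrable[OF g]
    borel_measurable_integrable[OF birkhoff_max_integrable[OF g]]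
  define h where "h n x = max (- ?M n (T x)) (g x) * indicator A x" for n x
  have hm[measurable]: "h n \<in> borel_measurable N" for n unfolding h_def by measurable
  have int: "0 \<le> integral\<^sup>L N (h n)" for n
  proof -
    have i1: "integrable N (\<lambda>x. ?M k x * indicator A x)" for k
      using integrable_mult_indicator[OF A(1) birkhoff_max_integrable[OF g, of k]] by (simp add: mult.commute)
    have "integral\<^sup>L N (h n) = integral\<^sup>L N (\<lambda>x. ?M (Suc n) x * indicator A x - ?M n (T x) * indicator A (T x))"
      by (rule Bochner_Integration.integral_cong) (auto simp: h_def A_iff indicator_def max_def)
    also have "\<dots> = integral\<^sup>L N (\<lambda>x. ?M (Suc n) x * indicator A x) - integral\<^sup>L N (\<lambda>x. ?M n x * indicator A x)"
      using i1 integrable_comp[OF i1[of n]]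
      by (subst Bochner_Integration.integral_diff)
         (auto simp del: birkhoff_max.simps intro!: integral_comp[of "\<lambda>x. ?M n x * indicator A x"])
    also have "\<dots> \<ge> 0"
      using i1 by (simp del: birkhoff_max.simps add: integral_mono birkhoff_max_mono mult_right_mono)
    finally show ?thesis .
  qed
  have "(\<lambda>n. integral\<^sup>L N (h n)) \<longlonglongrightarrow> integral\<^sup>L N (\<lambda>x. g x * indicator A x)"
  proof (rule integral_dominated_convergence[where w="\<lambda>x. \<bar>g x\<bar>"])
    show "AE x in N. (\<lambda>n. h n x) \<longlonglongrightarrow> g x * indicator A x"
    proof (rule AE_I2)
      fix x assume x: "x \<in> space N"
      show "(\<lambda>n. h n x) \<longlonglongrightarrow> g x * indicator A x"
      proof (cases "x \<in> A")
        case True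
        then have "T x \<in> A" using A_iff x by simp
        then obtain n0 where "(\<Sum>i<n0. g ((T ^^ i) (T x))) > - g x" using unbounded by blast
        with birkhoff_sum_le_max[of g T "T x" n0] have "?M n0 (T x) \<ge> - g x" by simp
        then have "?M n (T x) \<ge> - g x" if "n \<ge> n0" for n
          using lift_Suc_mono_le[of "\<lambda>n. ?M n (T x)", OF birkhoff_max_mono that] by simp
        then have "h n x = g x * indicator A x" if "n \<ge> n0" for n
          using that by (fastforce simp: h_def max_def)
        then have "\<forall>\<^sub>F n in sequentially. h n x = g x * indicator A x"
          by (auto simp: eventually_sequentially)
        then show ?thesis by (rule tendsto_eventually)
      qed (simp add: h_def)
    qed
    have "\<bar>max (- ?M n (T x)) (g x)\<bar> \<le> \<bar>g x\<bar>" for n x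
      using birkhoff_max_nonneg[of T g n "T x"] by linarith
    then show "AE x in N. norm (h n x) \<le> \<bar>g x\<bar>" for n
      by (intro AE_I2) (auto simp: h_def indicator_def)
  qed (use g in auto)
  then show ?thesis by (rule LIMSEQ_le_const) (auto simp: int)
qed

end

locale ergodic_map = measure_preserving_map +
  assumes ergodic: "A \<in> sets N \<Longrightarrow> T -` A \<inter> space N = A \<Longrightarrow>
    emeasure N A = 0 \<or> emeasure N (space N - A) = 0"
begin

text \<open>
  The set where the sums are unbounded above is invariant, so it is null or conull; being conull would
  make the integral of \<open>g\<close> nonnegative by the maximal ergodic inequality.
\<close>

lemma sums_bounded_above:
  assumes g: "integrable N g" and neg: "integral\<^sup>L N g < 0"
  shows "AE x in N. \<exists>K. \<forall>n. (\<Sum>i<n. g ((T ^^ i) x)) \<le> (K::real)"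
proof -
  note [measurable] = borel_measurable_integrable[OF g]
  define A where "A = {x \<in> space N. \<forall>K::nat. \<exists>n. (\<Sum>i<n. g ((T ^^ i) x)) > real K}"
  have [measurable]: "A \<in> sets N" unfolding A_def by measurable
  have unb: "\<exists>n. (\<Sum>i<n. g ((T ^^ i) x)) > K" if x: "x \<in> A" for x K
  proof -
    obtain k :: nat where "real k \<ge> K" using real_arch_simple by blast
    moreover obtain n where "(\<Sum>i<n. g ((T ^^ i) x)) > real k" using x unfolding A_def by blast
    ultimately show ?thesis by (meson le_less_trans)
  qed
  have inv: "T -` A \<inter> space N = A"
  proof (intro equalityI subsetI)
    fix x assume x: "x \<in> T -` A \<inter> space N"
    have "\<exists>n. (\<Sum>i<n. g ((T ^^ i) x)) > real K" for K :: nat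
    proof -
      obtain n where "(\<Sum>i<n. g ((T ^^ i) (T x))) > real K - g x" using unb x by blast
      then have "(\<Sum>i<Suc n. g ((T ^^ i) x)) > real K" unfolding birkhoff_sum_Suc by simp
      then show ?thesis by blast
    qed
    then show "x \<in> A" using x by (auto simp: A_def)
  next
    fix x assume x: "x \<in> A"
    then have sp: "x \<in> space N" by (simp add: A_def)
    have "\<exists>n. (\<Sum>i<n. g ((T ^^ i) (T x))) > real K" for K :: nat
    proof -
      obtain n where n: "(\<Sum>i<n. g ((T ^^ i) x)) > \<bar>real K + g x\<bar>" using unb x by blast
      then obtain m where m: "n = Suc m" by (cases n) auto
      from n[unfolded m] birkhoff_sum_Suc[of g T x m] have "(\<Sum>i<m. g ((T ^^ i) (T x))) > real K" by linarith
      then show ?thesis by blast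
    qed
    then show "x \<in> T -` A \<inter> space N"
      using sp measurable_space[OF T_measurable] by (auto simp: A_def)
  qed
  have "emeasure N (space N - A) \<noteq> 0"
  proof
    assume 0: "emeasure N (space N - A) = 0"
    have "AE x in N. x \<in> A"
      by (rule AE_I'[of "space N - A"]) (use 0 in auto)
    then have "integral\<^sup>L N (\<lambda>x. g x * indicator A x) = integral\<^sup>L N g"
      by (intro integral_cong_AE) auto
    with maximal_ergodic[OF g _ inv unb] neg show False by simp
  qed
  with ergodic[OF _ inv] have "A \<in> null_sets N" by auto
  moreover have "{x \<in> space N. \<not> (\<exists>K. \<forall>n. (\<Sum>i<n. g ((T ^^ i) x)) \<le> K)} \<subseteq> A"
    unfolding A_def by (auto simp: not_le)
  ultimately show ?thesis by (rule AE_I')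
qed

text \<open>
  Apply boundedness of the Birkhoff sums to \<open>f - c\<close> and divide by \<open>n\<close>.
\<close>

lemma birkhoff_upper:
  assumes f: "integrable N f" and c: "integral\<^sup>L N f < c * measure N (space N)"
    and e: "e > 0"
  shows "AE x in N. \<forall>\<^sub>F n in sequentially. (\<Sum>i<n. f ((T ^^ i) x)) / real n \<le> c + e"
proof -
  have "AE x in N. \<exists>K. \<forall>n. (\<Sum>i<n. f ((T ^^ i) x) - c) \<le> (K::real)"
    using sums_bounded_above[of "\<lambda>x. f x - c"] f c by (simp add: mult.commute)
  then show ?thesis
  proof eventually_elim
    case (elim x)
    then obtain K where K: "\<And>n. (\<Sum>i<n. f ((T ^^ i) x)) - real n * c \<le> K"
      by (auto simp: sum_subtractf)
    obtain n0 :: nat where n0: "real n0 > \<bar>K\<bar> / e" using reals_Archimedean2 by blast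
    show ?case unfolding eventually_sequentially
    proof (intro exI[of _ "Suc n0"] allI impI)
      fix n assume n: "Suc n0 \<le> n"
      have "\<bar>K\<bar> < e * real n0" using n0 e by (simp add: field_simps)
      also have "\<dots> \<le> e * real n" using n e by simp
      finally show "(\<Sum>i<n. f ((T ^^ i) x)) / real n \<le> c + e"
        using K[of n] n by (simp add: field_simps)
    qed
  qed
qed

text \<open>
  Birkhoff's theorem for an ergodic map: the upper bound for \<open>f\<close> and the one for \<open>- f\<close> enclose the averages.
\<close>

theorem birkhoff:
  assumes f: "integrable N f" and pos: "measure N (space N) > 0"
  shows "AE x in N. (\<lambda>n. (\<Sum>i<n. f ((T ^^ i) x)) / real n)
    \<longlonglongrightarrow> integral\<^sup>L N f / measure N (space N)"
proof -
  let ?m = "measure N (space N)"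
  let ?c = "integral\<^sup>L N f / ?m"
  have c: "?c * ?m = integral\<^sup>L N f" using pos by simp
  have gap: "integral\<^sup>L N f < (?c + 1 / real (Suc j)) * ?m"
            "integral\<^sup>L N (\<lambda>x. - f x) < (- ?c + 1 / real (Suc j)) * ?m" for j
  proof -
    have "1 / real (Suc j) * ?m > 0" using pos by (intro mult_pos_pos) simp_all
    then show "integral\<^sup>L N f < (?c + 1 / real (Suc j)) * ?m"
      "integral\<^sup>L N (\<lambda>x. - f x) < (- ?c + 1 / real (Suc j)) * ?m"
      using c by (simp_all only: distrib_right mult_minus_left integral_minus)
  qed
  have "AE x in N. \<forall>j::nat. \<forall>\<^sub>F n in sequentially.
      (\<Sum>i<n. f ((T ^^ i) x)) / real n \<le> ?c + 1 / Suc j + 1 / Suc j"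
    unfolding AE_all_countable
    by (intro allI birkhoff_upper[OF f gap(1)]) simp
  moreover have "AE x in N. \<forall>j::nat. \<forall>\<^sub>F n in sequentially.
      (\<Sum>i<n. - f ((T ^^ i) x)) / real n \<le> - ?c + 1 / Suc j + 1 / Suc j"
    unfolding AE_all_countable
    by (intro allI birkhoff_upper[OF _ gap(2)]) (simp_all add: f)
  ultimately show ?thesis
  proof eventually_elim
    case (elim x)
    show ?case
    proof (rule LIMSEQ_I)
      fix r :: real assume "r > 0"
      then obtain j :: nat where j: "1 / Suc j < r / 2"
        using nat_approx_posE[of "r / 2"] by auto
      from elim(1)[rule_format, of j] elim(2)[rule_format, of j]
      have "\<forall>\<^sub>F n in sequentially. norm ((\<Sum>i<n. f ((T ^^ i) x)) / real n - ?c) < r"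
      proof eventually_elim
        case (elim n)
        then show ?case using j unfolding sum_negf real_norm_def by linarith
      qed
      then show "\<exists>no. \<forall>n\<ge>no. norm ((\<Sum>i<n. f ((T ^^ i) x)) / real n - ?c) < r"
        by (simp add: eventually_sequentially)
    qed
  qed
qed

end


section \<open>Lebesgue measure on the space of \<open>2 \<times> 2\<close> matrices\<close>

lemma mat2_nth [simp]:
  "mat2 a b c d $ 1 $ 1 = a" "mat2 a b c d $ 1 $ 2 = b"
  "mat2 a b c d $ 2 $ 1 = c" "mat2 a b c d $ 2 $ 2 = d"
  by (simp_all add: mat2_def)

lemma matrix2_eq_iff:
  "A = B \<longleftrightarrow> A $ 1 $ 1 = B $ 1 $ 1 \<and> A $ 1 $ 2 = B $ 1 $ 2 \<and>
     A $ 2 $ 1 = B $ 2 $ 1 \<and> A $ 2 $ 2 = B $ 2 $ 2" for A B :: "real^2^2"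
  by (auto simp: vec_eq_iff forall_2)

lemma matrix_mult_nth [simp]:
  "(A ** B) $ i $ j = A $ i $ 1 * B $ 1 $ j + A $ i $ 2 * B $ 2 $ j" for A B :: "real^2^2"
  by (simp add: matrix_matrix_mult_def sum_2)

lemma mat_1_nth [simp]:
  "(mat 1 :: real^2^2) $ 1 $ 1 = 1" "(mat 1 :: real^2^2) $ 1 $ 2 = 0"
  "(mat 1 :: real^2^2) $ 2 $ 1 = 0" "(mat 1 :: real^2^2) $ 2 $ 2 = 1"
  by (simp_all add: mat_def)

lemma det_mat2 [simp]: "det (mat2 a b c d) = a * d - b * c"
  by (simp add: det_2)

lemma Basis_matrix2:
  "(Basis :: (real^2^2) set) = {mat2 1 0 0 0, mat2 0 1 0 0, mat2 0 0 1 0, mat2 0 0 0 1}"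
proof -
  have "axis 1 (axis 1 1) = mat2 1 0 0 0" "axis 1 (axis 2 1) = mat2 0 1 0 0"
       "axis 2 (axis 1 1) = mat2 0 0 1 0" "axis 2 (axis 2 1) = mat2 0 0 0 1"
    by (simp_all add: matrix2_eq_iff axis_def)
  then show ?thesis
    unfolding Basis_vec_def by (auto simp: UNIV_2)
qed

lemma inner_matrix2:
  "A \<bullet> B = A $ 1 $ 1 * B $ 1 $ 1 + A $ 1 $ 2 * B $ 1 $ 2 + A $ 2 $ 1 * B $ 2 $ 1 + A $ 2 $ 2 * B $ 2 $ 2"
  for A B :: "real^2^2"
  by (simp add: inner_vec_def sum_2)

lemma borel_measurable_nth [measurable (raw)]:
  "f \<in> borel_measurable M \<Longrightarrow> (\<lambda>x. (f x :: real^2^2) $ i $ j) \<in> borel_measurable M"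
  by (rule borel_measurable_continuous_on[of "\<lambda>A. A $ i $ j"])
     (auto intro!: continuous_intros)

lemma borel_measurable_mat2 [measurable (raw)]:
  assumes [measurable]: "a \<in> borel_measurable M" "b \<in> borel_measurable M"
    "c \<in> borel_measurable M" "d \<in> borel_measurable M"
  shows "(\<lambda>x. mat2 (a x) (b x) (c x) (d x)) \<in> borel_measurable M"
  by (subst borel_measurable_euclidean_space) (auto simp: Basis_matrix2 inner_matrix2)

lemma matrix_mult_mat2:
  "A ** B = mat2 (A $ 1 $ 1 * B $ 1 $ 1 + A $ 1 $ 2 * B $ 2 $ 1) (A $ 1 $ 1 * B $ 1 $ 2 + A $ 1 $ 2 * B $ 2 $ 2)
     (A $ 2 $ 1 * B $ 1 $ 1 + A $ 2 $ 2 * B $ 2 $ 1) (A $ 2 $ 1 * B $ 1 $ 2 + A $ 2 $ 2 * B $ 2 $ 2)"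
  for A B :: "real^2^2"
  by (simp add: matrix2_eq_iff)

lemma borel_measurable_matrix_mult [measurable (raw)]:
  assumes [measurable]: "f \<in> borel_measurable M" "g \<in> borel_measurable M"
  shows "(\<lambda>x. (f x :: real^2^2) ** (g x :: real^2^2)) \<in> borel_measurable M"
  unfolding matrix_mult_mat2 by measurable

lemma borel_measurable_det [measurable (raw)]:
  assumes [measurable]: "f \<in> borel_measurable M"
  shows "(\<lambda>x. det (f x :: real^2^2)) \<in> borel_measurable M"
  unfolding det_2 by measurable

lemma emeasure_lborel_Times:
  fixes A :: "'a::euclidean_space set" and B :: "'b::euclidean_space set"
  assumes "A \<in> sets borel" "B \<in> sets borel"
  shows "emeasure lborel (A \<times> B) = emeasure lborel A * emeasure lborel B"
  using lborel.emeasure_pair_measure_Times[of A lborel B] assms by (simp add: lborel_prod)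

text \<open>
  Coordinates are listed with the lower row \<open>(c, d)\<close> first because all later computations fix the lower
  row and change variables in the upper one.
\<close>

lemma lborel_matrix2:
  "(lborel :: (real^2^2) measure) =
     distr (lborel :: (real \<times> real \<times> real \<times> real) measure) borel (\<lambda>(c, d, a, b). mat2 a b c d)"
proof (rule lborel_eqI)
  fix l u :: "real^2^2" assume le: "\<And>b. b \<in> Basis \<Longrightarrow> l \<bullet> b \<le> u \<bullet> b"
  have [measurable]: "box l u \<in> sets borel" by simp
  have le': "l $ 1 $ 1 \<le> u $ 1 $ 1" "l $ 1 $ 2 \<le> u $ 1 $ 2" "l $ 2 $ 1 \<le> u $ 2 $ 1" "l $ 2 $ 2 \<le> u $ 2 $ 2"
    using le[of "mat2 1 0 0 0"] le[of "mat2 0 1 0 0"] le[of "mat2 0 0 1 0"] le[of "mat2 0 0 0 1"]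
    by (auto simp: Basis_matrix2 inner_matrix2)
  have "(\<lambda>(c, d, a, b). mat2 a b c d) -` box l u =
     {l $ 2 $ 1 <..< u $ 2 $ 1} \<times> {l $ 2 $ 2 <..< u $ 2 $ 2} \<times> {l $ 1 $ 1 <..< u $ 1 $ 1} \<times> {l $ 1 $ 2 <..< u $ 1 $ 2}"
    by (auto simp: box_def Basis_matrix2 inner_matrix2)
  then have "emeasure (distr lborel borel (\<lambda>(c, d, a, b). mat2 a b c d)) (box l u) =
     ennreal (u $ 2 $ 1 - l $ 2 $ 1) * (ennreal (u $ 2 $ 2 - l $ 2 $ 2) *
       (ennreal (u $ 1 $ 1 - l $ 1 $ 1) * ennreal (u $ 1 $ 2 - l $ 1 $ 2)))"
    using le' by (subst emeasure_distr)
      (simp_all add: emeasure_lborel_Times open_Times borel_open, simp add: borel_prod[symmetric])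
  also have "\<dots> = (\<Prod>b\<in>Basis. (u - l) \<bullet> b)"
    using le' by (auto simp: Basis_matrix2 inner_matrix2 matrix2_eq_iff ennreal_mult'[symmetric] ac_simps)
  finally show "emeasure (distr lborel borel (\<lambda>(c, d, a, b). mat2 a b c d)) (box l u) =
    (\<Prod>b\<in>Basis. (u - l) \<bullet> b)" .
qed simp

lemma nn_integral_lborel_fst:
  fixes f :: "'a::euclidean_space \<times> 'b::euclidean_space \<Rightarrow> ennreal"
  assumes "f \<in> borel_measurable borel"
  shows "(\<integral>\<^sup>+x. f x \<partial>lborel) = (\<integral>\<^sup>+x. \<integral>\<^sup>+y. f (x, y) \<partial>lborel \<partial>lborel)"
proof -
  have "f \<in> borel_measurable (lborel \<Otimes>\<^sub>M lborel)"
    using assms by (simp add: borel_prod lborel_prod)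
  from lborel.nn_integral_fst[OF this] show ?thesis by (simp add: lborel_prod)
qed

lemma borel_measurable_section:
  assumes "f \<in> borel_measurable borel"
  shows "(\<lambda>y. f (x, y)) \<in> borel_measurable borel"
  by (rule measurable_compose[OF _ assms]) (intro borel_measurable_continuous_onI continuous_intros)

lemma nn_integral_matrix2:
  assumes [measurable]: "F \<in> borel_measurable borel"
  shows "(\<integral>\<^sup>+M. F M \<partial>lborel) = (\<integral>\<^sup>+c. \<integral>\<^sup>+d. \<integral>\<^sup>+a. \<integral>\<^sup>+b. F (mat2 a b c d) \<partial>lborel \<partial>lborel \<partial>lborel \<partial>lborel)"
proof -
  define G :: "real \<times> real \<times> real \<times> real \<Rightarrow> ennreal" where "G x = F (case x of (c, d, a, b) \<Rightarrow> mat2 a b c d)" for x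
  have m0: "(\<lambda>(c, d, a, b). mat2 a b c d) \<in> borel_measurable (borel :: (real \<times> real \<times> real \<times> real) measure)"
    unfolding borel_prod[symmetric] by measurable
  have G: "G \<in> borel_measurable borel"
    unfolding G_def[abs_def] by (rule measurable_compose[OF m0]) simp
  have "(\<integral>\<^sup>+M. F M \<partial>lborel) = (\<integral>\<^sup>+x. G x \<partial>lborel)"
    unfolding lborel_matrix2 using m0 by (subst nn_integral_distr) (simp_all add: G_def[abs_def])
  also have "\<dots> = (\<integral>\<^sup>+c. \<integral>\<^sup>+d. \<integral>\<^sup>+a. \<integral>\<^sup>+b. G (c, d, a, b) \<partial>lborel \<partial>lborel \<partial>lborel \<partial>lborel)"
    using nn_integral_lborel_fst[OF G] nn_integral_lborel_fst[OF borel_measurable_section[OF G]]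
      nn_integral_lborel_fst[OF borel_measurable_section[OF borel_measurable_section[OF G]]]
    by simp
  finally show ?thesis by (simp add: G_def)
qed

text \<open>
  The linear change of variables in the plane, by two one-dimensional ones: if \<open>\<delta> \<noteq> 0\<close>, then \<open>y\<close> is scaled
  by \<open>\<delta>\<close> and \<open>x\<close> by the determinant over \<open>\<delta>\<close>.  If \<open>\<delta> = 0\<close>, the two rows are exchanged first.
\<close>

lemma nn_integral_linear2:
  fixes F :: "real \<Rightarrow> real \<Rightarrow> ennreal"
  assumes F: "case_prod F \<in> borel_measurable (borel \<Otimes>\<^sub>M borel)"
    and det: "\<alpha> * \<delta> - \<beta> * \<gamma> \<noteq> 0"
  shows "ennreal \<bar>\<alpha> * \<delta> - \<beta> * \<gamma>\<bar> * (\<integral>\<^sup>+x. \<integral>\<^sup>+y. F (\<alpha> * x + \<beta> * y) (\<gamma> * x + \<delta> * y) \<partial>lborel \<partial>lborel) =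
    (\<integral>\<^sup>+x. \<integral>\<^sup>+y. F x y \<partial>lborel \<partial>lborel)"
proof -
  have *: "ennreal \<bar>\<alpha> * \<delta> - \<beta> * \<gamma>\<bar> * (\<integral>\<^sup>+x. \<integral>\<^sup>+y. F (\<alpha> * x + \<beta> * y) (\<gamma> * x + \<delta> * y) \<partial>lborel \<partial>lborel) =
    (\<integral>\<^sup>+x. \<integral>\<^sup>+y. F x y \<partial>lborel \<partial>lborel)"
    if "\<delta> \<noteq> 0" and det: "\<alpha> * \<delta> - \<beta> * \<gamma> \<noteq> 0"
      and [measurable]: "case_prod F \<in> borel_measurable (borel \<Otimes>\<^sub>M borel)"
    for \<alpha> \<beta> \<gamma> \<delta> and F :: "real \<Rightarrow> real \<Rightarrow> ennreal"
  proof -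
    define e where "e = (\<alpha> * \<delta> - \<beta> * \<gamma>) / \<delta>"
    have e: "e \<noteq> 0" "\<alpha> = e + (\<beta> / \<delta>) * \<gamma>" and ab: "\<bar>\<alpha> * \<delta> - \<beta> * \<gamma>\<bar> = \<bar>e\<bar> * \<bar>\<delta>\<bar>"
      using that by (auto simp: e_def field_simps abs_mult abs_divide)
    have inner: "(\<integral>\<^sup>+y. F (e * x + (\<beta> / \<delta>) * y) y \<partial>lborel) =
        \<bar>\<delta>\<bar> * (\<integral>\<^sup>+y. F (\<alpha> * x + \<beta> * y) (\<gamma> * x + \<delta> * y) \<partial>lborel)" for x
      using \<open>\<delta> \<noteq> 0\<close>
      by (subst nn_integral_real_affine[where t="\<gamma> * x" and c=\<delta>])
         (auto simp: e(2) algebra_simps)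
    have outer: "(\<integral>\<^sup>+x. F x y \<partial>lborel) = \<bar>e\<bar> * (\<integral>\<^sup>+x. F (e * x + (\<beta> / \<delta>) * y) y \<partial>lborel)" for y
      using e(1) by (subst nn_integral_real_affine[where t="(\<beta> / \<delta>) * y" and c=e])
         (auto simp: algebra_simps)
    have "(\<integral>\<^sup>+x. \<integral>\<^sup>+y. F x y \<partial>lborel \<partial>lborel) = (\<integral>\<^sup>+y. \<integral>\<^sup>+x. F x y \<partial>lborel \<partial>lborel)"
      by (rule lborel_pair.Fubini'[symmetric]) measurable
    also have "\<dots> = (\<integral>\<^sup>+y. \<bar>e\<bar> * (\<integral>\<^sup>+x. F (e * x + (\<beta> / \<delta>) * y) y \<partial>lborel) \<partial>lborel)"
      unfolding outer[symmetric] ..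
    also have "\<dots> = \<bar>e\<bar> * (\<integral>\<^sup>+y. \<integral>\<^sup>+x. F (e * x + (\<beta> / \<delta>) * y) y \<partial>lborel \<partial>lborel)"
      by (rule nn_integral_cmult) measurable
    also have "(\<integral>\<^sup>+y. \<integral>\<^sup>+x. F (e * x + (\<beta> / \<delta>) * y) y \<partial>lborel \<partial>lborel) =
        (\<integral>\<^sup>+x. \<integral>\<^sup>+y. F (e * x + (\<beta> / \<delta>) * y) y \<partial>lborel \<partial>lborel)"
      by (rule lborel_pair.Fubini') measurable
    also have "\<dots> = \<bar>\<delta>\<bar> * (\<integral>\<^sup>+x. \<integral>\<^sup>+y. F (\<alpha> * x + \<beta> * y) (\<gamma> * x + \<delta> * y) \<partial>lborel \<partial>lborel)"
      unfolding inner by (rule nn_integral_cmult) measurable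
    finally show ?thesis
      by (simp add: ab ennreal_mult mult.assoc)
  qed
  show ?thesis
  proof (cases "\<delta> = 0")
    case False
    then show ?thesis using * det F by blast
  next
    case True
    then have "\<beta> \<noteq> 0" using det by auto
    note [measurable] = F
    have "(\<integral>\<^sup>+x. \<integral>\<^sup>+y. F x y \<partial>lborel \<partial>lborel) = (\<integral>\<^sup>+y. \<integral>\<^sup>+x. F x y \<partial>lborel \<partial>lborel)"
      by (rule lborel_pair.Fubini'[symmetric]) measurable
    also have "\<dots> = \<bar>\<gamma> * \<beta> - \<delta> * \<alpha>\<bar> * (\<integral>\<^sup>+x. \<integral>\<^sup>+y. F (\<alpha> * x + \<beta> * y) (\<gamma> * x + \<delta> * y) \<partial>lborel \<partial>lborel)"
      using \<open>\<beta> \<noteq> 0\<close> det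
      by (subst *[where \<alpha>=\<gamma> and \<beta>=\<delta> and \<gamma>=\<alpha> and \<delta>=\<beta> and F="\<lambda>x y. F y x", symmetric])
         (auto simp: algebra_simps)
    finally show ?thesis by (simp add: abs_minus_commute algebra_simps)
  qed
qed


lemma nn_integral_transpose:
  assumes [measurable]: "F \<in> borel_measurable borel"
  shows "(\<integral>\<^sup>+M. F (transpose M) \<partial>lborel) = (\<integral>\<^sup>+(M :: real^2^2). F M \<partial>lborel)"
proof -
  have t: "transpose M = mat2 (M $ 1 $ 1) (M $ 2 $ 1) (M $ 1 $ 2) (M $ 2 $ 2)" for M :: "real^2^2"
    by (simp add: matrix2_eq_iff transpose_def)
  have "(\<integral>\<^sup>+M. F (transpose M) \<partial>lborel) =
     (\<integral>\<^sup>+c. \<integral>\<^sup>+d. \<integral>\<^sup>+a. \<integral>\<^sup>+b. F (mat2 a c b d) \<partial>lborel \<partial>lborel \<partial>lborel \<partial>lborel)"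
    unfolding t by (subst nn_integral_matrix2) simp_all
  also have "\<dots> = (\<integral>\<^sup>+c. \<integral>\<^sup>+d. \<integral>\<^sup>+b. \<integral>\<^sup>+a. F (mat2 a c b d) \<partial>lborel \<partial>lborel \<partial>lborel \<partial>lborel)"
    by (intro nn_integral_cong lborel_pair.Fubini') measurable
  also have "\<dots> = (\<integral>\<^sup>+c. \<integral>\<^sup>+b. \<integral>\<^sup>+d. \<integral>\<^sup>+a. F (mat2 a c b d) \<partial>lborel \<partial>lborel \<partial>lborel \<partial>lborel)"
    by (intro nn_integral_cong lborel_pair.Fubini') measurable
  also have "\<dots> = (\<integral>\<^sup>+b. \<integral>\<^sup>+c. \<integral>\<^sup>+d. \<integral>\<^sup>+a. F (mat2 a c b d) \<partial>lborel \<partial>lborel \<partial>lborel \<partial>lborel)"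
    by (intro lborel_pair.Fubini') measurable
  also have "\<dots> = (\<integral>\<^sup>+b. \<integral>\<^sup>+d. \<integral>\<^sup>+c. \<integral>\<^sup>+a. F (mat2 a c b d) \<partial>lborel \<partial>lborel \<partial>lborel \<partial>lborel)"
    by (intro nn_integral_cong lborel_pair.Fubini') measurable
  also have "\<dots> = (\<integral>\<^sup>+b. \<integral>\<^sup>+d. \<integral>\<^sup>+a. \<integral>\<^sup>+c. F (mat2 a c b d) \<partial>lborel \<partial>lborel \<partial>lborel \<partial>lborel)"
    by (intro nn_integral_cong lborel_pair.Fubini') measurable
  also have "\<dots> = (\<integral>\<^sup>+M. F M \<partial>lborel)"
    by (subst nn_integral_matrix2) simp_all
  finally show ?thesis .
qed

text \<open>
  Right multiplication acts on each of the two rows as a linear map of determinant \<open>det h\<close>.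
\<close>

lemma nn_integral_mult_right:
  fixes h :: "real^2^2" and F :: "real^2^2 \<Rightarrow> ennreal"
  assumes [measurable]: "F \<in> borel_measurable borel" and h: "det h \<noteq> 0"
  shows "ennreal ((det h)\<^sup>2) * (\<integral>\<^sup>+M. F (M ** h) \<partial>lborel) = (\<integral>\<^sup>+M. F M \<partial>lborel)"
proof -
  define p q r s where "p = h $ 1 $ 1" "q = h $ 1 $ 2" "r = h $ 2 $ 1" "s = h $ 2 $ 2"
  have d: "p * s - r * q \<noteq> 0" "det h = p * s - r * q" using h by (simp_all add: det_2 p_q_r_s_def mult.commute)
  let ?d = "ennreal \<bar>p * s - r * q\<bar>"
  define I where "I c d = (\<integral>\<^sup>+a. \<integral>\<^sup>+b. F (mat2 a b c d) \<partial>lborel \<partial>lborel)" for c d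
  define K where "K c d = (\<integral>\<^sup>+a. \<integral>\<^sup>+b. F (mat2 (p * a + r * b) (q * a + s * b) c d) \<partial>lborel \<partial>lborel)" for c d
  have [measurable]: "case_prod I \<in> borel_measurable (borel \<Otimes>\<^sub>M borel)"
    "case_prod K \<in> borel_measurable (borel \<Otimes>\<^sub>M borel)"
    unfolding I_def K_def by measurable
  have rows: "?d * K c d = I c d" for c d
    unfolding I_def K_def
    by (rule nn_integral_linear2[of "\<lambda>a b. F (mat2 a b c d)", OF _ d(1)]) measurable
  have "(\<integral>\<^sup>+M. F (M ** h) \<partial>lborel) = (\<integral>\<^sup>+c. \<integral>\<^sup>+d. K (p * c + r * d) (q * c + s * d) \<partial>lborel \<partial>lborel)"
    unfolding K_def by (subst nn_integral_matrix2) (simp_all add: matrix_mult_mat2 p_q_r_s_def mult.commute)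
  then have "?d * (?d * (\<integral>\<^sup>+M. F (M ** h) \<partial>lborel)) = ?d * (\<integral>\<^sup>+c. \<integral>\<^sup>+d. K c d \<partial>lborel \<partial>lborel)"
    by (simp only: nn_integral_linear2[of K, OF _ d(1)] \<open>case_prod K \<in> _\<close>)
  also have "\<dots> = (\<integral>\<^sup>+c. ?d * (\<integral>\<^sup>+d. K c d \<partial>lborel) \<partial>lborel)"
    by (rule nn_integral_cmult[symmetric]) measurable
  also have "\<dots> = (\<integral>\<^sup>+c. \<integral>\<^sup>+d. ?d * K c d \<partial>lborel \<partial>lborel)"
    by (intro nn_integral_cong nn_integral_cmult[symmetric]) measurable
  also have "\<dots> = (\<integral>\<^sup>+M. F M \<partial>lborel)"
    unfolding rows I_def by (rule nn_integral_matrix2[symmetric]) simp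
  finally show ?thesis
    by (simp add: d(2) power2_eq_square ennreal_mult'[symmetric] mult.assoc[symmetric] abs_mult[symmetric])
qed

lemma nn_integral_mult_left:
  fixes h :: "real^2^2" and F :: "real^2^2 \<Rightarrow> ennreal"
  assumes [measurable]: "F \<in> borel_measurable borel" and h: "det h \<noteq> 0"
  shows "ennreal ((det h)\<^sup>2) * (\<integral>\<^sup>+M. F (h ** M) \<partial>lborel) = (\<integral>\<^sup>+M. F M \<partial>lborel)"
proof -
  have t[measurable]: "transpose \<in> borel_measurable (borel :: (real^2^2) measure)"
  proof -
    have "transpose M = mat2 (M $ 1 $ 1) (M $ 2 $ 1) (M $ 1 $ 2) (M $ 2 $ 2)" for M :: "real^2^2"
      by (simp add: matrix2_eq_iff transpose_def)
    then show ?thesis by (subst measurable_cong) (assumption, measurable)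
  qed
  have "(\<integral>\<^sup>+M. F (h ** M) \<partial>lborel) = (\<integral>\<^sup>+M. F (h ** transpose M) \<partial>lborel)"
    by (rule nn_integral_transpose[symmetric]) simp
  also have "\<dots> = (\<integral>\<^sup>+M. F (transpose (M ** transpose h)) \<partial>lborel)"
    by (simp add: matrix_transpose_mul)
  finally have "ennreal ((det h)\<^sup>2) * (\<integral>\<^sup>+M. F (h ** M) \<partial>lborel) = (\<integral>\<^sup>+M. F (transpose M) \<partial>lborel)"
    using nn_integral_mult_right[of "\<lambda>M. F (transpose M)" "transpose h"] h by (simp add: det_transpose)
  also have "\<dots> = (\<integral>\<^sup>+M. F M \<partial>lborel)"
    by (rule nn_integral_transpose) simp
  finally show ?thesis .
qed

lemma emeasure_mult_left:
  fixes h :: "real^2^2" and B :: "(real^2^2) set"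
  assumes [measurable]: "B \<in> sets borel" and h: "det h \<noteq> 0"
  shows "ennreal ((det h)\<^sup>2) * emeasure lborel {M. h ** M \<in> B} = emeasure lborel B"
proof -
  have "{M. h ** M \<in> B} \<in> sets borel" by measurable
  then have "emeasure lborel {M. h ** M \<in> B} = (\<integral>\<^sup>+M. indicator {M. h ** M \<in> B} M \<partial>lborel)"
    by (subst nn_integral_indicator) simp_all
  also have "\<dots> = (\<integral>\<^sup>+M. indicator B (h ** M) \<partial>lborel)"
    by (intro nn_integral_cong) (simp add: indicator_def)
  finally show ?thesis
    using nn_integral_mult_left[of "indicator B" h] h by simp
qed

lemma null_sets_mult_left:
  fixes h :: "real^2^2" and Z :: "(real^2^2) set"
  assumes Z: "Z \<in> null_sets lborel" and h: "det h \<noteq> 0"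
  shows "{M. h ** M \<in> Z} \<in> null_sets lborel"
proof -
  have [measurable]: "Z \<in> sets borel" using Z by auto
  have m: "{M. h ** M \<in> Z} \<in> sets borel" by measurable
  have "ennreal ((det h)\<^sup>2) * emeasure lborel {M. h ** M \<in> Z} = 0"
    using emeasure_mult_left[of Z h] h Z by auto
  then show ?thesis using h m by (auto simp: null_sets_def)
qed

lemma emeasure_mult_right:
  fixes h :: "real^2^2" and B :: "(real^2^2) set"
  assumes [measurable]: "B \<in> sets borel" and h: "det h \<noteq> 0"
  shows "ennreal ((det h)\<^sup>2) * emeasure lborel {M. M ** h \<in> B} = emeasure lborel B"
proof -
  have "{M. M ** h \<in> B} \<in> sets borel" by measurable
  then have "emeasure lborel {M. M ** h \<in> B} = (\<integral>\<^sup>+M. indicator {M. M ** h \<in> B} M \<partial>lborel)"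
    by (subst nn_integral_indicator) simp_all
  also have "\<dots> = (\<integral>\<^sup>+M. indicator B (M ** h) \<partial>lborel)"
    by (intro nn_integral_cong) (simp add: indicator_def)
  finally show ?thesis
    using nn_integral_mult_right[of "indicator B" h] h by simp
qed

lemma null_sets_mult_right:
  fixes h :: "real^2^2" and Z :: "(real^2^2) set"
  assumes Z: "Z \<in> null_sets lborel" and h: "det h \<noteq> 0"
  shows "{M. M ** h \<in> Z} \<in> null_sets lborel"
proof -
  have [measurable]: "Z \<in> sets borel" using Z by auto
  have m: "{M. M ** h \<in> Z} \<in> sets borel" by measurable
  have "ennreal ((det h)\<^sup>2) * emeasure lborel {M. M ** h \<in> Z} = 0"
    using emeasure_mult_right[of Z h] h Z by auto
  then show ?thesis using h m by (auto simp: null_sets_def)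
qed

lemma AE_mult_left:
  fixes h :: "real^2^2" and P :: "real^2^2 \<Rightarrow> bool"
  assumes "AE M in lborel. P M" and "det h \<noteq> 0"
  shows "AE M in lborel. P (h ** M)"
proof -
  obtain Z where Z: "{M \<in> space lborel. \<not> P M} \<subseteq> Z" "Z \<in> null_sets lborel"
    using assms(1) by (auto elim!: AE_E simp: null_sets_def)
  show ?thesis
    by (rule AE_I'[OF null_sets_mult_left[OF Z(2) assms(2)]]) (use Z(1) in auto)
qed

lemma AE_mult_right:
  fixes h :: "real^2^2" and P :: "real^2^2 \<Rightarrow> bool"
  assumes "AE M in lborel. P M" and "det h \<noteq> 0"
  shows "AE M in lborel. P (M ** h)"
proof -
  obtain Z where Z: "{M \<in> space lborel. \<not> P M} \<subseteq> Z" "Z \<in> null_sets lborel"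
    using assms(1) by (auto elim!: AE_E simp: null_sets_def)
  show ?thesis
    by (rule AE_I'[OF null_sets_mult_right[OF Z(2) assms(2)]]) (use Z(1) in auto)
qed

lemma AE_matrix2I:
  assumes [measurable]: "Measurable.pred borel P"
    and "AE c in lborel. AE d in lborel. AE a in lborel. AE b in lborel. P (mat2 a b c d)"
  shows "AE M in lborel. P M"
proof -
  have [measurable]: "{M. \<not> P M} \<in> sets borel" by measurable
  have "emeasure lborel {M. \<not> P M} = (\<integral>\<^sup>+M. indicator {M. \<not> P M} M \<partial>lborel)"
    by simp
  also have "\<dots> = (\<integral>\<^sup>+c. \<integral>\<^sup>+d. \<integral>\<^sup>+a. \<integral>\<^sup>+b. indicator {M. \<not> P M} (mat2 a b c d) \<partial>lborel \<partial>lborel \<partial>lborel \<partial>lborel)"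
    by (rule nn_integral_matrix2) simp
  also have "\<dots> = (\<integral>\<^sup>+(c::real). 0 \<partial>lborel)"
  proof (rule nn_integral_cong_AE, use assms(2) in eventually_elim)
    case (elim c)
    have "(\<integral>\<^sup>+d. \<integral>\<^sup>+a. \<integral>\<^sup>+b. indicator {M. \<not> P M} (mat2 a b c d) \<partial>lborel \<partial>lborel \<partial>lborel) = (\<integral>\<^sup>+(c::real). 0 \<partial>lborel)"
    proof (rule nn_integral_cong_AE, use elim in eventually_elim)
      case (elim d)
      have "(\<integral>\<^sup>+a. \<integral>\<^sup>+b. indicator {M. \<not> P M} (mat2 a b c d) \<partial>lborel \<partial>lborel) = (\<integral>\<^sup>+(c::real). 0 \<partial>lborel)"
      proof (rule nn_integral_cong_AE, use elim in eventually_elim)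
        case (elim a)
        have "(\<integral>\<^sup>+b. indicator {M. \<not> P M} (mat2 a b c d) \<partial>lborel) = (\<integral>\<^sup>+(c::real). 0 \<partial>lborel)"
          by (rule nn_integral_cong_AE, use elim in eventually_elim) (simp add: indicator_def)
        then show ?case by simp
      qed
      then show ?case by simp
    qed
    then show ?case by simp
  qed
  finally have "{M. \<not> P M} \<in> null_sets lborel" by (simp add: null_sets_def)
  then show ?thesis by (rule AE_I') auto
qed


section \<open>The quotient by a discrete group of matrices\<close>

text \<open>
  Measure-preserving maps that converge pointwise to the identity move a set of finite measure by little.
  An open set \<open>U\<close> slightly larger than \<open>B\<close> does the work: each point of \<open>B\<close> eventually stays in \<open>U\<close>, and
  the points that land in \<open>U - B\<close> have small measure because the maps preserve measure.
\<close>

lemma emeasure_displaced_tendsto_0: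
  fixes B :: "'a::euclidean_space set" and \<phi> :: "nat \<Rightarrow> 'a \<Rightarrow> 'a"
  assumes B [measurable]: "B \<in> sets borel" and fin: "emeasure lborel B < \<infinity>"
    and \<phi> [measurable]: "\<And>n. \<phi> n \<in> borel_measurable borel"
    and pres: "\<And>n X. X \<in> sets borel \<Longrightarrow> emeasure lborel {x. \<phi> n x \<in> X} = emeasure lborel X"
    and lim: "\<And>x. (\<lambda>n. \<phi> n x) \<longlonglongrightarrow> x"
  shows "(\<lambda>n. emeasure lborel {x \<in> B. \<phi> n x \<notin> B}) \<longlonglongrightarrow> 0"
proof (rule order_tendstoI)
  fix a :: ennreal assume "0 < a"
  then obtain y where y: "0 < y" "y < a" using dense by blast
  then obtain e where e: "y = ennreal e" "e > 0"
    by (cases y) (auto simp: top.extremum_strict)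
  obtain U where U: "open U" "B \<subseteq> U" "emeasure lborel (U - B) < ennreal (e / 2)"
    using outer_regular_lborel[OF B, of "e / 2"] e by auto
  have [measurable]: "U \<in> sets borel" using U(1) by simp
  \<comment> \<open>\<open>E n\<close> shrinks to the empty set pointwise, as \<open>U\<close> is a neighbourhood of each point of \<open>B\<close>.\<close>
  define E where "E n = {x \<in> B. \<phi> n x \<notin> U}" for n
  have [measurable]: "E n \<in> sets borel" for n unfolding E_def by measurable
  have "(\<lambda>n. \<integral>\<^sup>+x. indicator (E n) x \<partial>lborel) \<longlonglongrightarrow> (\<integral>\<^sup>+(x::'a). 0 \<partial>lborel)"
  proof (rule nn_integral_dominated_convergence[where w="indicator B"])
    show "AE x in lborel. (\<lambda>n. indicator (E n) x :: ennreal) \<longlonglongrightarrow> 0"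
    proof (rule AE_I2)
      fix x
      show "(\<lambda>n. indicator (E n) x :: ennreal) \<longlonglongrightarrow> 0"
      proof (cases "x \<in> B")
        case True
        then have "\<forall>\<^sub>F n in sequentially. \<phi> n x \<in> U"
          using topological_tendstoD[OF lim U(1)] U(2) by blast
        then have "\<forall>\<^sub>F n in sequentially. indicator (E n) x = (0::ennreal)"
          by eventually_elim (simp add: E_def)
        then show ?thesis by (rule tendsto_eventually)
      qed (simp add: E_def)
    qed
    show "AE x in lborel. indicator (E n) x \<le> (indicator B x :: ennreal)" for n
      by (rule AE_I2) (simp add: E_def indicator_def)
  qed (use fin in \<open>simp_all\<close>)
  then have "(\<lambda>n. emeasure lborel (E n)) \<longlonglongrightarrow> 0" by simp
  then have "\<forall>\<^sub>F n in sequentially. emeasure lborel (E n) < ennreal (e / 2)"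
    using e by (intro order_tendstoD) (auto simp: ennreal_zero_less_divide)
  then show "\<forall>\<^sub>F n in sequentially. emeasure lborel {x \<in> B. \<phi> n x \<notin> B} < a"
  proof eventually_elim
    case (elim n)
    have m: "{x. \<phi> n x \<in> U - B} \<in> sets borel" by measurable
    have "emeasure lborel {x \<in> B. \<phi> n x \<notin> B} \<le> emeasure lborel (E n \<union> {x. \<phi> n x \<in> U - B})"
      by (intro emeasure_mono) (use m in \<open>auto simp: E_def\<close>)
    also have "\<dots> \<le> emeasure lborel (E n) + emeasure lborel {x. \<phi> n x \<in> U - B}"
      using m by (intro emeasure_subadditive) simp_all
    also have "\<dots> \<le> ennreal (e / 2) + ennreal (e / 2)"
      using elim U(3) pres[of "U - B" n] by (intro add_mono) (simp_all add: less_imp_le)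
    also have "\<dots> = ennreal e" using e by (simp flip: ennreal_plus)
    also have "\<dots> < a" using y e by simp
    finally show ?case .
  qed
qed simp

definition pos_det :: "(real^2^2) set" where "pos_det = {M. det M > 0}"

text \<open>
  Lebesgue measure on this set replaces Haar measure on the group of matrices of determinant \<open>1\<close>, over
  which it is a cone: both left and right multiplication by elements of that group preserve it.
\<close>

definition unit_cone :: "(real^2^2) set" where "unit_cone = {M. 0 < det M \<and> det M < 1}"

lemma pos_det_borel [measurable]: "pos_det \<in> sets borel" unfolding pos_det_def by measurable
lemma unit_cone_borel [measurable]: "unit_cone \<in> sets borel" unfolding unit_cone_def by measurable

text \<open>
  The inverse of a matrix of determinant \<open>1\<close>, written without division.
\<close>

definition adj2 :: "real^2^2 \<Rightarrow> real^2^2" where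
  "adj2 A = mat2 (A $ 2 $ 2) (- A $ 1 $ 2) (- A $ 2 $ 1) (A $ 1 $ 1)"

lemma adj2_mult: "det A = 1 \<Longrightarrow> adj2 A ** A = mat 1" "det A = 1 \<Longrightarrow> A ** adj2 A = mat 1"
  by (simp_all add: adj2_def matrix2_eq_iff det_2 algebra_simps)

lemma adj2_mult_cancel: "det A = 1 \<Longrightarrow> adj2 A ** (A ** M) = M" "det A = 1 \<Longrightarrow> A ** (adj2 A ** M) = M"
  by (simp_all add: adj2_mult matrix_mul_assoc)

lemma adj2_adj2 [simp]: "adj2 (adj2 A) = A"
  by (simp add: adj2_def matrix2_eq_iff)

lemma det_adj2 [simp]: "det (adj2 A) = det A"
  by (simp add: adj2_def det_2)

lemma scaleR_matrix_mult: "(r *\<^sub>R A) ** B = r *\<^sub>R (A ** B)" "A ** (r *\<^sub>R B) = r *\<^sub>R (A ** B)"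
  for A B :: "real^2^2"
  by (simp_all add: matrix2_eq_iff algebra_simps)

lemma det_scaleR2: "det (r *\<^sub>R A) = r\<^sup>2 * det A" for A :: "real^2^2"
  by (simp add: det_2 power2_eq_square algebra_simps)

lemma mat_mult_scaleR: "mat r ** M = r *\<^sub>R M" for M :: "real^2^2"
  by (simp add: matrix2_eq_iff mat_def)

text \<open>
  Right multiplication by \<open>geo t\<close> is the geodesic flow: \<open>geo t\<close> moves \<open>\<i>\<close> to \<open>exp t * \<i>\<close>.
\<close>

definition geo :: "real \<Rightarrow> real^2^2" where "geo t = mat2 (exp (t / 2)) 0 0 (exp (- t / 2))"

lemma det_geo [simp]: "det (geo t) = 1" by (simp add: geo_def exp_minus field_simps flip: exp_add)

lemma null_sets_cone:
  assumes [measurable]: "B \<in> sets borel" and B: "B \<subseteq> pos_det"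
    and scale: "\<And>r M. r > 0 \<Longrightarrow> M \<in> B \<Longrightarrow> r *\<^sub>R M \<in> B"
    and cone: "B \<inter> unit_cone \<in> null_sets lborel"
  shows "B \<in> null_sets lborel"
proof -
  have "B \<subseteq> (\<Union>n. {M. mat (1 / real (Suc n)) ** M \<in> B \<inter> unit_cone})"
  proof
    fix M assume M: "M \<in> B"
    then have d: "det M > 0" using B by (auto simp: pos_det_def)
    obtain n :: nat where n: "det M < real n" using reals_Archimedean2 by blast
    have "real n * 1 \<le> real (Suc n) * real (Suc n)" by (intro mult_mono) simp_all
    then have "det M < (real (Suc n))\<^sup>2" using n unfolding power2_eq_square by linarith
    then have "det ((1 / real (Suc n)) *\<^sub>R M) < 1"
      by (simp only: det_scaleR2 power_divide) (simp add: divide_simps)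
    moreover have "(1 / real (Suc n)) *\<^sub>R M \<in> B"
      by (rule scale) (use M in auto)
    moreover have "det ((1 / real (Suc n)) *\<^sub>R M) > 0"
      using d by (simp only: det_scaleR2) simp
    ultimately show "M \<in> (\<Union>n. {M. mat (1 / real (Suc n)) ** M \<in> B \<inter> unit_cone})"
      by (auto simp: mat_mult_scaleR unit_cone_def simp del: of_nat_Suc)
  qed
  moreover have "(\<Union>n. {M. mat (1 / real (Suc n)) ** M \<in> B \<inter> unit_cone}) \<in> null_sets lborel"
    by (intro null_sets_UN null_sets_mult_left[OF cone]) (simp add: det_2 mat_def)
  ultimately show ?thesis by (rule null_sets_subset[rotated 2]) simp
qed

text \<open>
  A discrete group \<open>S\<close> of matrices with a fundamental domain \<open>D\<close> of finite measure for its action on the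
  cone.  Almost every orbit is required to meet \<open>D\<close> twice, because \<open>S\<close> is meant to be the preimage of a
  subgroup of \<open>PSL\<^sub>2(\<real>)\<close> and thus contains \<open>A\<close> together with \<open>- A\<close>.
\<close>

locale covolume_domain =
  fixes S :: "(real^2^2) set" and D :: "(real^2^2) set"
  assumes countable_S: "countable S"
    and det_S: "A \<in> S \<Longrightarrow> det A = 1"
    and mult_S: "A \<in> S \<Longrightarrow> B \<in> S \<Longrightarrow> A ** B \<in> S"
    and inv_S: "A \<in> S \<Longrightarrow> adj2 A \<in> S"
    and D_borel [measurable]: "D \<in> sets borel"
    and D_sub: "D \<subseteq> unit_cone"
    and D_finite: "emeasure lborel D < \<infinity>"
    and D_tiles: "AE M in lborel. M \<in> unit_cone \<longrightarrow> (\<integral>\<^sup>+A. indicator D (A ** M) \<partial>count_space S) = 2"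
begin

lemma bij_adj2: "bij_betw adj2 S S"
  by (rule bij_betwI[of _ _ _ adj2]) (auto simp: inv_S)

lemma measurable_sum_S [measurable]:
  "(\<And>A. A \<in> S \<Longrightarrow> f A \<in> borel_measurable M) \<Longrightarrow>
    (\<lambda>x. \<integral>\<^sup>+A. f A x \<partial>count_space S) \<in> borel_measurable M" for f :: "_ \<Rightarrow> _ \<Rightarrow> ennreal"
proof -
  assume f: "\<And>A. A \<in> S \<Longrightarrow> f A \<in> borel_measurable M"
  interpret sigma_finite_measure "count_space S"
    by (rule sigma_finite_measure_count_space_countable[OF countable_S])
  have "(\<lambda>(A, x). f A x) \<in> borel_measurable (count_space S \<Otimes>\<^sub>M M)"
    by (rule measurable_pair_measure_countable1[OF countable_S]) (simp add: f)
  then have "(\<lambda>(x, A). f A x) \<in> borel_measurable (M \<Otimes>\<^sub>M count_space S)"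
    by (subst measurable_pair_swap_iff) (simp add: split_beta)
  then show ?thesis by (rule borel_measurable_nn_integral)
qed

text \<open>
  Unfolding: a sum over the group integrated over the domain is an integral over the whole cone.
  Exchange sum and integral, move each \<open>A\<close> from \<open>\<psi>\<close> to \<open>D\<close> by invariance of Lebesgue measure, and
  recognize the number of translates of \<open>D\<close> that cover a point.
\<close>

lemma unfolding_formula:
  assumes [measurable]: "\<psi> \<in> borel_measurable borel" and supp: "\<And>M. M \<notin> unit_cone \<Longrightarrow> \<psi> M = 0"
  shows "(\<integral>\<^sup>+M. indicator D M * (\<integral>\<^sup>+A. \<psi> (A ** M) \<partial>count_space S) \<partial>lborel) = 2 * (\<integral>\<^sup>+M. \<psi> M \<partial>lborel)"
proof -
  have "(\<integral>\<^sup>+M. indicator D M * (\<integral>\<^sup>+A. \<psi> (A ** M) \<partial>count_space S) \<partial>lborel) =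
     (\<integral>\<^sup>+M. \<integral>\<^sup>+A. indicator D M * \<psi> (A ** M) \<partial>count_space S \<partial>lborel)"
    by (intro nn_integral_cong nn_integral_cmult[symmetric]) simp
  also have "\<dots> = (\<integral>\<^sup>+A. \<integral>\<^sup>+M. indicator D M * \<psi> (A ** M) \<partial>lborel \<partial>count_space S)"
    by (rule nn_integral_count_space_nn_integral[OF countable_S]) measurable
  also have "\<dots> = (\<integral>\<^sup>+A. \<integral>\<^sup>+M. indicator D (adj2 A ** M) * \<psi> M \<partial>lborel \<partial>count_space S)"
  proof (rule nn_integral_cong)
    fix A assume "A \<in> space (count_space S)"
    then have d: "det A = 1" using det_S by simp
    have "(\<lambda>M. indicator D (adj2 A ** M) * \<psi> M) \<in> borel_measurable borel" by measurable
    from nn_integral_mult_left[OF this, of A] d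
    show "(\<integral>\<^sup>+M. indicator D M * \<psi> (A ** M) \<partial>lborel) = (\<integral>\<^sup>+M. indicator D (adj2 A ** M) * \<psi> M \<partial>lborel)"
      by (simp add: adj2_mult_cancel)
  qed
  also have "\<dots> = (\<integral>\<^sup>+M. \<integral>\<^sup>+A. indicator D (adj2 A ** M) * \<psi> M \<partial>count_space S \<partial>lborel)"
    by (rule nn_integral_count_space_nn_integral[OF countable_S, symmetric]) measurable
  also have "\<dots> = (\<integral>\<^sup>+M. (\<integral>\<^sup>+A. indicator D (adj2 A ** M) \<partial>count_space S) * \<psi> M \<partial>lborel)"
    by (intro nn_integral_cong nn_integral_multc) simp
  also have "\<dots> = (\<integral>\<^sup>+M. (\<integral>\<^sup>+A. indicator D (A ** M) \<partial>count_space S) * \<psi> M \<partial>lborel)"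
    using nn_integral_bij_count_space[OF bij_adj2, of "\<lambda>A. indicator D (A ** M)" for M] by simp
  also have "\<dots> = (\<integral>\<^sup>+M. 2 * \<psi> M \<partial>lborel)"
    by (rule nn_integral_cong_AE, use D_tiles in eventually_elim) (use supp in \<open>auto\<close>)
  also have "\<dots> = 2 * (\<integral>\<^sup>+M. \<psi> M \<partial>lborel)"
    by (rule nn_integral_cmult) simp
  finally show ?thesis .
qed

text \<open>
  The measurable sets of the quotient of \<open>pos_det\<close> by \<open>S\<close> and by positive scalars, represented as saturated
  sets of matrices.  Thus the quotient measure needs no quotient space.
\<close>

definition inv_sets :: "(real^2^2) set set" where
  "inv_sets = {B \<in> sets borel. B \<subseteq> pos_det \<and> (\<forall>A\<in>S. \<forall>M\<in>B. A ** M \<in> B) \<and> (\<forall>r>0. \<forall>M\<in>B. r *\<^sub>R M \<in> B)}"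

lemma inv_sets_borel: "B \<in> inv_sets \<Longrightarrow> B \<in> sets borel"
  by (simp add: inv_sets_def)

lemma inv_sets_mult_iff: "B \<in> inv_sets \<Longrightarrow> A \<in> S \<Longrightarrow> A ** M \<in> B \<longleftrightarrow> M \<in> B"
proof
  assume B: "B \<in> inv_sets" "A \<in> S" "A ** M \<in> B"
  then have "adj2 A ** (A ** M) \<in> B" using inv_S unfolding inv_sets_def by blast
  then show "M \<in> B" by (simp add: adj2_mult_cancel det_S B)
qed (auto simp: inv_sets_def)

lemma inv_sets_scale_iff: "B \<in> inv_sets \<Longrightarrow> r > 0 \<Longrightarrow> r *\<^sub>R M \<in> B \<longleftrightarrow> M \<in> B"
proof
  assume "B \<in> inv_sets" "r > 0" "r *\<^sub>R M \<in> B"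
  then have "(1 / r) *\<^sub>R (r *\<^sub>R M) \<in> B" unfolding inv_sets_def by (auto simp del: scaleR_scaleR)
  then show "M \<in> B" using \<open>r > 0\<close> by simp
qed (auto simp: inv_sets_def)

lemma pos_det_mult: "det A > 0 \<Longrightarrow> A ** M \<in> pos_det \<longleftrightarrow> M \<in> pos_det"
  "det A > 0 \<Longrightarrow> M ** A \<in> pos_det \<longleftrightarrow> M \<in> pos_det"
  by (auto simp: pos_det_def det_mul zero_less_mult_iff)

lemma pos_det_scale: "r > 0 \<Longrightarrow> r *\<^sub>R M \<in> pos_det \<longleftrightarrow> M \<in> pos_det"
  by (auto simp: pos_det_def det_scaleR2 zero_less_mult_iff)

lemma inv_setsI:
  assumes "B \<in> sets borel" "B \<subseteq> pos_det"
    and "\<And>A M. A \<in> S \<Longrightarrow> M \<in> B \<Longrightarrow> A ** M \<in> B" "\<And>r M. r > 0 \<Longrightarrow> M \<in> B \<Longrightarrow> r *\<^sub>R M \<in> B"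
  shows "B \<in> inv_sets"
  using assms by (auto simp: inv_sets_def)

lemma sigma_algebra_inv_sets: "sigma_algebra pos_det inv_sets"
proof (unfold sigma_algebra_iff2, intro conjI ballI allI impI)
  fix B assume B: "B \<in> inv_sets"
  show "pos_det - B \<in> inv_sets"
  proof (rule inv_setsI)
    show "pos_det - B \<in> sets borel" using inv_sets_borel[OF B] by measurable
    show "A ** M \<in> pos_det - B" if "A \<in> S" "M \<in> pos_det - B" for A M
      using that inv_sets_mult_iff[OF B] det_S[OF that(1)] by (auto simp: pos_det_mult)
    show "r *\<^sub>R M \<in> pos_det - B" if "r > 0" "M \<in> pos_det - B" for r M
      using that inv_sets_scale_iff[OF B] by (auto simp: pos_det_scale)
  qed auto
next
  fix B :: "nat \<Rightarrow> _" assume "range B \<subseteq> inv_sets"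
  then have B: "B n \<in> inv_sets" for n by auto
  show "(\<Union>n. B n) \<in> inv_sets"
  proof (rule inv_setsI)
    show "(\<Union>n. B n) \<in> sets borel" using inv_sets_borel[OF B] by (intro sets.countable_UN) auto
    show "(\<Union>n. B n) \<subseteq> pos_det" using B unfolding inv_sets_def by blast
  qed (use B in \<open>auto simp: inv_sets_mult_iff inv_sets_scale_iff\<close>)
qed (auto simp: inv_sets_def)

text \<open>
  The Liouville measure of the quotient, as a measure on the saturated sets: the measure of the part in the
  fundamental domain.
\<close>

definition N :: "(real^2^2) measure" where
  "N = distr (restrict_space (density lborel (indicator D)) pos_det) (sigma pos_det inv_sets) (\<lambda>M. M)"

lemma space_N: "space N = pos_det"
  unfolding N_def space_distr by (rule space_measure_of) (auto simp: inv_sets_def)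

lemma sets_N: "sets N = inv_sets"
  unfolding N_def sets_distr
  using sigma_algebra.sigma_sets_eq[OF sigma_algebra_inv_sets]
  by (subst sets_measure_of) (auto simp: inv_sets_def)

lemma measurable_id_N:
  "(\<lambda>M. M) \<in> measurable (restrict_space (density lborel (indicator D)) pos_det) (sigma pos_det inv_sets)"
proof (rule measurable_sigma_sets[where \<Omega>=pos_det and A=inv_sets])
  show "sets (sigma pos_det inv_sets) = sigma_sets pos_det inv_sets"
    by (rule sets_measure_of) (auto simp: inv_sets_def)
  fix B assume "B \<in> inv_sets"
  then have "B \<in> sets borel" "B \<subseteq> pos_det" by (auto simp: inv_sets_def)
  then show "(\<lambda>M. M) -` B \<inter> space (restrict_space (density lborel (indicator D)) pos_det)
      \<in> sets (restrict_space (density lborel (indicator D)) pos_det)"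
    by (auto simp: sets_restrict_space_iff space_restrict_space Int_absorb2 inf.absorb1)
qed (auto simp: inv_sets_def space_restrict_space)

lemma nn_integral_N:
  assumes f: "f \<in> borel_measurable N" and [measurable]: "f \<in> borel_measurable borel"
  shows "(\<integral>\<^sup>+M. f M \<partial>N) = (\<integral>\<^sup>+M. indicator D M * f M \<partial>lborel)"
proof -
  have "f \<in> borel_measurable (sigma pos_det inv_sets)" using f unfolding N_def by simp
  then have "(\<integral>\<^sup>+M. f M \<partial>N) = (\<integral>\<^sup>+M. f M \<partial>(restrict_space (density lborel (indicator D)) pos_det))"
    unfolding N_def by (subst nn_integral_distr[OF measurable_id_N]) auto
  also have "\<dots> = (\<integral>\<^sup>+M. f M * indicator pos_det M \<partial>(density lborel (indicator D)))"
    by (subst nn_integral_restrict_space) auto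
  also have "\<dots> = (\<integral>\<^sup>+M. indicator D M * (f M * indicator pos_det M) \<partial>lborel)"
    by (subst nn_integral_density) auto
  also have "\<dots> = (\<integral>\<^sup>+M. indicator D M * f M \<partial>lborel)"
    using D_sub by (intro nn_integral_cong) (auto simp: indicator_def unit_cone_def pos_det_def)
  finally show ?thesis .
qed

lemma emeasure_N: "B \<in> inv_sets \<Longrightarrow> emeasure N B = emeasure lborel (B \<inter> D)"
proof -
  assume B: "B \<in> inv_sets"
  then have [measurable]: "B \<in> sets borel" by (rule inv_sets_borel)
  have "emeasure N B = (\<integral>\<^sup>+M. indicator B M \<partial>N)" using B by (simp add: sets_N)
  also have "\<dots> = (\<integral>\<^sup>+M. indicator D M * indicator B M \<partial>lborel)"
    by (intro nn_integral_N borel_measurable_indicator) (simp_all add: sets_N B)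
  also have "\<dots> = emeasure lborel (B \<inter> D)"
    by (simp add: indicator_inter_arith[symmetric] Int_commute)
  finally show ?thesis .
qed

lemma measurable_N:
  assumes [measurable]: "f \<in> borel_measurable borel"
    and "\<And>A M. A \<in> S \<Longrightarrow> M \<in> pos_det \<Longrightarrow> f (A ** M) = f M"
    and "\<And>r M. r > 0 \<Longrightarrow> M \<in> pos_det \<Longrightarrow> f (r *\<^sub>R M) = f M"
  shows "f \<in> measurable N (borel :: 'b::topological_space measure)"
proof (rule measurableI)
  fix X :: "'b set" assume [measurable]: "X \<in> sets borel"
  show "f -` X \<inter> space N \<in> sets N"
    unfolding space_N sets_N
  proof (rule inv_setsI)
    have "f -` X \<inter> space borel \<in> sets borel" by measurable
    then show "f -` X \<inter> pos_det \<in> sets borel" by (intro sets.Int) auto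
    show "A ** M \<in> f -` X \<inter> pos_det" if "A \<in> S" "M \<in> f -` X \<inter> pos_det" for A M
      using that assms(2) det_S[OF that(1)] by (auto simp: pos_det_mult)
    show "r *\<^sub>R M \<in> f -` X \<inter> pos_det" if "r > 0" "M \<in> f -` X \<inter> pos_det" for r M
      using that assms(3) by (auto simp: pos_det_scale)
  qed auto
qed auto

lemma inv_sets_translate:
  assumes B: "B \<in> inv_sets" and h: "det h = 1"
  shows "{M. M ** h \<in> B} \<in> inv_sets"
proof (rule inv_setsI)
  have [measurable]: "B \<in> sets borel" using B by (rule inv_sets_borel)
  show "{M. M ** h \<in> B} \<in> sets borel" by measurable
  show "{M. M ** h \<in> B} \<subseteq> pos_det"
    using B h pos_det_mult(2)[of h] by (auto simp: inv_sets_def)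
qed (use B in \<open>auto simp: matrix_mul_assoc[symmetric] inv_sets_mult_iff scaleR_matrix_mult inv_sets_scale_iff\<close>)

lemma measurable_translate_N: "det h = 1 \<Longrightarrow> (\<lambda>M. M ** h) \<in> measurable N N"
proof (rule measurableI)
  fix B assume h: "det h = 1" and "B \<in> sets N"
  then have B: "B \<in> inv_sets" by (simp add: sets_N)
  have "(\<lambda>M. M ** h) -` B \<inter> space N = {M. M ** h \<in> B}"
    using B h pos_det_mult(2)[of h] by (auto simp: inv_sets_def space_N)
  then show "(\<lambda>M. M ** h) -` B \<inter> space N \<in> sets N"
    using inv_sets_translate[OF B h] by (simp add: sets_N)
qed (simp add: space_N pos_det_mult)

text \<open>
  The measure does not depend on the fundamental domain, and \<open>D\<close> translated by \<open>h\<close> is another one.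
  Formally, \<open>2 * N {M. M ** h \<in> B}\<close> unfolds to twice the measure of \<open>B \<inter> D\<close>, with the cover by the
  translates of \<open>D\<close> evaluated at \<open>M ** h\<close>.
\<close>

lemma emeasure_translate_N:
  assumes B: "B \<in> inv_sets" and h: "det h = 1"
  shows "emeasure N {M. M ** h \<in> B} = emeasure N B"
proof -
  have [measurable]: "B \<in> sets borel" using B by (rule inv_sets_borel)
  have [measurable]: "{M. M ** h \<in> B} \<in> sets borel" by measurable
  have tile: "AE M in lborel. M ** h \<in> unit_cone \<longrightarrow> (\<integral>\<^sup>+A. indicator D (A ** (M ** h)) \<partial>count_space S) = 2"
    using AE_mult_right[OF D_tiles] h by simp
  have "2 * emeasure N {M. M ** h \<in> B} = 2 * (\<integral>\<^sup>+M. indicator ({M. M ** h \<in> B} \<inter> D) M \<partial>lborel)"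
    using inv_sets_translate[OF B h] by (simp add: emeasure_N)
  also have "\<dots> = (\<integral>\<^sup>+M. 2 * indicator ({M. M ** h \<in> B} \<inter> D) M \<partial>lborel)"
    by (rule nn_integral_cmult[symmetric]) simp
  also have "\<dots> = (\<integral>\<^sup>+M. indicator D M * (\<integral>\<^sup>+A. indicator (B \<inter> D) ((A ** M) ** h) \<partial>count_space S) \<partial>lborel)"
  proof (rule nn_integral_cong_AE, use tile in eventually_elim)
    case (elim M)
    have "(\<integral>\<^sup>+A. indicator (B \<inter> D) ((A ** M) ** h) \<partial>count_space S) =
       (\<integral>\<^sup>+A. indicator B (M ** h) * indicator D (A ** (M ** h)) \<partial>count_space S)"
      using inv_sets_mult_iff[OF B]
      by (intro nn_integral_cong) (auto simp: indicator_def matrix_mul_assoc[symmetric])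
    also have "\<dots> = indicator B (M ** h) * (\<integral>\<^sup>+A. indicator D (A ** (M ** h)) \<partial>count_space S)"
      by (rule nn_integral_cmult) simp
    finally show ?case
      using elim D_sub h by (auto simp: indicator_def unit_cone_def det_mul)
  qed
  also have "\<dots> = 2 * (\<integral>\<^sup>+M. indicator (B \<inter> D) (M ** h) \<partial>lborel)"
    using D_sub h by (intro unfolding_formula) (auto simp: indicator_def unit_cone_def det_mul)
  also have "(\<integral>\<^sup>+M. indicator (B \<inter> D) (M ** h) \<partial>lborel) = (\<integral>\<^sup>+M. indicator (B \<inter> D) M \<partial>lborel)"
    using nn_integral_mult_right[of "indicator (B \<inter> D)" h] h by simp
  also have "\<dots> = emeasure N B" using B by (simp add: emeasure_N)
  finally show ?thesis by (simp add: ennreal_mult_cancel_left)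
qed

text \<open>
  The translates of \<open>D\<close> cover almost all of the cone, so a saturated set that is null in \<open>D\<close> is null.
\<close>

lemma null_set_of_N:
  assumes B: "B \<in> inv_sets" and 0: "emeasure N B = 0"
  shows "B \<in> null_sets lborel"
proof -
  have [measurable]: "B \<in> sets borel" using B by (rule inv_sets_borel)
  have "2 * emeasure lborel (B \<inter> unit_cone) = 2 * (\<integral>\<^sup>+M. indicator (B \<inter> unit_cone) M \<partial>lborel)"
    by simp
  also have "\<dots> = (\<integral>\<^sup>+M. indicator D M * (\<integral>\<^sup>+A. indicator (B \<inter> unit_cone) (A ** M) \<partial>count_space S) \<partial>lborel)"
    by (rule unfolding_formula[symmetric]) auto
  also have "\<dots> = (\<integral>\<^sup>+(M::real^2^2). 0 \<partial>lborel)"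
  proof (rule nn_integral_cong_AE)
    have "B \<inter> D \<in> null_sets lborel" using 0 B by (auto simp: emeasure_N)
    then have "AE M in lborel. M \<notin> B \<inter> D" by (rule AE_not_in)
    then show "AE M in lborel. indicator D M * (\<integral>\<^sup>+A. indicator (B \<inter> unit_cone) (A ** M) \<partial>count_space S) = (0::ennreal)"
    proof eventually_elim
      case (elim M)
      have "(\<integral>\<^sup>+A. indicator (B \<inter> unit_cone) (A ** M) \<partial>count_space S) = (\<integral>\<^sup>+A. 0 \<partial>count_space S)" if "M \<in> D"
        using elim that B by (intro nn_integral_cong) (auto simp: inv_sets_mult_iff)
      then show ?case by (auto simp: indicator_def)
    qed
  qed
  finally have cone: "B \<inter> unit_cone \<in> null_sets lborel" by (auto simp: null_sets_def)
  then show ?thesis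
    by (rule null_sets_cone[rotated 3]) (use B in \<open>auto simp: inv_sets_def\<close>)
qed

end


section \<open>Ergodicity of the geodesic flow\<close>

definition upper_shear :: "real \<Rightarrow> real^2^2" where "upper_shear x = mat2 1 x 0 1"
definition lower_shear :: "real \<Rightarrow> real^2^2" where "lower_shear x = mat2 1 0 x 1"

lemma det_shear [simp]: "det (upper_shear x) = 1" "det (lower_shear x) = 1"
  by (simp_all add: upper_shear_def lower_shear_def)

lemma tendsto_mat2:
  assumes "(a \<longlongrightarrow> a') F" "(b \<longlongrightarrow> b') F" "(c \<longlongrightarrow> c') F" "(d \<longlongrightarrow> d') F"
  shows "((\<lambda>x. mat2 (a x) (b x) (c x) (d x)) \<longlongrightarrow> mat2 a' b' c' d') F"
proof (intro vec_tendstoI)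
  fix i j :: 2
  show "((\<lambda>x. mat2 (a x) (b x) (c x) (d x) $ i $ j) \<longlongrightarrow> mat2 a' b' c' d' $ i $ j) F"
    using exhaust_2[of i] exhaust_2[of j] assms by auto
qed

lemma mat_1_mat2: "mat 1 = mat2 1 0 0 1"
  by (simp add: matrix2_eq_iff)

context covolume_domain
begin

lemma space_N_minus: "B \<in> inv_sets \<Longrightarrow> pos_det - B \<in> inv_sets"
  using sets.compl_sets[of B N] by (simp add: sets_N space_N)

lemma AE_N_iff:
  assumes "B \<in> inv_sets"
  shows "emeasure N B = 0 \<longleftrightarrow> (AE M in lborel. M \<notin> B)"
proof
  assume "emeasure N B = 0"
  then show "AE M in lborel. M \<notin> B" using null_set_of_N[OF assms] AE_not_in by blast
next
  assume ae: "AE M in lborel. M \<notin> B"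
  have "B \<in> sets borel" using assms by (rule inv_sets_borel)
  then have "B \<in> null_sets lborel" using ae by (simp add: AE_iff_null_sets)
  then have "emeasure lborel (B \<inter> D) = 0" using null_set_Int2[of B lborel D] by auto
  then show "emeasure N B = 0" using emeasure_N[OF assms] by simp
qed

text \<open>
  The Mautner phenomenon.  The measure of the set \<open>B n\<close> of points of \<open>A\<close> that leave \<open>A\<close> under \<open>u n\<close> is the
  same for all \<open>n\<close>, since \<open>g\<close> carries these sets to each other and preserves \<open>A\<close>.  But \<open>u n\<close> tends to the
  identity, hence this constant is \<open>0\<close>.
\<close>

lemma mautner:
  assumes A: "A \<in> inv_sets" and g: "det g = 1" and Ag: "\<And>M. M ** g \<in> A \<longleftrightarrow> M \<in> A"
    and u: "\<And>n. det (u n) = 1" "u \<longlonglongrightarrow> mat 1" and conj: "\<And>n. u n ** g = g ** u (Suc n)"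
  shows "AE M in lborel. M \<in> A \<longrightarrow> M ** u 0 \<in> A"
proof -
  have [measurable]: "A \<in> sets borel" using A by (rule inv_sets_borel)
  define B where "B n = A - {M. M ** u n \<in> A}" for n
  have B: "B n \<in> inv_sets" for n
  proof -
    have "A - {M. M ** u n \<in> A} \<in> sets N"
      using A inv_sets_translate[OF A u(1)] by (intro sets.Diff) (simp_all add: sets_N)
    then show ?thesis by (simp add: B_def sets_N)
  qed
  have step: "emeasure N (B (Suc n)) = emeasure N (B n)" for n
  proof -
    have "{M. M ** g \<in> B (Suc n)} = B n"
    proof -
      have "M ** g ** u (Suc n) = M ** u n ** g" for M :: "real^2^2"
        by (simp only: matrix_mul_assoc[symmetric] conj)
      then show ?thesis by (auto simp: B_def Ag)
    qed
    then show ?thesis using emeasure_translate_N[OF B g, of "Suc n"] by simp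
  qed
  have const: "emeasure N (B n) = emeasure N (B 0)" for n
    by (induction n) (simp_all add: step)
  have "(\<lambda>n. emeasure lborel {M \<in> A \<inter> D. M ** u n \<notin> A \<inter> D}) \<longlonglongrightarrow> 0"
  proof (rule emeasure_displaced_tendsto_0)
    have "emeasure lborel (A \<inter> D) \<le> emeasure lborel D" by (intro emeasure_mono) auto
    then show "emeasure lborel (A \<inter> D) < \<infinity>" using D_finite by (rule le_less_trans)
    show "emeasure lborel {M. M ** u n \<in> X} = emeasure lborel X" if X: "X \<in> sets borel" for n and X :: "(real^2^2) set"
      using emeasure_mult_right[of X "u n"] X u by simp
    show "(\<lambda>n. M ** u n) \<longlonglongrightarrow> M" for M
    proof -
      have "(\<lambda>n. M ** u n) \<longlonglongrightarrow> M ** mat 1"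
        unfolding matrix_matrix_mult_def
        by (intro tendsto_vec_lambda tendsto_sum tendsto_mult tendsto_const tendsto_vec_nth u)
      then show ?thesis by simp
    qed
  qed auto
  moreover have "emeasure N (B 0) \<le> emeasure lborel {M \<in> A \<inter> D. M ** u n \<notin> A \<inter> D}" for n
  proof -
    have "emeasure N (B 0) = emeasure lborel (B n \<inter> D)"
      using const[of n] emeasure_N[OF B] by simp
    also have "\<dots> \<le> emeasure lborel {M \<in> A \<inter> D. M ** u n \<notin> A \<inter> D}"
      by (intro emeasure_mono) (auto simp: B_def)
    finally show ?thesis .
  qed
  ultimately have "emeasure N (B 0) \<le> 0" by (intro LIMSEQ_le_const) auto
  then have "AE M in lborel. M \<notin> B 0" using AE_N_iff[OF B] by simp
  then show ?thesis by eventually_elim (auto simp: B_def)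
qed

lemma geo_mult_iff:
  assumes A: "A \<in> inv_sets" and inv: "\<And>M. M \<in> pos_det \<Longrightarrow> M ** geo t \<in> A \<longleftrightarrow> M \<in> A"
  shows "M ** geo t \<in> A \<longleftrightarrow> M \<in> A" "M ** geo (- t) \<in> A \<longleftrightarrow> M \<in> A"
proof -
  have sub: "A \<subseteq> pos_det" using A by (simp add: inv_sets_def)
  show *: "M ** geo t \<in> A \<longleftrightarrow> M \<in> A" for M
    using inv[of M] sub pos_det_mult(2)[of "geo t" M] by auto
  have "M ** geo (- t) ** geo t = M"
    unfolding matrix_mul_assoc[symmetric]
    by (simp add: geo_def matrix2_eq_iff flip: exp_add)
  then show "M ** geo (- t) \<in> A \<longleftrightarrow> M \<in> A" using *[of "M ** geo (- t)"] by simp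
qed

text \<open>
  Conjugation by the geodesic flow contracts the upper shears and expands the lower ones; for the latter
  the inverse flow contracts.
\<close>

lemma shear_invariant:
  assumes A: "A \<in> inv_sets" and inv: "\<And>M. M \<in> pos_det \<Longrightarrow> M ** geo 1 \<in> A \<longleftrightarrow> M \<in> A"
  shows "AE M in lborel. M \<in> A \<longrightarrow> M ** upper_shear x \<in> A"
    and "AE M in lborel. M \<in> A \<longrightarrow> M ** lower_shear x \<in> A"
proof -
  note iff = geo_mult_iff[OF A inv]
  have lim: "(\<lambda>n. exp (- real n) * x) \<longlonglongrightarrow> 0"
    by real_asymp
  have e: "exp (- real n) = exp (- real n - 1) * exp 1" "exp (1/2) * exp (1/2) = exp (1::real)"
     "exp (-1/2) * exp (1/2) = (1::real)" for n
    by (simp_all flip: exp_add)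
  have half: "exp (- 1 - real n) * exp (1 / 2) = exp (- real n) * exp (- 1 / 2 :: real)" for n
    by (simp flip: exp_add)
  have "AE M in lborel. M \<in> A \<longrightarrow> M ** upper_shear (exp (- real 0) * x) \<in> A"
  proof (rule mautner[OF A _ iff(1), where u="\<lambda>n. upper_shear (exp (- real n) * x)"])
    show "(\<lambda>n. upper_shear (exp (- real n) * x)) \<longlonglongrightarrow> mat 1"
      using tendsto_mat2[OF tendsto_const lim tendsto_const tendsto_const, of 1 0 1]
      by (simp add: upper_shear_def mat_1_mat2)
    show "upper_shear (exp (- real n) * x) ** geo 1 = geo 1 ** upper_shear (exp (- real (Suc n)) * x)" for n
      using half[of n] by (simp add: upper_shear_def geo_def matrix2_eq_iff ac_simps)
  qed auto
  then show "AE M in lborel. M \<in> A \<longrightarrow> M ** upper_shear x \<in> A" by simp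
  have "AE M in lborel. M \<in> A \<longrightarrow> M ** lower_shear (exp (- real 0) * x) \<in> A"
  proof (rule mautner[OF A _ iff(2), where u="\<lambda>n. lower_shear (exp (- real n) * x)"])
    show "(\<lambda>n. lower_shear (exp (- real n) * x)) \<longlonglongrightarrow> mat 1"
      using tendsto_mat2[OF tendsto_const tendsto_const lim tendsto_const, of 1 0 1]
      by (simp add: lower_shear_def mat_1_mat2)
    show "lower_shear (exp (- real n) * x) ** geo (-1) = geo (-1) ** lower_shear (exp (- real (Suc n)) * x)" for n
      using half[of n] by (simp add: lower_shear_def geo_def matrix2_eq_iff ac_simps)
  qed auto
  then show "AE M in lborel. M \<in> A \<longrightarrow> M ** lower_shear x \<in> A" by simp
qed

text \<open>
  A matrix with nonzero lower left entry is a product of three shears; any other one becomes such a matrix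
  after multiplication by a lower shear.
\<close>

lemma shears_generate:
  assumes "det h = 1" and 1: "\<And>x. P (upper_shear x)" "\<And>x. P (lower_shear x)"
    and 2: "\<And>a b. P a \<Longrightarrow> P b \<Longrightarrow> P (a ** b)"
  shows "P h"
proof -
  have *: "P h" if d: "det h = 1" and r: "h $ 2 $ 1 \<noteq> 0" for h
  proof -
    have "h = upper_shear ((h $ 1 $ 1 - 1) / h $ 2 $ 1) ** (lower_shear (h $ 2 $ 1) ** upper_shear ((h $ 2 $ 2 - 1) / h $ 2 $ 1))"
      using d r unfolding det_2
      by (simp add: upper_shear_def lower_shear_def matrix2_eq_iff) (simp add: field_simps)
    then show ?thesis using 1 2 by metis
  qed
  show ?thesis
  proof (cases "h $ 2 $ 1 = 0")
    case True
    then have "h $ 1 $ 1 * h $ 2 $ 2 = 1" using assms(1) by (simp add: det_2)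
    then have "(h ** lower_shear 1) $ 2 $ 1 \<noteq> 0" using True by (auto simp: lower_shear_def)
    then have "P (h ** lower_shear 1)" using assms(1) by (intro *) (simp_all add: det_mul)
    then have "P (h ** lower_shear 1 ** lower_shear (-1))" using 1 2 by blast
    moreover have "h ** lower_shear 1 ** lower_shear (-1) = h"
      by (simp add: lower_shear_def matrix2_eq_iff)
    ultimately show ?thesis by simp
  qed (use assms(1) * in blast)
qed

text \<open>
  A flow-invariant set is almost invariant under all shears by the Mautner phenomenon, hence under each
  \<open>h\<close> of positive determinant.  By Fubini, for almost every \<open>M\<close> in it almost all \<open>M ** h\<close> belong to it; as
  \<open>h \<mapsto> M ** h\<close> is a linear bijection, a single such \<open>M\<close> makes the set conull.
\<close>

lemma geodesic_flow_ergodic: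
  assumes A: "A \<in> inv_sets" and inv: "\<And>M. M \<in> pos_det \<Longrightarrow> M ** geo 1 \<in> A \<longleftrightarrow> M \<in> A"
  shows "emeasure N A = 0 \<or> emeasure N (pos_det - A) = 0"
proof (rule disjCI)
  assume nonnull: "emeasure N (pos_det - A) \<noteq> 0"
  have [measurable]: "A \<in> sets borel" using A by (rule inv_sets_borel)
  have sl2: "AE M in lborel. M \<in> A \<longrightarrow> M ** h \<in> A" if "det h = 1" for h
  proof (rule conjunct2, rule shears_generate[OF that, where P="\<lambda>h. det h = 1 \<and> (AE M in lborel. M \<in> A \<longrightarrow> M ** h \<in> A)"])
    fix a b assume *: "det a = 1 \<and> (AE M in lborel. M \<in> A \<longrightarrow> M ** a \<in> A)"
      "det b = 1 \<and> (AE M in lborel. M \<in> A \<longrightarrow> M ** b \<in> A)"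
    then have "AE M in lborel. M \<in> A \<longrightarrow> M ** a \<in> A" "AE M in lborel. M ** a \<in> A \<longrightarrow> M ** a ** b \<in> A"
      using AE_mult_right[of "\<lambda>M. M \<in> A \<longrightarrow> M ** b \<in> A" a] by auto
    then have "AE M in lborel. M \<in> A \<longrightarrow> M ** (a ** b) \<in> A"
      by eventually_elim (auto simp: matrix_mul_assoc)
    then show "det (a ** b) = 1 \<and> (AE M in lborel. M \<in> A \<longrightarrow> M ** (a ** b) \<in> A)"
      using * by (simp add: det_mul)
  qed (use shear_invariant[OF A inv] in auto)
  have gl2: "AE M in lborel. M \<in> A \<longrightarrow> M ** h \<in> A" if h: "h \<in> pos_det" for h
  proof -
    define r where "r = sqrt (det h)"
    have r: "r > 0" "r\<^sup>2 = det h" using h by (auto simp: r_def pos_det_def)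
    then have "det ((1 / r) *\<^sub>R h) = 1" using h by (simp add: det_scaleR2 power_divide pos_det_def)
    from sl2[OF this] show ?thesis
      by eventually_elim (use r inv_sets_scale_iff[OF A, of "1 / r"] in \<open>simp add: scaleR_matrix_mult\<close>)
  qed
  \<comment> \<open>The pairs \<open>(h, M)\<close> that violate the invariance of \<open>A\<close>; they are null for each \<open>h\<close>.\<close>
  define Q :: "real^2^2 \<Rightarrow> real^2^2 \<Rightarrow> ennreal" where
    "Q h M = indicator pos_det h * indicator A M * indicator (- A) (M ** h)" for h M
  have [measurable]: "case_prod Q \<in> borel_measurable (borel \<Otimes>\<^sub>M borel)"
    unfolding Q_def by measurable
  have "(\<integral>\<^sup>+M. \<integral>\<^sup>+h. Q h M \<partial>lborel \<partial>lborel) = (\<integral>\<^sup>+h. \<integral>\<^sup>+M. Q h M \<partial>lborel \<partial>lborel)"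
    by (rule lborel_pair.Fubini') measurable
  also have "\<dots> = (\<integral>\<^sup>+(h::real^2^2). 0 \<partial>lborel)"
  proof (rule nn_integral_cong)
    fix h
    show "(\<integral>\<^sup>+M. Q h M \<partial>lborel) = 0"
    proof (cases "h \<in> pos_det")
      case True
      have "(\<integral>\<^sup>+M. Q h M \<partial>lborel) = (\<integral>\<^sup>+(M::real^2^2). 0 \<partial>lborel)"
        by (rule nn_integral_cong_AE, use gl2[OF True] in eventually_elim) (auto simp: Q_def)
      then show ?thesis by simp
    qed (simp add: Q_def)
  qed
  finally have "AE M in lborel. (\<integral>\<^sup>+h. Q h M \<partial>lborel) = 0"
    by (simp add: nn_integral_0_iff_AE)
  moreover have "M \<notin> A" if 0: "(\<integral>\<^sup>+h. Q h M \<partial>lborel) = 0" for M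
  proof
    assume M: "M \<in> A"
    have "AE h in lborel. Q h M = 0"
      using 0 by (subst (asm) nn_integral_0_iff_AE) simp_all
    then have ae: "AE h in lborel. h \<in> pos_det \<longrightarrow> M ** h \<in> A"
      by eventually_elim (auto simp: Q_def M indicator_def split: if_splits)
    have dM: "det M > 0" using M A by (auto simp: inv_sets_def pos_det_def)
    then have "invertible M" by (simp add: invertible_det_nz)
    then obtain M' where M': "M ** M' = mat 1" by (auto simp: invertible_def)
    then have "det M * det M' = 1" by (metis det_I det_mul)
    then have d': "det M' > 0" using dM by (metis zero_less_mult_pos zero_less_one)
    have "AE h in lborel. M' ** h \<in> pos_det \<longrightarrow> M ** (M' ** h) \<in> A"
      using AE_mult_left[OF ae, of M'] d' by simp
    then have "AE h in lborel. h \<notin> pos_det - A"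
      by eventually_elim (auto simp: pos_det_mult d' matrix_mul_assoc M')
    then show False using nonnull AE_N_iff[OF space_N_minus[OF A]] by simp
  qed
  ultimately have "AE M in lborel. M \<notin> A" by auto
  then show "emeasure N A = 0" using AE_N_iff[OF A] by simp
qed

text \<open>
  The flow is used at integral times only, so that Birkhoff's theorem for a single map applies.
\<close>

sublocale geodesic: ergodic_map N "\<lambda>M. M ** geo 1"
proof -
  interpret finite_measure N
  proof (rule finite_measureI)
    have "pos_det \<in> inv_sets" using sets.top[of N] by (simp add: sets_N space_N)
    then show "emeasure N (space N) \<noteq> \<infinity>"
      using D_finite emeasure_mono[of "pos_det \<inter> D" D lborel] by (auto simp: emeasure_N space_N top_unique)
  qed
  have eq: "(\<lambda>M. M ** geo 1) -` A \<inter> space N = {M. M ** geo 1 \<in> A}" if "A \<in> sets N" for A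
    using that sets.sets_into_space[OF that] pos_det_mult(2)[of "geo 1"] by (auto simp: space_N)
  show "ergodic_map N (\<lambda>M. M ** geo 1)"
  proof
    show "(\<lambda>M. M ** geo 1) \<in> measurable N N" by (simp add: measurable_translate_N)
    show "emeasure N ((\<lambda>M. M ** geo 1) -` A \<inter> space N) = emeasure N A" if "A \<in> sets N" for A
      using emeasure_translate_N[of A "geo 1"] that eq[OF that] by (simp add: sets_N)
    show "emeasure N A = 0 \<or> emeasure N (space N - A) = 0"
      if A: "A \<in> sets N" "(\<lambda>M. M ** geo 1) -` A \<inter> space N = A" for A
      unfolding space_N
    proof (rule geodesic_flow_ergodic)
      show "A \<in> inv_sets" using A by (simp add: sets_N)
      show "M ** geo 1 \<in> A \<longleftrightarrow> M \<in> A" if "M \<in> pos_det" for M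
        using A(2) that unfolding space_N by blast
    qed
  qed
qed

lemma measure_N: "measure N (space N) = measure lborel D"
proof -
  have "pos_det \<in> inv_sets" using sets.top[of N] by (simp add: sets_N space_N)
  moreover have "pos_det \<inter> D = D" using D_sub by (auto simp: unit_cone_def pos_det_def)
  ultimately show ?thesis by (simp add: measure_def emeasure_N space_N)
qed

end


section \<open>Counting crossings along an orbit of the flow\<close>

text \<open>
  The matrix \<open>M\<close> with rows \<open>(a, b)\<close> and \<open>(c, d)\<close> stands for the geodesic \<open>t \<mapsto> M (exp t * \<i>)\<close>, whose forward
  endpoint is \<open>a / c\<close> and whose backward endpoint is \<open>b / d\<close>.
\<close>

definition window :: "(real \<times> real) set \<Rightarrow> (real^2^2) set" where
  "window R = {M. M $ 2 $ 1 \<noteq> 0 \<and> M $ 2 $ 2 \<noteq> 0 \<and> (M $ 1 $ 1 / M $ 2 $ 1, M $ 1 $ 2 / M $ 2 $ 2) \<in> R}"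

text \<open>
  The time at which the geodesic of \<open>M\<close> is highest.  The flow shifts it at unit speed, which makes it a
  coordinate along the orbits of the flow.
\<close>

definition peak :: "real^2^2 \<Rightarrow> real" where "peak M = ln \<bar>M $ 2 $ 2 / M $ 2 $ 1\<bar>"

lemma window_borel [measurable]:
  assumes [measurable]: "R \<in> sets (borel \<Otimes>\<^sub>M borel)"
  shows "window R \<in> sets borel"
  unfolding window_def by measurable

lemma peak_borel [measurable]: "peak \<in> borel_measurable borel"
  unfolding peak_def[abs_def] by measurable

lemma window_scale: "r > 0 \<Longrightarrow> r *\<^sub>R M \<in> window R \<longleftrightarrow> M \<in> window R"
  by (auto simp: window_def)

lemma peak_scale: "r > 0 \<Longrightarrow> peak (r *\<^sub>R M) = peak M"
  by (auto simp: peak_def)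

lemma window_geo: "M ** geo t \<in> window R \<longleftrightarrow> M \<in> window R"
  by (simp add: window_def geo_def)

lemma peak_geo: "M \<in> window R \<Longrightarrow> peak (M ** geo t) = peak M - t"
  by (auto simp: window_def peak_def geo_def abs_mult abs_divide ln_mult ln_div ln_inverse exp_minus)

text \<open>
  The invariant measure on the space of geodesics, parametrized by their endpoints.
\<close>

definition flux :: "(real \<times> real) set \<Rightarrow> ennreal" where
  "flux R = (\<integral>\<^sup>+x. \<integral>\<^sup>+y. indicator R (x, y) * ennreal (1 / (x - y)\<^sup>2) \<partial>lborel \<partial>lborel)"

text \<open>
  Reflection folds an even integrand onto the positive half-line.
\<close>

lemma nn_integral_even:
  fixes f :: "real \<Rightarrow> ennreal"
  assumes [measurable]: "f \<in> borel_measurable borel" and even: "\<And>x. f (- x) = f x"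
  shows "(\<integral>\<^sup>+x. f x \<partial>lborel) = 2 * (\<integral>\<^sup>+x. f x * indicator {0<..} x \<partial>lborel)"
proof -
  have "(\<integral>\<^sup>+x. f x \<partial>lborel) = (\<integral>\<^sup>+x. f x * indicator {0<..} x + f x * indicator {..<0} x \<partial>lborel)"
    by (rule nn_integral_cong_AE, use AE_lborel_singleton[of "0::real"] in eventually_elim)
       (auto simp: indicator_def)
  also have "\<dots> = (\<integral>\<^sup>+x. f x * indicator {0<..} x \<partial>lborel) + (\<integral>\<^sup>+x. f x * indicator {..<0} x \<partial>lborel)"
    by (rule nn_integral_add) measurable
  also have "(\<integral>\<^sup>+x. f x * indicator {..<0} x \<partial>lborel) = (\<integral>\<^sup>+x. f x * indicator {0<..} x \<partial>lborel)"
    by (subst nn_integral_real_affine[where c="-1" and t=0]) (auto simp: even indicator_def intro!: nn_integral_cong)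
  finally show ?thesis by (simp add: mult_2)
qed

lemma nn_integral_cube_cone:
  assumes q: "q > 0"
  shows "(\<integral>\<^sup>+c. ennreal (\<bar>c\<bar> ^ 3) * indicator {c. 0 < c\<^sup>2 * q \<and> c\<^sup>2 * q < 1} c \<partial>lborel) = ennreal (1 / (2 * q\<^sup>2))"
proof -
  define r where "r = 1 / sqrt q"
  have r: "r > 0" "r ^ 2 = 1 / q" "r ^ 4 = 1 / q\<^sup>2"
  proof -
    show "r > 0" and 2: "r ^ 2 = 1 / q" using q by (simp_all add: r_def power_divide)
    have "r ^ 4 = (r ^ 2) ^ 2" by simp
    then show "r ^ 4 = 1 / q\<^sup>2" by (simp only: 2 power_divide) simp
  qed
  have lt: "c\<^sup>2 * q < 1 \<longleftrightarrow> c < r" if "c > 0" for c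
  proof -
    have "c\<^sup>2 * q < 1 \<longleftrightarrow> c\<^sup>2 < r\<^sup>2" using q by (simp add: r field_simps)
    also have "\<dots> \<longleftrightarrow> c < r" using that r(1) by (auto simp: power_strict_mono intro: power2_less_imp_less)
    finally show ?thesis .
  qed
  have "(\<integral>\<^sup>+c. ennreal (\<bar>c\<bar> ^ 3) * indicator {c. 0 < c\<^sup>2 * q \<and> c\<^sup>2 * q < 1} c \<partial>lborel) =
     2 * (\<integral>\<^sup>+c. ennreal (\<bar>c\<bar> ^ 3) * indicator {c. 0 < c\<^sup>2 * q \<and> c\<^sup>2 * q < 1} c * indicator {0<..} c \<partial>lborel)"
    by (rule nn_integral_even) (auto simp: indicator_def)
  also have "(\<integral>\<^sup>+c. ennreal (\<bar>c\<bar> ^ 3) * indicator {c. 0 < c\<^sup>2 * q \<and> c\<^sup>2 * q < 1} c * indicator {0<..} c \<partial>lborel)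
     = (\<integral>\<^sup>+c. ennreal (c ^ 3) * indicator {0..r} c \<partial>lborel)"
    by (rule nn_integral_cong_AE, use AE_lborel_singleton[of "0::real"] AE_lborel_singleton[of r] in eventually_elim)
       (use q in \<open>auto simp: indicator_def lt\<close>)
  also have "\<dots> = ennreal (r ^ 4 / 4 - 0 ^ 4 / 4)"
    using r(1) by (intro nn_integral_FTC_Icc[where F="\<lambda>c. c ^ 4 / 4"]) (auto intro!: derivative_eq_intros)
  also have "2 * \<dots> = ennreal (1 / (2 * q\<^sup>2))"
    by (simp add: r ennreal_mult'[symmetric] flip: ennreal_numeral)
  finally show ?thesis .
qed

lemma nn_integral_inverse_unit_log:
  assumes w: "w \<noteq> 0"
  shows "(\<integral>\<^sup>+x. ennreal (1 / \<bar>x\<bar>) * indicator {x. 0 < x * w \<and> 0 \<le> ln \<bar>x\<bar> \<and> ln \<bar>x\<bar> < 1} x \<partial>lborel) = 1"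
proof -
  have pos: "(\<integral>\<^sup>+x. ennreal (1 / \<bar>x\<bar>) * indicator {x. 0 < x \<and> 0 \<le> ln \<bar>x\<bar> \<and> ln \<bar>x\<bar> < 1} x \<partial>lborel) = 1"
  proof -
    have *: "ln x < 1 \<longleftrightarrow> x < exp 1" if "x > 0" for x :: real
      using that ln_less_cancel_iff[of x "exp 1"] by simp
    have "(\<integral>\<^sup>+x. ennreal (1 / \<bar>x\<bar>) * indicator {x. 0 < x \<and> 0 \<le> ln \<bar>x\<bar> \<and> ln \<bar>x\<bar> < 1} x \<partial>lborel)
       = (\<integral>\<^sup>+x. ennreal (1 / x) * indicator {1..exp 1} x \<partial>lborel)"
      by (rule nn_integral_cong_AE, use AE_lborel_singleton[of "exp 1::real"] in eventually_elim)
         (auto simp: indicator_def *)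
    also have "\<dots> = ennreal (ln (exp 1) - ln 1)"
      by (intro nn_integral_FTC_Icc) (auto intro!: derivative_eq_intros)
    finally show ?thesis by simp
  qed
  show ?thesis
  proof (cases "w > 0")
    case True
    then show ?thesis using pos by (simp add: zero_less_mult_iff)
  next
    case False
    then have "(\<integral>\<^sup>+x. ennreal (1 / \<bar>x\<bar>) * indicator {x. 0 < x * w \<and> 0 \<le> ln \<bar>x\<bar> \<and> ln \<bar>x\<bar> < 1} x \<partial>lborel) =
       (\<integral>\<^sup>+x. ennreal (1 / \<bar>x\<bar>) * indicator {x. 0 < x \<and> 0 \<le> ln \<bar>x\<bar> \<and> ln \<bar>x\<bar> < 1} x \<partial>lborel)"
      using w by (subst nn_integral_real_affine[where c="-1" and t=0])
        (auto simp: indicator_def zero_less_mult_iff mult_less_0_iff intro!: nn_integral_cong)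
    then show ?thesis using pos by simp
  qed
qed

text \<open>
  The mass that the cone \<open>0 < det < 1\<close> and one unit of time contribute to the geodesics with a given
  distance \<open>w\<close> of the endpoints.  The coordinates are \<open>c\<close> and \<open>s = d / c\<close>: the determinant is
  \<open>c\<^sup>2 * s * w\<close>, and \<open>ln \<bar>s\<bar>\<close> is the peak time.
\<close>

lemma flux_density:
  assumes w: "w \<noteq> 0"
  shows "(\<integral>\<^sup>+c. \<integral>\<^sup>+d. ennreal \<bar>c * d\<bar> * indicator {z. 0 < z * w \<and> z * w < 1} (c * d) *
     indicator {s. s \<noteq> 0 \<and> 0 \<le> ln \<bar>s\<bar> \<and> ln \<bar>s\<bar> < 1} (d / c) \<partial>lborel \<partial>lborel) = ennreal (1 / (2 * w\<^sup>2))"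
    (is "(\<integral>\<^sup>+c. \<integral>\<^sup>+d. ?f c d \<partial>lborel \<partial>lborel) = _")
proof -
  define L where "L = {s :: real. 0 < s * w \<and> 0 \<le> ln \<bar>s\<bar> \<and> ln \<bar>s\<bar> < 1}"
  have [measurable]: "L \<in> sets borel" unfolding L_def by measurable
  have "(\<integral>\<^sup>+c. \<integral>\<^sup>+d. ?f c d \<partial>lborel \<partial>lborel) =
     (\<integral>\<^sup>+c. \<integral>\<^sup>+s. ennreal (\<bar>c\<bar> ^ 3) * indicator {c. 0 < c\<^sup>2 * (s * w) \<and> c\<^sup>2 * (s * w) < 1} c *
        (ennreal \<bar>s\<bar> * indicator L s) \<partial>lborel \<partial>lborel)"
  proof (rule nn_integral_cong_AE, use AE_lborel_singleton[of "0::real"] in eventually_elim)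
    case (elim c)
    have "(\<integral>\<^sup>+d. ?f c d \<partial>lborel) = ennreal \<bar>c\<bar> * (\<integral>\<^sup>+s. ?f c (0 + c * s) \<partial>lborel)"
      by (rule nn_integral_real_affine) (use elim in auto)
    also have "\<dots> = (\<integral>\<^sup>+s. ennreal \<bar>c\<bar> * ?f c (0 + c * s) \<partial>lborel)"
      by (rule nn_integral_cmult[symmetric]) measurable
    also have "\<dots> = (\<integral>\<^sup>+s. ennreal (\<bar>c\<bar> ^ 3) * indicator {c. 0 < c\<^sup>2 * (s * w) \<and> c\<^sup>2 * (s * w) < 1} c *
        (ennreal \<bar>s\<bar> * indicator L s) \<partial>lborel)"
    proof (rule nn_integral_cong)
      fix s
      have i1: "c * (c * s) * w = c\<^sup>2 * (s * w)" by (simp add: power2_eq_square)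
      have i2: "s \<noteq> 0 \<and> 0 \<le> ln \<bar>s\<bar> \<and> ln \<bar>s\<bar> < 1 \<longleftrightarrow> s \<in> L" if "0 < c\<^sup>2 * (s * w)"
        using elim that by (auto simp: L_def zero_less_mult_iff)
      have i3: "c * s / c = s" using elim by simp
      have "\<bar>c\<bar> * \<bar>c * (c * s)\<bar> = \<bar>c\<bar> ^ 3 * \<bar>s\<bar>"
        by (simp only: abs_mult power3_eq_cube mult.assoc)
      then have i4: "ennreal \<bar>c\<bar> * ennreal \<bar>c * (c * s)\<bar> = ennreal (\<bar>c\<bar> ^ 3) * ennreal \<bar>s\<bar>"
        by (simp only: ennreal_mult[symmetric] abs_ge_zero zero_le_power)
      show "ennreal \<bar>c\<bar> * ?f c (0 + c * s) = ennreal (\<bar>c\<bar> ^ 3) *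
          indicator {c. 0 < c\<^sup>2 * (s * w) \<and> c\<^sup>2 * (s * w) < 1} c * (ennreal \<bar>s\<bar> * indicator L s)"
      proof (cases "0 < c\<^sup>2 * (s * w) \<and> c\<^sup>2 * (s * w) < 1")
        case True
        then show ?thesis
          unfolding add_0 indicator_def mem_Collect_eq i1 i3 using i2 i4 by simp
      next
        case False
        then have F: "(0 < c\<^sup>2 * (s * w) \<and> c\<^sup>2 * (s * w) < 1) = False" by blast
        show ?thesis unfolding add_0 indicator_def mem_Collect_eq i1 F by simp
      qed
    qed
    finally show ?case .
  qed
  also have "\<dots> = (\<integral>\<^sup>+s. \<integral>\<^sup>+c. ennreal (\<bar>c\<bar> ^ 3) * indicator {c. 0 < c\<^sup>2 * (s * w) \<and> c\<^sup>2 * (s * w) < 1} c *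
        (ennreal \<bar>s\<bar> * indicator L s) \<partial>lborel \<partial>lborel)"
    by (rule lborel_pair.Fubini') measurable
  also have "\<dots> = (\<integral>\<^sup>+s. ennreal (1 / (2 * w\<^sup>2)) * (ennreal (1 / \<bar>s\<bar>) * indicator L s) \<partial>lborel)"
  proof (rule nn_integral_cong)
    fix s
    have "(\<integral>\<^sup>+c. ennreal (\<bar>c\<bar> ^ 3) * indicator {c. 0 < c\<^sup>2 * (s * w) \<and> c\<^sup>2 * (s * w) < 1} c *
        (ennreal \<bar>s\<bar> * indicator L s) \<partial>lborel) = (\<integral>\<^sup>+c. ennreal (\<bar>c\<bar> ^ 3) *
        indicator {c. 0 < c\<^sup>2 * (s * w) \<and> c\<^sup>2 * (s * w) < 1} c \<partial>lborel) * (ennreal \<bar>s\<bar> * indicator L s)"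
      by (rule nn_integral_multc) measurable
    also have "\<dots> = ennreal (1 / (2 * w\<^sup>2)) * (ennreal (1 / \<bar>s\<bar>) * indicator L s)"
    proof (cases "s \<in> L")
      case True
      then have "s * w > 0" "s \<noteq> 0" by (auto simp: L_def)
      have "1 / (2 * (s * w)\<^sup>2) * \<bar>s\<bar> = 1 / (2 * w\<^sup>2) * (1 / \<bar>s\<bar>)"
        using \<open>s \<noteq> 0\<close> w by (simp add: field_simps power2_eq_square abs_mult_self_eq)
      then show ?thesis
        using True nn_integral_cube_cone[OF \<open>s * w > 0\<close>]
        by (simp add: ennreal_mult'[symmetric])
    qed simp
    finally show "(\<integral>\<^sup>+c. ennreal (\<bar>c\<bar> ^ 3) * indicator {c. 0 < c\<^sup>2 * (s * w) \<and> c\<^sup>2 * (s * w) < 1} c *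
        (ennreal \<bar>s\<bar> * indicator L s) \<partial>lborel) = ennreal (1 / (2 * w\<^sup>2)) * (ennreal (1 / \<bar>s\<bar>) * indicator L s)" .
  qed
  also have "\<dots> = ennreal (1 / (2 * w\<^sup>2)) * (\<integral>\<^sup>+s. ennreal (1 / \<bar>s\<bar>) * indicator L s \<partial>lborel)"
    by (rule nn_integral_cmult) measurable
  also have "\<dots> = ennreal (1 / (2 * w\<^sup>2))"
    unfolding L_def nn_integral_inverse_unit_log[OF w] by simp
  finally show ?thesis .
qed


definition crossing :: "(real \<times> real) set \<Rightarrow> real set \<Rightarrow> (real^2^2) set" where
  "crossing R J = {M \<in> window R. peak M \<in> J}"

lemma crossing_borel [measurable]:
  assumes [measurable]: "R \<in> sets (borel \<Otimes>\<^sub>M borel)" "J \<in> sets borel"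
  shows "crossing R J \<in> sets borel"
  unfolding crossing_def by measurable

text \<open>
  Substitute \<open>a = c * x\<close> and \<open>b = d * y\<close>, where \<open>x\<close> and \<open>y\<close> are the endpoints, and integrate the lower row
  first.  The factor \<open>2\<close> cancels the one in the integral of \<open>\<bar>c\<bar> ^ 3\<close> over the cone.
\<close>

lemma emeasure_crossing:
  assumes R [measurable]: "R \<in> sets (borel \<Otimes>\<^sub>M borel)" and off: "\<And>x. (x, x) \<notin> R"
  shows "2 * emeasure lborel (unit_cone \<inter> crossing R {0..<1}) = flux R"
proof -
  let ?g = "\<lambda>w c d. ennreal \<bar>c * d\<bar> * indicator {z. 0 < z * w \<and> z * w < 1} (c * d) *
     indicator {s. s \<noteq> 0 \<and> 0 \<le> ln \<bar>s\<bar> \<and> ln \<bar>s\<bar> < 1} (d / c)"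
  define E where "E = unit_cone \<inter> crossing R {0..<1}"
  have [measurable]: "E \<in> sets borel" unfolding E_def by measurable
  have inner: "(\<integral>\<^sup>+a. \<integral>\<^sup>+b. indicator E (mat2 a b c d) \<partial>lborel \<partial>lborel) =
      (\<integral>\<^sup>+x. \<integral>\<^sup>+y. indicator R (x, y) * ?g (x - y) c d \<partial>lborel \<partial>lborel)" for c d
  proof (cases "c = 0 \<or> d = 0")
    case True
    then show ?thesis by (auto simp: E_def crossing_def window_def)
  next
    case False
    \<comment> \<open>The zeros are the off-diagonal entries of the substitution \<open>(a, b) = (c * x, d * y)\<close>.\<close>
    have "(\<integral>\<^sup>+a. \<integral>\<^sup>+b. indicator E (mat2 a b c d) \<partial>lborel \<partial>lborel) =
      ennreal \<bar>c * d - 0 * 0\<bar> * (\<integral>\<^sup>+x. \<integral>\<^sup>+y. indicator E (mat2 (c * x + 0 * y) (0 * x + d * y) c d) \<partial>lborel \<partial>lborel)"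
      by (rule nn_integral_linear2[of "\<lambda>a b. indicator E (mat2 a b c d)", symmetric])
         (use False in \<open>auto\<close>)
    also have "\<dots> = (\<integral>\<^sup>+x. ennreal \<bar>c * d - 0 * 0\<bar> * (\<integral>\<^sup>+y. indicator E (mat2 (c * x + 0 * y) (0 * x + d * y) c d) \<partial>lborel) \<partial>lborel)"
      by (rule nn_integral_cmult[symmetric]) measurable
    also have "\<dots> = (\<integral>\<^sup>+x. \<integral>\<^sup>+y. ennreal \<bar>c * d - 0 * 0\<bar> * indicator E (mat2 (c * x + 0 * y) (0 * x + d * y) c d) \<partial>lborel \<partial>lborel)"
      by (intro nn_integral_cong nn_integral_cmult[symmetric]) measurable
    also have "\<dots> = (\<integral>\<^sup>+x. \<integral>\<^sup>+y. indicator R (x, y) * ?g (x - y) c d \<partial>lborel \<partial>lborel)"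
    proof (intro nn_integral_cong)
      fix x y :: real
      have "c * x * d - d * y * c = c * d * (x - y)" by (simp add: algebra_simps)
      then have "mat2 (c * x) (d * y) c d \<in> E \<longleftrightarrow> (x, y) \<in> R \<and>
         c * d \<in> {z. 0 < z * (x - y) \<and> z * (x - y) < 1} \<and> d / c \<in> {s. s \<noteq> 0 \<and> 0 \<le> ln \<bar>s\<bar> \<and> ln \<bar>s\<bar> < 1}"
        using False by (auto simp: E_def unit_cone_def crossing_def window_def peak_def)
      then show "ennreal \<bar>c * d - 0 * 0\<bar> * indicator E (mat2 (c * x + 0 * y) (0 * x + d * y) c d) =
          indicator R (x, y) * ?g (x - y) c d"
        by (simp add: indicator_def)
    qed
    finally show ?thesis .
  qed
  have "emeasure lborel E = (\<integral>\<^sup>+M. indicator E M \<partial>lborel)" by simp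
  also have "\<dots> = (\<integral>\<^sup>+c. \<integral>\<^sup>+d. \<integral>\<^sup>+x. \<integral>\<^sup>+y. indicator R (x, y) * ?g (x - y) c d \<partial>lborel \<partial>lborel \<partial>lborel \<partial>lborel)"
    unfolding inner[symmetric] by (rule nn_integral_matrix2) measurable
  also have "\<dots> = (\<integral>\<^sup>+c. \<integral>\<^sup>+x. \<integral>\<^sup>+d. \<integral>\<^sup>+y. indicator R (x, y) * ?g (x - y) c d \<partial>lborel \<partial>lborel \<partial>lborel \<partial>lborel)"
    by (intro nn_integral_cong lborel_pair.Fubini') measurable
  also have "\<dots> = (\<integral>\<^sup>+c. \<integral>\<^sup>+x. \<integral>\<^sup>+y. \<integral>\<^sup>+d. indicator R (x, y) * ?g (x - y) c d \<partial>lborel \<partial>lborel \<partial>lborel \<partial>lborel)"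
    by (intro nn_integral_cong lborel_pair.Fubini') measurable
  also have "\<dots> = (\<integral>\<^sup>+x. \<integral>\<^sup>+c. \<integral>\<^sup>+y. \<integral>\<^sup>+d. indicator R (x, y) * ?g (x - y) c d \<partial>lborel \<partial>lborel \<partial>lborel \<partial>lborel)"
    by (intro lborel_pair.Fubini') measurable
  also have "\<dots> = (\<integral>\<^sup>+x. \<integral>\<^sup>+y. \<integral>\<^sup>+c. \<integral>\<^sup>+d. indicator R (x, y) * ?g (x - y) c d \<partial>lborel \<partial>lborel \<partial>lborel \<partial>lborel)"
    by (intro nn_integral_cong lborel_pair.Fubini') measurable
  also have "\<dots> = (\<integral>\<^sup>+x. \<integral>\<^sup>+y. indicator R (x, y) * ennreal (1 / (2 * (x - y)\<^sup>2)) \<partial>lborel \<partial>lborel)"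
  proof (intro nn_integral_cong)
    fix x y :: real
    show "(\<integral>\<^sup>+c. \<integral>\<^sup>+d. indicator R (x, y) * ?g (x - y) c d \<partial>lborel \<partial>lborel) =
        indicator R (x, y) * ennreal (1 / (2 * (x - y)\<^sup>2))"
    proof (cases "(x, y) \<in> R")
      case True
      then have "x - y \<noteq> 0" using off by auto
      from flux_density[OF this] True show ?thesis by simp
    qed simp
  qed
  finally have "2 * emeasure lborel E =
      2 * (\<integral>\<^sup>+x. \<integral>\<^sup>+y. indicator R (x, y) * ennreal (1 / (2 * (x - y)\<^sup>2)) \<partial>lborel \<partial>lborel)" by simp
  also have "\<dots> = (\<integral>\<^sup>+x. 2 * (\<integral>\<^sup>+y. indicator R (x, y) * ennreal (1 / (2 * (x - y)\<^sup>2)) \<partial>lborel) \<partial>lborel)"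
    by (rule nn_integral_cmult[symmetric]) measurable
  also have "\<dots> = (\<integral>\<^sup>+x. \<integral>\<^sup>+y. 2 * (indicator R (x, y) * ennreal (1 / (2 * (x - y)\<^sup>2))) \<partial>lborel \<partial>lborel)"
    by (intro nn_integral_cong nn_integral_cmult[symmetric]) measurable
  also have "\<dots> = flux R"
    unfolding flux_def
    by (intro nn_integral_cong) (simp add: indicator_def ennreal_mult'[symmetric] flip: ennreal_numeral)
  finally show ?thesis unfolding E_def .
qed

context covolume_domain
begin

text \<open>
  Counted in \<^typ>\<open>ennreal\<close>, as finiteness is only known almost everywhere.  Each lift \<open>A ** M\<close> counts
  together with its negative.
\<close>

definition crossings :: "(real \<times> real) set \<Rightarrow> real set \<Rightarrow> real^2^2 \<Rightarrow> ennreal" where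
  "crossings R J M = (\<integral>\<^sup>+A. indicator (crossing R J) (A ** M) \<partial>count_space S)"

lemma crossings_borel [measurable]:
  assumes [measurable]: "R \<in> sets (borel \<Otimes>\<^sub>M borel)" "J \<in> sets borel"
  shows "crossings R J \<in> borel_measurable borel"
  unfolding crossings_def[abs_def] by measurable

lemma crossings_S:
  assumes "B \<in> S" shows "crossings R J (B ** M) = crossings R J M"
proof -
  have "bij_betw (\<lambda>A. A ** B) S S"
    by (rule bij_betwI[of _ _ _ "\<lambda>A. A ** adj2 B"])
       (use assms in \<open>auto simp: mult_S inv_S matrix_mul_assoc[symmetric] adj2_mult det_S\<close>)
  from nn_integral_bij_count_space[OF this, of "\<lambda>A. indicator (crossing R J) (A ** M)"]
  show ?thesis by (simp add: crossings_def matrix_mul_assoc)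
qed

lemma crossings_scale: "r > 0 \<Longrightarrow> crossings R J (r *\<^sub>R M) = crossings R J M"
  by (simp add: crossings_def scaleR_matrix_mult crossing_def indicator_def window_scale peak_scale)

lemma crossings_N:
  assumes "R \<in> sets (borel \<Otimes>\<^sub>M borel)" "J \<in> sets borel"
  shows "crossings R J \<in> borel_measurable N"
  using assms by (intro measurable_N crossings_borel) (auto simp: crossings_S crossings_scale)

text \<open>
  The sum over the group unfolds to the measure of a part of the cone.
\<close>

lemma nn_integral_crossings:
  assumes R [measurable]: "R \<in> sets (borel \<Otimes>\<^sub>M borel)" and off: "\<And>x. (x, x) \<notin> R"
  shows "(\<integral>\<^sup>+M. crossings R {0..<1} M \<partial>N) = flux R"
proof -
  have "(\<integral>\<^sup>+M. crossings R {0..<1} M \<partial>N) = (\<integral>\<^sup>+M. indicator D M * crossings R {0..<1} M \<partial>lborel)"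
    by (intro nn_integral_N crossings_N) measurable
  also have "\<dots> = (\<integral>\<^sup>+M. indicator D M *
      (\<integral>\<^sup>+A. indicator (unit_cone \<inter> crossing R {0..<1}) (A ** M) \<partial>count_space S) \<partial>lborel)"
  proof (rule nn_integral_cong)
    fix M
    have "(\<integral>\<^sup>+A. indicator (unit_cone \<inter> crossing R {0..<1}) (A ** M) \<partial>count_space S) = crossings R {0..<1} M"
      if "M \<in> D"
      unfolding crossings_def using that D_sub
      by (intro nn_integral_cong) (auto simp: indicator_def unit_cone_def det_mul det_S)
    then show "indicator D M * crossings R {0..<1} M = indicator D M *
      (\<integral>\<^sup>+A. indicator (unit_cone \<inter> crossing R {0..<1}) (A ** M) \<partial>count_space S)"
      by (auto simp: indicator_def)
  qed
  also have "\<dots> = 2 * (\<integral>\<^sup>+M. indicator (unit_cone \<inter> crossing R {0..<1}) M \<partial>lborel)"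
    by (rule unfolding_formula) (auto intro!: borel_measurable_indicator sets.Int unit_cone_borel crossing_borel)
  also have "\<dots> = flux R" using emeasure_crossing[OF assms] by simp
  finally show ?thesis .
qed

lemma geo_funpow: "((\<lambda>M. M ** geo 1) ^^ n) M = M ** geo (real n)"
proof (induction n)
  case 0
  then show ?case by (simp add: geo_def mat_1_mat2[symmetric])
next
  case (Suc n)
  have "geo (real n) ** geo 1 = geo (real (Suc n))"
    by (simp add: geo_def matrix2_eq_iff flip: exp_add)
  then show ?case using Suc by (simp add: matrix_mul_assoc[symmetric])
qed

text \<open>
  The count over \<open>n\<close> units of time is a Birkhoff sum of the count over one unit, because the flow preserves
  endpoints and shifts peaks.
\<close>

lemma crossings_sum:
  assumes [measurable]: "R \<in> sets (borel \<Otimes>\<^sub>M borel)"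
  shows "(\<Sum>i<n. crossings R {0..<1} (((\<lambda>M. M ** geo 1) ^^ i) M)) = crossings R {0..<real n} M"
proof -
  have "(\<Sum>i<n. indicator (crossing R {0..<1}) (A ** (M ** geo (real i)))) =
     (indicator (crossing R {0..<real n}) (A ** M) :: ennreal)" for A
  proof (induction n)
    case 0
    then show ?case by (simp add: crossing_def)
  next
    case (Suc n)
    then show ?case
      by (auto simp: matrix_mul_assoc indicator_def crossing_def window_geo peak_geo)
  qed
  then show ?thesis
    unfolding crossings_def geo_funpow
    by (subst nn_integral_sum[symmetric]) simp_all
qed

text \<open>
  Birkhoff's theorem for the number of crossings in one unit of time, whose mean is the flux.
\<close>

theorem crossings_asymptotics:
  assumes R [measurable]: "R \<in> sets (borel \<Otimes>\<^sub>M borel)" and off: "\<And>x. (x, x) \<notin> R"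
    and fin: "flux R < \<infinity>" and pos: "measure lborel D > 0"
  shows "AE M in N. (\<forall>n. crossings R {0..<real n} M < \<infinity>) \<and>
    (\<lambda>n. enn2real (crossings R {0..<real n} M) / real n) \<longlonglongrightarrow> enn2real (flux R) / measure lborel D"
proof -
  let ?c = "crossings R {0..<1}" and ?T = "\<lambda>M :: real^2^2. M ** geo 1"
  have cN [measurable]: "?c \<in> borel_measurable N" by (rule crossings_N) measurable
  have int: "(\<integral>\<^sup>+M. ?c M \<partial>N) = flux R" by (rule nn_integral_crossings[OF R off])
  have ae: "AE M in N. ?c M \<noteq> \<infinity>"
    using fin by (intro nn_integral_PInf_AE) (auto simp: int)
  have int': "(\<integral>\<^sup>+M. ennreal (enn2real (?c M)) \<partial>N) = flux R"
    unfolding int[symmetric]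
    by (rule nn_integral_cong_AE, use ae in eventually_elim) (auto simp: less_top)
  have integrable: "integrable N (\<lambda>M. enn2real (?c M))"
    by (rule integrableI_nonneg) (use fin int' in auto)
  have "integral\<^sup>L N (\<lambda>M. enn2real (?c M)) = enn2real (flux R)"
    by (subst integral_eq_nn_integral) (auto simp: int')
  then have lim: "AE M in N. (\<lambda>n. (\<Sum>i<n. enn2real (?c ((?T ^^ i) M))) / real n) \<longlonglongrightarrow>
      enn2real (flux R) / measure lborel D"
    using geodesic.birkhoff[OF integrable] pos by (simp add: measure_N)
  have fin_all: "AE M in N. \<forall>i. ?c ((?T ^^ i) M) \<noteq> \<infinity>"
    unfolding AE_all_countable by (intro allI geodesic.AE_funpow[OF ae])
  from lim fin_all show ?thesis
  proof eventually_elim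
    case (elim M)
    have "crossings R {0..<real n} M < \<infinity>" for n
      unfolding crossings_sum[OF R, symmetric] using elim(2) by (auto simp: less_top[symmetric])
    moreover have "(\<Sum>i<n. enn2real (?c ((?T ^^ i) M))) = enn2real (crossings R {0..<real n} M)" for n
      unfolding crossings_sum[OF R, symmetric] using elim(2)
      by (subst enn2real_sum) (auto simp: less_top[symmetric])
    ultimately show ?case using elim(1) by simp
  qed
qed

end


section \<open>The flux of deep geodesics\<close>

text \<open>
  A geodesic reaches the height \<open>\<bar>x - y\<bar> / 2\<close>, half the distance of its endpoints, so these are the
  endpoints of the geodesics that rise above height \<open>1 / k\<close>.
\<close>

definition deep_pairs :: "real \<Rightarrow> (real \<times> real) set" where
  "deep_pairs k = {(x, y). \<bar>x - y\<bar> > 2 / k}"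

lemma nn_integral_tail:
  assumes "x < (l::real)"
  shows "(\<integral>\<^sup>+y. indicator {y. l < y} y * ennreal (1 / (x - y)\<^sup>2) \<partial>lborel) = ennreal (1 / (l - x))"
proof -
  have "(\<integral>\<^sup>+y. indicator {y. l < y} y * ennreal (1 / (x - y)\<^sup>2) \<partial>lborel) =
     (\<integral>\<^sup>+y. ennreal (1 / (x - y)\<^sup>2) * indicator {l..} y \<partial>lborel)"
    by (rule nn_integral_cong_AE, use AE_lborel_singleton[of l] in eventually_elim)
       (auto simp: indicator_def)
  also have "\<dots> = ennreal (0 - (- 1 / (l - x)))"
  proof (rule nn_integral_FTC_atLeast[where F="\<lambda>y. - 1 / (y - x)"])
    show "((\<lambda>y. - 1 / (y - x)) has_real_derivative 1 / (x - y)\<^sup>2) (at y)" if "l \<le> y" for y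
      using that assms by (auto intro!: derivative_eq_intros simp: power2_eq_square divide_simps) (auto simp: algebra_simps)
    show "((\<lambda>y. - 1 / (y - x)) \<longlongrightarrow> 0) at_top" by real_asymp
  qed auto
  finally show ?thesis by simp
qed

text \<open>
  Both \<open>region_J\<close> and \<open>region_I\<close> are symmetric under \<open>(x, y) \<mapsto> (- x, - y)\<close> and given by a lower bound \<open>g\<close> for
  the second coordinate in the half with \<open>x < 0\<close>, where the inner integral is elementary.
\<close>

lemma flux_symmetric:
  fixes g :: "real \<Rightarrow> real"
  assumes [measurable]: "g \<in> borel_measurable borel" and g: "\<And>x. - 1 < x \<Longrightarrow> x < 0 \<Longrightarrow> x < g x"
  shows "flux ({(x, y). - 1 < x \<and> x < 0 \<and> g x < y} \<union> {(x, y). 0 < x \<and> x < 1 \<and> y < - g (- x)}) =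
    2 * (\<integral>\<^sup>+x. ennreal (1 / (g (- x) + x)) * indicator {0<..<1} x \<partial>lborel)"
proof -
  let ?R = "{(x, y). - 1 < x \<and> x < 0 \<and> g x < y} \<union> {(x, y). 0 < x \<and> x < 1 \<and> y < - g (- x)}"
  let ?h = "\<lambda>x. ennreal (1 / (g (- \<bar>x\<bar>) + \<bar>x\<bar>)) * indicator {x. 0 < \<bar>x\<bar> \<and> \<bar>x\<bar> < 1} x"
  have "flux ?R = (\<integral>\<^sup>+x. ?h x \<partial>lborel)"
    unfolding flux_def
  proof (rule nn_integral_cong)
    fix x :: real
    consider "- 1 < x \<and> x < 0" | "0 < x \<and> x < 1" | "\<not> (0 < \<bar>x\<bar> \<and> \<bar>x\<bar> < 1)" by linarith
    then show "(\<integral>\<^sup>+y. indicator ?R (x, y) * ennreal (1 / (x - y)\<^sup>2) \<partial>lborel) = ?h x"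
    proof cases
      case 1
      then have "(\<integral>\<^sup>+y. indicator ?R (x, y) * ennreal (1 / (x - y)\<^sup>2) \<partial>lborel) =
        (\<integral>\<^sup>+y. indicator {y. g x < y} y * ennreal (1 / (x - y)\<^sup>2) \<partial>lborel)"
        by (intro nn_integral_cong) (auto simp: indicator_def)
      then show ?thesis using 1 nn_integral_tail[of x "g x"] g[of x] by (auto simp: indicator_def)
    next
      case 2
      have "(\<integral>\<^sup>+y. indicator ?R (x, y) * ennreal (1 / (x - y)\<^sup>2) \<partial>lborel) =
        (\<integral>\<^sup>+y. indicator {y. g (- x) < y} y * ennreal (1 / (- x - y)\<^sup>2) \<partial>lborel)"
        using 2 by (subst nn_integral_real_affine[where c="-1" and t=0])
          (auto simp: indicator_def power2_eq_square algebra_simps intro!: nn_integral_cong)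
      then show ?thesis using 2 nn_integral_tail[of "- x" "g (- x)"] g[of "- x"] by (auto simp: indicator_def)
    next
      case 3
      then have "(\<integral>\<^sup>+y. indicator ?R (x, y) * ennreal (1 / (x - y)\<^sup>2) \<partial>lborel) = (\<integral>\<^sup>+(y::real). 0 \<partial>lborel)"
        by (intro nn_integral_cong) (auto simp: indicator_def)
      then show ?thesis using 3 by (auto simp: indicator_def)
    qed
  qed
  also have "\<dots> = 2 * (\<integral>\<^sup>+x. ?h x * indicator {0<..} x \<partial>lborel)"
    by (rule nn_integral_even) (auto simp: indicator_def)
  also have "(\<integral>\<^sup>+x. ?h x * indicator {0<..} x \<partial>lborel) = (\<integral>\<^sup>+x. ennreal (1 / (g (- x) + x)) * indicator {0<..<1} x \<partial>lborel)"
    by (intro nn_integral_cong) (auto simp: indicator_def)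
  finally show ?thesis .
qed

text \<open>
  The bound is \<open>g x = x + 2 / k\<close>, so the inner integral is the constant \<open>k / 2\<close>.
\<close>

lemma flux_J:
  assumes k: "0 < k" "k \<le> 2"
  shows "flux (region_J \<inter> deep_pairs k) = ennreal k"
proof -
  have k1: "2 / k \<ge> 1" using k by simp
  have "region_J \<inter> deep_pairs k = {(x, y). - 1 < x \<and> x < 0 \<and> x + 2 / k < y} \<union>
      {(x, y). 0 < x \<and> x < 1 \<and> y < - (- x + 2 / k)}"
    using k1 by (auto simp: region_J_def deep_pairs_def)
  then have "flux (region_J \<inter> deep_pairs k) = 2 * (\<integral>\<^sup>+x. ennreal (1 / ((- x + 2 / k) + x)) * indicator {0<..<1} x \<partial>lborel)"
    using k by (simp only:) (rule flux_symmetric, auto)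
  also have "\<dots> = 2 * (\<integral>\<^sup>+x. ennreal (k / 2) * indicator {0<..<1::real} x \<partial>lborel)"
    by simp
  also have "\<dots> = ennreal k"
    using k by (subst nn_integral_cmult_indicator) (auto simp: ennreal_mult'[symmetric] simp flip: ennreal_numeral)
  finally show ?thesis .
qed

text \<open>
  The bound is \<open>g x = max 1 (x + 2 / k)\<close>.  The maximum is the second term throughout if \<open>k \<le> 1\<close>; otherwise
  the two terms change places where \<open>- x\<close> equals \<open>2 / k - 1\<close>, and the logarithm in \<open>calA\<close> comes from the
  first one.
\<close>

lemma flux_I:
  assumes k: "0 < k" "k \<le> 2"
  shows "flux (region_I \<inter> deep_pairs k) = ennreal (calA k)"
proof -
  have k1: "2 / k \<ge> 1" using k by simp
  have "region_I \<inter> deep_pairs k = {(x, y). - 1 < x \<and> x < 0 \<and> max 1 (x + 2 / k) < y} \<union>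
      {(x, y). 0 < x \<and> x < 1 \<and> y < - (max 1 (- x + 2 / k))}"
    using k1 by (auto simp: region_I_def deep_pairs_def)
  then have eq: "flux (region_I \<inter> deep_pairs k) = 2 * (\<integral>\<^sup>+x. ennreal (1 / (max 1 (- x + 2 / k) + x)) * indicator {0<..<1} x \<partial>lborel)"
    using k by (simp only:) (rule flux_symmetric[where g="\<lambda>x. max 1 (x + 2 / k)"], auto)
  show ?thesis
  proof (cases "k \<le> 1")
    case True
    have "(\<integral>\<^sup>+x. ennreal (1 / (max 1 (- x + 2 / k) + x)) * indicator {0<..<1} x \<partial>lborel) =
        (\<integral>\<^sup>+x. ennreal (k / 2) * indicator {0<..<1::real} x \<partial>lborel)"
    proof (intro nn_integral_cong)
      fix x :: real
      have "2 / k \<ge> 2" using k True by (simp add: field_simps)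
      then show "ennreal (1 / (max 1 (- x + 2 / k) + x)) * indicator {0<..<1} x = ennreal (k / 2) * indicator {0<..<1::real} x"
        by (auto simp: indicator_def max_def)
    qed
    also have "2 * \<dots> = ennreal k"
      using k by (subst nn_integral_cmult_indicator) (auto simp: ennreal_mult'[symmetric] simp flip: ennreal_numeral)
    finally show ?thesis using eq True by (simp add: calA_def)
  next
    case False
    define z where "z = 2 / k - 1"
    have z: "0 \<le> z" "z < 1" using k False by (auto simp: z_def field_simps)
    have "(\<integral>\<^sup>+x. ennreal (1 / (max 1 (- x + 2 / k) + x)) * indicator {0<..<1} x \<partial>lborel) =
        (\<integral>\<^sup>+x. ennreal (k / 2) * indicator {0<..<z} x + ennreal (1 / (1 + x)) * indicator {z..1} x \<partial>lborel)"
    proof (rule nn_integral_cong_AE, use AE_lborel_singleton[of "0::real"] AE_lborel_singleton[of "1::real"] in eventually_elim)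
      case (elim x)
      have "max 1 (- x + 2 / k) + x = (if x < z then 2 / k else 1 + x)" by (auto simp: z_def max_def)
      then show ?case using z elim by (auto simp: indicator_def)
    qed
    also have "\<dots> = (\<integral>\<^sup>+x. ennreal (k / 2) * indicator {0<..<z} x \<partial>lborel) +
        (\<integral>\<^sup>+x. ennreal (1 / (1 + x)) * indicator {z..1} x \<partial>lborel)"
      by (rule nn_integral_add) auto
    also have "(\<integral>\<^sup>+x. ennreal (k / 2) * indicator {0<..<z} x \<partial>lborel) = ennreal (k / 2 * z)"
      using k z by (subst nn_integral_cmult_indicator) (auto simp: ennreal_mult'[symmetric])
    also have "(\<integral>\<^sup>+x. ennreal (1 / (1 + x)) * indicator {z..1} x \<partial>lborel) = ennreal (ln (1 + 1) - ln (1 + z))"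
      using z by (intro nn_integral_FTC_Icc) (auto intro!: derivative_eq_intros)
    also have "ln (1 + 1) - ln (1 + z) = ln k"
      using k by (simp add: z_def ln_div)
    also have "ennreal (k / 2 * z) + ennreal (ln k) = ennreal (k / 2 * z + ln k)"
      using k z False by (intro ennreal_plus[symmetric]) auto
    also have "k / 2 * z + ln k = (2 - k + 2 * ln k) / 2"
      using k by (simp add: z_def field_simps)
    finally have *: "(\<integral>\<^sup>+x. ennreal (1 / (max 1 (- x + 2 / k) + x)) * indicator {0<..<1} x \<partial>lborel) =
        ennreal ((2 - k + 2 * ln k) / 2)" .
    have "2 * ennreal (e / 2) = ennreal e" for e
      using ennreal_mult'[of 2 "e / 2"] by simp
    then show ?thesis unfolding eq * using False by (simp add: calA_def)
  qed
qed


section \<open>Iwasawa coordinates and hyperbolic area\<close>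

lemma borel_measurable_Complex [measurable (raw)]:
  assumes [measurable]: "f \<in> borel_measurable M" "g \<in> borel_measurable M"
  shows "(\<lambda>x. Complex (f x) (g x)) \<in> borel_measurable M"
  by (subst borel_measurable_euclidean_space) (auto simp: Basis_complex_def inner_complex_def)

lemma lborel_complex:
  "(lborel :: complex measure) = distr (lborel :: (real \<times> real) measure) borel (\<lambda>(x, y). Complex x y)"
proof (rule lborel_eqI)
  fix l u :: complex assume le: "\<And>b. b \<in> Basis \<Longrightarrow> l \<bullet> b \<le> u \<bullet> b"
  have le': "Re l \<le> Re u" "Im l \<le> Im u"
    using le[of 1] le[of \<i>] by (auto simp: Basis_complex_def inner_complex_def)
  have m: "(\<lambda>(x, y). Complex x y) \<in> borel_measurable (borel :: (real \<times> real) measure)"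
    unfolding borel_prod[symmetric] by measurable
  have "(\<lambda>(x, y). Complex x y) -` box l u = {Re l <..< Re u} \<times> {Im l <..< Im u}"
    by (auto simp: in_box_complex_iff)
  then have "emeasure (distr lborel borel (\<lambda>(x, y). Complex x y)) (box l u) =
     ennreal (Re u - Re l) * ennreal (Im u - Im l)"
    using le' m by (subst emeasure_distr) (simp_all add: emeasure_lborel_Times)
  also have "\<dots> = (\<Prod>b\<in>Basis. (u - l) \<bullet> b)"
    using le' by (simp add: Basis_complex_def inner_complex_def ennreal_mult'[symmetric])
  finally show "emeasure (distr lborel borel (\<lambda>(x, y). Complex x y)) (box l u) = (\<Prod>b\<in>Basis. (u - l) \<bullet> b)" .
qed simp

lemma nn_integral_complex:
  assumes f [measurable]: "f \<in> borel_measurable borel"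
  shows "(\<integral>\<^sup>+z. f z \<partial>lborel) = (\<integral>\<^sup>+x. \<integral>\<^sup>+y. f (Complex x y) \<partial>lborel \<partial>lborel)"
proof -
  have m: "(\<lambda>(x, y). Complex x y) \<in> borel_measurable (borel :: (real \<times> real) measure)"
    unfolding borel_prod[symmetric] by measurable
  have "(\<integral>\<^sup>+z. f z \<partial>lborel) = (\<integral>\<^sup>+p. f (case p of (x, y) \<Rightarrow> Complex x y) \<partial>lborel)"
    unfolding lborel_complex using m by (subst nn_integral_distr) simp_all
  also have "\<dots> = (\<integral>\<^sup>+x. \<integral>\<^sup>+y. f (Complex x y) \<partial>lborel \<partial>lborel)"
    by (subst nn_integral_lborel_fst) (use measurable_compose[OF m f] in simp_all)
  finally show ?thesis .
qed

text \<open>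
  The base point of the tangent vector that \<open>M\<close> represents.
\<close>

definition base :: "real^2^2 \<Rightarrow> complex" where "base M = moebius M \<i>"

lemma base_eq: "base M = Complex ((M $ 1 $ 1 * M $ 2 $ 1 + M $ 1 $ 2 * M $ 2 $ 2) / ((M $ 2 $ 1)\<^sup>2 + (M $ 2 $ 2)\<^sup>2))
   (det M / ((M $ 2 $ 1)\<^sup>2 + (M $ 2 $ 2)\<^sup>2))"
  by (simp add: base_def moebius_def complex_eq_iff Re_divide Im_divide det_2 algebra_simps)

lemma base_borel [measurable]: "base \<in> borel_measurable borel"
  unfolding base_eq[abs_def] by measurable

lemma base_scale: "r \<noteq> 0 \<Longrightarrow> base (r *\<^sub>R M) = base M"
proof -
  assume r: "r \<noteq> 0"
  have "r\<^sup>2 * x / (r\<^sup>2 * y) = x / y" for x y :: real using r by simp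
  then show ?thesis
    unfolding base_eq det_scaleR2 by (simp add: power_mult_distrib distrib_left[symmetric] power2_eq_square mult.assoc mult.left_commute)
qed

text \<open>
  The matrix with lower row \<open>(m, 1)\<close> that moves \<open>\<i>\<close> to the point \<open>x + y * \<i>\<close>.
\<close>

definition frame :: "real \<Rightarrow> real \<Rightarrow> real \<Rightarrow> real^2^2" where
  "frame x y m = mat2 (x * m + y) (x - y * m) m 1"

lemma det_frame: "det (frame x y m) = y * (1 + m\<^sup>2)"
  by (simp add: frame_def power2_eq_square algebra_simps)

lemma base_frame: "base (frame x y m) = Complex x y"
proof -
  have "1 + m\<^sup>2 \<noteq> 0" by (simp add: add_nonneg_eq_0_iff)
  then show ?thesis
    unfolding base_eq det_frame by (simp add: frame_def) (simp add: field_simps power2_eq_square)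
qed

lemma frame_borel [measurable (raw)]:
  assumes [measurable]: "f \<in> borel_measurable M" "g \<in> borel_measurable M" "h \<in> borel_measurable M"
  shows "(\<lambda>x. frame (f x) (g x) (h x)) \<in> borel_measurable M"
  unfolding frame_def by measurable

text \<open>
  Fix the lower row \<open>d * (m, 1)\<close>.  The upper row is then a linear function of the base point, with
  determinant of absolute value \<open>d\<^sup>2 * (1 + m\<^sup>2)\<close>, and one more factor \<open>\<bar>d\<bar>\<close> comes from the substitution
  \<open>c = d * m\<close>.
\<close>

lemma nn_integral_iwasawa:
  assumes [measurable]: "F \<in> borel_measurable borel"
  shows "(\<integral>\<^sup>+M. F M \<partial>lborel) = (\<integral>\<^sup>+d. \<integral>\<^sup>+m. ennreal (\<bar>d\<bar> ^ 3 * (1 + m\<^sup>2)) *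
    (\<integral>\<^sup>+z. F (d *\<^sub>R frame (Re z) (Im z) m) \<partial>lborel) \<partial>lborel \<partial>lborel)"
proof -
  define G where "G c d = (\<integral>\<^sup>+a. \<integral>\<^sup>+b. F (mat2 a b c d) \<partial>lborel \<partial>lborel)" for c d
  have [measurable]: "case_prod G \<in> borel_measurable (borel \<Otimes>\<^sub>M borel)" unfolding G_def by measurable
  have "(\<integral>\<^sup>+M. F M \<partial>lborel) = (\<integral>\<^sup>+c. \<integral>\<^sup>+d. G c d \<partial>lborel \<partial>lborel)"
    unfolding G_def by (rule nn_integral_matrix2) measurable
  also have "\<dots> = (\<integral>\<^sup>+d. \<integral>\<^sup>+c. G c d \<partial>lborel \<partial>lborel)"
    by (rule lborel_pair.Fubini') measurable
  also have "\<dots> = (\<integral>\<^sup>+d. \<integral>\<^sup>+m. ennreal (\<bar>d\<bar> ^ 3 * (1 + m\<^sup>2)) *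
    (\<integral>\<^sup>+z. F (d *\<^sub>R frame (Re z) (Im z) m) \<partial>lborel) \<partial>lborel \<partial>lborel)"
  proof (rule nn_integral_cong_AE, use AE_lborel_singleton[of "0::real"] in eventually_elim)
    case (elim d)
    have "(\<integral>\<^sup>+c. G c d \<partial>lborel) = ennreal \<bar>d\<bar> * (\<integral>\<^sup>+m. G (0 + d * m) d \<partial>lborel)"
      by (rule nn_integral_real_affine) (use elim in auto)
    also have "\<dots> = (\<integral>\<^sup>+m. ennreal \<bar>d\<bar> * G (d * m) d \<partial>lborel)"
      by (simp only: add_0, rule nn_integral_cmult[symmetric]) measurable
    also have "\<dots> = (\<integral>\<^sup>+m. ennreal (\<bar>d\<bar> ^ 3 * (1 + m\<^sup>2)) * (\<integral>\<^sup>+z. F (d *\<^sub>R frame (Re z) (Im z) m) \<partial>lborel) \<partial>lborel)"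
    proof (rule nn_integral_cong)
      fix m
      let ?\<delta> = "(d * m) * (- (d * m)) - d * d"
      have \<delta>: "?\<delta> = - (d\<^sup>2 * (1 + m\<^sup>2))" by (simp add: algebra_simps power2_eq_square)
      have "1 + m\<^sup>2 > 0" by (simp add: add_pos_nonneg)
      then have ne: "?\<delta> \<noteq> 0" and abs: "\<bar>?\<delta>\<bar> = d\<^sup>2 * (1 + m\<^sup>2)"
        using elim unfolding \<delta> by (simp_all add: abs_mult)
      have "case_prod (\<lambda>a b. F (mat2 a b (d * m) d)) \<in> borel_measurable (borel \<Otimes>\<^sub>M borel)" by measurable
      from nn_integral_linear2[OF this, of "d * m" "- (d * m)" d d] ne
      have "G (d * m) d = ennreal (d\<^sup>2 * (1 + m\<^sup>2)) *
        (\<integral>\<^sup>+x. \<integral>\<^sup>+y. F (mat2 (d * m * x + d * y) (d * x + - (d * m) * y) (d * m) d) \<partial>lborel \<partial>lborel)"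
        unfolding G_def abs by simp
      also have "(\<integral>\<^sup>+x. \<integral>\<^sup>+y. F (mat2 (d * m * x + d * y) (d * x + - (d * m) * y) (d * m) d) \<partial>lborel \<partial>lborel)
          = (\<integral>\<^sup>+x. \<integral>\<^sup>+y. F (d *\<^sub>R frame x y m) \<partial>lborel \<partial>lborel)"
      proof -
        have "mat2 (d * m * x + d * y) (d * x + - (d * m) * y) (d * m) d = d *\<^sub>R frame x y m" for x y
          by (simp add: frame_def matrix2_eq_iff algebra_simps)
        then show ?thesis by simp
      qed
      also have "\<dots> = (\<integral>\<^sup>+z. F (d *\<^sub>R frame (Re z) (Im z) m) \<partial>lborel)"
        by (subst nn_integral_complex) simp_all
      finally have "ennreal \<bar>d\<bar> * G (d * m) d = ennreal \<bar>d\<bar> * ennreal (d\<^sup>2 * (1 + m\<^sup>2)) *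
        (\<integral>\<^sup>+z. F (d *\<^sub>R frame (Re z) (Im z) m) \<partial>lborel)" by (simp add: mult.assoc)
      moreover have "\<bar>d\<bar> * (d\<^sup>2 * (1 + m\<^sup>2)) = \<bar>d\<bar> ^ 3 * (1 + m\<^sup>2)"
        by (cases "d \<ge> 0") (simp_all add: power3_eq_cube power2_eq_square)
      then have "ennreal \<bar>d\<bar> * ennreal (d\<^sup>2 * (1 + m\<^sup>2)) = ennreal (\<bar>d\<bar> ^ 3 * (1 + m\<^sup>2))"
        by (subst ennreal_mult'[symmetric]) simp_all
      ultimately show "ennreal \<bar>d\<bar> * G (d * m) d = ennreal (\<bar>d\<bar> ^ 3 * (1 + m\<^sup>2)) *
        (\<integral>\<^sup>+z. F (d *\<^sub>R frame (Re z) (Im z) m) \<partial>lborel)" by simp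
    qed
    finally show ?case .
  qed
  finally show ?thesis .
qed

lemma nn_integral_arctan: "(\<integral>\<^sup>+m. ennreal (1 / (1 + m\<^sup>2)) \<partial>lborel) = ennreal pi"
proof -
  have "(\<integral>\<^sup>+m. ennreal (1 / (1 + m\<^sup>2)) \<partial>lborel) = 2 * (\<integral>\<^sup>+m. ennreal (1 / (1 + m\<^sup>2)) * indicator {0<..} m \<partial>lborel)"
    by (rule nn_integral_even) auto
  also have "(\<integral>\<^sup>+m. ennreal (1 / (1 + m\<^sup>2)) * indicator {0<..} m \<partial>lborel) =
     (\<integral>\<^sup>+m. ennreal (1 / (1 + m\<^sup>2)) * indicator {0..} m \<partial>lborel)"
    by (rule nn_integral_cong_AE, use AE_lborel_singleton[of "0::real"] in eventually_elim)
       (auto simp: indicator_def)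
  also have "\<dots> = ennreal (pi / 2 - arctan 0)"
    by (rule nn_integral_FTC_atLeast)
       (auto intro!: derivative_eq_intros tendsto_arctan_at_top simp: inverse_eq_divide)
  finally show ?thesis using ennreal_mult'[of 2 "pi / 2"] by simp
qed

lemma upper_half_plane_borel [measurable]: "upper_half_plane \<in> sets borel"
  unfolding upper_half_plane_def by measurable

lemma emeasure_hyperbolic_area:
  assumes [measurable]: "B \<in> sets borel" and "B \<subseteq> upper_half_plane"
  shows "emeasure hyperbolic_area B = (\<integral>\<^sup>+z. ennreal (1 / (Im z)\<^sup>2) * indicator B z \<partial>lborel)"
proof -
  have "B \<in> sets (restrict_space lborel upper_half_plane)"
    using assms by (simp add: sets_restrict_space_iff)
  then have "emeasure hyperbolic_area B =
      (\<integral>\<^sup>+z. ennreal (1 / (Im z)\<^sup>2) * indicator B z \<partial>restrict_space lborel upper_half_plane)"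
    unfolding hyperbolic_area_def
    by (intro emeasure_density) (auto intro!: measurable_restrict_space1)
  also have "\<dots> = (\<integral>\<^sup>+z. ennreal (1 / (Im z)\<^sup>2) * indicator B z * indicator upper_half_plane z \<partial>lborel)"
    by (rule nn_integral_restrict_space) simp
  also have "\<dots> = (\<integral>\<^sup>+z. ennreal (1 / (Im z)\<^sup>2) * indicator B z \<partial>lborel)"
    using assms(2) by (intro nn_integral_cong) (auto simp: indicator_def)
  finally show ?thesis .
qed

text \<open>
  Over a fixed base point the integral over \<open>d\<close> gives the density \<open>1 / (Im z)\<^sup>2\<close> of hyperbolic area and
  leaves \<open>1 / (2 * (1 + m\<^sup>2))\<close>, whose integral over \<open>m\<close> is \<open>pi / 2\<close>.
\<close>

lemma emeasure_base:
  assumes [measurable]: "B \<in> sets borel" and B: "B \<subseteq> upper_half_plane"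
  shows "emeasure lborel {M \<in> unit_cone. base M \<in> B} = ennreal (pi / 2) * emeasure hyperbolic_area B"
proof -
  let ?E = "{M \<in> unit_cone. base M \<in> B}"
  let ?w = "\<lambda>d m. ennreal (\<bar>d\<bar> ^ 3 * (1 + m\<^sup>2))"
  let ?q = "\<lambda>z m. (1 + m\<^sup>2) * Im z"
  let ?C = "\<lambda>q. indicator {d. 0 < d\<^sup>2 * q \<and> d\<^sup>2 * q < 1} :: real \<Rightarrow> ennreal"
  have [measurable]: "?E \<in> sets borel" by measurable
  have "emeasure lborel ?E = (\<integral>\<^sup>+M. indicator ?E M \<partial>lborel)" by simp
  also have "\<dots> = (\<integral>\<^sup>+d. \<integral>\<^sup>+m. ?w d m * (\<integral>\<^sup>+z. indicator ?E (d *\<^sub>R frame (Re z) (Im z) m) \<partial>lborel) \<partial>lborel \<partial>lborel)"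
    by (rule nn_integral_iwasawa) measurable
  also have "\<dots> = (\<integral>\<^sup>+d. \<integral>\<^sup>+m. \<integral>\<^sup>+z. ?w d m * indicator ?E (d *\<^sub>R frame (Re z) (Im z) m) \<partial>lborel \<partial>lborel \<partial>lborel)"
    by (intro nn_integral_cong nn_integral_cmult[symmetric]) measurable
  also have "\<dots> = (\<integral>\<^sup>+d. \<integral>\<^sup>+m. \<integral>\<^sup>+z. indicator B z * (?w d m * ?C (?q z m) d) \<partial>lborel \<partial>lborel \<partial>lborel)"
  proof (intro nn_integral_cong)
    fix d m :: real and z :: complex
    have "d *\<^sub>R frame (Re z) (Im z) m \<in> ?E \<longleftrightarrow> 0 < d\<^sup>2 * ?q z m \<and> d\<^sup>2 * ?q z m < 1 \<and> z \<in> B"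
    proof (cases "d = 0")
      case False
      then show ?thesis
        by (auto simp: unit_cone_def det_scaleR2 det_frame base_scale base_frame mult.commute mult.left_commute)
    qed (auto simp: unit_cone_def det_2)
    then show "?w d m * indicator ?E (d *\<^sub>R frame (Re z) (Im z) m) = indicator B z * (?w d m * ?C (?q z m) d)"
      by (simp add: indicator_def)
  qed
  also have "\<dots> = (\<integral>\<^sup>+d. \<integral>\<^sup>+z. \<integral>\<^sup>+m. indicator B z * (?w d m * ?C (?q z m) d) \<partial>lborel \<partial>lborel \<partial>lborel)"
    by (intro nn_integral_cong lborel_pair.Fubini') measurable
  also have "\<dots> = (\<integral>\<^sup>+z. \<integral>\<^sup>+d. \<integral>\<^sup>+m. indicator B z * (?w d m * ?C (?q z m) d) \<partial>lborel \<partial>lborel \<partial>lborel)"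
    by (intro lborel_pair.Fubini') measurable
  also have "\<dots> = (\<integral>\<^sup>+z. \<integral>\<^sup>+m. \<integral>\<^sup>+d. indicator B z * (?w d m * ?C (?q z m) d) \<partial>lborel \<partial>lborel \<partial>lborel)"
    by (intro nn_integral_cong lborel_pair.Fubini') measurable
  also have "\<dots> = (\<integral>\<^sup>+z. ennreal (pi / 2) * (ennreal (1 / (Im z)\<^sup>2) * indicator B z) \<partial>lborel)"
  proof (rule nn_integral_cong)
    fix z
    show "(\<integral>\<^sup>+m. \<integral>\<^sup>+d. indicator B z * (?w d m * ?C (?q z m) d) \<partial>lborel \<partial>lborel) =
      ennreal (pi / 2) * (ennreal (1 / (Im z)\<^sup>2) * indicator B z)"
    proof (cases "z \<in> B")
      case True
      then have y: "Im z > 0" using B by (auto simp: upper_half_plane_def)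
      have "(\<integral>\<^sup>+d. indicator B z * (?w d m * ?C (?q z m) d) \<partial>lborel) = ennreal (1 / (2 * (Im z)\<^sup>2)) * ennreal (1 / (1 + m\<^sup>2))" for m
      proof -
        have p: "1 + m\<^sup>2 > 0" by (simp add: add_pos_nonneg)
        then have q: "?q z m > 0" using y by simp
        have "(\<integral>\<^sup>+d. indicator B z * (?w d m * ?C (?q z m) d) \<partial>lborel) =
           (\<integral>\<^sup>+d. ennreal (1 + m\<^sup>2) * (ennreal (\<bar>d\<bar> ^ 3) * ?C (?q z m) d) \<partial>lborel)"
          using True p by (intro nn_integral_cong) (simp add: ennreal_mult' ennreal_mult mult_ac)
        also have "\<dots> = ennreal (1 + m\<^sup>2) * (\<integral>\<^sup>+d. ennreal (\<bar>d\<bar> ^ 3) * ?C (?q z m) d \<partial>lborel)"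
          by (rule nn_integral_cmult) measurable
        also have "\<dots> = ennreal (1 + m\<^sup>2) * ennreal (1 / (2 * (?q z m)\<^sup>2))"
          unfolding nn_integral_cube_cone[OF q] ..
        also have "\<dots> = ennreal ((1 + m\<^sup>2) * (1 / (2 * (?q z m)\<^sup>2)))"
          using p by (intro ennreal_mult'[symmetric]) simp
        also have "(1 + m\<^sup>2) * (1 / (2 * (?q z m)\<^sup>2)) = 1 / (2 * (Im z)\<^sup>2) * (1 / (1 + m\<^sup>2))"
        proof -
          have "p * (1 / (2 * (p * v)\<^sup>2)) = 1 / (2 * v\<^sup>2) * (1 / p)" if "p > 0" "v > 0" for p v :: real
            using that by (simp add: field_simps power2_eq_square)
          then show ?thesis using p y by blast
        qed
        also have "ennreal \<dots> = ennreal (1 / (2 * (Im z)\<^sup>2)) * ennreal (1 / (1 + m\<^sup>2))"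
          by (rule ennreal_mult') simp
        finally show ?thesis .
      qed
      then have "(\<integral>\<^sup>+m. \<integral>\<^sup>+d. indicator B z * (?w d m * ?C (?q z m) d) \<partial>lborel \<partial>lborel) =
         (\<integral>\<^sup>+m. ennreal (1 / (2 * (Im z)\<^sup>2)) * ennreal (1 / (1 + m\<^sup>2)) \<partial>lborel)"
        by simp
      also have "\<dots> = ennreal (1 / (2 * (Im z)\<^sup>2)) * ennreal pi"
        by (subst nn_integral_cmult) (simp_all add: nn_integral_arctan)
      also have "\<dots> = ennreal (pi / 2) * ennreal (1 / (Im z)\<^sup>2)"
        by (simp add: ennreal_mult'[symmetric])
      finally show ?thesis using True by simp
    qed simp
  qed
  also have "\<dots> = ennreal (pi / 2) * emeasure hyperbolic_area B"
    unfolding emeasure_hyperbolic_area[OF assms] by (rule nn_integral_cmult) measurable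
  finally show ?thesis .
qed

lemma AE_base:
  assumes Z: "Z \<in> null_sets lborel"
  shows "AE M in lborel. M \<in> pos_det \<longrightarrow> base M \<notin> Z"
proof -
  have [measurable]: "Z \<in> sets borel" using Z by auto
  define B where "B = {M \<in> pos_det. base M \<in> Z}"
  have [measurable]: "B \<in> sets borel" unfolding B_def by measurable
  have base_pos: "base M \<in> upper_half_plane" if "M \<in> pos_det" for M
  proof -
    have "M $ 2 $ 1 \<noteq> 0 \<or> M $ 2 $ 2 \<noteq> 0" using that by (auto simp: pos_det_def det_2)
    then have "(M $ 2 $ 1)\<^sup>2 + (M $ 2 $ 2)\<^sup>2 > 0" by (simp add: sum_power2_gt_zero_iff)
    then show ?thesis using that by (simp add: base_eq upper_half_plane_def pos_det_def)
  qed
  have "B \<in> null_sets lborel"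
  proof (rule null_sets_cone)
    have "emeasure hyperbolic_area (Z \<inter> upper_half_plane) = (\<integral>\<^sup>+(z::complex). 0 \<partial>lborel)"
      unfolding emeasure_hyperbolic_area[of "Z \<inter> upper_half_plane", OF _ Int_lower2, simplified]
      by (rule nn_integral_cong_AE, use AE_not_in[OF Z] in eventually_elim) (auto simp: indicator_def)
    then have "emeasure lborel {M \<in> unit_cone. base M \<in> Z \<inter> upper_half_plane} = 0"
      by (subst emeasure_base) auto
    moreover have "B \<inter> unit_cone = {M \<in> unit_cone. base M \<in> Z \<inter> upper_half_plane}"
      using base_pos by (auto simp: B_def unit_cone_def pos_det_def)
    ultimately show "B \<inter> unit_cone \<in> null_sets lborel" by (auto simp: null_sets_def)
  qed (auto simp: B_def pos_det_def det_scaleR2 base_scale)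
  then show ?thesis by (rule AE_I') (auto simp: B_def)
qed


section \<open>The Ford domain of a zonal group\<close>

text \<open>
  The factor of automorphy: \<open>Im (A z)\<close> is \<open>det A * Im z / \<bar>den A z\<bar>\<^sup>2\<close>.
\<close>

definition den :: "real^2^2 \<Rightarrow> complex \<Rightarrow> complex" where
  "den A z = of_real (A $ 2 $ 1) * z + of_real (A $ 2 $ 2)"

lemma den_nonzero: "det A \<noteq> 0 \<Longrightarrow> Im z > 0 \<Longrightarrow> den A z \<noteq> 0"
  by (auto simp: den_def complex_eq_iff det_2)

lemma moebius_mult: "den A z \<noteq> 0 \<Longrightarrow> moebius (B ** A) z = moebius B (moebius A z)"
proof -
  assume d: "den A z \<noteq> 0"
  define u where "u = of_real (A $ 1 $ 1) * z + of_real (A $ 1 $ 2)"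
  have "moebius (B ** A) z = (of_real (B $ 1 $ 1) * u + of_real (B $ 1 $ 2) * den A z) /
     (of_real (B $ 2 $ 1) * u + of_real (B $ 2 $ 2) * den A z)"
    by (simp add: moebius_def u_def den_def algebra_simps)
  also have "\<dots> = ((of_real (B $ 1 $ 1) * u + of_real (B $ 1 $ 2) * den A z) / den A z) /
     ((of_real (B $ 2 $ 1) * u + of_real (B $ 2 $ 2) * den A z) / den A z)"
    using d by simp
  also have "\<dots> = moebius B (u / den A z)"
    using d by (simp add: moebius_def add_divide_distrib)
  finally show ?thesis by (simp add: u_def den_def moebius_def)
qed

lemma den_mult: "den A z \<noteq> 0 \<Longrightarrow> den (B ** A) z = den B (moebius A z) * den A z"
proof -
  assume "den A z \<noteq> 0"
  then have 1: "moebius A z * den A z = of_real (A $ 1 $ 1) * z + of_real (A $ 1 $ 2)"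
    by (simp add: moebius_def den_def)
  have "den B w * v = of_real (B $ 2 $ 1) * (w * v) + of_real (B $ 2 $ 2) * v" for w v
    by (simp add: den_def algebra_simps)
  then have "den B (moebius A z) * den A z =
      of_real (B $ 2 $ 1) * (moebius A z * den A z) + of_real (B $ 2 $ 2) * den A z" .
  also have "\<dots> = den (B ** A) z" unfolding 1 by (simp add: den_def algebra_simps)
  finally show ?thesis by simp
qed

lemma Im_moebius: "Im (moebius A z) = det A * Im z / (cmod (den A z))\<^sup>2"
  by (simp add: moebius_def den_def Im_divide det_2 cmod_power2 algebra_simps)

lemma moebius_upper: "det A > 0 \<Longrightarrow> Im z > 0 \<Longrightarrow> Im (moebius A z) > 0"
  using den_nonzero[of A z] by (simp add: Im_moebius)

lemma base_mult: "det M > 0 \<Longrightarrow> base (A ** M) = moebius A (base M)"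
  unfolding base_def by (rule moebius_mult) (simp add: den_nonzero)

lemma Im_base: "det M > 0 \<Longrightarrow> Im (base M) > 0"
  unfolding base_def by (rule moebius_upper) simp_all

lemma moebius_one [simp]: "moebius (mat 1) z = z"
  by (simp add: moebius_def)

definition translation :: "int \<Rightarrow> real^2^2" where "translation n = mat2 1 (of_int n) 0 1"

lemma moebius_translation [simp]: "moebius (translation n) z = z + of_int n"
  by (simp add: moebius_def translation_def)

lemma det_translation [simp]: "det (translation n) = 1"
  by (simp add: translation_def)

lemma translation_mult: "translation m ** translation n = translation (m + n)"
  by (simp add: translation_def matrix2_eq_iff)

text \<open>
  The properties of the preimage in \<open>SL\<^sub>2(\<real>)\<close> of a zonal Fuchsian group from which the Ford domain is built.
  Discreteness enters as finiteness of the bounded parts of \<open>S\<close>.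
\<close>

locale zonal_group =
  fixes S :: "(real^2^2) set"
  assumes det_S: "A \<in> S \<Longrightarrow> det A = 1"
    and mult_S: "A \<in> S \<Longrightarrow> B \<in> S \<Longrightarrow> A ** B \<in> S"
    and inv_S: "A \<in> S \<Longrightarrow> adj2 A \<in> S"
    and neg_S: "A \<in> S \<Longrightarrow> - A \<in> S"
    and translation_S: "translation n \<in> S"
    and stabilizer_S: "A \<in> S \<Longrightarrow> A $ 2 $ 1 = 0 \<Longrightarrow> \<exists>n. A = translation n \<or> A = - translation n"
    and bounded_finite: "finite {A \<in> S. \<forall>i j. \<bar>A $ i $ j\<bar> \<le> R}"
begin

lemma countable_S: "countable S"
proof -
  have "S \<subseteq> (\<Union>n::nat. {A \<in> S. \<forall>i j. \<bar>A $ i $ j\<bar> \<le> real n})"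
  proof
    fix A assume A: "A \<in> S"
    obtain n :: nat where n: "norm A \<le> real n" using real_arch_simple by blast
    have "\<bar>A $ i $ j\<bar> \<le> real n" for i j
      by (rule order_trans[OF component_le_norm_cart order_trans[OF Finite_Cartesian_Product.norm_nth_le n]])
    with A have "A \<in> {A \<in> S. \<forall>i j. \<bar>A $ i $ j\<bar> \<le> real n}" by simp
    then show "A \<in> (\<Union>n::nat. {A \<in> S. \<forall>i j. \<bar>A $ i $ j\<bar> \<le> real n})" by blast
  qed
  moreover have "countable (\<Union>n::nat. {A \<in> S. \<forall>i j. \<bar>A $ i $ j\<bar> \<le> real n})"
    by (rule countable_UN) (simp_all add: countable_finite[OF bounded_finite])
  ultimately show ?thesis by (rule countable_subset)
qed

lemma one_S: "mat 1 \<in> S"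
  using translation_S[of 0] by (simp add: translation_def mat_1_mat2)

text \<open>
  The Shimizu--Leutbecher lemma.  If \<open>0 < \<bar>c\<bar> < 1\<close>, then the iteration
  \<open>X \<mapsto> X ** translation 1 ** adj2 X\<close> squares the lower left entry, up to sign, and keeps the others
  bounded.  This yields infinitely many elements of \<open>S\<close> in a bounded set.
\<close>

lemma shimizu:
  assumes A: "A \<in> S" and c: "A $ 2 $ 1 \<noteq> 0"
  shows "\<bar>A $ 2 $ 1\<bar> \<ge> 1"
proof (rule ccontr)
  assume small: "\<not> \<bar>A $ 2 $ 1\<bar> \<ge> 1"
  define q where "q = \<bar>A $ 2 $ 1\<bar>"
  have q: "0 < q" "q < 1" using c small by (auto simp: q_def)
  \<comment> \<open>\<open>K\<close> bounds the upper left entry along the iteration, since \<open>1 + q * K \<le> K\<close>.\<close>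
  define K where "K = max \<bar>A $ 1 $ 1\<bar> (1 / (1 - q))"
  have K: "1 + q * K \<le> K" "K \<ge> 1"
  proof -
    have "K \<ge> 1 / (1 - q)" by (simp add: K_def)
    then have "K * (1 - q) \<ge> 1" using q by (simp add: field_simps)
    then show "1 + q * K \<le> K" by (simp add: algebra_simps)
    have "1 / (1 - q) \<ge> 1" using q by simp
    then show "K \<ge> 1" using \<open>K \<ge> 1 / (1 - q)\<close> by linarith
  qed
  define X where "X n = ((\<lambda>B. B ** translation 1 ** adj2 B) ^^ n) A" for n
  have X0: "X 0 = A" and XS: "X (Suc n) = X n ** translation 1 ** adj2 (X n)" for n
    by (simp_all add: X_def)
  have entries: "X (Suc n) = mat2 (1 - X n $ 1 $ 1 * X n $ 2 $ 1) ((X n $ 1 $ 1)\<^sup>2) (- (X n $ 2 $ 1)\<^sup>2) (1 + X n $ 1 $ 1 * X n $ 2 $ 1)"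
    if "X n \<in> S" for n
    using det_S[OF that] unfolding XS det_2
    by (simp add: matrix2_eq_iff translation_def adj2_def power2_eq_square algebra_simps)
  have inv: "X n \<in> S \<and> X n $ 2 $ 1 \<noteq> 0 \<and> \<bar>X n $ 2 $ 1\<bar> \<le> q \<and> \<bar>X n $ 1 $ 1\<bar> \<le> K" for n
  proof (induction n)
    case 0
    then show ?case using A c by (simp add: X0 q_def K_def)
  next
    case (Suc n)
    then have IH: "X n \<in> S" "X n $ 2 $ 1 \<noteq> 0" "\<bar>X n $ 2 $ 1\<bar> \<le> q" "\<bar>X n $ 1 $ 1\<bar> \<le> K" by auto
    have "\<bar>X n $ 2 $ 1\<bar> * \<bar>X n $ 2 $ 1\<bar> \<le> q * 1" using IH q by (intro mult_mono) auto
    then have "(X n $ 2 $ 1)\<^sup>2 \<le> q" by (simp add: power2_eq_square)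
    moreover have "\<bar>X n $ 1 $ 1\<bar> * \<bar>X n $ 2 $ 1\<bar> \<le> K * q" using IH K by (intro mult_mono) auto
    then have "\<bar>1 - X n $ 1 $ 1 * X n $ 2 $ 1\<bar> \<le> K"
      using K abs_triangle_ineq4[of 1 "X n $ 1 $ 1 * X n $ 2 $ 1"] by (simp add: abs_mult mult.commute)
    moreover have "X (Suc n) \<in> S"
      unfolding XS using IH by (intro mult_S inv_S translation_S)
    ultimately show ?case using IH by (simp add: entries)
  qed
  have dec: "\<bar>X (Suc n) $ 2 $ 1\<bar> < \<bar>X n $ 2 $ 1\<bar>" for n
  proof -
    have "\<bar>X n $ 2 $ 1\<bar> * \<bar>X n $ 2 $ 1\<bar> < \<bar>X n $ 2 $ 1\<bar> * 1"
      using inv[of n] q by (intro mult_strict_left_mono) auto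
    then show ?thesis using inv[of n] by (simp add: entries power2_eq_square)
  qed
  have "strict_mono (\<lambda>n. - \<bar>X n $ 2 $ 1\<bar>)" using dec by (intro strict_monoI_Suc) simp
  then have "inj (\<lambda>n. - \<bar>X n $ 2 $ 1\<bar>)" by (rule strict_mono_imp_inj_on)
  then have "inj (\<lambda>n. X (Suc n))" by (intro injI) (metis injD nat.inject)
  then have "infinite (range (\<lambda>n. X (Suc n)))" by (simp add: finite_image_iff)
  moreover have "range (\<lambda>n. X (Suc n)) \<subseteq> {A \<in> S. \<forall>i j. \<bar>A $ i $ j\<bar> \<le> 1 + K\<^sup>2}"
  proof safe
    fix n and i j :: 2
    show "X (Suc n) \<in> S" using inv by blast
    have a: "\<bar>X n $ 1 $ 1\<bar> \<le> K" "\<bar>X n $ 2 $ 1\<bar> \<le> 1" using inv[of n] q by auto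
    have "\<bar>X n $ 1 $ 1\<bar> * \<bar>X n $ 2 $ 1\<bar> \<le> K * 1" using a K by (intro mult_mono) auto
    moreover have "K * 1 \<le> K * K" using K by (intro mult_left_mono) auto
    ultimately have ac: "\<bar>X n $ 1 $ 1 * X n $ 2 $ 1\<bar> \<le> K\<^sup>2" by (simp add: abs_mult power2_eq_square)
    have aa: "(X n $ 1 $ 1)\<^sup>2 \<le> K\<^sup>2" using a by (metis abs_ge_zero power2_abs power_mono)
    have cc: "(X n $ 2 $ 1)\<^sup>2 \<le> 1" using a by (simp add: abs_square_le_1)
    have "\<bar>1 - X n $ 1 $ 1 * X n $ 2 $ 1\<bar> \<le> 1 + K\<^sup>2" "\<bar>1 + X n $ 1 $ 1 * X n $ 2 $ 1\<bar> \<le> 1 + K\<^sup>2"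
      using ac by linarith+
    moreover have "K\<^sup>2 \<ge> 0" by simp
    ultimately show "\<bar>X (Suc n) $ i $ j\<bar> \<le> 1 + K\<^sup>2"
      using exhaust_2[of i] exhaust_2[of j] inv[of n] aa cc by (auto simp: entries)
  qed
  ultimately show False using bounded_finite finite_subset by blast
qed

text \<open>
  The points of the strip \<open>\<bar>Re z\<bar> < 1 / 2\<close> that are strictly the highest in their orbit, up to translations.
\<close>

definition ford :: "complex set" where
  "ford = {z. Im z > 0 \<and> \<bar>Re z\<bar> < 1 / 2 \<and> (\<forall>A\<in>S. A $ 2 $ 1 \<noteq> 0 \<longrightarrow> cmod (den A z) > 1)}"

lemma ford_borel [measurable]: "ford \<in> sets borel"
proof -
  have "ford = {z. Im z > 0 \<and> \<bar>Re z\<bar> < 1 / 2} \<inter> {z. \<forall>A\<in>{A \<in> S. A $ 2 $ 1 \<noteq> 0}. cmod (den A z) > 1}"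
    by (auto simp: ford_def)
  also have "\<dots> \<in> sets borel"
  proof (rule sets.Int)
    have "countable {A \<in> S. A $ 2 $ 1 \<noteq> 0}" by (rule countable_subset[OF _ countable_S]) auto
    moreover have "{z. \<not> cmod (den A z) > 1} \<in> sets borel" for A
      unfolding den_def by measurable
    ultimately have "space borel - (\<Union>A\<in>{A \<in> S. A $ 2 $ 1 \<noteq> 0}. {z. \<not> cmod (den A z) > 1}) \<in> sets borel"
      by (intro sets.Diff sets.countable_UN') auto
    moreover have "space borel - (\<Union>A\<in>{A \<in> S. A $ 2 $ 1 \<noteq> 0}. {z. \<not> cmod (den A z) > 1}) =
      {z. \<forall>A\<in>{A \<in> S. A $ 2 $ 1 \<noteq> 0}. cmod (den A z) > 1}" by auto
    ultimately show "{z. \<forall>A\<in>{A \<in> S. A $ 2 $ 1 \<noteq> 0}. cmod (den A z) > 1} \<in> sets borel" by simp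
    show "{z :: complex. Im z > 0 \<and> \<bar>Re z\<bar> < 1 / 2} \<in> sets borel" by measurable
  qed
  finally show ?thesis .
qed

lemma ford_upper: "z \<in> ford \<Longrightarrow> Im z > 0"
  by (simp add: ford_def)

text \<open>
  An element with \<open>c \<noteq> 0\<close> lowers every point of the domain, and so does its inverse; hence \<open>c = 0\<close>, and the
  only such elements that match points of the strip are \<open>\<plusminus> mat 1\<close>.
\<close>

lemma ford_unique:
  assumes z: "z \<in> ford" and C: "C \<in> S" and w: "moebius C z \<in> ford"
  shows "C = mat 1 \<or> C = - mat 1"
proof -
  have dC: "det C = 1" using C by (rule det_S)
  have z0: "Im z > 0" using z by (rule ford_upper)
  have backward: "moebius (adj2 C) (moebius C z) = z"
    using moebius_mult[of C z "adj2 C"] den_nonzero[of C z] dC z0 by (simp add: adj2_mult)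
  have small: "Im (moebius A v) < Im v" if "v \<in> ford" "A \<in> S" "A $ 2 $ 1 \<noteq> 0" for A v
  proof -
    have pos: "cmod (den A v) > 1" "Im v > 0" using that by (auto simp: ford_def)
    then have "Im v * 1 < Im v * (cmod (den A v))\<^sup>2"
      by (intro mult_strict_left_mono) (simp_all add: one_less_power)
    then show ?thesis
      using pos that by (simp add: Im_moebius det_S divide_less_eq)
  qed
  have "C $ 2 $ 1 = 0"
  proof (rule ccontr)
    assume "C $ 2 $ 1 \<noteq> 0"
    then have "Im (moebius C z) < Im z" "Im (moebius (adj2 C) (moebius C z)) < Im (moebius C z)"
      using small[OF z C] small[OF w inv_S[OF C]] by (simp_all add: adj2_def)
    then show False by (simp add: backward)
  qed
  then obtain n where n: "C = translation n \<or> C = - translation n" using stabilizer_S[OF C] by blast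
  then have "moebius C z = z + of_int n" by auto
  then have "\<bar>Re z + of_int n\<bar> < 1 / 2" "\<bar>Re z\<bar> < 1 / 2" using w z by (auto simp: ford_def)
  then have "\<bar>real_of_int n\<bar> < 1" by linarith
  then have "n = 0" by linarith
  then show ?thesis using n by (auto simp: translation_def mat_1_mat2)
qed

text \<open>
  The two vertical lines and all isometric circles, which contain the boundary of the Ford domain.  If no
  image of a point lies on them, then the point has an image in the open domain.
\<close>

definition wall :: "complex set" where
  "wall = {z. \<bar>Re z\<bar> = 1 / 2} \<union> (\<Union>A\<in>{A \<in> S. A $ 2 $ 1 \<noteq> 0}. {z. cmod (den A z) = 1})"

text \<open>
  If the image is as high as \<open>z\<close>, then \<open>\<bar>den A z\<bar> \<le> 1\<close>, which bounds the lower row.  The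
  Shimizu--Leutbecher lemma keeps \<open>\<bar>den A z\<bar>\<close> away from \<open>0\<close>; this bounds the image point and with it the
  upper row.
\<close>

lemma finite_high_images:
  assumes z: "Im z > 0"
  shows "finite {A \<in> S. \<bar>Re (moebius A z)\<bar> \<le> 1 / 2 \<and> Im (moebius A z) \<ge> Im z}" (is "finite ?X")
proof -
  define y where "y = Im z"
  \<comment> \<open>\<open>R\<close> bounds both coefficients of any \<open>p * z + q\<close> of modulus at most \<open>y + 2\<close>.\<close>
  define R where "R = (1 + cmod z) * (y + 3) / y + y + 3"
  have y: "y > 0" using z by (simp add: y_def)
  have lin: "\<bar>p\<bar> \<le> R \<and> \<bar>q\<bar> \<le> R" if "cmod (of_real p * z + of_real q) \<le> y + 2" for p q :: real
  proof -
    have "\<bar>p\<bar> * y \<le> y + 2"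
      using abs_Im_le_cmod[of "of_real p * z + of_real q"] that y by (simp add: y_def abs_mult)
    then have p: "\<bar>p\<bar> \<le> (y + 2) / y" using y by (simp add: field_simps)
    have "of_real q = (of_real p * z + of_real q) - of_real p * z" by simp
    then have "\<bar>q\<bar> \<le> y + 2 + \<bar>p\<bar> * cmod z"
      using norm_triangle_ineq4[of "of_real p * z + of_real q" "of_real p * z"] that
      by (simp add: norm_mult)
    also have "\<bar>p\<bar> * cmod z \<le> (y + 2) / y * cmod z" using p by (intro mult_right_mono) auto
    finally have q: "\<bar>q\<bar> \<le> y + 2 + (y + 2) / y * cmod z" by simp
    have "R = (y + 2) / y + (y + 2) / y * cmod z + (1 + cmod z) / y + y + 3"
      using y by (simp add: R_def field_simps)
    moreover have "(y + 2) / y * cmod z \<ge> 0" "(y + 2) / y \<ge> 0" "(1 + cmod z) / y \<ge> 0" using y by auto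
    ultimately show ?thesis using p q y by linarith
  qed
  have "?X \<subseteq> {A \<in> S. \<forall>i j. \<bar>A $ i $ j\<bar> \<le> R}"
  proof safe
    fix A and i j :: 2
    assume A: "A \<in> S" and re: "\<bar>Re (moebius A z)\<bar> \<le> 1 / 2" and im: "Im (moebius A z) \<ge> Im z"
    have dA: "det A = 1" using A by (rule det_S)
    define r where "r = cmod (den A z)"
    have r: "r > 0" using den_nonzero[of A z] dA z by (simp add: r_def)
    have imA: "Im (moebius A z) = y / r\<^sup>2" by (simp add: Im_moebius dA r_def y_def)
    have "y \<le> y / r\<^sup>2" using im imA by (simp add: y_def)
    then have "y * r\<^sup>2 \<le> y * 1" using r by (simp add: field_simps)
    then have "r\<^sup>2 \<le> 1" using mult_le_cancel_left_pos[OF y] by blast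
    then have r1: "r \<le> 1" using r by (simp add: abs_square_le_1)
    have low: "y / r \<le> y + 1"
    proof (cases "A $ 2 $ 1 = 0")
      case True
      then obtain n where "A = translation n \<or> A = - translation n" using stabilizer_S A by blast
      then have "r = 1" by (auto simp: r_def den_def translation_def)
      then show ?thesis by simp
    next
      case False
      have "\<bar>A $ 2 $ 1\<bar> * y \<le> r"
        using abs_Im_le_cmod[of "den A z"] y by (simp add: r_def den_def y_def abs_mult)
      moreover have "1 * y \<le> \<bar>A $ 2 $ 1\<bar> * y" using shimizu[OF A False] y by (intro mult_right_mono) auto
      ultimately have "y / r \<le> 1" using r by simp
      then show ?thesis using y by linarith
    qed
    have "moebius A z * den A z = of_real (A $ 1 $ 1) * z + of_real (A $ 1 $ 2)"
      using r by (simp add: moebius_def den_def r_def)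
    then have "cmod (of_real (A $ 1 $ 1) * z + of_real (A $ 1 $ 2)) = cmod (moebius A z) * r"
      by (metis norm_mult r_def)
    also have "\<dots> \<le> (1 / 2 + y / r\<^sup>2) * r"
      using cmod_le[of "moebius A z"] re imA r y by (intro mult_right_mono) (auto simp: abs_of_nonneg)
    also have "\<dots> = r / 2 + y / r" using r by (simp add: field_simps power2_eq_square)
    also have "\<dots> \<le> y + 2" using low r1 by simp
    finally have "\<bar>A $ 1 $ 1\<bar> \<le> R \<and> \<bar>A $ 1 $ 2\<bar> \<le> R" by (rule lin)
    moreover have "\<bar>A $ 2 $ 1\<bar> \<le> R \<and> \<bar>A $ 2 $ 2\<bar> \<le> R"
      by (rule lin) (use r1 y in \<open>simp add: r_def den_def\<close>)
    ultimately show "\<bar>A $ i $ j\<bar> \<le> R"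
      using exhaust_2[of i] exhaust_2[of j] by auto
  qed
  then show ?thesis using bounded_finite finite_subset by blast
qed

text \<open>
  Take the highest image, and translate it into the strip.
\<close>

lemma ford_exists:
  assumes z: "Im z > 0" and generic: "\<And>A. A \<in> S \<Longrightarrow> moebius A z \<notin> wall"
  shows "\<exists>A\<in>S. moebius A z \<in> ford"
proof -
  let ?X = "{A \<in> S. \<bar>Re (moebius A z)\<bar> \<le> 1 / 2 \<and> Im (moebius A z) \<ge> Im z}"
  have up: "Im (moebius A z) > 0" "den A z \<noteq> 0" if "A \<in> S" for A
    using moebius_upper[of A z] den_nonzero[of A z] z det_S[OF that] by auto
  have center: "\<exists>n. \<bar>Re (moebius (translation n ** A) z)\<bar> \<le> 1 / 2 \<and>
      Im (moebius (translation n ** A) z) = Im (moebius A z)" if "A \<in> S" for A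
  proof (intro exI conjI)
    let ?n = "- round (Re (moebius A z))"
    have m: "moebius (translation ?n ** A) z = moebius A z + of_int ?n"
      using moebius_mult[OF up(2)[OF that]] by simp
    show "\<bar>Re (moebius (translation ?n ** A) z)\<bar> \<le> 1 / 2"
      unfolding m using of_int_round_abs_le[of "Re (moebius A z)"] by (simp add: abs_minus_commute)
    show "Im (moebius (translation ?n ** A) z) = Im (moebius A z)" unfolding m by simp
  qed
  obtain n where "translation n ** mat 1 \<in> ?X"
    using center[OF one_S] one_S by (auto intro!: mult_S translation_S)
  then have "?X \<noteq> {}" by blast
  then have fin: "finite ((\<lambda>A. Im (moebius A z)) ` ?X)" "(\<lambda>A. Im (moebius A z)) ` ?X \<noteq> {}"
    using finite_high_images[OF z] by auto
  from Max_in[OF this] obtain A where A: "A \<in> ?X"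
    and Aeq: "Im (moebius A z) = Max ((\<lambda>A. Im (moebius A z)) ` ?X)" by (metis (no_types, lifting) imageE)
  have max: "Im (moebius B z) \<le> Im (moebius A z)" if "B \<in> ?X" for B
    unfolding Aeq using that by (intro Max_ge[OF fin(1)]) blast
  from A have AS: "A \<in> S" by simp
  have all: "Im (moebius B z) \<le> Im (moebius A z)" if B: "B \<in> S" for B
  proof (cases "Im (moebius B z) \<ge> Im z")
    case True
    obtain n where n: "\<bar>Re (moebius (translation n ** B) z)\<bar> \<le> 1 / 2"
      "Im (moebius (translation n ** B) z) = Im (moebius B z)" using center[OF B] by blast
    then have "translation n ** B \<in> ?X" using True B by (auto intro!: mult_S translation_S)
    then show ?thesis using max n by force
  qed (use A in auto)
  have "cmod (den C (moebius A z)) > 1" if C: "C \<in> S" "C $ 2 $ 1 \<noteq> 0" for C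
  proof -
    have "Im (moebius C (moebius A z)) \<le> Im (moebius A z)"
      using all[OF mult_S[OF C(1) AS]] moebius_mult[OF up(2)[OF AS]] by simp
    then have le: "Im (moebius A z) / (cmod (den C (moebius A z)))\<^sup>2 \<le> Im (moebius A z)"
      by (simp add: Im_moebius[of C] det_S C)
    have pos: "cmod (den C (moebius A z)) > 0"
      using den_nonzero[of C "moebius A z"] det_S[OF C(1)] up(1)[OF AS] by simp
    have "Im (moebius A z) * 1 \<le> Im (moebius A z) * (cmod (den C (moebius A z)))\<^sup>2"
      using le pos by (simp add: field_simps)
    then have "1 \<le> (cmod (den C (moebius A z)))\<^sup>2" using mult_le_cancel_left_pos[OF up(1)[OF AS]] by blast
    then have "1 \<le> cmod (den C (moebius A z))" using pos
      by (metis abs_of_pos abs_square_less_1 not_le)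
    moreover have "cmod (den C (moebius A z)) \<noteq> 1" using generic[OF AS] C by (auto simp: wall_def)
    ultimately show ?thesis by simp
  qed
  moreover have "\<bar>Re (moebius A z)\<bar> < 1 / 2" using A generic[OF AS] by (auto simp: wall_def)
  ultimately have "moebius A z \<in> ford" using up(1)[OF AS] by (simp add: ford_def)
  then show ?thesis using AS by blast
qed

lemma null_sets_circle: "c \<noteq> 0 \<Longrightarrow> {z. cmod (of_real c * z + of_real d) = 1} \<in> null_sets lborel"
proof -
  assume c: "c \<noteq> 0"
  have "{z. cmod (of_real c * z + of_real d) = 1} = sphere (- of_real (d / c)) (1 / \<bar>c\<bar>)"
  proof -
    have "cmod (of_real c * z + of_real d) = \<bar>c\<bar> * cmod (z - (- of_real (d / c)))" for z
      using c norm_mult[of "complex_of_real c" "z + of_real (d / c)"] by (simp add: distrib_left)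
    moreover have "\<bar>c\<bar> * t = 1 \<longleftrightarrow> t = 1 / \<bar>c\<bar>" for t using c by (simp add: field_simps)
    ultimately show ?thesis by (auto simp only: sphere_def dist_norm norm_minus_commute)
  qed
  then show ?thesis
    using negligible_sphere[of "- of_real (d / c) :: complex" "1 / \<bar>c\<bar>"]
    by (simp add: negligible_iff_null_sets null_sets_completion_iff)
qed

lemma null_sets_vertical: "{z :: complex. \<bar>Re z\<bar> = r} \<in> null_sets lborel"
proof -
  have "{z :: complex. Re z = s} \<in> null_sets lborel" for s
  proof -
    have "negligible {z :: complex. 1 \<bullet> z = s}" by (rule negligible_hyperplane) simp
    moreover have "{z :: complex. 1 \<bullet> z = s} = {z. Re z = s}" by (auto simp: inner_complex_def)
    moreover have "{z :: complex. Re z = s} \<in> sets borel" by measurable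
    ultimately show ?thesis by (simp add: negligible_iff_null_sets null_sets_completion_iff)
  qed
  then have "{z :: complex. Re z = r} \<union> {z. Re z = - r} \<in> null_sets lborel" by (intro null_sets.Un)
  moreover have "{z :: complex. \<bar>Re z\<bar> = r} \<subseteq> {z :: complex. Re z = r} \<union> {z. Re z = - r}" by auto
  moreover have "{z :: complex. \<bar>Re z\<bar> = r} \<in> sets lborel" by simp
  ultimately show ?thesis by (metis null_sets_subset)
qed

lemma wall_null: "wall \<in> null_sets lborel"
  unfolding wall_def den_def
  using countable_S countable_subset[of "{A \<in> S. A $ 2 $ 1 \<noteq> 0}" S]
  by (intro null_sets.Un null_sets_vertical null_sets_UN') (auto simp: null_sets_circle)

text \<open>
  Turns an exceptional set of points of the plane into one of matrices, and makes it invariant under \<open>S\<close>.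
\<close>

lemma AE_generic_base:
  assumes "Z \<in> null_sets lborel"
  shows "AE M in lborel. M \<in> pos_det \<longrightarrow> (\<forall>A\<in>S. base (A ** M) \<notin> Z)"
proof -
  have "AE M in lborel. \<forall>A\<in>S. A ** M \<in> pos_det \<longrightarrow> base (A ** M) \<notin> Z"
    unfolding AE_ball_countable[OF countable_S]
  proof
    fix A assume "A \<in> S"
    then show "AE M in lborel. A ** M \<in> pos_det \<longrightarrow> base (A ** M) \<notin> Z"
      using AE_mult_left[OF AE_base[OF assms], of A] by (simp add: det_S)
  qed
  then show ?thesis by eventually_elim (auto simp: pos_det_def det_mul det_S)
qed

definition ford_cone :: "(real^2^2) set" where "ford_cone = {M \<in> unit_cone. base M \<in> ford}"

lemma ford_cone_borel [measurable]: "ford_cone \<in> sets borel"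
  unfolding ford_cone_def by measurable

text \<open>
  Almost every matrix has exactly two translates over the Ford domain, \<open>A ** M\<close> and \<open>- A ** M\<close>.
\<close>

lemma ford_tiles:
  "AE M in lborel. M \<in> unit_cone \<longrightarrow> (\<integral>\<^sup>+A. indicator ford_cone (A ** M) \<partial>count_space S) = 2"
  using AE_generic_base[OF wall_null]
proof eventually_elim
  case (elim M)
  show ?case
  proof
    assume M: "M \<in> unit_cone"
    then have d: "det M > 0" and P: "M \<in> pos_det" by (auto simp: unit_cone_def pos_det_def)
    have gen: "moebius A (base M) \<notin> wall" if "A \<in> S" for A
      using elim P that by (simp add: base_mult[OF d])
    obtain A where A: "A \<in> S" "moebius A (base M) \<in> ford"
      using ford_exists[OF Im_base[OF d] gen] by blast
    have "{B \<in> S. B ** M \<in> ford_cone} = {A, - A}"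
    proof (intro equalityI subsetI)
      fix B assume "B \<in> {B \<in> S. B ** M \<in> ford_cone}"
      then have B: "B \<in> S" "moebius B (base M) \<in> ford" by (auto simp: ford_cone_def base_mult[OF d])
      have dA: "det A = 1" using A det_S by blast
      have "moebius (B ** adj2 A) (moebius A (base M)) = moebius (B ** adj2 A ** A) (base M)"
        using moebius_mult[of A "base M" "B ** adj2 A"] den_nonzero[of A "base M"] dA Im_base[OF d] by simp
      also have "B ** adj2 A ** A = B" by (simp add: matrix_mul_assoc[symmetric] adj2_mult dA)
      finally have "B ** adj2 A = mat 1 \<or> B ** adj2 A = - mat 1"
        using ford_unique[OF A(2), of "B ** adj2 A"] A B by (auto intro: mult_S inv_S)
      then have "B ** adj2 A ** A = A \<or> B ** adj2 A ** A = - A"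
        by (auto simp: matrix_uminus_mult_left)
      then show "B \<in> {A, - A}" using \<open>B ** adj2 A ** A = B\<close> by auto
    next
      fix B assume "B \<in> {A, - A}"
      then have "B \<in> S" "moebius B (base M) \<in> ford" using A neg_S by auto
      then show "B \<in> {B \<in> S. B ** M \<in> ford_cone}"
        using M by (auto simp: ford_cone_def base_mult[OF d] unit_cone_def det_mul det_S)
    qed
    moreover have "A \<noteq> - A"
    proof
      assume "A = - A"
      then have "A $ i $ j = 0" for i j by (metis equation_minus_iff neg_equal_zero vector_uminus_component)
      then show False using det_S[OF A(1)] by (simp add: det_2)
    qed
    ultimately have card: "card {B \<in> S. B ** M \<in> ford_cone} = 2" "finite {B \<in> S. B ** M \<in> ford_cone}" by auto
    have "(\<integral>\<^sup>+A. indicator ford_cone (A ** M) \<partial>count_space S) =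
        (\<integral>\<^sup>+A. indicator {B \<in> S. B ** M \<in> ford_cone} A \<partial>count_space S)"
      by (intro nn_integral_cong) (auto simp: indicator_def)
    also have "\<dots> = emeasure (count_space S) {B \<in> S. B ** M \<in> ford_cone}"
      by (rule nn_integral_indicator) auto
    also have "\<dots> = 2" using card by (subst emeasure_count_space) auto
    finally show "(\<integral>\<^sup>+A. indicator ford_cone (A ** M) \<partial>count_space S) = 2" .
  qed
qed

end


section \<open>The area of the orbifold\<close>

lemma PSL2R_mult:
  assumes "det A = 1" "det B = 1"
  shows "psl_of A \<otimes>\<^bsub>PSL2R\<^esub> psl_of B = psl_of (A ** B)"
proof -
  have "({mat 1, - mat 1} #>\<^bsub>SL2R\<^esub> A) <#>\<^bsub>SL2R\<^esub> ({mat 1, - mat 1} #>\<^bsub>SL2R\<^esub> B) =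
    {mat 1, - mat 1} #>\<^bsub>SL2R\<^esub> (A \<otimes>\<^bsub>SL2R\<^esub> B)"
    using assms by (intro normal.rcos_sum[OF normal_centre_SL2R]) (simp_all add: SL2R_def)
  then show ?thesis by (simp add: PSL2R_def psl_of_def FactGroup_def SL2R_def)
qed

lemma PSL2R_one: "\<one>\<^bsub>PSL2R\<^esub> = psl_of (mat 1)"
  by (simp add: PSL2R_def FactGroup_def psl_of_eq)

lemma psl_of_carrier: "det A = 1 \<Longrightarrow> psl_of A \<in> carrier PSL2R"
  by (simp add: carrier_PSL2R SL2R_def)

lemma PSL2R_inv: "det A = 1 \<Longrightarrow> inv\<^bsub>PSL2R\<^esub> (psl_of A) = psl_of (adj2 A)"
  by (rule group.inv_equality[OF group_PSL2R])
    (simp_all add: PSL2R_mult adj2_mult PSL2R_one psl_of_carrier)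

lemma generate_translation:
  "g \<in> generate PSL2R {psl_of (mat2 1 1 0 1)} \<Longrightarrow> \<exists>n. g = psl_of (translation n)"
proof (induction rule: generate.induct)
  case one
  then show ?case by (auto simp: PSL2R_one translation_def mat_1_mat2 intro!: exI[of _ 0])
next
  case (incl h)
  then show ?case by (auto simp: translation_def intro!: exI[of _ 1])
next
  case (inv h)
  then show ?case by (auto simp: translation_def PSL2R_inv adj2_def intro!: exI[of _ "-1"])
next
  case (eng h1 h2)
  then show ?case by (auto simp: PSL2R_mult translation_mult)
qed

text \<open>
  Otherwise there is a convergent sequence \<open>f\<close> of distinct elements, and the quotients
  \<open>adj2 (f n) ** f (Suc n)\<close> tend to \<open>mat 1\<close>.  As \<open>mat 1\<close> is isolated, \<open>f\<close> is eventually constant.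
\<close>

lemma bounded_discrete_group_finite:
  fixes S :: "(real^2^2) set"
  assumes det: "\<And>A. A \<in> S \<Longrightarrow> det A = 1" and mult: "\<And>A B. A \<in> S \<Longrightarrow> B \<in> S \<Longrightarrow> A ** B \<in> S"
    and inv: "\<And>A. A \<in> S \<Longrightarrow> adj2 A \<in> S" and one: "mat 1 \<in> S" and discrete: "discrete S"
  shows "finite {A \<in> S. \<forall>i j. \<bar>A $ i $ j\<bar> \<le> R}"
proof (rule ccontr)
  let ?B = "{A \<in> S. \<forall>i j. \<bar>A $ i $ j\<bar> \<le> R}"
  assume inf: "infinite ?B"
  have "?B \<subseteq> cbox (mat2 (-R) (-R) (-R) (-R)) (mat2 R R R R)"
    by (auto simp: mem_box Basis_matrix2 inner_matrix2 abs_le_iff minus_le_iff)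
  moreover have "compact (cbox (mat2 (-R) (-R) (-R) (-R)) (mat2 R R R R))" by simp
  ultimately obtain L where "L islimpt ?B"
    using inf unfolding compact_eq_Bolzano_Weierstrass by blast
  then obtain f where f: "\<And>n. f n \<in> ?B - {L}" and lim: "f \<longlonglongrightarrow> L"
    unfolding islimpt_sequential by blast
  have fS: "f n \<in> S" "det (f n) = 1" for n using f[of n] det by auto
  have ent: "(\<lambda>n. f n $ i $ j) \<longlonglongrightarrow> L $ i $ j" for i j by (intro tendsto_vec_nth lim)
  have "(\<lambda>n. det (f n)) \<longlonglongrightarrow> det L" unfolding det_2 by (intro tendsto_diff tendsto_mult ent)
  then have "det L = 1" using fS(2) by (simp add: LIMSEQ_const_iff)
  have entS: "(\<lambda>n. f (Suc n) $ i $ j) \<longlonglongrightarrow> L $ i $ j" for i j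
    using LIMSEQ_Suc[OF ent[of i j]] .
  have "(\<lambda>n. adj2 (f n) ** f (Suc n)) \<longlonglongrightarrow> adj2 L ** L"
    unfolding matrix_mult_mat2 adj2_def mat2_nth
    by (intro tendsto_mat2 tendsto_add tendsto_mult tendsto_minus ent entS)
  then have "(\<lambda>n. adj2 (f n) ** f (Suc n)) \<longlonglongrightarrow> mat 1"
    by (simp add: adj2_mult \<open>det L = 1\<close>)
  moreover obtain T where T: "open T" "T \<inter> S = {mat 1}"
    using discreteD[OF discrete one] unfolding isolated_in_def by blast
  ultimately have "\<forall>\<^sub>F n in sequentially. adj2 (f n) ** f (Suc n) \<in> T"
    using topological_tendstoD by blast
  then obtain n0 where n0: "\<And>n. n \<ge> n0 \<Longrightarrow> adj2 (f n) ** f (Suc n) \<in> T"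
    unfolding eventually_sequentially by blast
  have step: "f (Suc n) = f n" if "n \<ge> n0" for n
  proof -
    have "adj2 (f n) ** f (Suc n) \<in> T \<inter> S" using n0[OF that] fS by (auto intro: mult inv)
    then have "f n ** (adj2 (f n) ** f (Suc n)) = f n ** mat 1" using T by simp
    then show ?thesis by (simp add: adj2_mult_cancel fS)
  qed
  have "f n = f n0" if "n \<ge> n0" for n
    using that by (induction rule: dec_induct) (simp_all add: step)
  then have "\<forall>\<^sub>F n in sequentially. f n = f n0" unfolding eventually_sequentially by blast
  then have "f \<longlonglongrightarrow> f n0" by (rule tendsto_eventually)
  then have "f n0 = L" using lim LIMSEQ_unique by blast
  then show False using f[of n0] by simp
qed

lemma mem_preimage_iff:
  assumes "\<Gamma> \<subseteq> carrier PSL2R"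
  shows "A \<in> \<Union>\<Gamma> \<longleftrightarrow> det A = 1 \<and> psl_of A \<in> \<Gamma>"
proof
  assume "A \<in> \<Union>\<Gamma>"
  then obtain g where g: "g \<in> \<Gamma>" "A \<in> g" by blast
  then obtain B where B: "g = psl_of B" "det B = 1"
    using assms by (auto simp: carrier_PSL2R SL2R_def)
  then have "A = B \<or> A = - B" using g by (simp add: psl_of_eq)
  then show "det A = 1 \<and> psl_of A \<in> \<Gamma>" using B g by (auto simp: psl_of_eq insert_commute det_uminus_2)
next
  assume "det A = 1 \<and> psl_of A \<in> \<Gamma>"
  then show "A \<in> \<Union>\<Gamma>" by (auto simp: psl_of_eq)
qed

lemma zonal_group_preimage:
  assumes "zonal_fuchsian \<Gamma>"
  shows "zonal_group (\<Union>\<Gamma>)"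
proof -
  have sub: "subgroup \<Gamma> PSL2R" and discrete: "discrete (\<Union>\<Gamma>)"
    and stab: "stab_infinity \<Gamma> = generate PSL2R {psl_of (mat2 1 1 0 1)}"
    using assms by (auto simp: zonal_fuchsian_def)
  note iff = mem_preimage_iff[OF subgroup.subset[OF sub]]
  have mult: "A ** B \<in> \<Union>\<Gamma>" if "A \<in> \<Union>\<Gamma>" "B \<in> \<Union>\<Gamma>" for A B
    using that subgroup.m_closed[OF sub, of "psl_of A" "psl_of B"] unfolding iff
    by (simp add: PSL2R_mult det_mul)
  have inv: "adj2 A \<in> \<Union>\<Gamma>" if "A \<in> \<Union>\<Gamma>" for A
    using that subgroup.m_inv_closed[OF sub, of "psl_of A"] unfolding iff by (simp add: PSL2R_inv)
  have one: "mat 1 \<in> \<Union>\<Gamma>" using subgroup.one_closed[OF sub] unfolding iff by (simp add: PSL2R_one)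
  have T: "translation 1 \<in> \<Union>\<Gamma>"
  proof -
    have "psl_of (mat2 1 1 0 1) \<in> stab_infinity \<Gamma>" unfolding stab by (rule generate.incl) simp
    then show ?thesis unfolding iff by (simp add: stab_infinity_def translation_def)
  qed
  have nat: "translation (int n) \<in> \<Union>\<Gamma>" for n
  proof (induction n)
    case 0
    then show ?case using one by (simp add: translation_def mat_1_mat2)
  next
    case (Suc n)
    then show ?case using mult[OF T Suc] by (simp add: translation_mult)
  qed
  have trans: "translation n \<in> \<Union>\<Gamma>" for n
  proof (cases n rule: int_cases2)
    case (nonpos k)
    have "adj2 (translation (int k)) = translation n" by (simp add: nonpos adj2_def translation_def)
    then show ?thesis using inv[OF nat[of k]] by simp
  qed (use nat in simp)
  have stabilizer: "\<exists>n. A = translation n \<or> A = - translation n" if A: "A \<in> \<Union>\<Gamma>" "A $ 2 $ 1 = 0" for A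
  proof -
    have "psl_of A \<in> stab_infinity \<Gamma>"
      using A unfolding iff by (simp add: stab_infinity_def psl_at_infinity_psl_of moebius_at_infinity_def)
    then obtain n where "psl_of A = psl_of (translation n)"
      unfolding stab using generate_translation by blast
    then show ?thesis by (auto simp: psl_of_eq doubleton_eq_iff)
  qed
  have neg: "- A \<in> \<Union>\<Gamma>" if "A \<in> \<Union>\<Gamma>" for A
    using that unfolding iff by (simp add: det_uminus_2 psl_of_eq insert_commute)
  have det: "det A = 1" if "A \<in> \<Union>\<Gamma>" for A
    using that unfolding iff by simp
  have fin: "finite {A \<in> \<Union>\<Gamma>. \<forall>i j. \<bar>A $ i $ j\<bar> \<le> R}" for R
    by (rule bounded_discrete_group_finite[OF det mult inv one discrete])
  show ?thesis
    by (rule zonal_group.intro[OF det mult inv neg trans stabilizer fin])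
qed

lemma orbit_eq:
  assumes "\<Gamma> \<subseteq> carrier PSL2R"
  shows "orbit \<Gamma> z = (\<lambda>A. moebius A z) ` \<Union>\<Gamma>"
proof -
  have g: "psl_act g = moebius A" if gA: "g \<in> \<Gamma>" "A \<in> g" for g A
  proof -
    obtain B where B: "g = psl_of B" using assms gA by (auto simp: carrier_PSL2R)
    then have "A = B \<or> A = - B" using gA by (simp add: psl_of_eq)
    then show ?thesis using B by (auto simp: psl_act_psl_of)
  qed
  have ne: "\<exists>A. A \<in> g" if "g \<in> \<Gamma>" for g
    using assms that by (auto simp: carrier_PSL2R psl_of_eq)
  show ?thesis
  proof (intro equalityI subsetI)
    fix w assume "w \<in> orbit \<Gamma> z"
    then obtain g where g': "g \<in> \<Gamma>" "w = psl_act g z" by (auto simp: orbit_def)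
    then obtain A where "A \<in> g" using ne by blast
    then show "w \<in> (\<lambda>A. moebius A z) ` \<Union>\<Gamma>" using g' g by auto
  next
    fix w assume "w \<in> (\<lambda>A. moebius A z) ` \<Union>\<Gamma>"
    then obtain g A where "g \<in> \<Gamma>" "A \<in> g" "w = moebius A z" by blast
    then show "w \<in> orbit \<Gamma> z" using g by (auto simp: orbit_def image_iff intro!: bexI[of _ g])
  qed
qed

context zonal_group
begin

lemma same_orbit_iff:
  assumes "Im z > 0"
  shows "(\<lambda>A. moebius A z) ` S = (\<lambda>A. moebius A w) ` S \<longleftrightarrow> (\<exists>A\<in>S. w = moebius A z)"
proof
  assume "(\<lambda>A. moebius A z) ` S = (\<lambda>A. moebius A w) ` S"
  moreover have "w \<in> (\<lambda>A. moebius A w) ` S" by (rule image_eqI[OF _ one_S]) simp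
  ultimately show "\<exists>A\<in>S. w = moebius A z" by auto
next
  assume "\<exists>A\<in>S. w = moebius A z"
  then obtain A where A: "A \<in> S" "w = moebius A z" by blast
  have m: "moebius B w = moebius (B ** A) z" for B
    unfolding A using moebius_mult[of A z B] den_nonzero[of A z] assms A det_S by simp
  show "(\<lambda>A. moebius A z) ` S = (\<lambda>A. moebius A w) ` S"
  proof (intro equalityI subsetI)
    fix v assume "v \<in> (\<lambda>A. moebius A z) ` S"
    then obtain B where B: "B \<in> S" "v = moebius B z" by blast
    have "v = moebius (B ** adj2 A) w"
      unfolding m B(2) by (simp add: matrix_mul_assoc[symmetric] adj2_mult det_S A)
    then show "v \<in> (\<lambda>A. moebius A w) ` S" using A B by (auto intro: mult_S inv_S)
  next
    fix v assume "v \<in> (\<lambda>A. moebius A w) ` S"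
    then obtain B where B: "B \<in> S" "v = moebius B w" by blast
    then show "v \<in> (\<lambda>A. moebius A z) ` S" using m mult_S A by blast
  qed
qed

text \<open>
  An element other than \<open>\<plusminus> mat 1\<close> has at most one fixed point in the upper half-plane, since its fixed points
  are roots of a real quadratic polynomial.  Orbits outside this countable set are free.
\<close>

lemma elliptic_fixed_points_countable:
  "countable {z. Im z > 0 \<and> (\<exists>C\<in>S. C \<noteq> mat 1 \<and> C \<noteq> - mat 1 \<and> moebius C z = z)}"
proof -
  have one: "\<exists>w. {z. Im z > 0 \<and> moebius C z = z} \<subseteq> {w}" if C: "C \<in> S" "C \<noteq> mat 1" "C \<noteq> - mat 1" for C
  proof -
    have "z = w" if zw: "Im z > 0" "moebius C z = z" "Im w > 0" "moebius C w = w" for z w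
    proof -
      have c: "C $ 2 $ 1 \<noteq> 0"
      proof
        assume "C $ 2 $ 1 = 0"
        then obtain n where n: "C = translation n \<or> C = - translation n" using stabilizer_S C by blast
        then have "z + of_int n = z" using zw by auto
        then have "n = 0" by simp
        then show False using n C by (auto simp: translation_def mat_1_mat2)
      qed
      have eqn: "of_real (C $ 1 $ 1) * v + of_real (C $ 1 $ 2) = v * (of_real (C $ 2 $ 1) * v + of_real (C $ 2 $ 2))"
        if "Im v > 0" "moebius C v = v" for v
        using that den_nonzero[of C v] det_S[OF C(1)] by (simp add: moebius_def den_def field_simps)
      have "(z - w) * (of_real (C $ 2 $ 1) * (z + w) + of_real (C $ 2 $ 2) - of_real (C $ 1 $ 1)) = 0"
      proof -
        have "(z - w) * (of_real (C $ 2 $ 1) * (z + w) + of_real (C $ 2 $ 2) - of_real (C $ 1 $ 1)) =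
          z * (of_real (C $ 2 $ 1) * z + of_real (C $ 2 $ 2)) - w * (of_real (C $ 2 $ 1) * w + of_real (C $ 2 $ 2))
          - of_real (C $ 1 $ 1) * (z - w)" by (simp add: algebra_simps)
        also have "\<dots> = 0"
          unfolding eqn[OF zw(1,2), symmetric] eqn[OF zw(3,4), symmetric] by (simp add: algebra_simps)
        finally show ?thesis .
      qed
      moreover have "of_real (C $ 2 $ 1) * (z + w) + of_real (C $ 2 $ 2) - of_real (C $ 1 $ 1) \<noteq> 0"
      proof
        assume "of_real (C $ 2 $ 1) * (z + w) + of_real (C $ 2 $ 2) - of_real (C $ 1 $ 1) = 0"
        then have "Im (of_real (C $ 2 $ 1) * (z + w) + of_real (C $ 2 $ 2) - of_real (C $ 1 $ 1)) = Im 0"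
          by (rule arg_cong)
        then show False using c zw by simp
      qed
      ultimately show "z = w" by simp
    qed
    then have uniq: "z = w" if "z \<in> {z. Im z > 0 \<and> moebius C z = z}" "w \<in> {z. Im z > 0 \<and> moebius C z = z}" for z w
      using that by blast
    show ?thesis
    proof (cases "{z. Im z > 0 \<and> moebius C z = z} = {}")
      case False
      then obtain w where "w \<in> {z. Im z > 0 \<and> moebius C z = z}" by blast
      then have "{z. Im z > 0 \<and> moebius C z = z} \<subseteq> {w}" using uniq by blast
      then show ?thesis by blast
    next
      case True
      show ?thesis unfolding True by simp
    qed
  qed
  have "countable {C \<in> S. C \<noteq> mat 1 \<and> C \<noteq> - mat 1}"
    by (rule countable_subset[OF _ countable_S]) auto
  moreover have "countable {z. Im z > 0 \<and> moebius C z = z}" if C: "C \<in> {C \<in> S. C \<noteq> mat 1 \<and> C \<noteq> - mat 1}" for C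
  proof -
    obtain w where "{z. Im z > 0 \<and> moebius C z = z} \<subseteq> {w}" using one[of C] C by blast
    then show ?thesis by (rule countable_subset) simp
  qed
  ultimately have "countable (\<Union>C\<in>{C \<in> S. C \<noteq> mat 1 \<and> C \<noteq> - mat 1}. {z. Im z > 0 \<and> moebius C z = z})"
    by (rule countable_UN)
  then show ?thesis by (rule countable_subset[rotated]) auto
qed

lemma covolume_domain_ford:
  assumes "emeasure hyperbolic_area ford < \<infinity>"
  shows "covolume_domain S ford_cone"
proof
  have "emeasure lborel ford_cone = ennreal (pi / 2) * emeasure hyperbolic_area ford"
    unfolding ford_cone_def using ford_upper by (intro emeasure_base) (auto simp: upper_half_plane_def)
  then show "emeasure lborel ford_cone < \<infinity>" using assms by (simp add: ennreal_mult_less_top)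
qed (use countable_S det_S mult_S inv_S ford_tiles in \<open>auto simp: ford_cone_def\<close>)

end

lemma sets_hyperbolic_area: "sets hyperbolic_area = {B \<in> sets borel. B \<subseteq> upper_half_plane}"
  unfolding hyperbolic_area_def by (auto simp: sets_restrict_space_iff)

lemma space_hyperbolic_area: "space hyperbolic_area = upper_half_plane"
  unfolding hyperbolic_area_def by (simp add: space_restrict_space)

text \<open>
  The total area is the largest area of a set that meets each orbit at most once.
\<close>

lemma orbifold_total_area:
  "emeasure (orbifold_area_measure \<Gamma>) (space (orbifold_area_measure \<Gamma>)) =
    (SUP B \<in> {B \<in> sets hyperbolic_area. inj_on (orbit \<Gamma>) B}. emeasure hyperbolic_area B)"
proof -
  have "{B \<in> sets hyperbolic_area. B \<subseteq> orbit \<Gamma> -` space (orbifold_area_measure \<Gamma>) \<and> inj_on (orbit \<Gamma>) B} =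
    {B \<in> sets hyperbolic_area. inj_on (orbit \<Gamma>) B}"
    using sets.sets_into_space[of _ hyperbolic_area]
    by (auto simp: orbifold_area_measure_def space_quotient_measure)
  then show ?thesis
    unfolding orbifold_area_measure_def by (subst emeasure_quotient_measure) auto
qed

text \<open>
  The Ford domain meets each orbit at most once, so its area is at most that of the orbifold and in
  particular finite.  Conversely, let \<open>B\<close> meet each orbit at most once.  Away from fixed points at most two
  elements of \<open>\<Union>\<Gamma>\<close> move a given matrix over \<open>B\<close>, and unfolding bounds the area of \<open>B\<close> by that of the Ford
  domain.  The factor \<open>pi / 2\<close> is the one between hyperbolic area and the measure of cones of matrices.
\<close>

lemma
  assumes \<Gamma>: "zonal_fuchsian \<Gamma>"
  shows covolume_domain_preimage: "covolume_domain (\<Union>\<Gamma>) (zonal_group.ford_cone (\<Union>\<Gamma>))"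
    and measure_ford_cone: "measure lborel (zonal_group.ford_cone (\<Union>\<Gamma>)) = pi / 2 * orbifold_area \<Gamma>"
    and measure_ford_cone_pos: "measure lborel (zonal_group.ford_cone (\<Union>\<Gamma>)) > 0"
proof -
  interpret zonal_group "\<Union>\<Gamma>" using zonal_group_preimage[OF \<Gamma>] .
  have carrier: "\<Gamma> \<subseteq> carrier PSL2R"
    using \<Gamma> subgroup.subset by (auto simp: zonal_fuchsian_def)
  note orb = orbit_eq[OF carrier]
  let ?total = "emeasure (orbifold_area_measure \<Gamma>) (space (orbifold_area_measure \<Gamma>))"
  have ford_sub: "ford \<subseteq> upper_half_plane" using ford_upper by (auto simp: upper_half_plane_def)
  have "inj_on (orbit \<Gamma>) ford"
  proof (rule inj_onI)
    fix z w assume zw: "z \<in> ford" "w \<in> ford" "orbit \<Gamma> z = orbit \<Gamma> w"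
    have "(\<lambda>A. moebius A z) ` \<Union>\<Gamma> = (\<lambda>A. moebius A w) ` \<Union>\<Gamma>" using zw(3) unfolding orb .
    from iffD1[OF same_orbit_iff[OF ford_upper[OF zw(1)]] this]
    obtain A where A: "A \<in> \<Union>\<Gamma>" "w = moebius A z" by (rule bexE)
    then have "A = mat 1 \<or> A = - mat 1" using ford_unique[OF zw(1) A(1)] zw(2) by simp
    then show "z = w" using A(2) by auto
  qed
  then have le: "emeasure hyperbolic_area ford \<le> ?total"
    unfolding orbifold_total_area using ford_sub by (intro SUP_upper) (simp add: sets_hyperbolic_area)
  moreover have "?total < \<infinity>" using \<Gamma> by (simp add: zonal_fuchsian_def)
  ultimately have fin: "emeasure hyperbolic_area ford < \<infinity>" by (rule le_less_trans)
  then show cov: "covolume_domain (\<Union>\<Gamma>) ford_cone" by (rule covolume_domain_ford)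
  then interpret covolume_domain "\<Union>\<Gamma>" ford_cone .
  have cone: "emeasure lborel ford_cone = ennreal (pi / 2) * emeasure hyperbolic_area ford"
    unfolding ford_cone_def by (intro emeasure_base ford_sub) simp
  have "emeasure hyperbolic_area B \<le> emeasure hyperbolic_area ford"
    if B: "B \<in> sets hyperbolic_area" "inj_on (orbit \<Gamma>) B" for B
  proof -
    have [measurable]: "B \<in> sets borel" and B_sub: "B \<subseteq> upper_half_plane"
      using B by (auto simp: sets_hyperbolic_area)
    let ?E = "{M \<in> unit_cone. base M \<in> B}"
    let ?Z = "{z. Im z > 0 \<and> (\<exists>C\<in>\<Union>\<Gamma>. C \<noteq> mat 1 \<and> C \<noteq> - mat 1 \<and> moebius C z = z)}"
    have [measurable]: "?E \<in> sets borel" by measurable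
    have "?Z \<in> null_sets lborel" by (rule countable_imp_null_set_lborel[OF elliptic_fixed_points_countable])
    then have gen: "AE M in lborel. M \<in> pos_det \<longrightarrow> (\<forall>A\<in>\<Union>\<Gamma>. base (A ** M) \<notin> ?Z)"
      by (rule AE_generic_base)
    \<comment> \<open>Compare the number of translates over \<open>B\<close> with the value \<open>2\<close> that it has for the Ford domain.\<close>
    have "2 * emeasure lborel ?E = 2 * (\<integral>\<^sup>+M. indicator ?E M \<partial>lborel)" by simp
    also have "\<dots> = (\<integral>\<^sup>+M. indicator ford_cone M * (\<integral>\<^sup>+A. indicator ?E (A ** M) \<partial>count_space (\<Union>\<Gamma>)) \<partial>lborel)"
      by (rule unfolding_formula[symmetric]) auto
    also have "\<dots> \<le> (\<integral>\<^sup>+M. 2 * indicator ford_cone M \<partial>lborel)"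
    proof (rule nn_integral_mono_AE, use gen in eventually_elim)
      case (elim M)
      show ?case
      proof (cases "M \<in> ford_cone")
        case True
        then have d: "det M > 0" and P: "M \<in> pos_det" by (auto simp: ford_cone_def unit_cone_def pos_det_def)
        let ?H = "{A \<in> \<Union>\<Gamma>. A ** M \<in> ?E}"
        have two: "A' = A \<or> A' = - A" if "A \<in> ?H" "A' \<in> ?H" for A A'
        proof -
          have AB: "A \<in> \<Union>\<Gamma>" "base (A ** M) \<in> B" "A' \<in> \<Union>\<Gamma>" "base (A' ** M) \<in> B" using that by auto
          have pos: "Im (base (A ** M)) > 0" "det (A ** M) > 0"
            using d det_S[OF AB(1)] by (auto simp: det_mul intro!: Im_base)
          define C where "C = A' ** adj2 A"
          have C: "C \<in> \<Union>\<Gamma>" unfolding C_def using AB by (intro mult_S inv_S)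
          have CA: "C ** A = A'" by (simp add: C_def matrix_mul_assoc[symmetric] adj2_mult det_S[OF AB(1)])
          have "C ** (A ** M) = A' ** M" using CA by (simp add: matrix_mul_assoc)
          then have bC: "base (A' ** M) = moebius C (base (A ** M))" using base_mult[OF pos(2), of C] by simp
          then have "orbit \<Gamma> (base (A ** M)) = orbit \<Gamma> (base (A' ** M))"
            unfolding orb by (intro iffD2[OF same_orbit_iff[OF pos(1)]] bexI[OF _ C])
          then have "base (A ** M) = base (A' ** M)" using B(2) AB by (auto dest: inj_onD)
          then have "moebius C (base (A ** M)) = base (A ** M)" using bC by simp
          then have "C = mat 1 \<or> C = - mat 1" using elim P AB(1) C pos(1) by blast
          then show ?thesis using CA by (auto simp: matrix_uminus_mult_left)
        qed
        have "(\<integral>\<^sup>+A. indicator ?E (A ** M) \<partial>count_space (\<Union>\<Gamma>)) = (\<integral>\<^sup>+A. indicator ?H A \<partial>count_space (\<Union>\<Gamma>))"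
          by (intro nn_integral_cong) (auto simp: indicator_def)
        also have "\<dots> = emeasure (count_space (\<Union>\<Gamma>)) ?H"
          by (rule nn_integral_indicator) auto
        also have "\<dots> \<le> 2"
        proof (cases "?H = {}")
          case False
          then obtain A where "A \<in> ?H" by blast
          then have sub: "?H \<subseteq> {A, - A}" using two by blast
          then have "card ?H \<le> card {A, - A}" "finite ?H" by (auto intro: card_mono finite_subset)
          moreover have "card {A, - A} \<le> 2" by (simp add: card_insert_if)
          ultimately have "card ?H \<le> 2" "finite ?H" by auto
          then have "emeasure (count_space (\<Union>\<Gamma>)) ?H = of_nat (card ?H)"
            by (subst emeasure_count_space) auto
          also have "\<dots> \<le> of_nat 2" using \<open>card ?H \<le> 2\<close> by (intro of_nat_mono)
          finally show ?thesis by simp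
        next
          case True
          show ?thesis unfolding True by simp
        qed
        finally show ?thesis using True by (simp add: indicator_def)
      qed simp
    qed
    also have "\<dots> = 2 * emeasure lborel ford_cone" by (subst nn_integral_cmult) simp_all
    finally have "emeasure lborel ?E \<le> emeasure lborel ford_cone"
      by (simp add: ennreal_mult_le_mult_iff)
    then show ?thesis
      unfolding cone emeasure_base[OF \<open>B \<in> sets borel\<close> B_sub] by (simp add: ennreal_mult_le_mult_iff)
  qed
  then have "?total \<le> emeasure hyperbolic_area ford"
    unfolding orbifold_total_area by (intro SUP_least) auto
  with le have "?total = emeasure hyperbolic_area ford" by (rule antisym[rotated])
  then show "measure lborel ford_cone = pi / 2 * orbifold_area \<Gamma>"
    by (simp add: measure_def cone orbifold_area_def enn2real_mult)
  have "emeasure lborel ford_cone \<noteq> 0"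
  proof
    assume 0: "emeasure lborel ford_cone = 0"
    then have "AE M in lborel. M \<notin> ford_cone" by (intro AE_not_in) (auto simp: null_sets_def)
    then have "(\<integral>\<^sup>+M. indicator ford_cone M * (\<integral>\<^sup>+A. indicator unit_cone (A ** M) \<partial>count_space (\<Union>\<Gamma>)) \<partial>lborel) =
        (\<integral>\<^sup>+(M::real^2^2). 0 \<partial>lborel)"
      by (intro nn_integral_cong_AE, eventually_elim) simp
    then have "2 * (\<integral>\<^sup>+M. indicator unit_cone M \<partial>lborel) = 0"
      by (subst unfolding_formula[symmetric]) auto
    then have "emeasure lborel unit_cone = 0" by simp
    then have "unit_cone \<in> null_sets lborel" by (simp add: null_sets_def)
    then have "negligible unit_cone" by (simp add: negligible_iff_null_sets null_sets_completionI)
    moreover have "open unit_cone"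
    proof -
      have "unit_cone = {M. 0 < det M} \<inter> {M. det M < 1}" by (auto simp: unit_cone_def)
      also have "open \<dots>"
        unfolding det_2 by (intro open_Int open_Collect_less continuous_intros)
      finally show ?thesis .
    qed
    moreover have "mat2 (1/2) 0 0 1 \<in> unit_cone" by (simp add: unit_cone_def)
    ultimately show False using open_not_negligible by blast
  qed
  then show "measure lborel ford_cone > 0"
    using D_finite by (simp add: measure_def enn2real_positive_iff less_top[symmetric] zero_less_iff_neq_zero)
qed


section \<open>Geodesic lines of the upper half-plane\<close>

text \<open>
  The image under \<open>M\<close> of the imaginary axis, parametrized by arc length.
\<close>

definition geodesic_of :: "real^2^2 \<Rightarrow> real \<Rightarrow> complex" where
  "geodesic_of M t = moebius M (of_real (exp t) * \<i>)"

lemma den_axis: "den M (of_real (exp t) * \<i>) = Complex (M $ 2 $ 2) (M $ 2 $ 1 * exp t)"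
  by (simp add: den_def complex_eq_iff)

lemma geodesic_of_mult: "det M > 0 \<Longrightarrow> geodesic_of (A ** M) t = moebius A (geodesic_of M t)"
  unfolding geodesic_of_def by (rule moebius_mult) (rule den_nonzero, simp_all)

lemma geodesic_of_upper: "det M > 0 \<Longrightarrow> Im (geodesic_of M t) > 0"
  unfolding geodesic_of_def by (rule moebius_upper) simp_all

lemma geodesic_of_uminus [simp]: "geodesic_of (- M) = geodesic_of M"
  by (simp add: geodesic_of_def fun_eq_iff)

lemma geodesic_of_0: "geodesic_of M 0 = base M"
  by (simp add: geodesic_of_def base_def)

lemma moebius_diff:
  assumes "den A z \<noteq> 0" "den A w \<noteq> 0"
  shows "moebius A z - moebius A w = of_real (det A) * (z - w) / (den A z * den A w)"
proof -
  have "moebius A z - moebius A w =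
      ((of_real (A $ 1 $ 1) * z + of_real (A $ 1 $ 2)) * den A w - (of_real (A $ 1 $ 1) * w + of_real (A $ 1 $ 2)) * den A z) /
      (den A z * den A w)"
    using assms unfolding moebius_def den_def by (subst diff_frac_eq) simp_all
  also have "(of_real (A $ 1 $ 1) * z + of_real (A $ 1 $ 2)) * den A w - (of_real (A $ 1 $ 1) * w + of_real (A $ 1 $ 2)) * den A z
      = of_real (det A) * (z - w)"
    by (simp add: den_def det_2 algebra_simps)
  finally show ?thesis .
qed

lemma hyperbolic_dist_moebius:
  assumes A: "det A > 0" and z: "Im z > 0" and w: "Im w > 0"
  shows "hyperbolic_dist (moebius A z) (moebius A w) = hyperbolic_dist z w"
proof -
  define p q where "p = cmod (den A z)" "q = cmod (den A w)"
  have d: "den A z \<noteq> 0" "den A w \<noteq> 0" using den_nonzero A z w by auto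
  then have pq: "p \<noteq> 0" "q \<noteq> 0" by (simp_all add: p_q_def)
  have "cmod (moebius A z - moebius A w) = det A * cmod (z - w) / (p * q)"
    using A by (simp add: moebius_diff[OF d] norm_divide norm_mult p_q_def)
  moreover have "(\<delta> * r / (p * q))\<^sup>2 / (2 * (\<delta> * x / p\<^sup>2) * (\<delta> * y / q\<^sup>2)) = r\<^sup>2 / (2 * x * y)"
    if "\<delta> \<noteq> 0" "x \<noteq> 0" "y \<noteq> 0" for \<delta> r x y :: real
    using that pq by (simp add: field_simps power2_eq_square)
  ultimately show ?thesis
    using A z w by (simp add: hyperbolic_dist_def Im_moebius p_q_def)
qed

lemma cosh_hyperbolic_dist:
  assumes "Im z > 0" "Im w > 0"
  shows "(cmod (z - w))\<^sup>2 + 2 * Im z * Im w = 2 * Im z * Im w * cosh (hyperbolic_dist z w)"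
proof -
  have "1 + (cmod (z - w))\<^sup>2 / (2 * Im z * Im w) \<ge> 1" using assms by simp
  then have "cosh (hyperbolic_dist z w) = 1 + (cmod (z - w))\<^sup>2 / (2 * Im z * Im w)"
    unfolding hyperbolic_dist_def by (rule cosh_arcosh_real)
  then show ?thesis using assms by (simp add: field_simps)
qed

lemma hyperbolic_dist_axis:
  "hyperbolic_dist (of_real (exp s) * \<i>) (of_real (exp t) * \<i>) = \<bar>s - t\<bar>"
proof -
  have "cmod (of_real (exp s) * \<i> - of_real (exp t) * \<i>) = \<bar>exp s - exp t\<bar>"
    by (metis left_diff_distrib norm_ii norm_mult norm_of_real of_real_diff mult.right_neutral)
  moreover have "1 + (exp s - exp t)\<^sup>2 / (2 * exp s * exp t) = cosh (s - t)"
    by (simp add: cosh_def exp_diff exp_minus field_simps power2_eq_square)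
  then have "1 + (exp s - exp t)\<^sup>2 / (2 * exp s * exp t) = cosh \<bar>s - t\<bar>"
    by (simp only: cosh_real_abs)
  ultimately have "hyperbolic_dist (of_real (exp s) * \<i>) (of_real (exp t) * \<i>) = arcosh (cosh \<bar>s - t\<bar>)"
    by (simp only: hyperbolic_dist_def power2_abs) simp
  then show ?thesis by (simp only: arcosh_cosh_real abs_ge_zero)
qed

lemma geodesic_line_geodesic_of: "det M > 0 \<Longrightarrow> geodesic_line (geodesic_of M)"
  unfolding geodesic_line_def
  by (auto simp: upper_half_plane_def geodesic_of_upper)
     (simp add: geodesic_of_def hyperbolic_dist_moebius hyperbolic_dist_axis)

lemma geodesic_line_moebius:
  assumes "geodesic_line \<gamma>" "det A > 0"
  shows "geodesic_line (\<lambda>t. moebius A (\<gamma> t))"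
  using assms by (auto simp: geodesic_line_def upper_half_plane_def moebius_upper hyperbolic_dist_moebius)

text \<open>
  The distance formula without \<^const>\<open>arcosh\<close>: a polynomial relation between any two points of a geodesic.
\<close>

lemma geodesic_line_eqn:
  assumes "geodesic_line \<gamma>"
  shows "(Re (\<gamma> t) - Re (\<gamma> s))\<^sup>2 + (Im (\<gamma> t) - Im (\<gamma> s))\<^sup>2 + 2 * Im (\<gamma> t) * Im (\<gamma> s) =
    2 * Im (\<gamma> t) * Im (\<gamma> s) * cosh (t - s)"
proof -
  have "Im (\<gamma> t) > 0" "Im (\<gamma> s) > 0" "hyperbolic_dist (\<gamma> t) (\<gamma> s) = \<bar>t - s\<bar>"
    using assms by (auto simp: geodesic_line_def upper_half_plane_def)
  with cosh_hyperbolic_dist[of "\<gamma> t" "\<gamma> s"] show ?thesis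
    by (simp add: cmod_power2 cosh_real_abs)
qed

text \<open>
  The relation between a point \<open>(x, y)\<close> of a geodesic and the point \<open>exp a * \<i>\<close> of the imaginary axis,
  with \<open>cosh\<close> expanded.
\<close>

lemma axis_unique:
  fixes x y t :: real
  assumes y: "y = exp t" and eq: "x\<^sup>2 + y\<^sup>2 + (exp a)\<^sup>2 = y * (exp t + (exp a)\<^sup>2 / exp t)"
  shows "x = 0"
proof -
  have "y * (exp t + (exp a)\<^sup>2 / exp t) = y\<^sup>2 + (exp a)\<^sup>2"
    by (simp add: y field_simps power2_eq_square)
  then have "x\<^sup>2 = 0" using eq by linarith
  then show ?thesis by simp
qed

lemma cosh_exp: "2 * y * exp a * cosh (t - a) = y * (exp t + (exp a)\<^sup>2 / exp t)" for y a t :: real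
  by (simp add: cosh_def exp_diff exp_minus field_simps power2_eq_square)

text \<open>
  Move the geodesic by the inverse of \<open>M\<close> to the imaginary axis.  The distances of \<open>\<gamma> t\<close> to the two common
  points determine first its height and then its real part.
\<close>

lemma geodesic_line_unique_two_points:
  assumes \<gamma>: "geodesic_line \<gamma>" and M: "det M = 1"
    and eq: "\<gamma> a = geodesic_of M a" "\<gamma> b = geodesic_of M b" and ab: "a \<noteq> b"
  shows "\<gamma> = geodesic_of M"
proof
  fix t
  define \<beta> where "\<beta> t = moebius (adj2 M) (\<gamma> t)" for t
  have \<beta>: "geodesic_line \<beta>" unfolding \<beta>_def by (rule geodesic_line_moebius[OF \<gamma>]) (simp add: M)
  have inv: "moebius (adj2 M) (geodesic_of M s) = of_real (exp s) * \<i>" for s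
  proof -
    have "moebius (adj2 M) (geodesic_of M s) = moebius (adj2 M ** M) (of_real (exp s) * \<i>)"
      unfolding geodesic_of_def by (rule moebius_mult[symmetric]) (rule den_nonzero, simp_all add: M)
    then show ?thesis by (simp add: adj2_mult M)
  qed
  have ends: "\<beta> a = of_real (exp a) * \<i>" "\<beta> b = of_real (exp b) * \<i>"
    by (simp_all add: \<beta>_def eq inv)
  define x y where "x = Re (\<beta> t)" "y = Im (\<beta> t)"
  have e: "x\<^sup>2 + y\<^sup>2 + (exp s)\<^sup>2 = y * (exp t + (exp s)\<^sup>2 / exp t)" if "\<beta> s = of_real (exp s) * \<i>" for s
  proof -
    have "x\<^sup>2 + (y - exp s)\<^sup>2 + 2 * y * exp s = 2 * y * exp s * cosh (t - s)"
      using geodesic_line_eqn[OF \<beta>, of t s] by (simp add: that x_y_def)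
    then show ?thesis unfolding cosh_exp by (simp add: power2_diff algebra_simps)
  qed
  have e': "(exp s)\<^sup>2 - y * ((exp s)\<^sup>2 / exp t) = y * exp t - x\<^sup>2 - y\<^sup>2" if "\<beta> s = of_real (exp s) * \<i>" for s
    using e[OF that] by (simp only: distrib_left)
  \<comment> \<open>Subtracting the relations for \<open>a\<close> and \<open>b\<close> eliminates \<open>x\<close>.\<close>
  have "((exp a)\<^sup>2 - (exp b)\<^sup>2) * (1 - y / exp t) =
      ((exp a)\<^sup>2 - y * ((exp a)\<^sup>2 / exp t)) - ((exp b)\<^sup>2 - y * ((exp b)\<^sup>2 / exp t))"
    by (simp add: algebra_simps)
  also have "\<dots> = 0" unfolding e'[OF ends(1)] e'[OF ends(2)] by simp
  finally have "((exp a)\<^sup>2 - (exp b)\<^sup>2) * (1 - y / exp t) = 0" .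
  moreover have "(exp a)\<^sup>2 - (exp b)\<^sup>2 \<noteq> 0"
    using ab by (simp flip: exp_double)
  ultimately have "1 - y / exp t = 0" by (metis mult_eq_0_iff)
  then have y: "y = exp t" by simp
  then have "x = 0" using axis_unique e[OF ends(1)] by blast
  then have "\<beta> t = of_real (exp t) * \<i>" using y by (simp add: complex_eq_iff x_y_def)
  moreover have "moebius M (\<beta> t) = \<gamma> t"
  proof -
    have "Im (\<gamma> t) > 0" using \<gamma> by (auto simp: geodesic_line_def upper_half_plane_def)
    then have "moebius M (\<beta> t) = moebius (M ** adj2 M) (\<gamma> t)"
      unfolding \<beta>_def by (intro moebius_mult[symmetric] den_nonzero) (simp_all add: M)
    then show ?thesis by (simp add: adj2_mult M)
  qed
  ultimately show "\<gamma> t = geodesic_of M t" by (simp add: geodesic_of_def)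
qed

lemma has_field_derivative_moebius:
  assumes "den A z \<noteq> 0"
  shows "(moebius A has_field_derivative of_real (det A) / (den A z)\<^sup>2) (at z)"
proof -
  have "((\<lambda>z. (of_real (A $ 1 $ 1) * z + of_real (A $ 1 $ 2)) / (of_real (A $ 2 $ 1) * z + of_real (A $ 2 $ 2)))
      has_field_derivative of_real (det A) / (den A z)\<^sup>2) (at z)"
    using assms unfolding den_def
    by (auto intro!: derivative_eq_intros simp: det_2 power2_eq_square algebra_simps)
  then show ?thesis unfolding moebius_def[abs_def] .
qed

lemma has_vector_derivative_geodesic_of:
  assumes "det M > 0"
  shows "(geodesic_of M has_vector_derivative
    of_real (det M) * (of_real (exp t) * \<i>) / (den M (of_real (exp t) * \<i>))\<^sup>2) (at t)"
proof -
  have 1: "((\<lambda>t. of_real (exp t) * \<i>) has_vector_derivative of_real (exp t) * \<i>) (at t)"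
    by (auto intro!: derivative_eq_intros has_vector_derivative_of_real simp flip: has_real_derivative_iff_has_vector_derivative)
  have "den M (of_real (exp t) * \<i>) \<noteq> 0" using assms by (intro den_nonzero) simp_all
  from field_vector_diff_chain_at[OF 1 has_field_derivative_moebius[OF this]]
  show ?thesis by (simp add: geodesic_of_def[abs_def] o_def mult.commute)
qed

text \<open>
  The direction of the image under \<open>M\<close> of the upward vertical vector at \<open>\<i>\<close>: the derivative of \<open>M\<close> at \<open>\<i>\<close> is
  \<open>det M / (den M \<i>)\<^sup>2\<close>.
\<close>

definition direction :: "real^2^2 \<Rightarrow> complex" where
  "direction M = (sgn (inverse (den M \<i>)))\<^sup>2 * \<i>"

definition tangent :: "real^2^2 \<Rightarrow> complex \<times> complex" where
  "tangent M = (base M, direction M)"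

lemma has_vector_derivative_geodesic_of_0:
  assumes M: "det M = 1"
  shows "(geodesic_of M has_vector_derivative Im (base M) *\<^sub>R direction M) (at 0)"
proof -
  let ?d = "den M \<i>"
  have d: "?d \<noteq> 0" using M by (intro den_nonzero) simp_all
  have "\<i> / ?d\<^sup>2 = Im (base M) *\<^sub>R direction M"
  proof -
    have "Im (base M) = 1 / (cmod ?d)\<^sup>2" by (simp add: base_def Im_moebius M)
    moreover have "(sgn (inverse ?d))\<^sup>2 = of_real ((cmod ?d)\<^sup>2) / ?d\<^sup>2"
    proof -
      have "sgn (inverse ?d) = of_real (cmod ?d) / ?d"
        by (simp only: sgn_div_norm norm_inverse inverse_inverse_eq scaleR_conv_of_real divide_inverse)
      then show ?thesis by (simp add: power_divide)
    qed
    ultimately have "Im (base M) *\<^sub>R direction M = of_real (1 / (cmod ?d)\<^sup>2) * (of_real ((cmod ?d)\<^sup>2) / ?d\<^sup>2 * \<i>)"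
      by (simp only: direction_def scaleR_conv_of_real)
    then show ?thesis using d by simp
  qed
  then show ?thesis using has_vector_derivative_geodesic_of[of M 0] M by simp
qed

text \<open>
  Comparing derivatives at \<open>0\<close> in the distance formula between \<open>\<beta> t\<close> and \<open>\<beta> s\<close> determines the height of
  \<open>\<beta> t\<close>; the distance to \<open>\<beta> 0\<close> then determines its real part.
\<close>

lemma geodesic_line_unique_vertical:
  assumes \<beta>: "geodesic_line \<beta>" and 0: "\<beta> 0 = \<i>" and deriv: "(\<beta> has_vector_derivative \<i>) (at 0)"
  shows "\<beta> t = of_real (exp t) * \<i>"
proof -
  define x y where "x = Re (\<beta> t)" "y = Im (\<beta> t)"
  have re: "((\<lambda>s. Re (\<beta> s)) has_real_derivative 0) (at 0)"
    using bounded_linear.has_vector_derivative[OF bounded_linear_Re deriv] by (simp add: has_real_derivative_iff_has_vector_derivative)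
  have im: "((\<lambda>s. Im (\<beta> s)) has_real_derivative 1) (at 0)"
    using bounded_linear.has_vector_derivative[OF bounded_linear_Im deriv] by (simp add: has_real_derivative_iff_has_vector_derivative)
  have lhs: "((\<lambda>s. (x - Re (\<beta> s))\<^sup>2 + (y - Im (\<beta> s))\<^sup>2 + 2 * y * Im (\<beta> s)) has_real_derivative 2) (at 0)"
  proof -
    have "((\<lambda>s. (x - f s)\<^sup>2 + (y - g s)\<^sup>2 + 2 * y * g s) has_real_derivative 2) (at 0)"
      if "(f has_real_derivative 0) (at 0)" "(g has_real_derivative 1) (at 0)" "f 0 = 0" "g 0 = 1" for f g :: "real \<Rightarrow> real"
      by (auto intro!: derivative_eq_intros that(1,2) simp: that(3,4))
    from this[OF re im] show ?thesis by (simp add: 0)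
  qed
  have rhs: "((\<lambda>s. 2 * y * Im (\<beta> s) * cosh (t - s)) has_real_derivative 2 * y * (cosh t - sinh t)) (at 0)"
  proof -
    have "((\<lambda>s. 2 * y * g s * cosh (t - s)) has_real_derivative 2 * y * (cosh t - sinh t)) (at 0)"
      if "(g has_real_derivative 1) (at 0)" "g 0 = 1" for g :: "real \<Rightarrow> real"
      by (auto intro!: derivative_eq_intros that(1) simp: that(2) algebra_simps)
    from this[OF im] show ?thesis by (simp add: 0)
  qed
  have "(\<lambda>s. (x - Re (\<beta> s))\<^sup>2 + (y - Im (\<beta> s))\<^sup>2 + 2 * y * Im (\<beta> s)) = (\<lambda>s. 2 * y * Im (\<beta> s) * cosh (t - s))"
    using geodesic_line_eqn[OF \<beta>, of t] by (auto simp: x_y_def)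
  then have "2 = 2 * y * (cosh t - sinh t)" using DERIV_unique[OF lhs] rhs by simp
  then have "y * exp (- t) = 1" by (simp add: cosh_minus_sinh)
  then have y: "y = exp t" by (simp add: exp_minus field_simps)
  have "x\<^sup>2 + y\<^sup>2 + (exp 0)\<^sup>2 = y * (exp t + (exp 0)\<^sup>2 / exp t)"
    using geodesic_line_eqn[OF \<beta>, of t 0] cosh_exp[of y 0 t]
    by (simp add: 0 x_y_def[symmetric] power2_diff algebra_simps)
  then have "x = 0" using axis_unique[OF y] by blast
  then show ?thesis using y by (simp add: complex_eq_iff x_y_def)
qed

text \<open>
  Existence is the explicit geodesic.  For uniqueness, the inverse of \<open>M\<close> reduces to the upward vertical
  vector at \<open>\<i>\<close>.
\<close>

lemma geodesic_from_tangent: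
  assumes M: "det M = 1"
  shows "geodesic_from (tangent M) = geodesic_of M"
  unfolding geodesic_from_def tangent_def prod.case
proof (rule the_equality)
  show "geodesic_line (geodesic_of M) \<and> geodesic_of M 0 = base M \<and>
      (geodesic_of M has_vector_derivative Im (base M) *\<^sub>R direction M) (at 0)"
    using M by (simp add: geodesic_line_geodesic_of geodesic_of_0 has_vector_derivative_geodesic_of_0)
next
  fix \<gamma> assume \<gamma>: "geodesic_line \<gamma> \<and> \<gamma> 0 = base M \<and> (\<gamma> has_vector_derivative Im (base M) *\<^sub>R direction M) (at 0)"
  define \<beta> where "\<beta> t = moebius (adj2 M) (\<gamma> t)" for t
  have inv: "moebius (adj2 M) (geodesic_of M s) = of_real (exp s) * \<i>" for s
  proof -
    have "moebius (adj2 M) (geodesic_of M s) = moebius (adj2 M ** M) (of_real (exp s) * \<i>)"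
      unfolding geodesic_of_def by (rule moebius_mult[symmetric]) (rule den_nonzero, simp_all add: M)
    then show ?thesis by (simp add: adj2_mult M)
  qed
  have dn: "den (adj2 M) (base M) \<noteq> 0" using M Im_base[of M] by (intro den_nonzero) simp_all
  note D = has_field_derivative_moebius[OF dn]
  have c1: "((moebius (adj2 M) \<circ> geodesic_of M) has_vector_derivative
      (Im (base M) *\<^sub>R direction M) * (of_real (det (adj2 M)) / (den (adj2 M) (base M))\<^sup>2)) (at 0)"
    by (rule field_vector_diff_chain_at[OF has_vector_derivative_geodesic_of_0[OF M]]) (simp only: geodesic_of_0 D)
  have c2: "((moebius (adj2 M) \<circ> \<gamma>) has_vector_derivative
      (Im (base M) *\<^sub>R direction M) * (of_real (det (adj2 M)) / (den (adj2 M) (base M))\<^sup>2)) (at 0)"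
    by (rule field_vector_diff_chain_at) (use \<gamma> D in auto)
  have "(moebius (adj2 M) \<circ> geodesic_of M) = (\<lambda>s. of_real (exp s) * \<i>)" by (simp add: o_def inv)
  moreover have "((\<lambda>s. of_real (exp s) * \<i>) has_vector_derivative of_real (exp 0) * \<i>) (at 0)"
    by (auto intro!: derivative_eq_intros has_vector_derivative_of_real simp flip: has_real_derivative_iff_has_vector_derivative)
  ultimately have "(Im (base M) *\<^sub>R direction M) * (of_real (det (adj2 M)) / (den (adj2 M) (base M))\<^sup>2) = of_real (exp 0) * \<i>"
    using c1 vector_derivative_unique_at by metis
  then have "((moebius (adj2 M) \<circ> \<gamma>) has_vector_derivative \<i>) (at 0)" using c2 by simp
  then have "(\<beta> has_vector_derivative \<i>) (at 0)" by (simp add: \<beta>_def[abs_def] o_def)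
  moreover have "geodesic_line \<beta>" unfolding \<beta>_def using \<gamma> M by (intro geodesic_line_moebius) auto
  moreover have "\<beta> 0 = \<i>" using \<gamma> inv[of 0] by (simp add: \<beta>_def geodesic_of_0)
  ultimately have \<beta>: "\<beta> t = of_real (exp t) * \<i>" for t by (intro geodesic_line_unique_vertical)
  show "\<gamma> = geodesic_of M"
  proof
    fix t
    have "Im (\<gamma> t) > 0" using \<gamma> by (auto simp: geodesic_line_def upper_half_plane_def)
    then have "moebius M (\<beta> t) = moebius (M ** adj2 M) (\<gamma> t)"
      unfolding \<beta>_def by (intro moebius_mult[symmetric] den_nonzero) (simp_all add: M)
    then show "\<gamma> t = geodesic_of M t" by (simp add: adj2_mult M \<beta> geodesic_of_def)
  qed
qed

lemma tangent_act_tangent: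
  assumes "det A = 1" "det M > 0"
  shows "tangent_act (psl_of A) (tangent M) = tangent (A ** M)"
proof -
  have d: "den A (base M) \<noteq> 0" "den M \<i> \<noteq> 0"
    using assms Im_base[of M] den_nonzero[of A "base M"] den_nonzero[of M \<i>] by auto
  have "deriv (moebius A) (base M) = 1 / (den A (base M))\<^sup>2"
    using has_field_derivative_moebius[OF d(1)] assms(1) by (simp add: DERIV_imp_deriv)
  then have "sgn (deriv (moebius A) (base M)) * direction M = direction (A ** M)"
    unfolding direction_def den_mult[OF d(2)] base_def[symmetric]
    by (simp add: sgn_mult power2_eq_square divide_inverse mult_ac)
  then show ?thesis
    using assms by (simp add: tangent_def tangent_act_def psl_act_psl_of base_mult)
qed

text \<open>
  The height at time \<open>s\<close> is \<open>exp s / (d\<^sup>2 + c\<^sup>2 * exp (2 * s))\<close>; it is stationary only at the peak, where its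
  value is \<open>1 / (2 * \<bar>c * d\<bar>)\<close>.
\<close>

lemma geodesic_tangency:
  assumes M: "det M = 1"
  shows "tangent_to_horocycle (geodesic_of M) m s \<longleftrightarrow>
    M $ 2 $ 1 \<noteq> 0 \<and> M $ 2 $ 2 \<noteq> 0 \<and> s = peak M \<and> m = 1 / (2 * \<bar>M $ 2 $ 1 * M $ 2 $ 2\<bar>)"
proof -
  define c d where "c = M $ 2 $ 1" "d = M $ 2 $ 2"
  define E where "E = exp s"
  have E: "E > 0" by (simp add: E_def)
  have cd: "c \<noteq> 0 \<or> d \<noteq> 0" using M by (auto simp: det_2 c_d_def)
  have front: "frontier (horodisk m) = {z. Im z = m}"
  proof -
    have "horodisk m = {z. \<i> \<bullet> z > m}" by (simp add: horodisk_def inner_complex_def)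
    then show ?thesis
      using frontier_halfspace_gt[of \<i> m] by (simp add: inner_complex_def)
  qed
  have Im: "Im (geodesic_of M s) = E / (d\<^sup>2 + (c * E)\<^sup>2)"
    by (simp add: geodesic_of_def Im_moebius M den_axis cmod_power2 c_d_def E_def)
  have "vector_derivative (geodesic_of M) (at s) = of_real E * \<i> / (Complex d (c * E))\<^sup>2"
    using vector_derivative_at[OF has_vector_derivative_geodesic_of[of M s]] M by (simp only: den_axis c_d_def E_def) simp
  moreover have "Im (of_real E * \<i> / (Complex d (c * E))\<^sup>2) = 0 \<longleftrightarrow> d\<^sup>2 = (c * E)\<^sup>2"
  proof -
    define w where "w = Complex d (c * E)"
    have w: "w \<noteq> 0" using cd E by (auto simp: w_def complex_eq_iff)
    have "w\<^sup>2 = Complex (d\<^sup>2 - (c * E)\<^sup>2) (2 * d * (c * E))" by (simp add: w_def complex_eq_iff power2_eq_square)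
    then have "Re (w\<^sup>2) = d\<^sup>2 - (c * E)\<^sup>2" by simp
    moreover have "Im (of_real E * \<i> / w\<^sup>2) = E * Re (w\<^sup>2) / (cmod (w\<^sup>2))\<^sup>2"
      by (simp add: Im_divide cmod_power2)
    ultimately show ?thesis using E w unfolding w_def[symmetric] by simp
  qed
  ultimately have deriv: "Im (vector_derivative (geodesic_of M) (at s)) = 0 \<longleftrightarrow> d\<^sup>2 = (c * E)\<^sup>2" by simp
  have pk: "d\<^sup>2 = (c * E)\<^sup>2 \<longleftrightarrow> c \<noteq> 0 \<and> d \<noteq> 0 \<and> s = peak M"
  proof -
    have "d\<^sup>2 = (c * E)\<^sup>2 \<longleftrightarrow> \<bar>d\<bar> = \<bar>c\<bar> * E"
      using E by (metis abs_mult abs_of_pos power2_eq_iff_nonneg abs_ge_zero power2_abs)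
    also have "\<dots> \<longleftrightarrow> c \<noteq> 0 \<and> d \<noteq> 0 \<and> \<bar>d / c\<bar> = E"
      using cd E by (auto simp: abs_divide field_simps)
    also have "\<dots> \<longleftrightarrow> c \<noteq> 0 \<and> d \<noteq> 0 \<and> s = peak M"
      unfolding peak_def c_d_def[symmetric] E_def by (metis divide_eq_0_iff exp_ln ln_exp zero_less_abs_iff)
    finally show ?thesis .
  qed
  have height: "E / (d\<^sup>2 + (c * E)\<^sup>2) = 1 / (2 * \<bar>c * d\<bar>)" if "d\<^sup>2 = (c * E)\<^sup>2"
  proof -
    have "\<bar>d\<bar> = \<bar>c\<bar> * E"
      using that E by (metis abs_mult abs_of_pos power2_eq_iff_nonneg abs_ge_zero power2_abs)
    then have "2 * \<bar>c * d\<bar> = 2 * c\<^sup>2 * E" by (simp add: abs_mult power2_eq_square)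
    moreover have "d\<^sup>2 + (c * E)\<^sup>2 = 2 * c\<^sup>2 * E * E" using that by (simp add: power2_eq_square)
    ultimately show ?thesis using E by simp
  qed
  show ?thesis
    unfolding tangent_to_horocycle_def front deriv mem_Collect_eq Im c_d_def[symmetric]
    using pk height by auto
qed

lemma geodesic_endpoints:
  assumes M: "det M = 1" and c: "M $ 2 $ 1 \<noteq> 0" and d: "M $ 2 $ 2 \<noteq> 0"
  shows "(geodesic_of M \<longlongrightarrow> of_real (M $ 1 $ 1 / M $ 2 $ 1)) at_top"
    and "(geodesic_of M \<longlongrightarrow> of_real (M $ 1 $ 2 / M $ 2 $ 2)) at_bot"
proof -
  have g: "geodesic_of M t = (of_real (M $ 1 $ 1) * (of_real (exp t) * \<i>) + of_real (M $ 1 $ 2)) /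
      (of_real (M $ 2 $ 1) * (of_real (exp t) * \<i>) + of_real (M $ 2 $ 2))" for t
    by (simp add: geodesic_of_def moebius_def)
  have bot: "((\<lambda>t. complex_of_real (exp t)) \<longlongrightarrow> of_real 0) at_bot"
    by (intro tendsto_of_real exp_at_bot)
  have "((\<lambda>t. (of_real (M $ 1 $ 1) * (of_real (exp t) * \<i>) + of_real (M $ 1 $ 2)) /
      (of_real (M $ 2 $ 1) * (of_real (exp t) * \<i>) + of_real (M $ 2 $ 2))) \<longlongrightarrow>
      (of_real (M $ 1 $ 1) * (of_real 0 * \<i>) + of_real (M $ 1 $ 2)) /
      (of_real (M $ 2 $ 1) * (of_real 0 * \<i>) + complex_of_real (M $ 2 $ 2))) at_bot"
    using d by (intro tendsto_intros bot) simp
  then show "(geodesic_of M \<longlongrightarrow> of_real (M $ 1 $ 2 / M $ 2 $ 2)) at_bot"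
    unfolding g[abs_def] by simp
  have top: "((\<lambda>t. complex_of_real (exp (- t))) \<longlongrightarrow> of_real 0) at_top"
    by (intro tendsto_of_real) real_asymp
  have g': "geodesic_of M t = (of_real (M $ 1 $ 1) * \<i> + of_real (M $ 1 $ 2) * of_real (exp (- t))) /
      (of_real (M $ 2 $ 1) * \<i> + of_real (M $ 2 $ 2) * of_real (exp (- t)))" for t
  proof -
    define e where "e = complex_of_real (exp t)"
    have e: "e \<noteq> 0" "complex_of_real (exp (- t)) = 1 / e"
      by (simp_all add: e_def exp_minus field_simps)
    have "(of_real (M $ 1 $ 1) * \<i> + of_real (M $ 1 $ 2) * (1 / e)) /
      (of_real (M $ 2 $ 1) * \<i> + of_real (M $ 2 $ 2) * (1 / e)) =
      (e * (of_real (M $ 1 $ 1) * \<i> + of_real (M $ 1 $ 2) * (1 / e))) /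
      (e * (of_real (M $ 2 $ 1) * \<i> + of_real (M $ 2 $ 2) * (1 / e)))" using e by simp
    also have "\<dots> = geodesic_of M t"
    proof -
      have "e * (of_real p * \<i> + of_real q * (1 / e)) = of_real p * (e * \<i>) + of_real q" for p q
        using e by (simp add: distrib_left)
      then show ?thesis unfolding g e_def[symmetric] by simp
    qed
    finally show ?thesis by (simp add: e)
  qed
  have "((\<lambda>t. (of_real (M $ 1 $ 1) * \<i> + of_real (M $ 1 $ 2) * of_real (exp (- t))) /
      (of_real (M $ 2 $ 1) * \<i> + of_real (M $ 2 $ 2) * of_real (exp (- t)))) \<longlongrightarrow>
      (of_real (M $ 1 $ 1) * \<i> + of_real (M $ 1 $ 2) * of_real 0) /
      (of_real (M $ 2 $ 1) * \<i> + complex_of_real (M $ 2 $ 2) * of_real 0)) at_top"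
    using c by (intro tendsto_intros top) simp
  then show "(geodesic_of M \<longlongrightarrow> of_real (M $ 1 $ 1 / M $ 2 $ 1)) at_top"
    unfolding g'[abs_def] using c by simp
qed

lemma endpoints_in_geodesic_of:
  assumes M: "det M = 1" and c: "M $ 2 $ 1 \<noteq> 0" and d: "M $ 2 $ 2 \<noteq> 0"
  shows "endpoints_in (geodesic_of M) X \<longleftrightarrow> M \<in> window X"
proof -
  note l = geodesic_endpoints[OF assms]
  show ?thesis
  proof
    assume "endpoints_in (geodesic_of M) X"
    then obtain x y where xy: "(x, y) \<in> X" "(geodesic_of M \<longlongrightarrow> of_real x) at_top" "(geodesic_of M \<longlongrightarrow> of_real y) at_bot"
      unfolding endpoints_in_def by blast
    have "complex_of_real x = of_real (M $ 1 $ 1 / M $ 2 $ 1)"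
      by (rule tendsto_unique[OF _ xy(2) l(1)]) simp
    moreover have "complex_of_real y = of_real (M $ 1 $ 2 / M $ 2 $ 2)"
      by (rule tendsto_unique[OF _ xy(3) l(2)]) simp
    ultimately have "x = M $ 1 $ 1 / M $ 2 $ 1" "y = M $ 1 $ 2 / M $ 2 $ 2"
      by (simp_all only: of_real_eq_iff)
    then show "M \<in> window X" using xy(1) c d by (simp add: window_def)
  next
    assume "M \<in> window X"
    then have "(M $ 1 $ 1 / M $ 2 $ 1, M $ 1 $ 2 / M $ 2 $ 2) \<in> X" by (simp add: window_def)
    then show "endpoints_in (geodesic_of M) X"
      unfolding endpoints_in_def using l by blast
  qed
qed


section \<open>Excursions as crossings\<close>

lemma translation_entries:
  fixes N :: "real^2^2"
  shows
  "(translation n ** N) $ 1 $ 1 = N $ 1 $ 1 + of_int n * N $ 2 $ 1"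
  "(translation n ** N) $ 1 $ 2 = N $ 1 $ 2 + of_int n * N $ 2 $ 2"
  "(translation n ** N) $ 2 $ 1 = N $ 2 $ 1" "(translation n ** N) $ 2 $ 2 = N $ 2 $ 2"
  by (simp_all add: translation_def)

lemma peak_translation: "peak (translation n ** N) = peak N"
  by (simp only: peak_def translation_entries)

lemma peak_uminus: "peak (- N) = peak N"
  by (simp add: peak_def)

lemma window_uminus: "- N \<in> window R \<longleftrightarrow> N \<in> window R"
  by (simp add: window_def)

lemma window_translation:
  "translation n ** N \<in> window R \<longleftrightarrow> N $ 2 $ 1 \<noteq> 0 \<and> N $ 2 $ 2 \<noteq> 0 \<and>
    (N $ 1 $ 1 / N $ 2 $ 1 + of_int n, N $ 1 $ 2 / N $ 2 $ 2 + of_int n) \<in> R"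
  unfolding window_def mem_Collect_eq translation_entries by (auto simp: add_divide_distrib)

text \<open>
  The forward endpoint is confined to \<open>{-1<..<1}\<close> without \<open>0\<close>, so that only \<open>n = \<plusminus>1\<close> would be possible
  otherwise; but then the backward endpoint is on the wrong side of \<open>0\<close>.
\<close>

lemma window_region_J_unique:
  assumes "N \<in> window region_J" "translation n ** N \<in> window region_J"
  shows "n = 0"
proof -
  define x y where "x = N $ 1 $ 1 / N $ 2 $ 1" "y = N $ 1 $ 2 / N $ 2 $ 2"
  have xy: "(x, y) \<in> region_J" "(x + of_int n, y + of_int n) \<in> region_J"
    using assms by (auto simp: window_translation x_y_def) (simp add: window_def)
  then have "\<bar>real_of_int n\<bar> < 2" by (auto simp: region_J_def)
  then have "n = -1 \<or> n = 0 \<or> n = 1" by linarith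
  then show ?thesis using xy by (auto simp: region_J_def)
qed

lemma endpoint_distance:
  fixes N :: "real^2^2"
  assumes "det N = 1" "N $ 2 $ 1 \<noteq> 0" "N $ 2 $ 2 \<noteq> 0"
  shows "\<bar>N $ 1 $ 1 / N $ 2 $ 1 - N $ 1 $ 2 / N $ 2 $ 2\<bar> = 1 / \<bar>N $ 2 $ 1 * N $ 2 $ 2\<bar>"
proof -
  have "N $ 1 $ 1 / N $ 2 $ 1 - N $ 1 $ 2 / N $ 2 $ 2 = det N / (N $ 2 $ 1 * N $ 2 $ 2)"
    using assms(2,3) by (simp add: det_2 field_simps)
  then show ?thesis using assms(1) by (simp add: abs_divide)
qed

lemma window_deep_iff:
  assumes "det N = 1" "k > 0"
  shows "N \<in> window (R \<inter> deep_pairs k) \<longleftrightarrow> N \<in> window R \<and> 2 * \<bar>N $ 2 $ 1 * N $ 2 $ 2\<bar> < k"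
proof (cases "N $ 2 $ 1 \<noteq> 0 \<and> N $ 2 $ 2 \<noteq> 0")
  case True
  then have "\<bar>N $ 2 $ 1 * N $ 2 $ 2\<bar> > 0" by simp
  then have "2 / k < 1 / \<bar>N $ 2 $ 1 * N $ 2 $ 2\<bar> \<longleftrightarrow> 2 * \<bar>N $ 2 $ 1 * N $ 2 $ 2\<bar> < k"
    using assms(2) by (simp add: divide_simps)
  then show ?thesis
    using True endpoint_distance[OF assms(1)] by (simp add: window_def deep_pairs_def)
qed (auto simp: window_def)

text \<open>
  Endpoints at distance greater than \<open>1\<close> lie on different sides of an integer next to \<open>x\<close>; translate this
  integer to \<open>0\<close>.  This is where the bound \<open>2\<close> for the depth comes from.
\<close>

lemma window_region_J_exists:
  assumes "det N = 1" and c: "N $ 2 $ 1 \<noteq> 0" and d: "N $ 2 $ 2 \<noteq> 0"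
    and nonint: "\<And>n. N $ 1 $ 1 / N $ 2 $ 1 \<noteq> of_int n" and deep: "2 * \<bar>N $ 2 $ 1 * N $ 2 $ 2\<bar> < 2"
  shows "\<exists>n. translation n ** N \<in> window region_J"
proof -
  define x y where "x = N $ 1 $ 1 / N $ 2 $ 1" "y = N $ 1 $ 2 / N $ 2 $ 2"
  have "1 / \<bar>N $ 2 $ 1 * N $ 2 $ 2\<bar> > 1" using c d deep by simp
  then have far: "\<bar>x - y\<bar> > 1" using endpoint_distance[OF assms(1) c d] by (simp add: x_y_def)
  have x: "of_int \<lfloor>x\<rfloor> < x" "x < of_int \<lfloor>x\<rfloor> + 1"
  proof -
    have "x \<noteq> of_int \<lfloor>x\<rfloor>" using nonint[of "\<lfloor>x\<rfloor>"] by (simp add: x_y_def)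
    then show "of_int \<lfloor>x\<rfloor> < x" using of_int_floor_le[of x] by linarith
    show "x < of_int \<lfloor>x\<rfloor> + 1" by linarith
  qed
  show ?thesis
  proof (cases "y > x")
    case True
    have "real_of_int (- \<lfloor>x\<rfloor> - 1) = - of_int \<lfloor>x\<rfloor> - 1" by simp
    then have "- 1 < x + of_int (- \<lfloor>x\<rfloor> - 1)" "x + of_int (- \<lfloor>x\<rfloor> - 1) < 0" "0 < y + of_int (- \<lfloor>x\<rfloor> - 1)"
      using far x True by linarith+
    then have "(x + of_int (- \<lfloor>x\<rfloor> - 1), y + of_int (- \<lfloor>x\<rfloor> - 1)) \<in> region_J"
      unfolding region_J_def by (simp del: of_int_diff of_int_minus)
    then show ?thesis using c d unfolding x_y_def[symmetric] window_translation by blast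
  next
    case False
    have "real_of_int (- \<lfloor>x\<rfloor>) = - of_int \<lfloor>x\<rfloor>" by simp
    then have "0 < x + of_int (- \<lfloor>x\<rfloor>)" "x + of_int (- \<lfloor>x\<rfloor>) < 1" "y + of_int (- \<lfloor>x\<rfloor>) < 0"
      using far x False by linarith+
    then have "(x + of_int (- \<lfloor>x\<rfloor>), y + of_int (- \<lfloor>x\<rfloor>)) \<in> region_J"
      unfolding region_J_def by (simp del: of_int_diff of_int_minus)
    then show ?thesis using c d unfolding x_y_def[symmetric] window_translation by blast
  qed
qed

lemma AE_matrix_entry_nonzero:
  "AE N in lborel. (N :: real^2^2) $ 2 $ 1 \<noteq> 0" "AE N in lborel. (N :: real^2^2) $ 2 $ 2 \<noteq> 0"
proof -
  have nz: "AE x in lborel. x \<noteq> (0::real)" by (rule AE_lborel_singleton)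
  show "AE N in lborel. (N :: real^2^2) $ 2 $ 1 \<noteq> 0"
  proof (rule AE_matrix2I)
    show "AE c in lborel. AE d in lborel. AE a in lborel. AE b in lborel. mat2 a b c d $ 2 $ 1 \<noteq> 0"
      using nz by eventually_elim simp
  qed measurable
  show "AE N in lborel. (N :: real^2^2) $ 2 $ 2 \<noteq> 0"
  proof (rule AE_matrix2I)
    show "AE c in lborel. AE d in lborel. AE a in lborel. AE b in lborel. mat2 a b c d $ 2 $ 2 \<noteq> 0"
      by (rule AE_I2, use nz in eventually_elim) simp
  qed measurable
qed

lemma AE_endpoint_nonint:
  "AE N in lborel. \<forall>n. (N :: real^2^2) $ 2 $ 1 \<noteq> 0 \<longrightarrow> N $ 1 $ 1 / N $ 2 $ 1 \<noteq> of_int n"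
proof (rule AE_matrix2I, measurable, rule AE_I2, rule AE_I2)
  fix c d :: real
  have "AE a in lborel. \<forall>n. c \<noteq> 0 \<longrightarrow> a / c \<noteq> of_int n"
    unfolding AE_all_countable
  proof
    fix n
    show "AE a in lborel. c \<noteq> 0 \<longrightarrow> a / c \<noteq> of_int n"
      using AE_lborel_singleton[of "of_int n * c"] by eventually_elim (auto simp: field_simps)
  qed
  then show "AE a in lborel. AE b in lborel. \<forall>n. mat2 a b c d $ 2 $ 1 \<noteq> 0 \<longrightarrow>
      mat2 a b c d $ 1 $ 1 / mat2 a b c d $ 2 $ 1 \<noteq> of_int n"
    by eventually_elim simp
qed

text \<open>
  Equality of the peaks means that the ratios \<open>d / c\<close> of the two lower rows agree up to sign.  They cannot be
  equal, because then \<open>C $ 2 $ 1 * det N\<close> would vanish.  If they are opposite, then \<open>N\<close> is a zero of the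
  polynomial \<open>p\<close>, which is of degree one in the upper right entry of \<open>N\<close>.
\<close>

lemma AE_peak_neq:
  assumes C: "C $ 2 $ 1 \<noteq> 0"
  shows "AE N in lborel. N \<in> pos_det \<longrightarrow> N $ 2 $ 1 \<noteq> 0 \<longrightarrow> N $ 2 $ 2 \<noteq> 0 \<longrightarrow>
    (C ** N) $ 2 $ 1 \<noteq> 0 \<longrightarrow> (C ** N) $ 2 $ 2 \<noteq> 0 \<longrightarrow> peak (C ** N) \<noteq> peak N"
proof -
  define p where "p N = C $ 2 $ 1 * (N $ 2 $ 1 * N $ 1 $ 2 + N $ 2 $ 2 * N $ 1 $ 1) + 2 * C $ 2 $ 2 * N $ 2 $ 1 * N $ 2 $ 2" for N :: "real^2^2"
  have "AE N in lborel. N $ 2 $ 1 \<noteq> 0 \<longrightarrow> p N \<noteq> 0"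
  proof (rule AE_matrix2I, unfold p_def, measurable, rule AE_I2, rule AE_I2, rule AE_I2)
    fix a c d :: real
    show "AE b in lborel. mat2 a b c d $ 2 $ 1 \<noteq> 0 \<longrightarrow> C $ 2 $ 1 * (mat2 a b c d $ 2 $ 1 * mat2 a b c d $ 1 $ 2 +
        mat2 a b c d $ 2 $ 2 * mat2 a b c d $ 1 $ 1) + 2 * C $ 2 $ 2 * mat2 a b c d $ 2 $ 1 * mat2 a b c d $ 2 $ 2 \<noteq> 0"
      using AE_lborel_singleton[of "- (C $ 2 $ 1 * d * a + 2 * C $ 2 $ 2 * c * d) / (C $ 2 $ 1 * c)"]
      by eventually_elim (use C in \<open>auto simp: field_simps\<close>)
  qed
  then show ?thesis
  proof eventually_elim
    case (elim N)
    show ?case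
    proof (intro impI notI)
      define a b c d where "a = N $ 1 $ 1" "b = N $ 1 $ 2" "c = N $ 2 $ 1" "d = N $ 2 $ 2"
      define c' d' where "c' = (C ** N) $ 2 $ 1" "d' = (C ** N) $ 2 $ 2"
      assume N: "N \<in> pos_det" "N $ 2 $ 1 \<noteq> 0" "N $ 2 $ 2 \<noteq> 0" "(C ** N) $ 2 $ 1 \<noteq> 0" "(C ** N) $ 2 $ 2 \<noteq> 0"
        and pk: "peak (C ** N) = peak N"
      have "\<bar>d' / c'\<bar> = \<bar>d / c\<bar>"
        using pk N unfolding peak_def a_b_c_d_def[symmetric] c'_d'_def[symmetric] by (simp del: abs_divide)
      then have "(d' / c')\<^sup>2 = (d / c)\<^sup>2" by (metis power2_abs)
      then have "(d' * c - d * c') * (d' * c + d * c') = 0"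
        using N unfolding a_b_c_d_def[symmetric] c'_d'_def[symmetric]
        by (simp add: power2_eq_square field_simps)
      moreover have "d' * c - d * c' = - C $ 2 $ 1 * (a * d - b * c)"
        by (simp add: c'_d'_def a_b_c_d_def algebra_simps)
      moreover have "a * d - b * c > 0" using N by (simp add: pos_det_def det_2 a_b_c_d_def)
      moreover have "d' * c + d * c' = p N"
        by (simp add: c'_d'_def a_b_c_d_def p_def algebra_simps)
      ultimately show False using C elim N by simp
    qed
  qed
qed

context zonal_group
begin

text \<open>
  The geodesics for which excursions are unambiguous: no lift has an endpoint at \<open>\<infinity>\<close> or an integral forward
  endpoint, and two lifts that peak at the same time differ by a translation.
\<close>

definition generic :: "real^2^2 \<Rightarrow> bool" where
  "generic M \<longleftrightarrow> (\<forall>A\<in>S. (A ** M) $ 2 $ 1 \<noteq> 0 \<and> (A ** M) $ 2 $ 2 \<noteq> 0 \<and>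
      (\<forall>n. (A ** M) $ 1 $ 1 / (A ** M) $ 2 $ 1 \<noteq> of_int n) \<and>
      (\<forall>C\<in>S. C $ 2 $ 1 \<noteq> 0 \<longrightarrow> peak (C ** (A ** M)) \<noteq> peak (A ** M)))"

lemma AE_generic: "AE M in lborel. M \<in> pos_det \<longrightarrow> generic M"
proof -
  have 1: "AE M :: real^2^2 in lborel. \<forall>A\<in>S. (A ** M) $ 2 $ 1 \<noteq> 0 \<and> (A ** M) $ 2 $ 2 \<noteq> 0 \<and>
      (\<forall>n. (A ** M) $ 1 $ 1 / (A ** M) $ 2 $ 1 \<noteq> of_int n)"
    unfolding AE_ball_countable[OF countable_S]
  proof
    fix A assume A: "A \<in> S"
    have "AE N in lborel. (N :: real^2^2) $ 2 $ 1 \<noteq> 0 \<and> N $ 2 $ 2 \<noteq> 0 \<and> (\<forall>n. N $ 1 $ 1 / N $ 2 $ 1 \<noteq> of_int n)"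
      using AE_matrix_entry_nonzero AE_endpoint_nonint by eventually_elim simp
    then show "AE M :: real^2^2 in lborel. (A ** M) $ 2 $ 1 \<noteq> 0 \<and> (A ** M) $ 2 $ 2 \<noteq> 0 \<and>
      (\<forall>n. (A ** M) $ 1 $ 1 / (A ** M) $ 2 $ 1 \<noteq> of_int n)"
      by (rule AE_mult_left) (simp add: det_S A)
  qed
  have 2: "AE M :: real^2^2 in lborel. \<forall>A\<in>S. \<forall>C\<in>S. C $ 2 $ 1 \<noteq> 0 \<longrightarrow> A ** M \<in> pos_det \<longrightarrow> (A ** M) $ 2 $ 1 \<noteq> 0 \<longrightarrow>
      (A ** M) $ 2 $ 2 \<noteq> 0 \<longrightarrow> (C ** (A ** M)) $ 2 $ 1 \<noteq> 0 \<longrightarrow> (C ** (A ** M)) $ 2 $ 2 \<noteq> 0 \<longrightarrow>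
      peak (C ** (A ** M)) \<noteq> peak (A ** M)"
    unfolding AE_ball_countable[OF countable_S]
  proof (intro ballI)
    fix A C assume A: "A \<in> S" and "C \<in> S"
    show "AE M :: real^2^2 in lborel. C $ 2 $ 1 \<noteq> 0 \<longrightarrow> A ** M \<in> pos_det \<longrightarrow> (A ** M) $ 2 $ 1 \<noteq> 0 \<longrightarrow>
      (A ** M) $ 2 $ 2 \<noteq> 0 \<longrightarrow> (C ** (A ** M)) $ 2 $ 1 \<noteq> 0 \<longrightarrow> (C ** (A ** M)) $ 2 $ 2 \<noteq> 0 \<longrightarrow>
      peak (C ** (A ** M)) \<noteq> peak (A ** M)"
    proof (cases "C $ 2 $ 1 = 0")
      case False
      from AE_mult_left[OF AE_peak_neq[OF this], of A] show ?thesis by (simp add: det_S A)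
    qed simp
  qed
  from 1 2 show ?thesis
  proof eventually_elim
    case (elim M)
    show ?case
    proof
      assume P: "M \<in> pos_det"
      show "generic M"
        unfolding generic_def
      proof (intro ballI conjI impI)
        fix A C assume A: "A \<in> S" and C: "C \<in> S" "C $ 2 $ 1 \<noteq> 0"
        have "A ** M \<in> pos_det" using P A by (simp add: pos_det_def det_mul det_S)
        moreover have "(C ** (A ** M)) $ 2 $ 1 \<noteq> 0 \<and> (C ** (A ** M)) $ 2 $ 2 \<noteq> 0"
          using elim(1) mult_S[OF C(1) A] unfolding matrix_mul_assoc by blast
        ultimately show "peak (C ** (A ** M)) \<noteq> peak (A ** M)"
          using elim A C by blast
      qed (use elim(1) in blast)+
    qed
  qed
qed

lemma generic_same_peak:
  assumes gen: "generic M" and A: "A \<in> S" and B: "B \<in> S" and eq: "peak (B ** M) = peak (A ** M)"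
  shows "\<exists>n. B ** M = translation n ** (A ** M) \<and> B = translation n ** A \<or>
    B ** M = - (translation n ** (A ** M)) \<and> B = - (translation n ** A)"
proof -
  define C where "C = B ** adj2 A"
  have C: "C \<in> S" unfolding C_def using A B by (intro mult_S inv_S)
  have CA: "C ** A = B" by (simp add: C_def matrix_mul_assoc[symmetric] adj2_mult det_S[OF A])
  then have CM: "C ** (A ** M) = B ** M" by (simp add: matrix_mul_assoc)
  have "C $ 2 $ 1 = 0" using gen A C eq unfolding generic_def CM[symmetric] by blast
  then obtain n where "C = translation n \<or> C = - translation n" using stabilizer_S[OF C] by blast
  then show ?thesis using CA CM by (auto simp: matrix_uminus_mult_left intro!: exI[of _ n])
qed

text \<open>
  A translation separates lifts that peak simultaneously, and at most one of them has endpoints in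
  \<open>region_J\<close>.
\<close>

lemma generic_window_unique:
  assumes gen: "generic M" and A: "A \<in> S" "A ** M \<in> window region_J"
    and B: "B \<in> S" "B ** M \<in> window region_J" and eq: "peak (B ** M) = peak (A ** M)"
  shows "B = A \<or> B = - A"
proof -
  obtain n where n: "B ** M = translation n ** (A ** M) \<and> B = translation n ** A \<or>
    B ** M = - (translation n ** (A ** M)) \<and> B = - (translation n ** A)"
    using generic_same_peak[OF gen A(1) B(1) eq] by blast
  then have "translation n ** (A ** M) \<in> window region_J" using B(2) by (auto simp: window_uminus)
  then have "n = 0" using window_region_J_unique A(2) by blast
  then have "translation n = mat 1" by (simp add: translation_def mat_1_mat2)
  then show ?thesis using n by auto
qed

definition peaks :: "(real \<times> real) set \<Rightarrow> real^2^2 \<Rightarrow> real set" where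
  "peaks R M = {peak (A ** M) | A. A \<in> S \<and> A ** M \<in> window R}"

text \<open>
  Over each peak there is exactly one pair \<open>A\<close>, \<open>- A\<close>.
\<close>

lemma card_crossing:
  assumes gen: "generic M" and R: "R \<subseteq> region_J"
    and fin: "finite {A \<in> S. A ** M \<in> crossing R J}"
  shows "finite (peaks R M \<inter> J)" "card {A \<in> S. A ** M \<in> crossing R J} = 2 * card (peaks R M \<inter> J)"
proof -
  let ?H = "{A \<in> S. A ** M \<in> crossing R J}"
  have sub: "window R \<subseteq> window region_J" using R by (auto simp: window_def)
  have img: "peaks R M \<inter> J = (\<lambda>A. peak (A ** M)) ` ?H"
    by (auto simp: peaks_def crossing_def)
  then show finP: "finite (peaks R M \<inter> J)" using fin by simp
  define fiber where "fiber s = {A \<in> ?H. peak (A ** M) = s}" for s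
  have "card (fiber s) = 2" if s: "s \<in> peaks R M \<inter> J" for s
  proof -
    obtain A where A: "A \<in> ?H" "peak (A ** M) = s" using s unfolding img by blast
    have "fiber s = {A, - A}"
    proof (intro equalityI subsetI)
      fix B assume "B \<in> fiber s"
      then have "B \<in> S" "B ** M \<in> window region_J" "peak (B ** M) = peak (A ** M)"
        using sub A by (auto simp: fiber_def crossing_def)
      then show "B \<in> {A, - A}"
        using generic_window_unique[OF gen, of A B] A sub by (auto simp: crossing_def)
    next
      fix B assume "B \<in> {A, - A}"
      then show "B \<in> fiber s"
        using A neg_S by (auto simp: fiber_def crossing_def matrix_uminus_mult_left window_uminus peak_uminus)
    qed
    moreover have "A \<noteq> - A"
    proof
      assume "A = - A"
      then have "A $ i $ j = 0" for i j by (metis equation_minus_iff neg_equal_zero vector_uminus_component)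
      then show False using det_S[of A] A by (simp add: det_2)
    qed
    ultimately show ?thesis by simp
  qed
  moreover have "?H = (\<Union>s\<in>peaks R M \<inter> J. fiber s)" unfolding img by (auto simp: fiber_def)
  moreover have "card (\<Union>s\<in>peaks R M \<inter> J. fiber s) = (\<Sum>s\<in>peaks R M \<inter> J. card (fiber s))"
  proof (rule card_UN_disjoint[OF finP])
    show "\<forall>s\<in>peaks R M \<inter> J. finite (fiber s)"
      unfolding fiber_def by (intro ballI finite_subset[OF _ fin]) blast
  qed (auto simp: fiber_def)
  ultimately show "card ?H = 2 * card (peaks R M \<inter> J)" by simp
qed

end

context
  fixes \<Gamma> :: "(real^2^2) set set" and M :: "real^2^2"
  assumes \<Gamma>: "zonal_fuchsian \<Gamma>" and M: "det M = 1"
begin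

interpretation zonal_group "\<Union>\<Gamma>" by (rule zonal_group_preimage[OF \<Gamma>])

lemma subset_carrier: "\<Gamma> \<subseteq> carrier PSL2R"
  using \<Gamma> subgroup.subset by (auto simp: zonal_fuchsian_def)

lemma orbit_geodesic: "A \<in> \<Union>\<Gamma> \<Longrightarrow> orbit \<Gamma> (geodesic_of (A ** M) t) = orbit \<Gamma> (geodesic_of M t)"
proof -
  assume A: "A \<in> \<Union>\<Gamma>"
  have up: "Im (geodesic_of M t) > 0" using M by (simp add: geodesic_of_upper)
  have "geodesic_of (A ** M) t = moebius A (geodesic_of M t)" using M by (intro geodesic_of_mult) simp
  then have "orbit \<Gamma> (geodesic_of M t) = orbit \<Gamma> (geodesic_of (A ** M) t)"
    unfolding orbit_eq[OF subset_carrier] by (intro iffD2[OF same_orbit_iff[OF up]] bexI[OF _ A])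
  then show ?thesis ..
qed

lemma tangent_orbit_tangent: "tangent_orbit \<Gamma> (tangent M) = (\<lambda>A. tangent (A ** M)) ` \<Union>\<Gamma>"
proof -
  have act: "tangent_act g (tangent M) = tangent (A ** M)" if g: "g \<in> \<Gamma>" "A \<in> g" for g A
  proof -
    have A: "A \<in> \<Union>\<Gamma>" using g by blast
    obtain B where B: "g = psl_of B" using subset_carrier g by (auto simp: carrier_PSL2R)
    then have "psl_of A = g" using g(2) by (auto simp: psl_of_eq insert_commute)
    then show ?thesis using tangent_act_tangent[OF det_S[OF A], of M] M by simp
  qed
  have ne: "\<exists>A. A \<in> g" if "g \<in> \<Gamma>" for g
    using subset_carrier that by (auto simp: carrier_PSL2R psl_of_eq)
  show ?thesis
  proof (intro equalityI subsetI)
    fix w assume "w \<in> tangent_orbit \<Gamma> (tangent M)"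
    then obtain g where g': "g \<in> \<Gamma>" "w = tangent_act g (tangent M)" by (auto simp: tangent_orbit_def)
    then obtain A where "A \<in> g" using ne by blast
    then show "w \<in> (\<lambda>A. tangent (A ** M)) ` \<Union>\<Gamma>" using g' act by auto
  next
    fix w assume "w \<in> (\<lambda>A. tangent (A ** M)) ` \<Union>\<Gamma>"
    then obtain g A where "g \<in> \<Gamma>" "A \<in> g" "w = tangent (A ** M)" by blast
    then show "w \<in> tangent_orbit \<Gamma> (tangent M)"
      using act by (auto simp: tangent_orbit_def image_iff intro!: bexI[of _ g])
  qed
qed

lemma orbifold_geodesic_tangent:
  "orbifold_geodesic \<Gamma> (tangent_orbit \<Gamma> (tangent M)) = (\<lambda>t. orbit \<Gamma> (geodesic_of M t))"
proof
  fix t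
  have "tangent_orbit \<Gamma> (tangent M) \<noteq> {}" using one_S by (auto simp: tangent_orbit_tangent)
  then have "(SOME w. w \<in> tangent_orbit \<Gamma> (tangent M)) \<in> tangent_orbit \<Gamma> (tangent M)"
    by (simp add: some_in_eq)
  then obtain A where A: "A \<in> \<Union>\<Gamma>" "(SOME w. w \<in> tangent_orbit \<Gamma> (tangent M)) = tangent (A ** M)"
    unfolding tangent_orbit_tangent by blast
  have "det (A ** M) = 1" using M det_S[OF A(1)] by (simp add: det_mul)
  then show "orbifold_geodesic \<Gamma> (tangent_orbit \<Gamma> (tangent M)) t = orbit \<Gamma> (geodesic_of M t)"
    unfolding orbifold_geodesic_def A(2) by (simp add: geodesic_from_tangent orbit_geodesic[OF A(1)])
qed

abbreviation "curve \<equiv> (\<lambda>t. orbit \<Gamma> (geodesic_of M t))"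

text \<open>
  For each time \<open>t\<close> the lift agrees at \<open>t\<close> with the translate of the given geodesic by some group element.
  There are uncountably many times and countably many elements, so one element serves two times, and two
  points determine a geodesic.
\<close>

lemma lift_of_iff: "lift_of \<Gamma> curve \<gamma> \<longleftrightarrow> (\<exists>A\<in>\<Union>\<Gamma>. \<gamma> = geodesic_of (A ** M))"
proof
  assume "\<exists>A\<in>\<Union>\<Gamma>. \<gamma> = geodesic_of (A ** M)"
  then obtain A where A: "A \<in> \<Union>\<Gamma>" "\<gamma> = geodesic_of (A ** M)" by blast
  then show "lift_of \<Gamma> curve \<gamma>"
    using M det_S[OF A(1)] orbit_geodesic[OF A(1)]
    by (auto simp: lift_of_def det_mul intro!: geodesic_line_geodesic_of)
next
  assume L: "lift_of \<Gamma> curve \<gamma>"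
  then have line: "geodesic_line \<gamma>" and orb: "\<And>t. orbit \<Gamma> (\<gamma> t) = orbit \<Gamma> (geodesic_of M t)"
    by (auto simp: lift_of_def)
  have "\<exists>A\<in>\<Union>\<Gamma>. \<gamma> t = geodesic_of (A ** M) t" for t
  proof -
    have up: "Im (geodesic_of M t) > 0" using M by (simp add: geodesic_of_upper)
    have "\<exists>A\<in>\<Union>\<Gamma>. \<gamma> t = moebius A (geodesic_of M t)"
      using orb[of t] unfolding orbit_eq[OF subset_carrier] by (intro iffD1[OF same_orbit_iff[OF up]]) simp
    then show ?thesis using geodesic_of_mult[of M _ t] M by simp
  qed
  then obtain f where f: "\<And>t. f t \<in> \<Union>\<Gamma>" "\<And>t. \<gamma> t = geodesic_of (f t ** M) t" by metis
  have "\<not> inj f"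
  proof
    assume "inj f"
    moreover have "countable (range f)" using f(1) by (intro countable_subset[OF _ countable_S]) blast
    ultimately have "countable (UNIV :: real set)" using countable_image_inj_on by blast
    then show False using uncountable_UNIV_real by blast
  qed
  then obtain s t where st: "f s = f t" "s \<noteq> t" by (auto simp: inj_def)
  have "\<gamma> = geodesic_of (f s ** M)"
  proof (rule geodesic_line_unique_two_points[OF line])
    show "det (f s ** M) = 1" using M det_S[OF f(1)] by (simp add: det_mul)
    show "\<gamma> s = geodesic_of (f s ** M) s" "\<gamma> t = geodesic_of (f s ** M) t"
      using f(2)[of s] f(2)[of t] st by simp_all
    show "s \<noteq> t" by (rule st(2))
  qed
  then show "\<exists>A\<in>\<Union>\<Gamma>. \<gamma> = geodesic_of (A ** M)" using f(1) by blast
qed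

lemma det_translate: "A \<in> \<Union>\<Gamma> \<Longrightarrow> det (A ** M) = 1"
  using M det_S by (simp add: det_mul del: Union_iff)

lemma excursion_at_iff:
  "excursion_at \<Gamma> curve \<delta> s \<longleftrightarrow> (\<exists>A\<in>\<Union>\<Gamma>. (A ** M) $ 2 $ 1 \<noteq> 0 \<and> (A ** M) $ 2 $ 2 \<noteq> 0 \<and>
    s = peak (A ** M) \<and> \<delta> = 2 * \<bar>(A ** M) $ 2 $ 1 * (A ** M) $ 2 $ 2\<bar>)"
proof -
  have *: "\<delta> > 0 \<and> tangent_to_horocycle (geodesic_of (A ** M)) (1 / \<delta>) s \<longleftrightarrow>
    (A ** M) $ 2 $ 1 \<noteq> 0 \<and> (A ** M) $ 2 $ 2 \<noteq> 0 \<and>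
    s = peak (A ** M) \<and> \<delta> = 2 * \<bar>(A ** M) $ 2 $ 1 * (A ** M) $ 2 $ 2\<bar>" if A: "A \<in> \<Union>\<Gamma>" for A
  proof -
    have "\<delta> > 0 \<and> 1 / \<delta> = 1 / (2 * \<bar>u\<bar>) \<longleftrightarrow> \<delta> = 2 * \<bar>u\<bar>" if "u \<noteq> 0" for u :: real
      using that by (auto simp: divide_simps)
    from this[of "(A ** M) $ 2 $ 1 * (A ** M) $ 2 $ 2"] show ?thesis
      unfolding geodesic_tangency[OF det_translate[OF A]] by (auto simp del: matrix_mult_nth)
  qed
  have "excursion_at \<Gamma> curve \<delta> s \<longleftrightarrow> (\<exists>A\<in>\<Union>\<Gamma>. \<delta> > 0 \<and> tangent_to_horocycle (geodesic_of (A ** M)) (1 / \<delta>) s)"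
    unfolding excursion_at_def lift_of_iff by blast
  then show ?thesis using * by blast
qed

context
  assumes gen: "generic M"
begin

lemma gen_entries: "A \<in> \<Union>\<Gamma> \<Longrightarrow> (A ** M) $ 2 $ 1 \<noteq> 0 \<and> (A ** M) $ 2 $ 2 \<noteq> 0"
  using gen unfolding generic_def by blast

lemma excursions_generic:
  assumes k: "0 < k" "k \<le> 2"
  shows "excursions \<Gamma> curve k = peaks (region_J \<inter> deep_pairs k) M"
proof (intro equalityI subsetI)
  fix s assume "s \<in> excursions \<Gamma> curve k"
  then obtain A where A: "A \<in> \<Union>\<Gamma>" "s = peak (A ** M)" "2 * \<bar>(A ** M) $ 2 $ 1 * (A ** M) $ 2 $ 2\<bar> < k"
    unfolding excursions_def excursion_at_iff by blast
  let ?N = "A ** M"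
  have "\<exists>n. translation n ** ?N \<in> window region_J"
  proof (rule window_region_J_exists[OF det_translate[OF A(1)]])
    show "?N $ 1 $ 1 / ?N $ 2 $ 1 \<noteq> of_int n" for n using gen A(1) unfolding generic_def by blast
    show "2 * \<bar>?N $ 2 $ 1 * ?N $ 2 $ 2\<bar> < 2" using A(3) k by linarith
  qed (use gen_entries[OF A(1)] in blast)+
  then obtain n where n: "translation n ** ?N \<in> window region_J" by blast
  have B: "translation n ** A \<in> \<Union>\<Gamma>" using A(1) by (intro mult_S translation_S)
  have eq: "translation n ** A ** M = translation n ** ?N" by (simp add: matrix_mul_assoc)
  have "translation n ** A ** M \<in> window (region_J \<inter> deep_pairs k)"
    unfolding window_deep_iff[OF det_translate[OF B] k(1)] using n A(3)
    by (simp only: eq translation_entries)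
  moreover have "s = peak (translation n ** A ** M)" using A(2) by (simp only: eq peak_translation)
  ultimately show "s \<in> peaks (region_J \<inter> deep_pairs k) M"
    unfolding peaks_def using B by blast
next
  fix s assume "s \<in> peaks (region_J \<inter> deep_pairs k) M"
  then obtain A where A: "A \<in> \<Union>\<Gamma>" "s = peak (A ** M)" "A ** M \<in> window (region_J \<inter> deep_pairs k)"
    unfolding peaks_def by blast
  then show "s \<in> excursions \<Gamma> curve k"
    unfolding excursions_def excursion_at_iff mem_Collect_eq
    using gen_entries[OF A(1)] window_deep_iff[OF det_translate[OF A(1)] k(1)] by blast
qed

text \<open>
  Lifts that peak simultaneously are translates of each other and so have the same height.
\<close>

lemma depth_generic:
  assumes A: "A \<in> \<Union>\<Gamma>"
  shows "depth \<Gamma> curve (peak (A ** M)) = 2 * \<bar>(A ** M) $ 2 $ 1 * (A ** M) $ 2 $ 2\<bar>"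
  unfolding depth_def
proof (rule the_equality)
  show "excursion_at \<Gamma> curve (2 * \<bar>(A ** M) $ 2 $ 1 * (A ** M) $ 2 $ 2\<bar>) (peak (A ** M))"
    unfolding excursion_at_iff using gen_entries[OF A] A by blast
next
  fix \<delta> assume "excursion_at \<Gamma> curve \<delta> (peak (A ** M))"
  then obtain B where B: "B \<in> \<Union>\<Gamma>" "peak (A ** M) = peak (B ** M)" "\<delta> = 2 * \<bar>(B ** M) $ 2 $ 1 * (B ** M) $ 2 $ 2\<bar>"
    unfolding excursion_at_iff by blast
  obtain n where "B ** M = translation n ** (A ** M) \<or> B ** M = - (translation n ** (A ** M))"
    using generic_same_peak[OF gen A B(1) B(2)[symmetric]] by blast
  then have "\<bar>(B ** M) $ 2 $ 1 * (B ** M) $ 2 $ 2\<bar> = \<bar>(A ** M) $ 2 $ 1 * (A ** M) $ 2 $ 2\<bar>"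
    by (auto simp only: translation_entries vector_uminus_component mult_minus_left mult_minus_right minus_minus)
  then show "\<delta> = 2 * \<bar>(A ** M) $ 2 $ 1 * (A ** M) $ 2 $ 2\<bar>" using B(3) by simp
qed

lemma excursion_lift_generic:
  assumes A: "A \<in> \<Union>\<Gamma>" "A ** M \<in> window region_J"
  shows "excursion_lift \<Gamma> curve (peak (A ** M)) = geodesic_of (A ** M)"
  unfolding excursion_lift_def
proof (rule the_equality)
  show "lift_of \<Gamma> curve (geodesic_of (A ** M)) \<and>
      tangent_to_horocycle (geodesic_of (A ** M)) (1 / depth \<Gamma> curve (peak (A ** M))) (peak (A ** M)) \<and>
      endpoints_in (geodesic_of (A ** M)) region_J"
    unfolding lift_of_iff geodesic_tangency[OF det_translate[OF A(1)]] depth_generic[OF A(1)]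
    using A gen_entries[OF A(1)] endpoints_in_geodesic_of[OF det_translate[OF A(1)]] by blast
next
  fix \<gamma> assume \<gamma>: "lift_of \<Gamma> curve \<gamma> \<and>
      tangent_to_horocycle \<gamma> (1 / depth \<Gamma> curve (peak (A ** M))) (peak (A ** M)) \<and> endpoints_in \<gamma> region_J"
  then obtain B where B: "B \<in> \<Union>\<Gamma>" "\<gamma> = geodesic_of (B ** M)" unfolding lift_of_iff by blast
  have "peak (B ** M) = peak (A ** M)"
    using \<gamma> unfolding B(2) geodesic_tangency[OF det_translate[OF B(1)]] by simp
  moreover have "B ** M \<in> window region_J"
    using \<gamma> endpoints_in_geodesic_of[OF det_translate[OF B(1)]] gen_entries[OF B(1)] unfolding B(2) by blast
  ultimately have "B = A \<or> B = - A" using generic_window_unique[OF gen A B(1)] by blast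
  then show "\<gamma> = geodesic_of (A ** M)" using B(2) by (auto simp: matrix_uminus_mult_left)
qed

lemma region_I_subset: "region_I \<subseteq> region_J"
  by (auto simp: region_I_def region_J_def)

lemma approximating_excursions_generic:
  assumes k: "0 < k" "k \<le> 2"
  shows "approximating_excursions \<Gamma> curve k = peaks (region_I \<inter> deep_pairs k) M"
proof -
  have iff: "endpoints_in (excursion_lift \<Gamma> curve (peak (A ** M))) region_I \<longleftrightarrow> A ** M \<in> window region_I"
    if A: "A \<in> \<Union>\<Gamma>" "A ** M \<in> window region_J" for A
    unfolding excursion_lift_generic[OF A]
    using endpoints_in_geodesic_of[OF det_translate[OF A(1)]] gen_entries[OF A(1)] by blast
  show ?thesis
  proof (intro equalityI subsetI)
    fix s assume "s \<in> approximating_excursions \<Gamma> curve k"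
    then have s: "s \<in> peaks (region_J \<inter> deep_pairs k) M" "endpoints_in (excursion_lift \<Gamma> curve s) region_I"
      by (simp_all add: approximating_excursions_def excursions_generic[OF k])
    then obtain A where A: "A \<in> \<Union>\<Gamma>" "s = peak (A ** M)" "A ** M \<in> window (region_J \<inter> deep_pairs k)"
      unfolding peaks_def by blast
    then have J: "A ** M \<in> window region_J" by (simp add: window_def del: matrix_mult_nth)
    have "A ** M \<in> window (region_I \<inter> deep_pairs k)"
      using iff[OF A(1) J] s(2) A window_deep_iff[OF det_translate[OF A(1)] k(1)] by blast
    then show "s \<in> peaks (region_I \<inter> deep_pairs k) M" unfolding peaks_def using A by blast
  next
    fix s assume "s \<in> peaks (region_I \<inter> deep_pairs k) M"
    then obtain A where A: "A \<in> \<Union>\<Gamma>" "s = peak (A ** M)" "A ** M \<in> window (region_I \<inter> deep_pairs k)"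
      unfolding peaks_def by blast
    then have I: "A ** M \<in> window region_I" by (simp add: window_def del: matrix_mult_nth)
    then have J: "A ** M \<in> window region_J" using region_I_subset by (auto simp: window_def simp del: matrix_mult_nth)
    have "A ** M \<in> window (region_J \<inter> deep_pairs k)"
      using J A window_deep_iff[OF det_translate[OF A(1)] k(1)] by blast
    then have "s \<in> peaks (region_J \<inter> deep_pairs k) M" unfolding peaks_def using A by blast
    then show "s \<in> approximating_excursions \<Gamma> curve k"
      using iff[OF A(1) J] I A(2) by (simp add: approximating_excursions_def excursions_generic[OF k])
  qed
qed

end

end


section \<open>From integral times and rational depths to all times and depths\<close>

text \<open>
  Enclose \<open>t\<close> between consecutive integers.
\<close>

lemma count_asymptotics:
  fixes E :: "real set"
  assumes fin: "\<And>n :: nat. finite (E \<inter> {0..<real n})"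
    and lim: "(\<lambda>n. real (card (E \<inter> {0..<real n})) / real n) \<longlonglongrightarrow> L"
  shows "((\<lambda>t. real (card (E \<inter> {0..t})) / t) \<longlongrightarrow> L) at_top"
proof -
  define c where "c n = real (card (E \<inter> {0..<real n}))" for n :: nat
  have fl: "filterlim (\<lambda>t::real. nat \<lfloor>t\<rfloor>) sequentially at_top"
    by (intro filterlim_compose[OF filterlim_nat_sequentially filterlim_floor_sequentially])
  have l1: "(\<lambda>n. c n / real n * (real n / (real n + 1))) \<longlonglongrightarrow> L * 1"
  proof (rule tendsto_mult)
    show "(\<lambda>n. c n / real n) \<longlonglongrightarrow> L" using lim by (simp add: c_def)
    show "(\<lambda>n. real n / (real n + 1)) \<longlonglongrightarrow> 1" by real_asymp
  qed
  have l2: "(\<lambda>n. c (Suc n) / real (Suc n) * ((real n + 1) / real n)) \<longlonglongrightarrow> L * 1"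
  proof (rule tendsto_mult)
    show "(\<lambda>n. c (Suc n) / real (Suc n)) \<longlonglongrightarrow> L"
      using LIMSEQ_Suc[OF lim] by (simp only: c_def)
    show "(\<lambda>n. (real n + 1) / real n) \<longlonglongrightarrow> 1" by real_asymp
  qed
  show ?thesis
  proof (rule tendsto_sandwich)
    show "((\<lambda>t :: real. c (nat \<lfloor>t\<rfloor>) / real (nat \<lfloor>t\<rfloor>) * (real (nat \<lfloor>t\<rfloor>) / (real (nat \<lfloor>t\<rfloor>) + 1))) \<longlongrightarrow> L) at_top"
      using filterlim_compose[OF l1 fl] by simp
    show "((\<lambda>t :: real. c (Suc (nat \<lfloor>t\<rfloor>)) / real (Suc (nat \<lfloor>t\<rfloor>)) * ((real (nat \<lfloor>t\<rfloor>) + 1) / real (nat \<lfloor>t\<rfloor>))) \<longlongrightarrow> L) at_top"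
      using filterlim_compose[OF l2 fl] by simp
    have ev: "\<forall>\<^sub>F t :: real in at_top. t \<ge> 1" by (rule eventually_ge_at_top)
    show "\<forall>\<^sub>F t in at_top. c (nat \<lfloor>t\<rfloor>) / real (nat \<lfloor>t\<rfloor>) * (real (nat \<lfloor>t\<rfloor>) / (real (nat \<lfloor>t\<rfloor>) + 1)) \<le> real (card (E \<inter> {0..t})) / t"
      using ev
    proof eventually_elim
      case (elim t)
      define n where "n = nat \<lfloor>t\<rfloor>"
      have n: "real n \<le> t" "t < real n + 1" "n \<ge> 1" using elim unfolding n_def by linarith+
      have "E \<inter> {0..t} \<subseteq> E \<inter> {0..<real (Suc n)}" using n by auto
      then have finT: "finite (E \<inter> {0..t})" by (rule finite_subset) (rule fin)
      have "c n \<le> real (card (E \<inter> {0..t}))"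
        unfolding c_def using n by (intro of_nat_mono card_mono[OF finT]) auto
      then have "c n / (real n + 1) \<le> real (card (E \<inter> {0..t})) / t"
        using n elim by (intro frac_le) auto
      then show ?case using n unfolding n_def[symmetric] by simp
    qed
    show "\<forall>\<^sub>F t in at_top. real (card (E \<inter> {0..t})) / t \<le> c (Suc (nat \<lfloor>t\<rfloor>)) / real (Suc (nat \<lfloor>t\<rfloor>)) * ((real (nat \<lfloor>t\<rfloor>) + 1) / real (nat \<lfloor>t\<rfloor>))"
      using ev
    proof eventually_elim
      case (elim t)
      define n where "n = nat \<lfloor>t\<rfloor>"
      have n: "real n \<le> t" "t < real n + 1" "n \<ge> 1" using elim unfolding n_def by linarith+
      have "real (card (E \<inter> {0..t})) \<le> c (Suc n)"
        unfolding c_def using n by (intro of_nat_mono card_mono[OF fin]) auto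
      then have "real (card (E \<inter> {0..t})) / t \<le> c (Suc n) / real n"
        using n by (intro frac_le) auto
      then show ?case using n unfolding n_def[symmetric] by (simp add: add.commute)
    qed
  qed
qed

text \<open>
  Enclose \<open>k\<close> between rational numbers at which \<open>G\<close> is close to \<open>G k\<close>.  The endpoint \<open>2\<close> is itself rational,
  so it needs no larger rational number.
\<close>

lemma monotone_family_limit:
  fixes F :: "real \<Rightarrow> real \<Rightarrow> real" and G :: "real \<Rightarrow> real"
  assumes mono: "\<And>j k. 0 < j \<Longrightarrow> j \<le> k \<Longrightarrow> k \<le> 2 \<Longrightarrow> \<forall>\<^sub>F t in at_top. F j t \<le> F k t"
    and rat: "\<And>q. q \<in> \<rat> \<Longrightarrow> 0 < q \<Longrightarrow> q \<le> 2 \<Longrightarrow> (F q \<longlongrightarrow> G q) at_top"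
    and cont: "continuous_on {0<..} G" and k: "0 < k" "k \<le> 2"
  shows "(F k \<longlongrightarrow> G k) at_top"
proof (cases "k = 2")
  case True
  then show ?thesis using rat[of 2] by simp
next
  case False
  then have k2: "k < 2" using k by simp
  have "isCont G k" using cont k(1) by (simp add: continuous_on_eq_continuous_at)
  then have G: "(G \<longlongrightarrow> G k) (at k)" by (simp add: isCont_def)
  show ?thesis
  proof (rule order_tendstoI)
    fix a assume "a < G k"
    then have "\<forall>\<^sub>F x in at k. a < G x" using G by (simp add: order_tendsto_iff)
    then have "\<forall>\<^sub>F x in at_left k. a < G x" by (simp add: eventually_at_split)
    then obtain b where b: "b < k" "\<And>x. b < x \<Longrightarrow> x < k \<Longrightarrow> a < G x"
      unfolding eventually_at_left_field by blast
    obtain q where q: "q \<in> \<rat>" "max b 0 < q" "q < k" using Rats_dense_in_real[of "max b 0" k] b k by auto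
    then have "\<forall>\<^sub>F t in at_top. a < F q t" using rat[of q] b(2)[of q] k2 by (auto intro: order_tendstoD)
    moreover have "\<forall>\<^sub>F t in at_top. F q t \<le> F k t" using q k by (intro mono) auto
    ultimately show "\<forall>\<^sub>F t in at_top. a < F k t" by eventually_elim linarith
  next
    fix a assume "G k < a"
    then have "\<forall>\<^sub>F x in at k. G x < a" using G by (simp add: order_tendsto_iff)
    then have "\<forall>\<^sub>F x in at_right k. G x < a" by (simp add: eventually_at_split)
    then obtain b where b: "k < b" "\<And>x. k < x \<Longrightarrow> x < b \<Longrightarrow> G x < a"
      unfolding eventually_at_right_field by blast
    obtain q where q: "q \<in> \<rat>" "k < q" "q < min b 2" using Rats_dense_in_real[of k "min b 2"] b k2 by auto
    then have "\<forall>\<^sub>F t in at_top. F q t < a" using rat[of q] b(2)[of q] k by (auto intro: order_tendstoD)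
    moreover have "\<forall>\<^sub>F t in at_top. F k t \<le> F q t" using q k by (intro mono) auto
    ultimately show "\<forall>\<^sub>F t in at_top. F k t < a" by eventually_elim linarith
  qed
qed

lemma continuous_on_calA: "continuous_on {0<..} calA"
proof -
  have "calA z = min z 1 + (1 - max z 1) + 2 * ln (max z 1)" for z
    by (auto simp: calA_def max_def min_def)
  then have eq: "calA = (\<lambda>z. min z 1 + (1 - max z 1) + 2 * ln (max z 1))" by auto
  show ?thesis unfolding eq by (auto intro!: continuous_intros)
qed

lemma region_borel [measurable]:
  "region_J \<inter> deep_pairs k \<in> sets (borel \<Otimes>\<^sub>M borel)" "region_I \<inter> deep_pairs k \<in> sets (borel \<Otimes>\<^sub>M borel)"
proof -
  have "region_J \<in> sets (borel \<Otimes>\<^sub>M borel)" "region_I \<in> sets (borel \<Otimes>\<^sub>M borel)"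
    unfolding region_J_def region_I_def by (intro sets.Un pair_measureI; simp)+
  moreover have "{p \<in> space (borel \<Otimes>\<^sub>M borel). \<bar>fst p - snd p\<bar> > 2 / k} \<in> sets (borel \<Otimes>\<^sub>M (borel :: real measure))"
    by measurable
  then have "deep_pairs k \<in> sets (borel \<Otimes>\<^sub>M borel)"
    by (simp add: deep_pairs_def space_pair_measure case_prod_beta')
  ultimately show "region_J \<inter> deep_pairs k \<in> sets (borel \<Otimes>\<^sub>M borel)" "region_I \<inter> deep_pairs k \<in> sets (borel \<Otimes>\<^sub>M borel)"
    by auto
qed


section \<open>Null sets of the unit tangent bundle\<close>

text \<open>
  The rational parametrization of the unit circle without \<open>- \<i>\<close>; \<open>slope\<close> below is its inverse.  It gives
  the direction of \<open>frame x y m\<close>.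
\<close>

definition turn :: "real \<Rightarrow> complex" where
  "turn m = Complex (2 * m / (1 + m\<^sup>2)) ((1 - m\<^sup>2) / (1 + m\<^sup>2))"

definition slope :: "complex \<Rightarrow> real" where "slope u = Re u / (1 + Im u)"

lemma direction_eq: "den M \<i> \<noteq> 0 \<Longrightarrow> direction M = of_real ((cmod (den M \<i>))\<^sup>2) / (den M \<i>)\<^sup>2 * \<i>"
proof -
  have "sgn (inverse w) = of_real (cmod w) / w" for w :: complex
    by (simp only: sgn_div_norm norm_inverse inverse_inverse_eq scaleR_conv_of_real divide_inverse)
  then show ?thesis by (simp add: direction_def power_divide)
qed

lemma direction_frame: "direction (frame x y m) = turn m"
proof -
  have d: "den (frame x y m) \<i> = Complex 1 m" by (simp add: den_def frame_def complex_eq_iff)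
  have p: "1 + m\<^sup>2 > 0" by (simp add: add_pos_nonneg)
  have ne: "Complex 1 m \<noteq> 0" by (simp add: complex_eq_iff)
  have "turn m * (Complex 1 m)\<^sup>2 = of_real (1 + m\<^sup>2) * \<i>"
  proof -
    have sq: "(Complex 1 m)\<^sup>2 = Complex (1 - m\<^sup>2) (2 * m)"
      by (simp add: complex_eq_iff power2_eq_square)
    have "2 * m / (1 + m\<^sup>2) * (2 * m) + (1 - m\<^sup>2) / (1 + m\<^sup>2) * (1 - m\<^sup>2) =
        (4 * m\<^sup>2 + (1 - m\<^sup>2)\<^sup>2) / (1 + m\<^sup>2)"
      by (simp add: add_divide_distrib power2_eq_square)
    also have "4 * m\<^sup>2 + (1 - m\<^sup>2)\<^sup>2 = (1 + m\<^sup>2) * (1 + m\<^sup>2)"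
      by (simp add: power2_eq_square algebra_simps)
    also have "(1 + m\<^sup>2) * (1 + m\<^sup>2) / (1 + m\<^sup>2) = 1 + m\<^sup>2" using p by simp
    finally show ?thesis unfolding sq turn_def by (simp add: complex_eq_iff)
  qed
  moreover have "(cmod (Complex 1 m))\<^sup>2 = 1 + m\<^sup>2" by (simp add: cmod_power2)
  moreover have "turn m = turn m * (Complex 1 m)\<^sup>2 / (Complex 1 m)\<^sup>2" using ne by simp
  ultimately show ?thesis using ne by (simp add: direction_eq d)
qed

lemma turn_slope:
  assumes "cmod u = 1" "u \<noteq> - \<i>"
  shows "turn (slope u) = u"
proof -
  define a b where "a = Re u" "b = Im u"
  have ab: "a\<^sup>2 + b\<^sup>2 = 1" using assms(1) by (metis a_b_def cmod_power2 power_one)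
  have b1: "1 + b > 0"
  proof -
    have "b\<^sup>2 \<le> 1" using ab zero_le_power2[of a] by linarith
    then have "\<bar>b\<bar> \<le> 1" by (simp add: abs_square_le_1)
    then have "b \<ge> -1" by linarith
    moreover have "b \<noteq> -1" using ab assms(2) by (auto simp: complex_eq_iff a_b_def)
    ultimately show ?thesis by simp
  qed
  have s: "slope u = a / (1 + b)" by (simp add: slope_def a_b_def)
  have "a\<^sup>2 = (1 + b) * (1 - b)" using ab by (simp add: algebra_simps power2_eq_square)
  then have m2: "(slope u)\<^sup>2 = (1 - b) / (1 + b)" using b1 by (simp add: s power_divide power2_eq_square)
  have "1 + (slope u)\<^sup>2 = 2 / (1 + b)" "1 - (slope u)\<^sup>2 = 2 * b / (1 + b)"
    unfolding m2 using b1 by (simp_all add: field_simps)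
  then have "turn (slope u) = Complex a b"
    unfolding turn_def using b1 by (simp add: s)
  then show ?thesis by (simp add: a_b_def complex_eq_iff)
qed

text \<open>
  A matrix that represents a given tangent vector.  The direction \<open>- \<i>\<close>, which no \<open>frame\<close> has, is represented
  by a matrix with lower row \<open>(1, 0)\<close>.
\<close>

definition tangent_section :: "complex \<times> complex \<Rightarrow> real^2^2" where
  "tangent_section w = (if snd w = - \<i> then mat2 (Re (fst w)) (- Im (fst w)) 1 0
     else frame (Re (fst w)) (Im (fst w)) (slope (snd w)))"

lemma tangent_section:
  assumes "Im z > 0" "cmod u = 1"
  shows "tangent_section (z, u) \<in> pos_det" "tangent (tangent_section (z, u)) = (z, u)"
proof -
  have "tangent_section (z, u) \<in> pos_det \<and> tangent (tangent_section (z, u)) = (z, u)"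
  proof (cases "u = - \<i>")
    case True
    have "direction (mat2 (Re z) (- Im z) 1 0) = - \<i>"
      by (subst direction_eq) (simp_all add: den_def)
    moreover have "base (mat2 (Re z) (- Im z) 1 0) = z"
      by (simp add: base_eq complex_eq_iff)
    ultimately show ?thesis using True assms by (simp add: tangent_section_def tangent_def pos_det_def)
  next
    case False
    have "1 + (slope u)\<^sup>2 > 0" by (simp add: add_pos_nonneg)
    then show ?thesis
      using False assms turn_slope[OF assms(2) False]
      by (simp add: tangent_section_def tangent_def pos_det_def det_frame base_frame direction_frame)
  qed
  then show "tangent_section (z, u) \<in> pos_det" "tangent (tangent_section (z, u)) = (z, u)" by auto
qed

lemma den_scale: "den (r *\<^sub>R M) z = of_real r * den M z"
  by (simp add: den_def algebra_simps)

lemma tangent_scale: "r > 0 \<Longrightarrow> tangent (r *\<^sub>R M) = tangent M"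
  by (simp add: tangent_def base_scale direction_def den_scale sgn_mult sgn_of_real)

text \<open>
  The lower row is determined by the base point and the direction up to a real factor, because the square of
  \<open>den M \<i>\<close> is determined up to a positive one; the upper row follows from the base point.
\<close>

lemma tangent_eqD:
  assumes M: "M \<in> pos_det" and N: "N \<in> pos_det" and eq: "tangent M = tangent N"
  shows "\<exists>r. r \<noteq> 0 \<and> N = r *\<^sub>R M"
proof -
  have d: "den M \<i> \<noteq> 0" "den N \<i> \<noteq> 0"
    using M N den_nonzero[of M \<i>] den_nonzero[of N \<i>] by (auto simp: pos_det_def)
  have "(sgn (inverse (den M \<i>)))\<^sup>2 = (sgn (inverse (den N \<i>)))\<^sup>2"
    using eq by (simp add: tangent_def direction_def)
  then have "sgn (inverse (den M \<i>)) = sgn (inverse (den N \<i>)) \<or> sgn (inverse (den M \<i>)) = - sgn (inverse (den N \<i>))"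
    by (rule power2_eq_iff[THEN iffD1])
  moreover have sg: "sgn (inverse w) = of_real (cmod w) / w" for w :: complex
    by (simp only: sgn_div_norm norm_inverse inverse_inverse_eq scaleR_conv_of_real divide_inverse)
  ultimately have "of_real (cmod (den M \<i>)) / den M \<i> = of_real (cmod (den N \<i>)) / den N \<i> \<or>
      of_real (cmod (den M \<i>)) / den M \<i> = - (of_real (cmod (den N \<i>)) / den N \<i>)"
    by (simp only: sg)
  then have "of_real (cmod (den M \<i>)) * den N \<i> = of_real (cmod (den N \<i>)) * den M \<i> \<or>
      of_real (cmod (den M \<i>)) * den N \<i> = - (of_real (cmod (den N \<i>)) * den M \<i>)"
    using d by (simp add: field_simps)
  then have "den N \<i> = of_real (cmod (den N \<i>) / cmod (den M \<i>)) * den M \<i> \<or>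
      den N \<i> = of_real (- (cmod (den N \<i>) / cmod (den M \<i>))) * den M \<i>"
    using d by (simp add: field_simps)
  then obtain r where r: "den N \<i> = of_real r * den M \<i>" by blast
  have r0: "r \<noteq> 0" using r d by auto
  have num: "of_real (A $ 1 $ 1) * \<i> + of_real (A $ 1 $ 2) = base A * den A \<i>" if "den A \<i> \<noteq> 0" for A
    using that by (simp add: base_def moebius_def den_def)
  have "base M = base N" using eq by (simp add: tangent_def)
  then have "of_real (N $ 1 $ 1) * \<i> + of_real (N $ 1 $ 2) = of_real r * (of_real (M $ 1 $ 1) * \<i> + of_real (M $ 1 $ 2))"
    unfolding num[OF d(1)] num[OF d(2)] r by simp
  then have "N $ 1 $ 1 = r * M $ 1 $ 1" "N $ 1 $ 2 = r * M $ 1 $ 2" by (auto simp: complex_eq_iff)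
  moreover have "N $ 2 $ 1 = r * M $ 2 $ 1" "N $ 2 $ 2 = r * M $ 2 $ 2"
    using r by (auto simp: den_def complex_eq_iff)
  ultimately have "N = r *\<^sub>R M" by (simp add: matrix2_eq_iff)
  then show ?thesis using r0 by blast
qed

lemma slope_cis: "slope (cis \<phi>) = tan ((pi / 2 - \<phi>) / 2)"
proof -
  have "2 * ((pi / 2 - \<phi>) / 2) = pi / 2 - \<phi>" by simp
  then show ?thesis
    unfolding tan_half by (simp only:) (simp add: slope_def cos_diff sin_diff add.commute)
qed

text \<open>
  Null sets of slopes are null sets of angles.  The angle is a differentiable function of the slope on each of
  the two arcs that \<open>3 * pi / 2\<close> cuts out of \<open>{0..<2 * pi}\<close>.
\<close>

lemma null_sets_slope:
  assumes B: "B \<in> null_sets lborel"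
  shows "AE \<phi> in lborel. 0 \<le> \<phi> \<longrightarrow> \<phi> < 2 * pi \<longrightarrow> slope (cis \<phi>) \<notin> B"
proof -
  have B': "negligible B" using B by (simp add: negligible_iff_null_sets null_sets_completionI)
  define g where "g j m = pi / 2 - 2 * arctan m + j" for j m :: real
  have neg: "negligible (g j ` B)" for j
  proof (rule negligible_differentiable_image_negligible[OF order_refl B'])
    have "((\<lambda>m. pi / 2 - 2 * arctan m + j) has_real_derivative - 2 * inverse (1 + m\<^sup>2)) (at m)" for m
      by (auto intro!: derivative_eq_intros)
    then have "(\<lambda>m. pi / 2 - 2 * arctan m + j) differentiable at m" for m
      unfolding real_differentiable_def by blast
    then have "(\<lambda>m. pi / 2 - 2 * arctan m + j) differentiable at m within B" for m
      by (rule differentiable_at_withinI)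
    then show "g j differentiable_on B" unfolding g_def[abs_def] differentiable_on_def by blast
  qed
  have "negligible (g 0 ` B \<union> g (2 * pi) ` B \<union> {3 * pi / 2})" using neg by (intro negligible_Un) auto
  then have "AE \<phi> in lebesgue. \<phi> \<notin> g 0 ` B \<union> g (2 * pi) ` B \<union> {3 * pi / 2}"
    by (intro AE_not_in) (simp add: negligible_iff_null_sets)
  then have "AE \<phi> in lborel. \<phi> \<notin> g 0 ` B \<union> g (2 * pi) ` B \<union> {3 * pi / 2}"
    by (simp add: AE_completion_iff)
  then show ?thesis
  proof eventually_elim
    case (elim \<phi>)
    show ?case
    proof (intro impI notI)
      assume \<phi>: "0 \<le> \<phi>" "\<phi> < 2 * pi" and mem: "slope (cis \<phi>) \<in> B"
      have "\<phi> = g 0 (slope (cis \<phi>)) \<or> \<phi> = g (2 * pi) (slope (cis \<phi>)) \<or> \<phi> = 3 * pi / 2"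
      proof -
        consider "\<phi> < 3 * pi / 2" | "\<phi> = 3 * pi / 2" | "3 * pi / 2 < \<phi>" by linarith
        then show ?thesis
        proof cases
          case 1
          have "arctan (slope (cis \<phi>)) = (pi / 2 - \<phi>) / 2"
          proof -
            have "- (pi / 2) < (pi / 2 - \<phi>) / 2" "(pi / 2 - \<phi>) / 2 < pi / 2"
              using \<phi> 1 pi_gt_zero by (simp_all add: field_simps)
            then show ?thesis unfolding slope_cis by (rule arctan_tan)
          qed
          then have "\<phi> = g 0 (slope (cis \<phi>))" by (simp add: g_def)
          then show ?thesis by blast
        next
          case 3
          have "slope (cis \<phi>) = tan ((pi / 2 - \<phi>) / 2 + pi)"
            unfolding slope_cis by (rule tan_periodic_pi[symmetric])
          moreover have "arctan (tan ((pi / 2 - \<phi>) / 2 + pi)) = (pi / 2 - \<phi>) / 2 + pi"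
          proof -
            have "- (pi / 2) < (pi / 2 - \<phi>) / 2 + pi" "(pi / 2 - \<phi>) / 2 + pi < pi / 2"
              using \<phi> 3 pi_gt_zero by (simp_all add: field_simps)
            then show ?thesis by (rule arctan_tan)
          qed
          ultimately have "arctan (slope (cis \<phi>)) = (pi / 2 - \<phi>) / 2 + pi" by (simp only:)
          then have "\<phi> = g (2 * pi) (slope (cis \<phi>))" by (simp add: g_def field_simps)
          then show ?thesis by blast
        qed simp
      qed
      then show False using elim mem by auto
    qed
  qed
qed

lemma space_circle_measure: "space circle_measure = sphere 0 1"
  by (simp add: circle_measure_def space_restrict_space)

lemma measurable_cis_circle:
  "cis \<in> measurable (restrict_space lborel {0..<2 * pi}) (restrict_space borel (sphere 0 1))"
proof (rule measurable_restrict_space2)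
  show "cis \<in> space (restrict_space lborel {0..<2 * pi}) \<rightarrow> sphere 0 1" by auto
  have "cis \<in> borel_measurable borel"
    by (intro borel_measurable_continuous_onI continuous_intros)
  then show "cis \<in> borel_measurable (restrict_space lborel {0..<2 * pi})"
    by (intro measurable_restrict_space1) simp
qed

lemma finite_measure_circle: "finite_measure circle_measure"
proof (rule finite_measureI)
  have "emeasure circle_measure (space circle_measure) = emeasure (restrict_space lborel {0..<2 * pi}) (cis -` sphere 0 1 \<inter> space (restrict_space lborel {0..<2 * pi}))"
    unfolding space_circle_measure unfolding circle_measure_def
    by (rule emeasure_distr[OF measurable_cis_circle]) (simp add: sets_restrict_space_iff)
  also have "\<dots> = emeasure lborel ({0..<2 * pi} :: real set)"
  proof -
    have "cis -` sphere 0 1 \<inter> space (restrict_space lborel {0..<2 * pi}) = {0..<2 * pi}" by (auto simp: space_restrict_space)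
    then show ?thesis by (simp only:) (subst emeasure_restrict_space, auto)
  qed
  also have "\<dots> < \<infinity>" by simp
  finally show "emeasure circle_measure (space circle_measure) \<noteq> \<infinity>" by simp
qed

lemma nn_integral_circle:
  assumes [measurable]: "f \<in> borel_measurable borel"
  shows "(\<integral>\<^sup>+u. f u \<partial>circle_measure) = (\<integral>\<^sup>+\<phi>. f (cis \<phi>) * indicator {0..<2 * pi} \<phi> \<partial>lborel)"
proof -
  have "f \<in> borel_measurable (restrict_space borel (sphere 0 1))" by (intro measurable_restrict_space1) simp
  then have "(\<integral>\<^sup>+u. f u \<partial>circle_measure) = (\<integral>\<^sup>+\<phi>. f (cis \<phi>) \<partial>restrict_space lborel {0..<2 * pi})"
    unfolding circle_measure_def by (intro nn_integral_distr measurable_cis_circle) simp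
  also have "\<dots> = (\<integral>\<^sup>+\<phi>. f (cis \<phi>) * indicator {0..<2 * pi} \<phi> \<partial>lborel)"
    by (rule nn_integral_restrict_space) simp
  finally show ?thesis .
qed

lemma nn_integral_hyperbolic_area:
  assumes [measurable]: "f \<in> borel_measurable borel"
  shows "(\<integral>\<^sup>+z. f z \<partial>hyperbolic_area) = (\<integral>\<^sup>+z. ennreal (1 / (Im z)\<^sup>2) * f z * indicator upper_half_plane z \<partial>lborel)"
  unfolding hyperbolic_area_def
  by (subst nn_integral_density) (auto intro!: measurable_restrict_space1 nn_integral_restrict_space)

lemma space_liouville: "space liouville = upper_half_plane \<times> sphere 0 1"
  by (simp add: liouville_def space_pair_measure space_hyperbolic_area space_circle_measure)

lemma measurable_liouville [measurable]:
  "fst \<in> borel_measurable liouville" "snd \<in> borel_measurable liouville"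
proof -
  have "(\<lambda>z. z) \<in> borel_measurable hyperbolic_area"
    unfolding hyperbolic_area_def by (simp add: measurable_restrict_space1)
  then show "fst \<in> borel_measurable liouville"
    unfolding liouville_def using measurable_compose[OF measurable_fst] by blast
  have "(\<lambda>z. z) \<in> borel_measurable circle_measure"
    unfolding circle_measure_def by (simp add: measurable_restrict_space1)
  then show "snd \<in> borel_measurable liouville"
    unfolding liouville_def using measurable_compose[OF measurable_snd] by blast
qed

lemma tangent_section_borel [measurable (raw)]:
  assumes [measurable]: "f \<in> borel_measurable M" "g \<in> borel_measurable M"
  shows "(\<lambda>x. tangent_section (f x, g x)) \<in> borel_measurable M"
  unfolding tangent_section_def slope_def fst_conv snd_conv by measurable

lemma cis_eq_minus_i: "0 \<le> \<phi> \<Longrightarrow> \<phi> < 2 * pi \<Longrightarrow> cis \<phi> = - \<i> \<Longrightarrow> \<phi> = 3 * pi / 2"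
proof -
  assume \<phi>: "0 \<le> \<phi>" "\<phi> < 2 * pi" and "cis \<phi> = - \<i>"
  then have sc: "cos \<phi> = 0" "sin \<phi> = -1" by (auto simp: complex_eq_iff)
  have e: "3 * pi / 2 = pi + pi / 2" by simp
  have "sin \<phi> = sin (3 * pi / 2) \<and> cos \<phi> = cos (3 * pi / 2)"
    unfolding e sin_add cos_add sc by simp
  then have "\<exists>n::int. \<phi> = 3 * pi / 2 + 2 * pi * n" by (rule sin_cos_eq_iff[THEN iffD1])
  then obtain n :: int where n: "\<phi> = 3 * pi / 2 + 2 * pi * n" by (rule exE)
  have bound: "x < 1 \<and> -1 < x" if p: "p > 0" "0 \<le> 3 * p / 2 + 2 * p * x" "3 * p / 2 + 2 * p * x < 2 * p" for p x :: real
  proof -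
    have "x < 1"
    proof (rule ccontr)
      assume "\<not> x < 1"
      then have "p * 1 \<le> p * x" using p(1) by (intro mult_left_mono) auto
      then show False using p unfolding mult.assoc mult_1_right by linarith
    qed
    moreover have "-1 < x"
    proof (rule ccontr)
      assume "\<not> -1 < x"
      then have "p * x \<le> p * (-1)" using p(1) by (intro mult_left_mono) auto
      then show False using p unfolding mult.assoc mult_minus_right mult_1_right by linarith
    qed
    ultimately show ?thesis ..
  qed
  have "real_of_int n < 1 \<and> -1 < real_of_int n"
    using bound[OF pi_gt_zero, of n] \<phi> unfolding n[symmetric] by blast
  then have "n = 0" by simp
  then show "\<phi> = 3 * pi / 2" using n by simp
qed

text \<open>
  In Iwasawa coordinates, a null set that is invariant under positive scalars is null in the remaining
  coordinates for a single \<open>d > 0\<close>, and \<open>d\<close> can be scaled away.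
\<close>

lemma null_frames:
  assumes Z: "Z \<in> null_sets lborel" and scale: "\<And>r M. r > 0 \<Longrightarrow> r *\<^sub>R M \<in> Z \<longleftrightarrow> M \<in> Z"
  shows "AE m in lborel. (\<integral>\<^sup>+z. indicator Z (frame (Re z) (Im z) m) \<partial>lborel) = (0 :: ennreal)"
proof -
  have [measurable]: "Z \<in> sets borel" using Z by auto
  let ?I = "\<lambda>d. \<integral>\<^sup>+m. ennreal (\<bar>d\<bar> ^ 3 * (1 + m\<^sup>2)) * (\<integral>\<^sup>+z. indicator Z (d *\<^sub>R frame (Re z) (Im z) m) \<partial>lborel) \<partial>lborel"
  have "(\<integral>\<^sup>+d. ?I d \<partial>lborel) = emeasure lborel Z"
    by (subst nn_integral_iwasawa[symmetric]) simp_all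
  then have "(\<integral>\<^sup>+d. ?I d \<partial>lborel) = 0" using Z by auto
  then have ae: "AE d in lborel. ?I d = 0"
    by (subst nn_integral_0_iff_AE[symmetric]) simp_all
  have "\<exists>d>0. ?I d = 0"
  proof (rule ccontr)
    assume no: "\<not> (\<exists>d>0. ?I d = 0)"
    have "AE d in lborel. d \<notin> {0<..<1::real}"
      using ae by eventually_elim (use no in force)
    moreover have "{0<..<1::real} \<in> sets lborel" by simp
    ultimately have "{0<..<1::real} \<in> null_sets lborel" using AE_iff_null_sets by blast
    then have "emeasure lborel {0<..<1::real} = 0" by (rule null_setsD1)
    then show False by simp
  qed
  then obtain d where d: "d > 0" "?I d = 0" by blast
  then have "AE m in lborel. ennreal (\<bar>d\<bar> ^ 3 * (1 + m\<^sup>2)) * (\<integral>\<^sup>+z. indicator Z (d *\<^sub>R frame (Re z) (Im z) m) \<partial>lborel) = 0"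
    by (subst (asm) nn_integral_0_iff_AE) simp_all
  then show ?thesis
  proof eventually_elim
    case (elim m)
    have "1 + m\<^sup>2 > 0" by (simp add: add_pos_nonneg)
    then have "\<bar>d\<bar> ^ 3 * (1 + m\<^sup>2) > 0" using d by simp
    then have "(\<integral>\<^sup>+z. indicator Z (d *\<^sub>R frame (Re z) (Im z) m) \<partial>lborel) = (0 :: ennreal)"
      using elim by (simp only: mult_eq_0_iff ennreal_eq_0_iff) simp
    then show ?case using scale[OF d(1)] by (simp add: indicator_def)
  qed
qed

text \<open>
  Fubini: for almost every angle the slice of the set over that angle is null by the previous lemma.
\<close>

lemma null_tangent_set:
  assumes Z: "Z \<in> null_sets lborel" and scale: "\<And>r M. r > 0 \<Longrightarrow> r *\<^sub>R M \<in> Z \<longleftrightarrow> M \<in> Z"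
  shows "{w \<in> space liouville. tangent_section w \<in> Z} \<in> null_sets liouville"
proof -
  have [measurable]: "Z \<in> sets borel" using Z by auto
  interpret circle: finite_measure circle_measure by (rule finite_measure_circle)
  let ?E = "{w \<in> space liouville. tangent_section w \<in> Z}"
  have "(\<lambda>w. tangent_section (fst w, snd w)) \<in> borel_measurable liouville" by measurable
  then have "tangent_section \<in> borel_measurable liouville" by simp
  then have E: "?E \<in> sets liouville" by measurable
  then have E': "?E \<in> sets (hyperbolic_area \<Otimes>\<^sub>M circle_measure)" by (simp add: liouville_def)
  define k :: "complex \<Rightarrow> real \<Rightarrow> ennreal" where
    "k z \<phi> = ennreal (1 / (Im z)\<^sup>2) * indicator upper_half_plane z * (indicator Z (tangent_section (z, cis \<phi>)) * indicator {0..<2 * pi} \<phi>)" for z \<phi>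
  have [measurable]: "cis \<in> borel_measurable borel"
    by (intro borel_measurable_continuous_onI continuous_intros)
  have [measurable]: "case_prod k \<in> borel_measurable (borel \<Otimes>\<^sub>M borel)" unfolding k_def by measurable
  have "emeasure liouville ?E = (\<integral>\<^sup>+z. \<integral>\<^sup>+u. indicator ?E (z, u) \<partial>circle_measure \<partial>hyperbolic_area)"
    unfolding liouville_def by (rule circle.emeasure_pair_measure) (use E' in \<open>simp add: liouville_def\<close>)
  also have "\<dots> = (\<integral>\<^sup>+z. \<integral>\<^sup>+u. indicator Z (tangent_section (z, u)) \<partial>circle_measure \<partial>hyperbolic_area)"
    by (intro nn_integral_cong) (auto simp: indicator_def space_liouville space_hyperbolic_area space_circle_measure)
  also have "\<dots> = (\<integral>\<^sup>+z. \<integral>\<^sup>+\<phi>. indicator Z (tangent_section (z, cis \<phi>)) * indicator {0..<2 * pi} \<phi> \<partial>lborel \<partial>hyperbolic_area)"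
    by (intro nn_integral_cong nn_integral_circle) measurable
  also have "\<dots> = (\<integral>\<^sup>+z. ennreal (1 / (Im z)\<^sup>2) * (\<integral>\<^sup>+\<phi>. indicator Z (tangent_section (z, cis \<phi>)) * indicator {0..<2 * pi} \<phi> \<partial>lborel) *
      indicator upper_half_plane z \<partial>lborel)"
    by (rule nn_integral_hyperbolic_area) measurable
  also have "\<dots> = (\<integral>\<^sup>+z. \<integral>\<^sup>+\<phi>. k z \<phi> \<partial>lborel \<partial>lborel)"
  proof (rule nn_integral_cong)
    fix z
    have "(\<integral>\<^sup>+\<phi>. k z \<phi> \<partial>lborel) = ennreal (1 / (Im z)\<^sup>2) * indicator upper_half_plane z *
       (\<integral>\<^sup>+\<phi>. indicator Z (tangent_section (z, cis \<phi>)) * indicator {0..<2 * pi} \<phi> \<partial>lborel)"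
      unfolding k_def by (rule nn_integral_cmult) measurable
    then show "ennreal (1 / (Im z)\<^sup>2) * (\<integral>\<^sup>+\<phi>. indicator Z (tangent_section (z, cis \<phi>)) * indicator {0..<2 * pi} \<phi> \<partial>lborel) *
      indicator upper_half_plane z = (\<integral>\<^sup>+\<phi>. k z \<phi> \<partial>lborel)" by (simp only: mult_ac)
  qed
  also have "\<dots> = (\<integral>\<^sup>+\<phi>. \<integral>\<^sup>+z. k z \<phi> \<partial>lborel \<partial>lborel)"
    by (rule lborel_pair.Fubini') measurable
  also have "\<dots> = (\<integral>\<^sup>+(\<phi>::real). 0 \<partial>lborel)"
  proof (rule nn_integral_cong_AE)
    let ?B = "{m. (\<integral>\<^sup>+z. indicator Z (frame (Re z) (Im z) m) \<partial>lborel) \<noteq> (0 :: ennreal)}"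
    have "?B \<in> sets lborel" by measurable
    then have "?B \<in> null_sets lborel"
      using null_frames[OF assms] by (simp add: AE_iff_null_sets)
    from null_sets_slope[OF this] AE_lborel_singleton[of "3 * pi / 2"]
    show "AE \<phi> in lborel. (\<integral>\<^sup>+z. k z \<phi> \<partial>lborel) = 0"
    proof eventually_elim
      case (elim \<phi>)
      show ?case
      proof (cases "0 \<le> \<phi> \<and> \<phi> < 2 * pi")
        case True
        then have ne: "cis \<phi> \<noteq> - \<i>" using cis_eq_minus_i elim(2) by blast
        have "(\<integral>\<^sup>+z. indicator Z (frame (Re z) (Im z) (slope (cis \<phi>))) \<partial>lborel) = (0 :: ennreal)"
          using elim(1) True by simp
        then have "AE z in lborel. indicator Z (frame (Re z) (Im z) (slope (cis \<phi>))) = (0 :: ennreal)"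
          by (subst (asm) nn_integral_0_iff_AE) simp_all
        then have "AE z in lborel. k z \<phi> = 0"
          by eventually_elim (simp add: k_def tangent_section_def ne)
        then show ?thesis by (subst nn_integral_0_iff_AE) simp_all
      next
        case False
        then have "k z \<phi> = 0" for z by (auto simp: k_def)
        then show ?thesis by simp
      qed
    qed
  qed
  finally have "emeasure liouville ?E = 0" by simp
  then show ?thesis using E by (simp add: null_sets_def)
qed

text \<open>
  The transfer of "almost everywhere" from matrices to \<open>T\<^sub>1S\<close>.  The set \<open>E\<close> of tangent vectors represented in
  \<open>Z\<close> is saturated for the orbit map and null, so that the measure of its image, a supremum over subsets of
  \<open>E\<close>, is \<open>0\<close>.
\<close>

lemma unit_tangent_null:
  assumes \<Gamma>: "zonal_fuchsian \<Gamma>" and Z: "Z \<in> null_sets lborel" "Z \<subseteq> pos_det"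
    and scale: "\<And>r M. r > 0 \<Longrightarrow> r *\<^sub>R M \<in> Z \<longleftrightarrow> M \<in> Z"
    and inv: "\<And>A M. A \<in> \<Union>\<Gamma> \<Longrightarrow> A ** M \<in> Z \<longleftrightarrow> M \<in> Z"
    and good: "\<And>M. det M = 1 \<Longrightarrow> M \<notin> Z \<Longrightarrow> P (tangent_orbit \<Gamma> (tangent M))"
  shows "AE v in unit_tangent_measure \<Gamma>. P v"
proof -
  interpret zonal_group "\<Union>\<Gamma>" by (rule zonal_group_preimage[OF \<Gamma>])
  let ?p = "tangent_orbit \<Gamma>"
  define E where "E = {w \<in> space liouville. tangent_section w \<in> Z}"
  have E: "E \<in> null_sets liouville" unfolding E_def by (rule null_tangent_set[OF Z(1) scale])
  have minus: "- M \<in> Z \<longleftrightarrow> M \<in> Z" for M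
    using inv[OF neg_S[OF one_S], of M] by (simp add: matrix_uminus_mult_left)
  have same: "M \<in> Z \<longleftrightarrow> N \<in> Z" if MN: "M \<in> pos_det" "N \<in> pos_det" "tangent M = tangent N" for M N
  proof -
    obtain r where r: "r \<noteq> 0" "N = r *\<^sub>R M" using tangent_eqD[OF MN] by (elim exE conjE)
    consider "r > 0" | "- r > 0" using r(1) by linarith
    then show ?thesis
    proof cases
      case 1
      show ?thesis unfolding r(2) by (rule scale[OF 1, symmetric])
    next
      case 2
      have "- N = (- r) *\<^sub>R M" unfolding r(2) by simp
      then have "- N \<in> Z \<longleftrightarrow> M \<in> Z" using scale[OF 2, of M] by (simp only:)
      then show ?thesis unfolding minus by (rule sym)
    qed
  qed
  \<comment> \<open>The section has arbitrary determinant; scaling makes it \<open>1\<close>.\<close>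
  have normalized: "\<exists>M. det M = 1 \<and> tangent M = w \<and> (M \<in> Z \<longleftrightarrow> w \<in> E)" if w: "w \<in> space liouville" for w
  proof -
    obtain z u where zu: "w = (z, u)" "Im z > 0" "cmod u = 1"
      using w by (auto simp: space_liouville upper_half_plane_def)
    define N where "N = tangent_section w"
    have N: "N \<in> pos_det" "tangent N = w" using tangent_section[OF zu(2,3)] by (simp_all add: N_def zu(1))
    define r where "r = 1 / sqrt (det N)"
    have r: "r > 0" "r\<^sup>2 * det N = 1" using N(1) by (auto simp: r_def pos_det_def power_divide)
    have "det (r *\<^sub>R N) = 1" "tangent (r *\<^sub>R N) = w" "r *\<^sub>R N \<in> Z \<longleftrightarrow> w \<in> E"
      using r N scale[OF r(1)] w by (simp_all add: det_scaleR2 tangent_scale E_def N_def)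
    then show ?thesis by blast
  qed
  have saturated: "w \<in> E" if w: "w \<in> space liouville" and eq: "?p w = ?p w'" and w': "w' \<in> E" for w w'
  proof -
    have "w' \<in> space liouville" using w' by (simp add: E_def)
    then obtain M' where M': "det M' = 1" "tangent M' = w'" "M' \<in> Z" using normalized w' by blast
    obtain M where M: "det M = 1" "tangent M = w" "M \<in> Z \<longleftrightarrow> w \<in> E" using normalized[OF w] by blast
    have "tangent (mat 1 ** M) \<in> ?p (tangent M)"
      unfolding tangent_orbit_tangent[OF \<Gamma> M(1)] using one_S by blast
    then have "tangent M \<in> ?p (tangent M')" using eq M M' by simp
    then obtain A where A: "A \<in> \<Union>\<Gamma>" "tangent M = tangent (A ** M')"
      unfolding tangent_orbit_tangent[OF \<Gamma> M'(1)] by blast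
    have "M \<in> Z \<longleftrightarrow> A ** M' \<in> Z"
      using M(1) M'(1) det_S[OF A(1)] by (intro same A) (simp_all add: pos_det_def det_mul)
    then show "w \<in> E" using M(3) M'(3) inv[OF A(1)] by simp
  qed
  have Esub: "E \<subseteq> space liouville" by (auto simp: E_def)
  have pre: "?p -` (?p ` E) \<inter> space liouville = E"
  proof (intro equalityI subsetI)
    fix w assume "w \<in> ?p -` (?p ` E) \<inter> space liouville"
    then have w: "w \<in> space liouville" and "?p w \<in> ?p ` E" by (rule IntD2, rule IntD1[THEN vimageD])
    from this(2) obtain w' where "?p w = ?p w'" "w' \<in> E" by (rule imageE)
    then show "w \<in> E" by (rule saturated[OF w])
  next
    fix w assume "w \<in> E"
    then show "w \<in> ?p -` (?p ` E) \<inter> space liouville" by (intro IntI vimageI2 imageI subsetD[OF Esub])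
  qed
  have sets: "?p ` E \<in> sets (unit_tangent_measure \<Gamma>)"
  proof -
    have "?p -` (?p ` E) \<inter> space liouville \<in> sets liouville" unfolding pre by (rule null_setsD2[OF E])
    with image_mono[OF Esub]
    have "?p ` E \<in> {F. F \<subseteq> ?p ` space liouville \<and> ?p -` F \<inter> space liouville \<in> sets liouville}"
      by (intro CollectI conjI)
    then show ?thesis unfolding unit_tangent_measure_def sets_quotient_measure .
  qed
  have "emeasure (unit_tangent_measure \<Gamma>) (?p ` E) = 0"
  proof -
    have zero: "emeasure liouville B = 0" if B: "B \<in> sets liouville" "B \<subseteq> ?p -` (?p ` E)" for B
    proof -
      have "B \<subseteq> ?p -` (?p ` E) \<inter> space liouville"
        using B(2) sets.sets_into_space[OF B(1)] by (rule Int_greatest)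
      then have "B \<subseteq> E" unfolding pre .
      then have "emeasure liouville B \<le> emeasure liouville E" by (rule emeasure_mono[OF _ null_setsD2[OF E]])
      then show ?thesis unfolding null_setsD1[OF E] by simp
    qed
    have "(SUP B \<in> {B \<in> sets liouville. B \<subseteq> ?p -` (?p ` E) \<and> inj_on ?p B}. emeasure liouville B) \<le> 0"
      by (rule SUP_least, elim CollectE conjE, rule eq_refl, rule zero)
    then show ?thesis
      unfolding unit_tangent_measure_def emeasure_quotient_measure[OF sets[unfolded unit_tangent_measure_def]]
      by (simp only: le_zero_eq)
  qed
  then have null: "?p ` E \<in> null_sets (unit_tangent_measure \<Gamma>)" using sets by (rule null_setsI)
  show ?thesis
  proof (rule AE_I'[OF null], intro subsetI)
    fix v assume "v \<in> {v \<in> space (unit_tangent_measure \<Gamma>). \<not> P v}"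
    then have "v \<in> ?p ` space liouville" and nP: "\<not> P v"
      unfolding unit_tangent_measure_def space_quotient_measure by (rule CollectE, blast)+
    then obtain w where w: "w \<in> space liouville" "v = ?p w" by blast
    obtain M where M: "det M = 1" "tangent M = w" "M \<in> Z \<longleftrightarrow> w \<in> E" using normalized[OF w(1)] by blast
    have "M \<in> Z" using good[OF M(1)] nP w(2) M(2) by blast
    then show "v \<in> ?p ` E" using M(3) w(2) by blast
  qed
qed


section \<open>The frequency of excursions\<close>

context zonal_group
begin

lemma generic_mult:
  assumes A: "A \<in> S" and M: "generic M"
  shows "generic (A ** M)"
  unfolding generic_def
proof
  fix B assume "B \<in> S"
  then have "B ** A \<in> S" using A by (rule mult_S)
  then show "(B ** (A ** M)) $ 2 $ 1 \<noteq> 0 \<and> (B ** (A ** M)) $ 2 $ 2 \<noteq> 0 \<and>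
      (\<forall>n. (B ** (A ** M)) $ 1 $ 1 / (B ** (A ** M)) $ 2 $ 1 \<noteq> of_int n) \<and>
      (\<forall>C\<in>S. C $ 2 $ 1 \<noteq> 0 \<longrightarrow> peak (C ** (B ** (A ** M))) \<noteq> peak (B ** (A ** M)))"
    using M unfolding generic_def matrix_mul_assoc[of B A M] by (rule bspec[rotated])
qed

lemma generic_scale:
  assumes r: "r > 0" and M: "generic M"
  shows "generic (r *\<^sub>R M)"
  using M unfolding generic_def scaleR_matrix_mult peak_scale[OF r] using r
  by (simp del: matrix_mult_nth)

lemma generic_borel: "{M. generic M} \<in> sets borel"
proof -
  have peak: "{M \<in> space borel. C $ 2 $ 1 \<noteq> 0 \<longrightarrow> peak (C ** (A ** M)) \<noteq> peak (A ** M)} \<in> sets borel" for A C :: "real^2^2"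
    by measurable
  have "{M \<in> space borel. \<forall>C\<in>S. C $ 2 $ 1 \<noteq> 0 \<longrightarrow> peak (C ** (A ** M)) \<noteq> peak (A ** M)} \<in> sets borel" for A :: "real^2^2"
    by (intro sets.sets_Collect_countable_All' countable_S peak)
  moreover have "{M \<in> space borel. (A ** (M :: real^2^2)) $ 2 $ 1 \<noteq> 0} \<in> sets borel" "{M \<in> space borel. (A ** (M :: real^2^2)) $ 2 $ 2 \<noteq> 0} \<in> sets borel"
    "{M \<in> space borel. \<forall>n. (A ** (M :: real^2^2)) $ 1 $ 1 / (A ** M) $ 2 $ 1 \<noteq> of_int n} \<in> sets borel" for A :: "real^2^2"
    by measurable
  ultimately have "{M \<in> space borel. (A ** M) $ 2 $ 1 \<noteq> 0 \<and> (A ** M) $ 2 $ 2 \<noteq> 0 \<and>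
      (\<forall>n. (A ** M) $ 1 $ 1 / (A ** M) $ 2 $ 1 \<noteq> of_int n) \<and>
      (\<forall>C\<in>S. C $ 2 $ 1 \<noteq> 0 \<longrightarrow> peak (C ** (A ** M)) \<noteq> peak (A ** M))} \<in> sets borel" for A :: "real^2^2"
    by (intro sets.sets_Collect_conj)
  then have "{M \<in> space borel. generic M} \<in> sets borel"
    unfolding generic_def by (intro sets.sets_Collect_countable_All' countable_S)
  then show ?thesis by simp
qed

end

context covolume_domain
begin

lemma crossings_card:
  assumes "crossings R J M < \<infinity>"
  shows "finite {A \<in> S. A ** M \<in> crossing R J}" "enn2real (crossings R J M) = card {A \<in> S. A ** M \<in> crossing R J}"
proof -
  let ?H = "{A \<in> S. A ** M \<in> crossing R J}"
  have "crossings R J M = (\<integral>\<^sup>+A. indicator ?H A \<partial>count_space S)"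
    unfolding crossings_def by (intro nn_integral_cong) (simp add: indicator_def)
  also have "\<dots> = emeasure (count_space S) ?H" by (rule nn_integral_indicator) simp
  finally have e: "crossings R J M = emeasure (count_space S) ?H" .
  show f: "finite ?H"
  proof (rule ccontr)
    assume "infinite ?H"
    then have "crossings R J M = \<infinity>" unfolding e by (subst emeasure_count_space_infinite) auto
    then show False using assms by simp
  qed
  then show "enn2real (crossings R J M) = card ?H" unfolding e by (subst emeasure_count_space_finite) auto
qed

end

context
  fixes \<Gamma> :: "(real^2^2) set set"
  assumes \<Gamma>: "zonal_fuchsian \<Gamma>"
begin

interpretation zonal_group "\<Union>\<Gamma>" by (rule zonal_group_preimage[OF \<Gamma>])

interpretation cone: covolume_domain "\<Union>\<Gamma>" ford_cone by (rule covolume_domain_preimage[OF \<Gamma>])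

lemma orbifold_area_pos: "orbifold_area \<Gamma> > 0"
  using measure_ford_cone_pos[OF \<Gamma>] unfolding measure_ford_cone[OF \<Gamma>] by (simp add: zero_less_mult_iff)

text \<open>
  Generic matrices form a saturated set, to which the measure of the quotient applies.
\<close>

lemma AE_generic_cone: "AE M in cone.N. generic M"
proof -
  let ?B = "pos_det - {M. generic M}"
  have B: "?B \<in> cone.inv_sets"
  proof (rule cone.inv_setsI)
    have "pos_det \<in> sets borel" using cone.inv_sets_borel[of pos_det] sets.top[of cone.N] by (simp add: cone.sets_N cone.space_N)
    then show "?B \<in> sets borel" by (intro sets.Diff generic_borel)
    show "A ** M \<in> ?B" if A: "A \<in> \<Union>\<Gamma>" and M: "M \<in> ?B" for A M
    proof -
      have "adj2 A ** (A ** M) = M" by (rule adj2_mult_cancel(1)[OF det_S[OF A]])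
      then have "\<not> generic (A ** M)" using M generic_mult[OF inv_S[OF A], of "A ** M"] by auto
      then show ?thesis using M A by (auto simp: cone.pos_det_mult det_S)
    qed
    show "r *\<^sub>R M \<in> ?B" if r: "r > 0" and M: "M \<in> ?B" for r M
    proof -
      have "(1 / r) *\<^sub>R (r *\<^sub>R M) = M" using r by simp
      then have "\<not> generic (r *\<^sub>R M)" using M r generic_scale[of "1 / r" "r *\<^sub>R M"] by auto
      then show ?thesis using M r by (auto simp: cone.pos_det_scale)
    qed
  qed simp
  have "AE M in lborel. M \<notin> ?B" using AE_generic by eventually_elim simp
  then have "emeasure cone.N ?B = 0" using cone.AE_N_iff[OF B] by simp
  then have "?B \<in> null_sets cone.N" using B by (simp add: null_sets_def cone.sets_N)
  then show ?thesis by (rule AE_I') (auto simp: cone.space_N)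
qed

text \<open>
  The conclusion of the asymptotics of crossings for a region of flux \<open>\<phi>\<close>; the denominator is the total mass of
  the quotient.
\<close>

definition well_distributed :: "(real \<times> real) set \<Rightarrow> real \<Rightarrow> real^2^2 \<Rightarrow> bool" where
  "well_distributed R \<phi> M \<longleftrightarrow> (\<forall>n. cone.crossings R {0..<real n} M < \<infinity>) \<and>
    (\<lambda>n. enn2real (cone.crossings R {0..<real n} M) / real n) \<longlonglongrightarrow> \<phi> / (pi / 2 * orbifold_area \<Gamma>)"

lemma AE_well_distributed:
  assumes R: "R \<in> sets (borel \<Otimes>\<^sub>M borel)" "\<And>x. (x, x) \<notin> R" and \<phi>: "flux R = ennreal \<phi>" "\<phi> \<ge> 0"
  shows "AE M in cone.N. well_distributed R \<phi> M"
  using cone.crossings_asymptotics[OF R _ measure_ford_cone_pos[OF \<Gamma>]] \<phi>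
  unfolding well_distributed_def by (simp add: measure_ford_cone[OF \<Gamma>])

text \<open>
  The pairs \<open>\<plusminus> A\<close> turn the rate \<open>\<phi> / (pi / 2 * area)\<close> of crossings into half of it for peaks.
\<close>

lemma well_distributed_peaks:
  assumes M: "generic M" and R: "R \<subseteq> region_J" and wd: "well_distributed R \<phi> M"
  shows "\<And>n. finite (peaks R M \<inter> {0..<real n})"
    and "((\<lambda>t. real (card (peaks R M \<inter> {0..t})) / t) \<longlongrightarrow> \<phi> / (pi * orbifold_area \<Gamma>)) at_top"
proof -
  have fin: "cone.crossings R {0..<real n} M < \<infinity>" for n using wd by (simp add: well_distributed_def)
  note card = card_crossing[OF M R cone.crossings_card(1)[OF fin]]
  show f: "finite (peaks R M \<inter> {0..<real n})" for n by (rule card(1))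
  have "enn2real (cone.crossings R {0..<real n} M) = 2 * real (card (peaks R M \<inter> {0..<real n}))" for n
    unfolding cone.crossings_card(2)[OF fin] card(2) by simp
  then have "(\<lambda>n. 1 / 2 * (2 * real (card (peaks R M \<inter> {0..<real n})) / real n)) \<longlonglongrightarrow> 1 / 2 * (\<phi> / (pi / 2 * orbifold_area \<Gamma>))"
    using wd unfolding well_distributed_def by (intro tendsto_mult tendsto_const) simp
  then have "(\<lambda>n. real (card (peaks R M \<inter> {0..<real n})) / real n) \<longlonglongrightarrow> \<phi> / (pi * orbifold_area \<Gamma>)"
    by (simp add: field_simps)
  then show "((\<lambda>t. real (card (peaks R M \<inter> {0..t})) / t) \<longlongrightarrow> \<phi> / (pi * orbifold_area \<Gamma>)) at_top"
    by (rule count_asymptotics[OF f])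
qed

text \<open>
  The limits hold for rational \<open>k\<close> by hypothesis; both counts increase with \<open>k\<close>, and the claimed limits are
  continuous in \<open>k\<close>.
\<close>

lemma excursion_counts:
  assumes M: "det M = 1" "generic M"
    and wd: "\<And>q. q \<in> \<rat> \<Longrightarrow> 0 < q \<Longrightarrow> q \<le> 2 \<Longrightarrow>
      well_distributed (region_J \<inter> deep_pairs q) q M \<and> well_distributed (region_I \<inter> deep_pairs q) (calA q) M"
    and k: "0 < k" "k \<le> 2"
  defines "v \<equiv> tangent_orbit \<Gamma> (tangent M)"
  shows "((\<lambda>t. real (N_exc \<Gamma> v k t) / t) \<longlongrightarrow> k / (pi * orbifold_area \<Gamma>)) at_top"
    and "((\<lambda>t. real (N_approx \<Gamma> v k t) / t) \<longlongrightarrow> calA k / (pi * orbifold_area \<Gamma>)) at_top"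
proof -
  let ?\<gamma> = "orbifold_geodesic \<Gamma> v"
  have \<gamma>: "?\<gamma> = (\<lambda>t. orbit \<Gamma> (geodesic_of M t))"
    unfolding v_def by (rule orbifold_geodesic_tangent[OF \<Gamma> M(1)])
  have exc: "excursions \<Gamma> ?\<gamma> j = peaks (region_J \<inter> deep_pairs j) M"
    and appr: "approximating_excursions \<Gamma> ?\<gamma> j = peaks (region_I \<inter> deep_pairs j) M" if "0 < j" "j \<le> 2" for j
    unfolding \<gamma> using excursions_generic[OF \<Gamma> M that] approximating_excursions_generic[OF \<Gamma> M that] by simp_all
  have "finite (excursions \<Gamma> ?\<gamma> j \<inter> {0..t})" if j: "0 < j" "j \<le> 2" for j t
  proof -
    obtain n :: nat where "t < real n" using reals_Archimedean2 by blast
    then have "excursions \<Gamma> ?\<gamma> j \<inter> {0..t} \<subseteq> excursions \<Gamma> ?\<gamma> 2 \<inter> {0..<real n}"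
      unfolding excursions_def using j(2) by (intro Int_mono) (auto intro: less_le_trans)
    moreover have "finite (excursions \<Gamma> ?\<gamma> 2 \<inter> {0..<real n})"
      using well_distributed_peaks(1)[OF M(2) Int_lower1, of "deep_pairs 2" 2] wd[of 2] by (simp add: exc)
    ultimately show ?thesis by (rule finite_subset)
  qed
  note fin = this
  show "((\<lambda>t. real (N_exc \<Gamma> v k t) / t) \<longlongrightarrow> k / (pi * orbifold_area \<Gamma>)) at_top"
  proof (rule monotone_family_limit[where F = "\<lambda>k t. real (N_exc \<Gamma> v k t) / t" and G = "\<lambda>k. k / (pi * orbifold_area \<Gamma>)", OF _ _ _ k])
    show "continuous_on {0<..} (\<lambda>k. k / (pi * orbifold_area \<Gamma>))"
      using orbifold_area_pos by (intro continuous_intros) auto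
    fix i j :: real assume j: "0 < i" "i \<le> j" "j \<le> 2"
    have "N_exc \<Gamma> v i t \<le> N_exc \<Gamma> v j t" for t
      unfolding N_exc_def using j by (intro card_mono fin) (auto simp: excursions_def intro: less_le_trans)
    then show "\<forall>\<^sub>F t in at_top. real (N_exc \<Gamma> v i t) / t \<le> real (N_exc \<Gamma> v j t) / t"
      by (intro eventually_mono[OF eventually_gt_at_top[of 0]] divide_right_mono) simp_all
  next
    fix q :: real assume q: "q \<in> \<rat>" "0 < q" "q \<le> 2"
    show "((\<lambda>t. real (N_exc \<Gamma> v q t) / t) \<longlongrightarrow> q / (pi * orbifold_area \<Gamma>)) at_top"
      unfolding N_exc_def exc[OF q(2,3)]
      using wd[OF q] by (intro well_distributed_peaks(2)[OF M(2)]) auto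
  qed
  show "((\<lambda>t. real (N_approx \<Gamma> v k t) / t) \<longlongrightarrow> calA k / (pi * orbifold_area \<Gamma>)) at_top"
  proof (rule monotone_family_limit[where F = "\<lambda>k t. real (N_approx \<Gamma> v k t) / t" and G = "\<lambda>k. calA k / (pi * orbifold_area \<Gamma>)", OF _ _ _ k])
    show "continuous_on {0<..} (\<lambda>k. calA k / (pi * orbifold_area \<Gamma>))"
      using orbifold_area_pos by (intro continuous_intros continuous_on_calA) auto
    fix i j :: real assume j: "0 < i" "i \<le> j" "j \<le> 2"
    have "N_approx \<Gamma> v i t \<le> N_approx \<Gamma> v j t" for t
      unfolding N_approx_def
    proof (rule card_mono)
      show "finite (approximating_excursions \<Gamma> ?\<gamma> j \<inter> {0..t})"
        by (rule finite_subset[OF _ fin[of j t]]) (use j in \<open>auto simp: approximating_excursions_def\<close>)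
    qed (use j in \<open>auto simp: approximating_excursions_def excursions_def intro: less_le_trans\<close>)
    then show "\<forall>\<^sub>F t in at_top. real (N_approx \<Gamma> v i t) / t \<le> real (N_approx \<Gamma> v j t) / t"
      by (intro eventually_mono[OF eventually_gt_at_top[of 0]] divide_right_mono) simp_all
  next
    fix q :: real assume q: "q \<in> \<rat>" "0 < q" "q \<le> 2"
    show "((\<lambda>t. real (N_approx \<Gamma> v q t) / t) \<longlongrightarrow> calA q / (pi * orbifold_area \<Gamma>)) at_top"
      unfolding N_approx_def appr[OF q(2,3)]
      using wd[OF q] region_I_subset[OF \<Gamma> M] by (intro well_distributed_peaks(2)[OF M(2)]) auto
  qed
qed

lemma calA_nonneg: "0 < k \<Longrightarrow> k \<le> 2 \<Longrightarrow> calA k \<ge> 0"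
  by (simp add: calA_def)

text \<open>
  Only countably many conditions, one pair for each rational \<open>k\<close>, are imposed on \<open>M\<close>.  The matrices that
  violate one of them lie in a saturated null set.
\<close>

lemma AE_excursion_counts:
  "AE v in unit_tangent_measure \<Gamma>. \<forall>k. 0 < k \<and> k \<le> 2 \<longrightarrow>
    ((\<lambda>t. real (N_exc \<Gamma> v k t) / t) \<longlongrightarrow> k / (pi * orbifold_area \<Gamma>)) at_top \<and>
    ((\<lambda>t. real (N_approx \<Gamma> v k t) / t) \<longlongrightarrow> calA k / (pi * orbifold_area \<Gamma>)) at_top"
proof -
  let ?Q = "{q \<in> \<rat>. 0 < q \<and> q \<le> (2 :: real)}"
  have "countable ?Q" using countable_rat by (rule countable_subset[rotated]) auto
  moreover have "AE M in cone.N. well_distributed (region_J \<inter> deep_pairs q) q M \<and>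
      well_distributed (region_I \<inter> deep_pairs q) (calA q) M" if q: "q \<in> ?Q" for q
  proof -
    have off: "(x, x) \<notin> deep_pairs q" for x using q by (simp add: deep_pairs_def)
    have "AE M in cone.N. well_distributed (region_J \<inter> deep_pairs q) q M"
      using q off by (intro AE_well_distributed flux_J region_borel) auto
    moreover have "AE M in cone.N. well_distributed (region_I \<inter> deep_pairs q) (calA q) M"
      using q off by (intro AE_well_distributed flux_I region_borel calA_nonneg) auto
    ultimately show ?thesis by eventually_elim simp
  qed
  ultimately have "AE M in cone.N. \<forall>q\<in>?Q. well_distributed (region_J \<inter> deep_pairs q) q M \<and>
      well_distributed (region_I \<inter> deep_pairs q) (calA q) M" (is "AE M in cone.N. ?W M")
    by (subst AE_ball_countable) blast+
  then have "AE M in cone.N. generic M \<and> ?W M" using AE_generic_cone by eventually_elim simp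
  then obtain Z where Z: "{M \<in> space cone.N. \<not> (generic M \<and> ?W M)} \<subseteq> Z" "emeasure cone.N Z = 0" "Z \<in> sets cone.N"
    by (rule AE_E)
  then have inv: "Z \<in> cone.inv_sets" by (simp add: cone.sets_N)
  show ?thesis
  proof (rule unit_tangent_null[OF \<Gamma>])
    show "Z \<in> null_sets lborel" using inv Z(2) by (rule cone.null_set_of_N)
    show "Z \<subseteq> pos_det" using sets.sets_into_space[OF Z(3)] by (simp add: cone.space_N)
    show "r *\<^sub>R M \<in> Z \<longleftrightarrow> M \<in> Z" if "r > 0" for r M using inv that by (rule cone.inv_sets_scale_iff)
    show "A ** M \<in> Z \<longleftrightarrow> M \<in> Z" if "A \<in> \<Union>\<Gamma>" for A M using inv that by (rule cone.inv_sets_mult_iff)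
    fix M :: "real^2^2" assume M: "det M = 1" "M \<notin> Z"
    have "M \<in> space cone.N" using M(1) by (simp add: cone.space_N pos_det_def)
    then have "generic M" "?W M" using Z(1) M(2) by blast+
    then show "\<forall>k. 0 < k \<and> k \<le> 2 \<longrightarrow>
      ((\<lambda>t. real (N_exc \<Gamma> (tangent_orbit \<Gamma> (tangent M)) k t) / t) \<longlongrightarrow> k / (pi * orbifold_area \<Gamma>)) at_top \<and>
      ((\<lambda>t. real (N_approx \<Gamma> (tangent_orbit \<Gamma> (tangent M)) k t) / t) \<longlongrightarrow> calA k / (pi * orbifold_area \<Gamma>)) at_top"
      using excursion_counts[OF M(1)] by blast
  qed
qed

end

theorem theorem1:
  fixes \<Gamma> :: "(real^2^2) set set"
  assumes "zonal_fuchsian \<Gamma>" and "normalized \<Gamma>"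
  shows "AE v in unit_tangent_measure \<Gamma>. \<forall>k. 0 < k \<and> k \<le> 2 \<longrightarrow>
    (\<Gamma> = PSL2Z \<or> U_eta (eta \<Gamma>) \<notin> \<Gamma> \<longrightarrow>
      ((\<lambda>t. real (N_exc \<Gamma> v k t) / t) \<longlongrightarrow> k / (pi * orbifold_area \<Gamma>)) at_top) \<and>
    ((\<lambda>t. real (N_approx \<Gamma> v k t) / t) \<longlongrightarrow> calA k / (pi * orbifold_area \<Gamma>)) at_top"
  using AE_excursion_counts[OF assms(1)] by eventually_elim blast

end
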